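(* Let $c>0$. There exists $\delta>0$ (depending on $c$) such that, for any $h_0\in H^4(S^1)$ satisfying $\|h_0-c\|_{H^4(S^1)}<\delta$ and $\frac1{2\pi}\int_{S^1}h_0\,d\theta=c$, there exists a unique solution $h\in C([0,\infty);H^4(S^1))\cap C^1((0,\infty);H^4(S^1))$ of $$\partial_th+\partial_\theta\left(h^2\int_0^1z\,\psi\Big(\tilde\beta+z\,h\,\big(\partial_\theta h+\partial_\theta^3h\big)\Big)\,dz\right)=0,\qquad t>0,\ \theta\in S^1,$$ with $h(0,\cdot)=h_0(\cdot)$. Moreover, $$\|h(t,\cdot)-c\|_{H^4(S^1)}\le C\delta,\qquad t\ge0,$$ where $C$ depends only on $c$.
   Context: $S^1$ is identified with $[0,2\pi]$ with periodic boundary conditions; $H^k(S^1)$ is the usual Sobolev space of $2\pi$-periodic real-valued functions. The constant $\tilde\beta>0$ and the function $\psi:\mathbb{R}\to\mathbb{R}$ are fixed throughout (the dependence of constants on $\tilde\beta$ and $\psi$ is not tracked). The function $\psi$ is the inverse of the strictly increasing map $s\mapsto\mu(|s|)s$ on $\mathbb{R}$, where $\mu>0$ is the strain-dependent viscosity, i.e. $\psi(\mu(|s|)s)=s$ for $s\in\mathbb{R}$; the map $s\mapsto\mu(|s|)s$ and its inverse $\psi$ are assumed smooth (so $\psi'>0$), with $\psi$ defined on all of $\mathbb{R}$. *)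

theory Defs
  imports "HOL-Analysis.Analysis"
begin

definition smooth_fun :: "(real \<Rightarrow> real) \<Rightarrow> bool" where
  "smooth_fun f \<longleftrightarrow> (\<forall>n x. (deriv ^^ n) f field_differentiable (at x))"

text \<open>The \<open>\<psi>\<close> belonging to a strain-dependent viscosity \<open>\<mu>\<close>; only the values of \<open>\<mu>\<close> on
  \<open>[0,\<infinity>)\<close> matter. The last conjunct says that the inverse is defined on all of \<open>\<real>\<close>.\<close>

definition viscosity_inverse :: "(real \<Rightarrow> real) \<Rightarrow> (real \<Rightarrow> real) \<Rightarrow> bool" where
  "viscosity_inverse \<mu> \<psi> \<longleftrightarrow>
     (\<forall>s\<ge>0. \<mu> s > 0) \<and> strict_mono (\<lambda>s. \<mu> \<bar>s\<bar> * s) \<and>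
     smooth_fun (\<lambda>s. \<mu> \<bar>s\<bar> * s) \<and> smooth_fun \<psi> \<and>
     (\<forall>s. \<psi> (\<mu> \<bar>s\<bar> * s) = s) \<and> (\<forall>y. \<mu> \<bar>\<psi> y\<bar> * \<psi> y = y)"

text \<open>Functions on the circle are \<open>2\<pi>\<close>-periodic functions on \<open>\<real>\<close>, integrated over one period.
  Elements of Lebesgue and Sobolev spaces are represented by functions; two functions represent
  the same element iff they agree almost everywhere.\<close>

abbreviation circle :: "real measure" where
  "circle \<equiv> lebesgue_on {0..2*pi}"

definition L2_circle :: "(real \<Rightarrow> real) set" where
  "L2_circle = {f. periodic_fun_simple f (2*pi) \<and> f \<in> borel_measurable circle \<and>
                   integrable circle (\<lambda>x. (f x)\<^sup>2)}"

definition has_weak_deriv :: "nat \<Rightarrow> (real \<Rightarrow> real) \<Rightarrow> (real \<Rightarrow> real) \<Rightarrow> bool" where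
  "has_weak_deriv j f g \<longleftrightarrow> f \<in> L2_circle \<and> g \<in> L2_circle \<and>
     (\<forall>\<phi>. smooth_fun \<phi> \<and> periodic_fun_simple \<phi> (2*pi) \<longrightarrow>
        (LINT x|circle. f x * (deriv ^^ j) \<phi> x) = (-1)^j * (LINT x|circle. g x * \<phi> x))"

text \<open>An arbitrary representative of the weak derivative, which is unique almost everywhere.\<close>

definition weak_deriv :: "nat \<Rightarrow> (real \<Rightarrow> real) \<Rightarrow> real \<Rightarrow> real" where
  "weak_deriv j f = (SOME g. has_weak_deriv j f g)"

definition sobolev :: "nat \<Rightarrow> (real \<Rightarrow> real) set" where
  "sobolev k = {f. f \<in> L2_circle \<and> (\<forall>j\<le>k. \<exists>g. has_weak_deriv j f g)}"

text \<open>Only meaningful for \<open>f \<in> sobolev k\<close>.\<close>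

definition sobolev_norm :: "nat \<Rightarrow> (real \<Rightarrow> real) \<Rightarrow> real" where
  "sobolev_norm k f = sqrt (\<Sum>j\<le>k. LINT x|circle. (weak_deriv j f x)\<^sup>2)"

definition sobolev_continuous_on :: "nat \<Rightarrow> real set \<Rightarrow> (real \<Rightarrow> real \<Rightarrow> real) \<Rightarrow> bool" where
  "sobolev_continuous_on k I h \<longleftrightarrow> (\<forall>t\<in>I. h t \<in> sobolev k) \<and>
     (\<forall>t\<in>I. ((\<lambda>s. sobolev_norm k (\<lambda>x. h s x - h t x)) \<longlongrightarrow> 0) (at t within I))"

text \<open>\<open>h \<in> C\<^sup>1(I; H\<^sup>k)\<close> with time derivative \<open>h'\<close>, as a curve in the normed space \<open>H\<^sup>k\<close>.\<close>

definition sobolev_C1_on ::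
  "nat \<Rightarrow> real set \<Rightarrow> (real \<Rightarrow> real \<Rightarrow> real) \<Rightarrow> (real \<Rightarrow> real \<Rightarrow> real) \<Rightarrow> bool" where
  "sobolev_C1_on k I h h' \<longleftrightarrow>
     sobolev_continuous_on k I h \<and> sobolev_continuous_on k I h' \<and>
     (\<forall>t\<in>I. ((\<lambda>s. sobolev_norm k (\<lambda>x. (h s x - h t x) / (s - t) - h' t x)) \<longlongrightarrow> 0)
               (at t within I))"

definition flux :: "real \<Rightarrow> (real \<Rightarrow> real) \<Rightarrow> (real \<Rightarrow> real) \<Rightarrow> real \<Rightarrow> real" where
  "flux \<beta> \<psi> u x = (u x)\<^sup>2 *
     (LINT z|lebesgue_on {0..1}. z * \<psi> (\<beta> + z * u x * (weak_deriv 1 u x + weak_deriv 3 u x)))"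

text \<open>For \<open>h t \<in> H\<^sup>4\<close> the flux lies in \<open>H\<^sup>1\<close>, and the equation is an identity in \<open>L\<^sup>2\<close> at every
  \<open>t > 0\<close>, stated by saying that \<open>- h' t\<close> is the weak derivative of the flux.\<close>

definition film_solution ::
  "real \<Rightarrow> (real \<Rightarrow> real) \<Rightarrow> (real \<Rightarrow> real) \<Rightarrow> (real \<Rightarrow> real \<Rightarrow> real) \<Rightarrow> bool" where
  "film_solution \<beta> \<psi> h0 h \<longleftrightarrow>
     sobolev_continuous_on 4 {0..} h \<and>
     (\<exists>h'. sobolev_C1_on 4 {0<..} h h' \<and>
           (\<forall>t>0. has_weak_deriv 1 (flux \<beta> \<psi> (h t)) (\<lambda>x. - h' t x))) \<and>
     (AE x in circle. h 0 x = h0 x)"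

end

theory Submission
  imports Defs
begin

text \<open>
  Write \<open>h = c + v\<close> with \<open>v = \<Sum>\<^sub>k Re (a\<^sub>k e\<^bsup>ikx\<^esup>)\<close>. The linearisation at \<open>v = 0\<close> damps every mode \<open>k \<ge> 2\<close>
  but is neutral at \<open>k = 1\<close>, since \<open>\<partial> + \<partial>\<^sup>3\<close> annihilates \<open>e\<^bsup>ix\<^esup>\<close>. Stability of that mode comes from the cubic
  normal form: eliminating the mode 2 coupling yields
  \<open>d/dt |a\<^sub>1|\<^sup>2 \<le> - \<gamma> |a\<^sub>1|\<^sup>4 + \<dots>\<close> with \<open>\<gamma>\<close> proportional to \<open>\<psi>(\<beta>)\<^sup>2\<close>, and \<open>\<psi>(\<beta>) > 0\<close> because \<open>\<beta> > 0\<close>. Hence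
  \<open>|a\<^sub>1|\<^sup>2\<close> with a cubic correction plus a small multiple of the \<open>H\<^sup>4\<close> norm of the remaining modes is
  a Lyapunov function, uniformly for all Galerkin truncations. Parabolic smoothing bounds higher
  norms for \<open>t > 0\<close>, and monotonicity of the flux in \<open>\<partial> v + \<partial>\<^sup>3 v\<close> gives a Gronwall estimate in the \<open>H\<^sup>1\<close>
  norm between a Galerkin approximation and any other solution; this yields both convergence of
  the approximations and uniqueness.
\<close>

subsection \<open>Smooth functions\<close>

text \<open>Mode 1 loses energy only at quartic order, so a crude bound on the nonlinearity would
  swamp its decay. With a the modulus of mode 1 and y the H^6 norm of the other modes, every error
  in the Lyapunov estimate has to be a small factor times a^4 + y^2. This is possible because
  \<partial> + \<partial>^3 kills mode 1: apart from the square of mode 1, which has frequencies 0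
  and 2 only, each nonlinear term carries a factor y.

  The base order is 4 because v' + v''' enters the flux pointwise and four derivatives bound it
  uniformly. The nonlinear flux then has to be estimated quadratically, but linearly in the highest
  norm, with constants independent of the number of modes; the weights below and Bessel's inequality
  serve this purpose.

  A competing solution is not assumed to stay small. Its smallness comes from continuity in H^4:
  while it is small it coincides with the constructed solution, which obeys a strictly better
  bound.\<close>

lemma deriv_funpow_Suc: "(deriv ^^ Suc n) f = (deriv ^^ n) (deriv f)"
  by (simp add: funpow_Suc_right del: funpow.simps)

lemma smooth_fun_deriv: "smooth_fun f \<Longrightarrow> smooth_fun (deriv f)"
  unfolding smooth_fun_def by (metis deriv_funpow_Suc)

lemma smooth_fun_deriv_n: "smooth_fun f \<Longrightarrow> smooth_fun ((deriv ^^ n) f)"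
  by (induction n) (auto intro: smooth_fun_deriv)

lemma smooth_fun_DERIV: "smooth_fun f \<Longrightarrow> (f has_real_derivative deriv f x) (at x)"
  unfolding smooth_fun_def by (metis DERIV_deriv_iff_field_differentiable funpow_0)

lemma smooth_fun_DERIV_n:
  "smooth_fun f \<Longrightarrow> ((deriv ^^ n) f has_real_derivative (deriv ^^ Suc n) f x) (at x)"
  using smooth_fun_DERIV[OF smooth_fun_deriv_n] by simp

lemma smooth_fun_continuous: "smooth_fun f \<Longrightarrow> continuous_on S f"
  by (meson DERIV_isCont continuous_at_imp_continuous_on smooth_fun_DERIV)

text \<open>All iterated derivatives stay in \<open>X\<close>, so it suffices to exhibit a set of
  differentiable functions closed under \<open>deriv\<close>; no formula for an n-th derivative is
  needed.\<close>

lemma smooth_fun_coinduct: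
  assumes "f \<in> X" and "\<And>g. g \<in> X \<Longrightarrow> (\<forall>x. g field_differentiable at x) \<and> deriv g \<in> X"
  shows "smooth_fun f"
proof -
  have "(deriv ^^ n) f \<in> X" for n
    by (induction n) (use assms in auto)
  then show ?thesis
    unfolding smooth_fun_def using assms(2) by blast
qed

text \<open>Differentiating a composition produces a product, and differentiating a product a sum of
  products, so compositions cannot be shown smooth without treating the other two operations at the
  same time.\<close>

inductive_set smooth_alg :: "(real \<Rightarrow> real) set" where
  base: "smooth_fun f \<Longrightarrow> f \<in> smooth_alg"
| add: "f \<in> smooth_alg \<Longrightarrow> g \<in> smooth_alg \<Longrightarrow> (\<lambda>x. f x + g x) \<in> smooth_alg"
| mult: "f \<in> smooth_alg \<Longrightarrow> g \<in> smooth_alg \<Longrightarrow> (\<lambda>x. f x * g x) \<in> smooth_alg"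
| comp: "smooth_fun R \<Longrightarrow> f \<in> smooth_alg \<Longrightarrow> (\<lambda>x. R (f x)) \<in> smooth_alg"

lemma smooth_alg_deriv:
  "f \<in> smooth_alg \<Longrightarrow> (\<forall>x. f field_differentiable at x) \<and> deriv f \<in> smooth_alg"
proof (induction rule: smooth_alg.induct)
  case (base f)
  then show ?case
    by (meson field_differentiable_def smooth_alg.base smooth_fun_DERIV smooth_fun_deriv)
next
  case (add f g)
  then have "(f has_real_derivative deriv f x) (at x)" "(g has_real_derivative deriv g x) (at x)" for x
    by (auto simp: DERIV_deriv_iff_field_differentiable)
  then have *: "((\<lambda>x. f x + g x) has_real_derivative deriv f x + deriv g x) (at x)" for x
    by (intro DERIV_add)
  then have "deriv (\<lambda>x. f x + g x) = (\<lambda>x. deriv f x + deriv g x)"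
    by (intro ext DERIV_imp_deriv)
  with * add show ?case
    using smooth_alg.add by (auto simp: field_differentiable_def)
next
  case (mult f g)
  then have "(f has_real_derivative deriv f x) (at x)" "(g has_real_derivative deriv g x) (at x)" for x
    by (auto simp: DERIV_deriv_iff_field_differentiable)
  then have *: "((\<lambda>x. f x * g x) has_real_derivative deriv f x * g x + deriv g x * f x) (at x)" for x
    by (intro DERIV_mult)
  then have "deriv (\<lambda>x. f x * g x) = (\<lambda>x. deriv f x * g x + deriv g x * f x)"
    by (intro ext DERIV_imp_deriv)
  with * mult show ?case
    by (auto simp: field_differentiable_def intro: smooth_alg.add smooth_alg.mult)
next
  case (comp R f)
  then have "(f has_real_derivative deriv f x) (at x)" for x
    by (auto simp: DERIV_deriv_iff_field_differentiable)
  then have *: "((\<lambda>x. R (f x)) has_real_derivative deriv R (f x) * deriv f x) (at x)" for x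
    using DERIV_chain2 comp.hyps(1) smooth_fun_DERIV by blast
  then have "deriv (\<lambda>x. R (f x)) = (\<lambda>x. deriv R (f x) * deriv f x)"
    by (intro ext DERIV_imp_deriv)
  moreover have "(\<lambda>x. deriv R (f x) * deriv f x) \<in> smooth_alg"
    using smooth_alg.mult[OF smooth_alg.comp[OF smooth_fun_deriv[OF comp.hyps(1)] comp.hyps(2)]]
      comp.IH by blast
  ultimately show ?case
    using * unfolding field_differentiable_def by (metis (no_types, lifting))
qed

lemma smooth_alg_imp_smooth: "f \<in> smooth_alg \<Longrightarrow> smooth_fun f"
  by (rule smooth_fun_coinduct[of _ smooth_alg]) (auto dest: smooth_alg_deriv)

lemma smooth_fun_add: "smooth_fun f \<Longrightarrow> smooth_fun g \<Longrightarrow> smooth_fun (\<lambda>x. f x + g x)"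
  and smooth_fun_mult: "smooth_fun f \<Longrightarrow> smooth_fun g \<Longrightarrow> smooth_fun (\<lambda>x. f x * g x)"
  and smooth_fun_comp: "smooth_fun R \<Longrightarrow> smooth_fun f \<Longrightarrow> smooth_fun (\<lambda>x. R (f x))"
  by (auto intro!: smooth_alg_imp_smooth intro: smooth_alg.intros)

lemma smooth_fun_const: "smooth_fun (\<lambda>x. a)"
  by (rule smooth_fun_coinduct[of _ "range (\<lambda>a x. a)"]) auto

lemma smooth_fun_ident: "smooth_fun (\<lambda>x. x)"
  by (rule smooth_fun_coinduct[of _ "insert (\<lambda>x. x) (range (\<lambda>a x. a))"]) auto

lemma smooth_fun_power: "smooth_fun f \<Longrightarrow> smooth_fun (\<lambda>x. f x ^ n)"
  by (induction n) (auto intro: smooth_fun_const smooth_fun_mult)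

lemmas smooth_intros = smooth_fun_add smooth_fun_mult smooth_fun_const smooth_fun_ident
  smooth_fun_power

text \<open>Differentiation under the integral multiplies the weight by z and replaces
  \<open>f\<close> by its derivative. With an arbitrary continuous weight the family is therefore
  closed under \<open>deriv\<close>. Both the averaged constitutive law and its Taylor remainder
  have this form.\<close>

lemma smooth_fun_param_integral:
  fixes f k :: "real \<Rightarrow> real"
  assumes f: "smooth_fun f" and k: "continuous_on {0..1} k"
  shows "smooth_fun (\<lambda>y. integral {0..1} (\<lambda>z. k z * f (a + z * y)))"
    and "((\<lambda>y. integral {0..1} (\<lambda>z. k z * f (a + z * y))) has_real_derivative
            integral {0..1} (\<lambda>z. (k z * z) * deriv f (a + z * y))) (at y)"
proof -
  have D: "((\<lambda>y. integral {0..1} (\<lambda>z. k z * f (a + z * y))) has_real_derivative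
            integral {0..1} (\<lambda>z. (k z * z) * deriv f (a + z * y))) (at y)"
    if f: "smooth_fun f" and k: "continuous_on {0..1} k" for f k :: "real \<Rightarrow> real" and y
  proof -
    have 1: "((\<lambda>y. k z * f (a + z * y)) has_real_derivative (k z * z) * deriv f (a + z * y))
        (at y within UNIV)" for z y
    proof -
      have "((\<lambda>y. a + z * y) has_real_derivative z) (at y)"
        by (auto intro!: derivative_eq_intros)
      from DERIV_cmult[OF DERIV_chain2[OF smooth_fun_DERIV[OF f] this], of "k z"]
      show ?thesis by (simp add: mult_ac)
    qed
    have 2: "continuous_on {0..1} (\<lambda>z. k z * f (a + z * y))" for y
      by (intro continuous_intros k continuous_on_compose2[OF smooth_fun_continuous[OF f, of UNIV]]) auto
    have 3: "continuous_on (UNIV \<times> {0..1}) (\<lambda>(y, z). (k z * z) * deriv f (a + z * y))"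
      unfolding case_prod_beta
      by (intro continuous_intros continuous_on_compose2[OF k]
          continuous_on_compose2[OF smooth_fun_continuous[OF smooth_fun_deriv[OF f], of UNIV]]) auto
    have "((\<lambda>y. integral (cbox 0 1) (\<lambda>z. k z * f (a + z * y))) has_real_derivative
            integral (cbox 0 1) (\<lambda>z. (k z * z) * deriv f (a + z * y))) (at y within UNIV)"
      by (rule leibniz_rule_field_derivative)
         (use 1 2 3 in \<open>simp_all add: integrable_continuous_real\<close>)
    then show ?thesis by (simp add: cbox_interval)
  qed
  show "((\<lambda>y. integral {0..1} (\<lambda>z. k z * f (a + z * y))) has_real_derivative
            integral {0..1} (\<lambda>z. (k z * z) * deriv f (a + z * y))) (at y)"
    by (rule D[OF f k])
  define X :: "(real \<Rightarrow> real) set"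
    where "X = {h. \<exists>f k. smooth_fun f \<and> continuous_on {0..1} k \<and>
      h = (\<lambda>y. integral {0..1} (\<lambda>z. k z * f (a + z * y)))}"
  show "smooth_fun (\<lambda>y. integral {0..1} (\<lambda>z. k z * f (a + z * y)))"
  proof (rule smooth_fun_coinduct[of _ X])
    show "(\<lambda>y. integral {0..1} (\<lambda>z. k z * f (a + z * y))) \<in> X"
      unfolding X_def using f k by blast
    fix g assume "g \<in> X"
    then obtain f k where f: "smooth_fun f" and k: "continuous_on {0..1} k"
      and g: "g = (\<lambda>y. integral {0..1} (\<lambda>z. k z * f (a + z * y)))"
      unfolding X_def by blast
    have "deriv g = (\<lambda>y. integral {0..1} (\<lambda>z. (k z * z) * deriv f (a + z * y)))"
      unfolding g by (intro ext DERIV_imp_deriv D f k)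
    moreover have "continuous_on {0..1} (\<lambda>z. k z * z)" by (intro continuous_intros k)
    ultimately have "deriv g \<in> X"
      unfolding X_def using smooth_fun_deriv[OF f] by blast
    moreover have "\<forall>x. g field_differentiable at x"
      unfolding g field_differentiable_def using D[OF f k] by blast
    ultimately show "(\<forall>x. g field_differentiable at x) \<and> deriv g \<in> X" by blast
  qed
qed

subsection \<open>Fourier series on the circle\<close>

abbreviation cint :: "(real \<Rightarrow> 'a::{banach,second_countable_topology}) \<Rightarrow> 'a" where
  "cint f \<equiv> integral\<^sup>L circle f"

text \<open>For real functions the frequencies k \<ge> 0 suffice. The factor 1 / pi makes
  \<open>fc\<close> inverse to \<open>fser\<close> for k \<ge> 1, while index 0 gives twice the
  mean; hence the recurring conditions of mean zero and \<open>c 0 = 0\<close>.\<close>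

definition fc :: "(real \<Rightarrow> real) \<Rightarrow> nat \<Rightarrow> complex" where
  "fc f k = of_real (1 / pi) * cint (\<lambda>x. complex_of_real (f x) * cis (- (real k * x)))"

definition fser :: "(nat \<Rightarrow> complex) \<Rightarrow> real \<Rightarrow> real" where
  "fser c x = (\<Sum>k. Re (c k * cis (real k * x)))"

definition ddc :: "(nat \<Rightarrow> complex) \<Rightarrow> nat \<Rightarrow> complex" where
  "ddc c k = \<i> * of_nat k * c k"

section \<open>Integration over one period\<close>

lemma finite_measure_circle: "finite_measure circle"
  by (rule finite_measureI) (simp add: space_restrict_space emeasure_restrict_space)

lemma measure_circle [simp]: "measure circle {0..2 * pi} = 2 * pi"
  by (simp add: measure_restrict_space)

lemma circle_integrable:
  fixes f :: "real \<Rightarrow> 'b::euclidean_space"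
  shows "continuous_on UNIV f \<Longrightarrow> integrable circle f"
  by (rule continuous_imp_integrable_real) (auto intro: continuous_on_subset)

lemma circle_measurable:
  fixes f :: "real \<Rightarrow> 'b::euclidean_space"
  shows "continuous_on UNIV f \<Longrightarrow> f \<in> borel_measurable circle"
  using circle_integrable borel_measurable_integrable by blast

lemma cint_const: "cint (\<lambda>_. a) = (2 * pi) *\<^sub>R a"
  by (simp add: measure_circle)

lemma cint_bound:
  fixes f :: "real \<Rightarrow> 'b::euclidean_space"
  assumes "integrable circle f" "\<And>x. norm (f x) \<le> B"
  shows "norm (cint f) \<le> 2 * pi * B"
proof -
  interpret finite_measure circle by (rule finite_measure_circle)
  have "norm (cint f) \<le> cint (\<lambda>x. norm (f x))" by (rule integral_norm_bound)
  also have "\<dots> \<le> cint (\<lambda>x. B)"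
    by (rule integral_mono) (use assms in auto)
  also have "\<dots> = 2 * pi * B" by (subst cint_const) simp
  finally show ?thesis .
qed

lemma cint_nonneg: "(\<And>x. 0 \<le> f x) \<Longrightarrow> 0 \<le> cint (f :: real \<Rightarrow> real)"
  by (simp add: integral_nonneg_AE)

lemma cint_mono:
  fixes f g :: "real \<Rightarrow> real"
  assumes "continuous_on UNIV f" "continuous_on UNIV g" "\<And>x. f x \<le> g x"
  shows "cint f \<le> cint g"
  by (rule integral_mono) (use assms circle_integrable in auto)

lemma cint_FTC:
  fixes f :: "real \<Rightarrow> 'b::euclidean_space"
  assumes "\<And>x. (f has_vector_derivative f' x) (at x)" "continuous_on UNIV f'"
  shows "cint f' = f (2 * pi) - f 0"
proof -
  have "cint f' = integral {0..2*pi} f'"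
    by (rule lebesgue_integral_eq_integral) (use assms circle_integrable in auto)
  also have "(f' has_integral f (2*pi) - f 0) {0..2*pi}"
    by (rule fundamental_theorem_of_calculus)
      (use assms in \<open>auto intro: has_vector_derivative_at_within\<close>)
  then have "integral {0..2*pi} f' = f (2 * pi) - f 0" by (rule integral_unique)
  finally show ?thesis .
qed

lemma continuous_on_cis_mult [continuous_intros]: "continuous_on S (\<lambda>x. cis (a * x))"
  by (intro continuous_intros)

lemma cis_vector_derivative:
  "((\<lambda>x. cis (a * x)) has_vector_derivative (\<i> * of_real a * cis (a * x))) (at x)"
proof -
  have "((\<lambda>x. exp (\<i> * of_real (a * x))) has_vector_derivative
      (\<i> * of_real a * exp (\<i> * of_real (a * x)))) (at x)"
    by (auto intro!: derivative_eq_intros has_vector_derivative_real_field)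
  then show ?thesis by (simp add: cis_conv_exp)
qed

lemma cis_2pi_mult: "cis (2 * pi * of_int n) = 1"
  by (metis cis_multiple_2pi Ints_of_int)

lemma cint_cis:
  assumes "n \<noteq> 0"
  shows "cint (\<lambda>x. cis (of_int n * x)) = 0"
proof -
  have "((\<lambda>x. cis (of_int n * x) / (\<i> * of_int n)) has_vector_derivative cis (of_int n * x)) (at x)" for x
    using has_vector_derivative_mult_right[OF cis_vector_derivative[of "of_int n" x], of "1 / (\<i> * of_int n)"]
      assms by simp
  then have "cint (\<lambda>x. cis (of_int n * x)) =
      cis (of_int n * (2*pi)) / (\<i> * of_int n) - cis (of_int n * 0) / (\<i> * of_int n)"
    by (rule cint_FTC) (intro continuous_intros)
  then show ?thesis using cis_2pi_mult[of n] by (simp add: mult.commute)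
qed

lemma integrable_mult_cis:
  assumes "integrable circle (f :: real \<Rightarrow> real)"
  shows "integrable circle (\<lambda>x. complex_of_real (f x) * cis (a * x))"
proof (rule Bochner_Integration.integrable_bound)
  show "integrable circle f" by fact
  have "(\<lambda>x. cis (a * x)) \<in> borel_measurable circle"
    by (rule circle_measurable) (intro continuous_intros)
  with assms show "(\<lambda>x. complex_of_real (f x) * cis (a * x)) \<in> borel_measurable circle"
    by (intro borel_measurable_times borel_measurable_of_real) auto
qed (simp add: norm_mult)

lemma integrable_mult_cis': 
  assumes "integrable circle (f :: real \<Rightarrow> real)"
  shows "integrable circle (\<lambda>x. complex_of_real (f x) * cis (- (a * x)))"
  using integrable_mult_cis[OF assms, of "- a"] by simp

lemma fc_add:
  assumes "integrable circle f" "integrable circle g"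
  shows "fc (\<lambda>x. f x + g x) k = fc f k + fc g k"
  unfolding fc_def
  using Bochner_Integration.integral_add[OF integrable_mult_cis'[OF assms(1)] integrable_mult_cis'[OF assms(2)]]
  by (simp add: ring_distribs)

lemma fc_cmult: "fc (\<lambda>x. a * f x) k = of_real a * fc f k"
proof -
  have "cint (\<lambda>x. complex_of_real (a * f x) * cis (- (real k * x))) =
      cint (\<lambda>x. complex_of_real a * (complex_of_real (f x) * cis (- (real k * x))))"
    by (simp add: mult.assoc)
  then show ?thesis unfolding fc_def by simp
qed

lemma fc_diff:
  assumes "integrable circle f" "integrable circle g"
  shows "fc (\<lambda>x. f x - g x) k = fc f k - fc g k"
  using fc_add[of f "\<lambda>x. (-1) * g x" k] fc_cmult[of "-1" g k] assms by simp

lemma fc_sum: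
  assumes "finite A" "\<And>i. i \<in> A \<Longrightarrow> integrable circle (f i)"
  shows "fc (\<lambda>x. \<Sum>i\<in>A. f i x) k = (\<Sum>i\<in>A. fc (f i) k)"
  using assms
proof (induction rule: finite_induct)
  case empty
  then show ?case by (simp add: fc_def)
next
  case (insert i A)
  then have "fc (\<lambda>x. f i x + (\<Sum>i\<in>A. f i x)) k = fc (f i) k + fc (\<lambda>x. \<Sum>i\<in>A. f i x) k"
    by (intro fc_add) auto
  with insert show ?case by simp
qed

lemma fc_bound:
  assumes "integrable circle f" "\<And>x. \<bar>f x\<bar> \<le> B"
  shows "norm (fc f k) \<le> 2 * B"
proof -
  have "norm (cint (\<lambda>x. complex_of_real (f x) * cis (- (real k * x)))) \<le> 2 * pi * B"
    by (rule cint_bound) (use assms integrable_mult_cis' in \<open>auto simp: norm_mult\<close>)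
  then show ?thesis unfolding fc_def
    by (simp add: norm_mult norm_divide field_simps)
qed

lemma fc_0: "fc f 0 = of_real (cint f / pi)"
proof -
  have "cint (\<lambda>x. complex_of_real (f x)) = complex_of_real (cint f)"
    by (rule integral_complex_of_real)
  then show ?thesis unfolding fc_def by simp
qed

section \<open>Orthogonality of the modes and absolutely convergent series\<close>

lemma Re_mult_cis_fourier:
  assumes "1 \<le> n"
  shows "fc (\<lambda>x. Re (a * cis (real n * x))) k = (if k = n then a else 0)"
proof -
  have eq: "complex_of_real (Re (a * cis (real n * x))) * cis (- (real k * x)) =
     (a / 2) * cis (of_int (int n - int k) * x) + (cnj a / 2) * cis (of_int (- int n - int k) * x)" for x
  proof -
    have "complex_of_real (Re z) * w = (z * w + cnj z * w) / 2" for z w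
      by (metis add_divide_distrib complex_add_cnj distrib_right mult.assoc nonzero_mult_div_cancel_left times_divide_eq_right zero_neq_numeral mult.commute of_real_mult of_real_numeral)
    then have "complex_of_real (Re (a * cis (real n * x))) * cis (- (real k * x)) =
      (a / 2) * (cis (real n * x) * cis (- (real k * x))) + (cnj a / 2) * (cis (- (real n * x)) * cis (- (real k * x)))"
      by (simp only: complex_cnj_mult cis_cnj) (simp add: ring_distribs add_divide_distrib mult.assoc)
    also have "\<dots> = (a / 2) * cis (of_int (int n - int k) * x) + (cnj a / 2) * cis (of_int (- int n - int k) * x)"
    proof -
      have "real n * x + - (real k * x) = of_int (int n - int k) * x"
        "- (real n * x) + - (real k * x) = of_int (- int n - int k) * x"
        by (simp_all add: algebra_simps)
      then show ?thesis by (simp only: cis_mult)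
    qed
    finally show ?thesis .
  qed
  have int: "integrable circle (\<lambda>x. b * cis (of_int m * x))" for b :: complex and m :: int
    by (intro circle_integrable continuous_intros)
  have "cint (\<lambda>x. complex_of_real (Re (a * cis (real n * x))) * cis (- (real k * x))) =
     (a / 2) * cint (\<lambda>x. cis (of_int (int n - int k) * x)) +
     (cnj a / 2) * cint (\<lambda>x. cis (of_int (- int n - int k) * x))"
    unfolding eq by (subst Bochner_Integration.integral_add[OF int int]) simp
  \<comment> \<open>The frequency - n - k cannot vanish because n \<ge> 1, so only the other
    exponential can have a nonzero integral.\<close>
  moreover have "cint (\<lambda>x. cis (of_int (- int n - int k) * x)) = 0"
    using assms by (intro cint_cis) auto
  moreover have "cint (\<lambda>x. cis (of_int (int n - int k) * x)) = (if k = n then 2 * pi else 0)"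
    using cint_cis[of "int n - int k"] by (auto simp: cint_const scaleR_conv_of_real)
  ultimately show ?thesis unfolding fc_def by auto
qed

lemma fser_term_bound: "norm (Re (c k * cis (real k * x))) \<le> norm (c k)"
  using abs_Re_le_cmod[of "c k * cis (real k * x)"] by (simp add: norm_mult)

lemma summable_fser:
  assumes "summable (\<lambda>k. norm (c k))"
  shows "summable (\<lambda>k. Re (c k * cis (real k * x)))"
  by (rule summable_comparison_test'[OF assms, of 0]) (rule fser_term_bound)

lemma fser_bound:
  assumes "summable (\<lambda>k. norm (c k))"
  shows "\<bar>fser c x\<bar> \<le> (\<Sum>k. norm (c k))"
proof -
  have "norm (fser c x) \<le> (\<Sum>k. norm (c k))" unfolding fser_def
    by (rule norm_suminf_le[OF _ assms]) (rule fser_term_bound)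
  then show ?thesis by simp
qed

lemma fser_add:
  assumes "summable (\<lambda>k. norm (c k))" "summable (\<lambda>k. norm (d k))"
  shows "fser (\<lambda>k. c k + d k) x = fser c x + fser d x"
  unfolding fser_def
  by (subst suminf_add[OF summable_fser[OF assms(1)] summable_fser[OF assms(2)]]) (simp add: ring_distribs)

lemma fser_diff:
  assumes "summable (\<lambda>k. norm (c k))" "summable (\<lambda>k. norm (d k))"
  shows "fser (\<lambda>k. c k - d k) x = fser c x - fser d x"
  unfolding fser_def
  by (subst suminf_diff[OF summable_fser[OF assms(1)] summable_fser[OF assms(2)]]) (simp add: ring_distribs)

lemma fser_cmult:
  assumes "summable (\<lambda>k. norm (c k))"
  shows "fser (\<lambda>k. of_real a * c k) x = a * fser c x"
  unfolding fser_def
  by (subst suminf_mult[OF summable_fser[OF assms], symmetric]) (simp add: mult.assoc)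

lemma fser_finite:
  assumes "\<And>k. m < k \<Longrightarrow> c k = 0"
  shows "fser c x = (\<Sum>k\<le>m. Re (c k * cis (real k * x)))"
  unfolding fser_def by (rule suminf_finite) (use assms in auto)

lemma fser_periodic: "fser c (x + 2 * pi) = fser c x"
proof -
  have "cis (real k * (x + 2 * pi)) = cis (real k * x)" for k
  proof -
    have "cis (real k * (x + 2 * pi)) = cis (real k * x) * cis (2 * pi * of_int (int k))"
      by (simp add: cis_mult algebra_simps)
    then show ?thesis by (simp only: cis_2pi_mult) simp
  qed
  then show ?thesis unfolding fser_def by simp
qed

lemma fser_tail_bound:
  assumes "summable (\<lambda>k. norm (c k))"
  shows "\<bar>fser c x - (\<Sum>k<n. Re (c k * cis (real k * x)))\<bar> \<le> (\<Sum>k. norm (c k)) - (\<Sum>k<n. norm (c k))"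
proof -
  have "fser c x - (\<Sum>k<n. Re (c k * cis (real k * x))) = (\<Sum>k. Re (c (k + n) * cis (real (k + n) * x)))"
    unfolding fser_def using suminf_minus_initial_segment[OF summable_fser[OF assms, of x], of n] by simp
  also have "norm \<dots> \<le> (\<Sum>k. norm (c (k + n)))"
    by (rule norm_suminf_le) (rule fser_term_bound, use assms summable_iff_shift[of "\<lambda>k. norm (c k)" n] in simp)
  also have "\<dots> = (\<Sum>k. norm (c k)) - (\<Sum>k<n. norm (c k))"
    by (rule suminf_minus_initial_segment[OF assms])
  finally show ?thesis by simp
qed

lemma fser_uniform_limit:
  assumes "summable (\<lambda>k. norm (c k))"
  shows "uniform_limit UNIV (\<lambda>n x. \<Sum>k<n. Re (c k * cis (real k * x))) (fser c) sequentially"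
  unfolding fser_def
  by (rule Weierstrass_m_test[OF _ assms]) (rule fser_term_bound)

lemma fser_continuous:
  assumes "summable (\<lambda>k. norm (c k))"
  shows "continuous_on S (fser c)"
proof -
  have "continuous_on UNIV (fser c)"
    by (rule uniform_limit_theorem[OF _ fser_uniform_limit[OF assms]])
       (auto intro!: always_eventually continuous_intros)
  then show ?thesis by (rule continuous_on_subset) auto
qed

lemma fser_DERIV:
  assumes "summable (\<lambda>k. norm (c k))" "summable (\<lambda>k. norm (ddc c k))"
  shows "(fser c has_real_derivative fser (ddc c) x) (at x)"
proof -
  have D: "((\<lambda>x. Re (c k * cis (real k * x))) has_real_derivative Re (ddc c k * cis (real k * x))) (at x)" for k x
  proof -
    have "((\<lambda>x. c k * cis (real k * x)) has_vector_derivative c k * (\<i> * of_real (real k) * cis (real k * x))) (at x)"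
      by (rule has_vector_derivative_mult_right[OF cis_vector_derivative])
    then have "((\<lambda>x. Re (c k * cis (real k * x))) has_vector_derivative Re (c k * (\<i> * of_real (real k) * cis (real k * x)))) (at x)"
      by (rule bounded_linear.has_vector_derivative[OF bounded_linear_Re])
    then show ?thesis by (simp add: has_real_derivative_iff_has_vector_derivative ddc_def mult_ac)
  qed
  have "((\<lambda>x. \<Sum>k. Re (c k * cis (real k * x))) has_field_derivative (\<Sum>k. Re (ddc c k * cis (real k * x)))) (at x)"
  proof (rule has_field_derivative_series'(2)[of UNIV _ _ 0])
    show "uniformly_convergent_on UNIV (\<lambda>n x. \<Sum>i<n. Re (ddc c i * cis (real i * x)))"
      using fser_uniform_limit[OF assms(2)] uniformly_convergent_on_def by blast
  qed (use D summable_fser[OF assms(1), of 0] in simp_all)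
  then show ?thesis unfolding fser_def[abs_def] .
qed

lemma fc_fser:
  assumes "summable (\<lambda>k. norm (c k))" "c 0 = 0"
  shows "fc (fser c) k = c k"
proof -
  let ?S = "\<lambda>n x. \<Sum>k<n. Re (c k * cis (real k * x))"
  have intS: "integrable circle (?S n)" for n by (intro circle_integrable continuous_intros)
  have intf: "integrable circle (fser c)" by (intro circle_integrable fser_continuous assms)
  have mode: "fc (\<lambda>x. Re (c j * cis (real j * x))) k = (if k = j then c j else 0)" for j
    using Re_mult_cis_fourier[of j "c j" k] assms(2) by (cases "j = 0") (auto simp: fc_def)
  have S: "fc (?S n) k = c k" if "k < n" for n
  proof -
    have "fc (?S n) k = (\<Sum>j<n. fc (\<lambda>x. Re (c j * cis (real j * x))) k)"
      by (rule fc_sum) (auto intro!: circle_integrable continuous_intros)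
    also have "\<dots> = (\<Sum>j<n. if k = j then c j else 0)" by (simp only: mode)
    also have "\<dots> = c k" using that by simp
    finally show ?thesis .
  qed
  have lim: "(\<lambda>n. 2 * ((\<Sum>k. norm (c k)) - (\<Sum>k<n. norm (c k)))) \<longlonglongrightarrow> 2 * ((\<Sum>k. norm (c k)) - (\<Sum>k. norm (c k)))"
    by (intro tendsto_intros summable_LIMSEQ assms)
  \<comment> \<open>Partial sums longer than k have the exact k-th coefficient already, so only the
    tail contributes, and it is uniformly small.\<close>
  have "norm (fc (fser c) k - c k) \<le> 2 * ((\<Sum>k. norm (c k)) - (\<Sum>k<n. norm (c k)))" if "n \<ge> Suc k" for n
  proof -
    have "norm (fc (\<lambda>x. fser c x - ?S n x) k) \<le> 2 * ((\<Sum>k. norm (c k)) - (\<Sum>k<n. norm (c k)))"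
      by (rule fc_bound[OF _ fser_tail_bound[OF assms(1)]]) (intro Bochner_Integration.integrable_diff intf intS)
    then show ?thesis using fc_diff[OF intf intS, of n k] S[of n] that by simp
  qed
  then have "norm (fc (fser c) k - c k) \<le> 2 * ((\<Sum>k. norm (c k)) - (\<Sum>k. norm (c k)))"
    by (intro LIMSEQ_le_const[OF lim]) auto
  then show ?thesis by simp
qed

lemma cint_fser:
  assumes "summable (\<lambda>k. norm (c k))" "c 0 = 0"
  shows "cint (fser c) = 0"
  using fc_fser[OF assms, of 0] assms(2) by (simp add: fc_0)

text \<open>Integration by parts, carried out as the fundamental theorem for \<open>f\<close> times
  the exponential; periodicity makes the boundary values cancel.\<close>

lemma fc_deriv:
  assumes D: "\<And>x. (f has_real_derivative f' x) (at x)" and cont: "continuous_on UNIV f'"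
    and per: "f (2 * pi) = f 0"
  shows "fc f' k = \<i> * of_nat k * fc f k" "cint f' = 0"
proof -
  have cf: "continuous_on UNIV f"
    using D by (meson DERIV_isCont continuous_at_imp_continuous_on)
  show "cint f' = 0"
    using cint_FTC[of f f'] D cont per by (simp add: has_real_derivative_iff_has_vector_derivative)
  let ?g = "\<lambda>x. complex_of_real (f' x) * cis (- (real k * x))"
  let ?h = "\<lambda>x. complex_of_real (f x) * cis (- (real k * x))"
  have Df: "((\<lambda>x. complex_of_real (f x)) has_vector_derivative complex_of_real (f' x)) (at x)" for x
    by (rule bounded_linear.has_vector_derivative[OF bounded_linear_of_real])
       (use D in \<open>simp add: has_real_derivative_iff_has_vector_derivative\<close>)
  have "((\<lambda>x. complex_of_real (f x) * cis ((- real k) * x)) has_vector_derivative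
     (complex_of_real (f x) * (\<i> * of_real (- real k) * cis ((- real k) * x)) + complex_of_real (f' x) * cis ((- real k) * x))) (at x)" for x
    by (rule has_vector_derivative_mult[OF Df cis_vector_derivative])
  then have *: "(?h has_vector_derivative (?g x + (- (\<i> * of_nat k)) * ?h x)) (at x)" for x
    by (simp add: algebra_simps)
  have c0: "continuous_on UNIV (\<lambda>x. cis (- (real k * x)))" by (intro continuous_intros)
  have c1: "continuous_on UNIV ?g" and c2: "continuous_on UNIV ?h"
    by (rule continuous_on_mult[OF continuous_on_of_real c0]; fact)+
  then have "cint (\<lambda>x. ?g x + (- (\<i> * of_nat k)) * ?h x) = ?h (2 * pi) - ?h 0"
    by (intro cint_FTC[OF *] continuous_on_add continuous_on_mult_left c1 c2)
  also have "cis (- (real k * (2 * pi))) = 1"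
    using cis_2pi_mult[of "- int k"] by (simp add: mult_ac)
  then have "?h (2 * pi) - ?h 0 = 0" using per by simp
  finally have "cint ?g + (- (\<i> * of_nat k)) * cint ?h = 0"
    using circle_integrable[OF c1] circle_integrable[OF c2] by (subst (asm) Bochner_Integration.integral_add) auto
  then show "fc f' k = \<i> * of_nat k * fc f k" unfolding fc_def by (simp add: algebra_simps)
qed

subsection \<open>Density of trigonometric polynomials and Parseval's identity\<close>

text \<open>Square integrability as in \<open>L2_circle\<close> but without periodicity, which the
  clamped and cut-off functions of the density argument need not have.\<close>

definition sqi :: "(real \<Rightarrow> real) \<Rightarrow> bool" where
  "sqi f \<longleftrightarrow> f \<in> borel_measurable circle \<and> integrable circle (\<lambda>x. (f x)\<^sup>2)"

definition tr :: "nat \<Rightarrow> (nat \<Rightarrow> complex) \<Rightarrow> nat \<Rightarrow> complex" where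
  "tr m c k = (if 1 \<le> k \<and> k \<le> m then c k else 0)"

lemma tr_simps [simp]: "tr m c 0 = 0" "m < k \<Longrightarrow> tr m c k = 0"
  by (auto simp: tr_def)

lemma summable_tr: "summable (\<lambda>k. norm (tr m c k))"
  by (rule summable_finite[of "{..m}"]) (auto simp: tr_def)

lemma sqi_integrable: "sqi f \<Longrightarrow> integrable circle f"
proof -
  assume f: "sqi f"
  interpret finite_measure circle by (rule finite_measure_circle)
  have le: "\<bar>f x\<bar> \<le> 1 + (f x)\<^sup>2" for x
    using sum_squares_bound[of "\<bar>f x\<bar>" 1] by simp
  show "integrable circle f"
  proof (rule Bochner_Integration.integrable_bound)
    show "integrable circle (\<lambda>x. 1 + (f x)\<^sup>2)" using f unfolding sqi_def by auto
    show "AE x in circle. norm (f x) \<le> norm (1 + (f x)\<^sup>2)"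
      using le by (intro AE_I2) (simp add: order_trans[OF le])
  qed (use f in \<open>simp add: sqi_def\<close>)
qed

lemma sqi_mult_integrable: "sqi f \<Longrightarrow> sqi g \<Longrightarrow> integrable circle (\<lambda>x. f x * g x)"
proof -
  assume f: "sqi f" and g: "sqi g"
  have le: "\<bar>f x * g x\<bar> \<le> (f x)\<^sup>2 + (g x)\<^sup>2" for x
    using sum_squares_bound[of "\<bar>f x\<bar>" "\<bar>g x\<bar>"]
      mult_nonneg_nonneg[OF abs_ge_zero[of "f x"] abs_ge_zero[of "g x"]]
    unfolding abs_mult power2_abs by linarith
  show "integrable circle (\<lambda>x. f x * g x)"
  proof (rule Bochner_Integration.integrable_bound)
    show "integrable circle (\<lambda>x. (f x)\<^sup>2 + (g x)\<^sup>2)" using f g unfolding sqi_def by auto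
    show "AE x in circle. norm (f x * g x) \<le> norm ((f x)\<^sup>2 + (g x)\<^sup>2)"
      by (intro AE_I2) (use le in \<open>simp add: order_trans[OF le]\<close>)
    show "(\<lambda>x. f x * g x) \<in> borel_measurable circle"
      by (rule borel_measurable_times) (use f g in \<open>simp_all add: sqi_def\<close>)
  qed
qed

lemma sqi_add: "sqi f \<Longrightarrow> sqi g \<Longrightarrow> sqi (\<lambda>x. f x + g x)"
proof -
  assume f: "sqi f" and g: "sqi g"
  have "(\<lambda>x. (f x + g x)\<^sup>2) = (\<lambda>x. (f x)\<^sup>2 + (g x)\<^sup>2 + 2 * (f x * g x))"
    by (auto simp: power2_eq_square algebra_simps)
  moreover have "integrable circle (\<lambda>x. (f x)\<^sup>2 + (g x)\<^sup>2 + 2 * (f x * g x))"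
    using f g sqi_mult_integrable[OF f g] unfolding sqi_def by auto
  ultimately show ?thesis using f g unfolding sqi_def by auto
qed

lemma sqi_cmult: "sqi f \<Longrightarrow> sqi (\<lambda>x. a * f x)"
  unfolding sqi_def by (auto simp: power_mult_distrib)

lemma sqi_diff: "sqi f \<Longrightarrow> sqi g \<Longrightarrow> sqi (\<lambda>x. f x - g x)"
  using sqi_add[of f "\<lambda>x. (-1) * g x"] sqi_cmult[of g "-1"] by simp

lemma sqi_continuous: "continuous_on UNIV f \<Longrightarrow> sqi f"
  unfolding sqi_def by (auto intro!: circle_measurable circle_integrable continuous_intros)

lemma sqi_const: "sqi (\<lambda>x. a)" by (rule sqi_continuous) auto

lemma sqi_L2: "f \<in> L2_circle \<Longrightarrow> sqi f" unfolding L2_circle_def sqi_def by auto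

lemma cint_mult_mode:
  assumes "integrable circle f"
  shows "cint (\<lambda>x. f x * Re (a * cis (real k * x))) = pi * Re (a * cnj (fc f k))"
    and "integrable circle (\<lambda>x. f x * Re (a * cis (real k * x)))"
proof -
  have eq: "f x * Re (a * cis (real k * x)) = Re (cnj a * (complex_of_real (f x) * cis (- (real k * x))))" for x
    by (simp add: algebra_simps)
  have i: "integrable circle (\<lambda>x. cnj a * (complex_of_real (f x) * cis (- (real k * x))))"
    using integrable_mult_cis'[OF assms] by simp
  show "integrable circle (\<lambda>x. f x * Re (a * cis (real k * x)))"
    unfolding eq using integrable_Re[OF i] .
  have "cint (\<lambda>x. f x * Re (a * cis (real k * x))) = Re (cnj a * cint (\<lambda>x. complex_of_real (f x) * cis (- (real k * x))))"
    unfolding eq using integral_Re[OF i] integrable_mult_cis'[OF assms] by simp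
  also have "\<dots> = pi * Re (cnj a * fc f k)" unfolding fc_def by (simp add: field_simps)
  also have "Re (cnj a * fc f k) = Re (a * cnj (fc f k))" by simp
  finally show "cint (\<lambda>x. f x * Re (a * cis (real k * x))) = pi * Re (a * cnj (fc f k))" .
qed

lemma cint_mult_fser:
  assumes "integrable circle f" "\<And>k. m < k \<Longrightarrow> c k = 0"
  shows "cint (\<lambda>x. f x * fser c x) = pi * (\<Sum>k\<le>m. Re (c k * cnj (fc f k)))"
  by (simp add: fser_finite[of m c] assms sum_distrib_left cint_mult_mode(1)[OF assms(1), simplified]
      Bochner_Integration.integral_sum cint_mult_mode(2)[OF assms(1), simplified])

section \<open>Trigonometric polynomials and uniform approximation\<close>

inductive_set trigp :: "(real \<Rightarrow> real) set" where
  cos: "(\<lambda>x. a * cos (of_int k * x)) \<in> trigp"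
| sin: "(\<lambda>x. a * sin (of_int k * x)) \<in> trigp"
| add: "f \<in> trigp \<Longrightarrow> g \<in> trigp \<Longrightarrow> (\<lambda>x. f x + g x) \<in> trigp"

lemma trigp_const: "(\<lambda>x. a) \<in> trigp"
  using trigp.cos[of a 0] by simp

lemma trigp_cos_mult: "f \<in> trigp \<Longrightarrow> (\<lambda>x. a * cos (of_int k * x) * f x) \<in> trigp"
proof (induction rule: trigp.induct)
  case (cos b l)
  have "(\<lambda>x. a * cos (of_int k * x) * (b * cos (of_int l * x))) =
    (\<lambda>x. (a * b / 2) * cos (of_int (k - l) * x) + (a * b / 2) * cos (of_int (k + l) * x))"
    by (rule ext) (simp add: cos_add cos_diff algebra_simps)
  then show ?case by (simp only: trigp.intros)
next
  case (sin b l)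
  have "(\<lambda>x. a * cos (of_int k * x) * (b * sin (of_int l * x))) =
    (\<lambda>x. (a * b / 2) * sin (of_int (l - k) * x) + (a * b / 2) * sin (of_int (k + l) * x))"
    by (rule ext) (simp add: sin_add sin_diff algebra_simps)
  then show ?case by (simp only: trigp.intros)
next
  case (add f g)
  from trigp.add[OF add.IH] show ?case by (simp add: ring_distribs)
qed

lemma trigp_sin_mult: "f \<in> trigp \<Longrightarrow> (\<lambda>x. a * sin (of_int k * x) * f x) \<in> trigp"
proof (induction rule: trigp.induct)
  case (cos b l)
  have "(\<lambda>x. a * sin (of_int k * x) * (b * cos (of_int l * x))) =
    (\<lambda>x. (a * b / 2) * sin (of_int (k - l) * x) + (a * b / 2) * sin (of_int (k + l) * x))"
    by (rule ext) (simp add: sin_add sin_diff algebra_simps)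
  then show ?case by (simp only: trigp.intros)
next
  case (sin b l)
  have "(\<lambda>x. a * sin (of_int k * x) * (b * sin (of_int l * x))) =
    (\<lambda>x. (a * b / 2) * cos (of_int (l - k) * x) + (- a * b / 2) * cos (of_int (k + l) * x))"
    by (rule ext) (simp add: cos_add cos_diff algebra_simps)
  then show ?case by (simp only: trigp.intros)
next
  case (add f g)
  from trigp.add[OF add.IH] show ?case by (simp add: ring_distribs)
qed

lemma trigp_mult: "f \<in> trigp \<Longrightarrow> g \<in> trigp \<Longrightarrow> (\<lambda>x. f x * g x) \<in> trigp"
proof (induction rule: trigp.induct)
  case (add f1 f2)
  from trigp.add[OF add.IH(1)[OF add.prems] add.IH(2)[OF add.prems]] show ?case by (simp add: ring_distribs)
qed (auto intro: trigp_cos_mult trigp_sin_mult)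

text \<open>On the unit circle a linear functional of \<open>cis x\<close> is a combination of cos x
  and sin x, and trigonometric polynomials form an algebra. This transports Stone-Weierstrass from
  the circle in the plane to periodic functions.\<close>

lemma trigp_polynomial: "real_polynomial_function p \<Longrightarrow> (\<lambda>x. p (cis x)) \<in> trigp"
proof (induction rule: real_polynomial_function.induct)
  case (linear p)
  then interpret bounded_linear p .
  have "p (cis x) = p 1 * cos x + p \<i> * sin x" for x
  proof -
    have "cis x = cos x *\<^sub>R 1 + sin x *\<^sub>R \<i>" by (simp add: complex_eq_iff)
    then have "p (cis x) = p (cos x *\<^sub>R 1 + sin x *\<^sub>R \<i>)" by simp
    also have "\<dots> = p 1 * cos x + p \<i> * sin x" by (simp only: add scaleR) simp
    finally show ?thesis .
  qed
  then show ?case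
    using trigp.add[OF trigp.cos[of "p 1" 1] trigp.sin[of "p \<i>" 1]] by simp
qed (auto intro: trigp_const trigp.add trigp_mult)

text \<open>Integer frequencies keep the product formulas in \<open>trigp\<close> free of case
  distinctions. Here negative frequencies are folded onto positive ones, and frequency 0 becomes the
  separate constant.\<close>

lemma trigp_fser:
  assumes "f \<in> trigp"
  shows "\<exists>a c m. c 0 = 0 \<and> (\<forall>k>m. c k = 0) \<and> (\<forall>x. f x = a + fser c x)"
  using assms
proof (induction rule: trigp.induct)
  case (cos b l)
  show ?case
  proof (cases "l = 0")
    case True
    then show ?thesis by (intro exI[of _ b] exI[of _ "\<lambda>_. 0"] exI[of _ 0]) (auto simp: fser_def)
  next
    case False
    let ?c = "\<lambda>k. if k = nat \<bar>l\<bar> then complex_of_real b else 0"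
    have "fser ?c x = Re (?c (nat \<bar>l\<bar>) * cis (real (nat \<bar>l\<bar>) * x))" for x
      unfolding fser_def by (subst suminf_finite[of "{nat \<bar>l\<bar>}"]) auto
    then have "\<forall>x. b * cos (of_int l * x) = 0 + fser ?c x" by (auto simp: abs_if)
    with False show ?thesis by (intro exI[of _ 0] exI[of _ ?c] exI[of _ "nat \<bar>l\<bar>"]) auto
  qed
next
  case (sin b l)
  show ?case
  proof (cases "l = 0")
    case True
    then show ?thesis by (intro exI[of _ 0] exI[of _ "\<lambda>_. 0"] exI[of _ 0]) (auto simp: fser_def)
  next
    case False
    let ?c = "\<lambda>k. if k = nat \<bar>l\<bar> then complex_of_real (- b * of_int (sgn l)) * \<i> else 0"
    have "fser ?c x = Re (?c (nat \<bar>l\<bar>) * cis (real (nat \<bar>l\<bar>) * x))" for x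
      unfolding fser_def by (subst suminf_finite[of "{nat \<bar>l\<bar>}"]) auto
    then have "\<forall>x. b * sin (of_int l * x) = 0 + fser ?c x" using False by (auto simp: abs_if sgn_if)
    with False show ?thesis by (intro exI[of _ 0] exI[of _ ?c] exI[of _ "nat \<bar>l\<bar>"]) auto
  qed
next
  case (add f g)
  then obtain a c m b d n where 1: "c 0 = 0" "\<forall>k>m. c k = 0" "\<forall>x. f x = a + fser c x"
    and 2: "d 0 = 0" "\<forall>k>n. d k = 0" "\<forall>x. g x = b + fser d x" by blast
  have "summable (\<lambda>k. norm (c k))" "summable (\<lambda>k. norm (d k))"
    by (rule summable_finite[of "{..m}"] summable_finite[of "{..n}"]; use 1 2 in \<open>auto simp: not_le\<close>)+
  then have "\<forall>x. f x + g x = (a + b) + fser (\<lambda>k. c k + d k) x"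
    using 1 2 fser_add[of c d] by auto
  then show ?case using 1 2
    by (intro exI[of _ "a + b"] exI[of _ "\<lambda>k. c k + d k"] exI[of _ "max m n"]) auto
qed

text \<open>The function is carried to the unit circle by \<open>Arg2pi\<close>, which jumps at the
  positive real axis. Vanishing near both ends of the period makes the transported function
  continuous across this jump, so Stone-Weierstrass applies.\<close>

lemma trigp_uniform_approx:
  fixes u :: "real \<Rightarrow> real"
  assumes u: "continuous_on UNIV u" and d: "0 < \<delta>" "\<delta> < pi"
    and z: "\<And>x. x < \<delta> \<or> 2 * pi - \<delta> < x \<Longrightarrow> u x = 0" and e: "0 < e"
  shows "\<exists>p\<in>trigp. \<forall>x\<in>{0..2*pi}. \<bar>u x - p x\<bar> < e"
proof -
  let ?G = "\<lambda>z. u (Arg2pi z)"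
  have near1: "?G z = 0" if zs: "norm z = 1" "cos \<delta> < Re z" for z
  proof -
    have "z = cis (Arg2pi z)"
      using Arg2pi[of z] zs by (simp add: cis_conv_exp mult.commute is_Arg_def)
    then have R: "cos \<delta> < cos (Arg2pi z)" using zs by (metis cis.simps(1))
    have "Arg2pi z < \<delta> \<or> 2 * pi - \<delta> < Arg2pi z"
    proof (rule ccontr)
      assume "\<not> ?thesis"
      then have a: "\<delta> \<le> Arg2pi z" "Arg2pi z \<le> 2 * pi - \<delta>" by auto
      show False
      proof (cases "Arg2pi z \<le> pi")
        case True
        then show ?thesis using cos_monotone_0_pi_le[of \<delta> "Arg2pi z"] a d R by auto
      next
        case False
        then show ?thesis using cos_monotone_0_pi_le[of \<delta> "2 * pi - Arg2pi z"] a d R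
          by (auto simp: cos_2pi_minus)
      qed
    qed
    then show ?thesis by (rule z)
  qed
  have cont: "continuous_on (sphere 0 1) ?G"
    unfolding continuous_on_eq_continuous_within
  proof
    fix z :: complex assume zs: "z \<in> sphere 0 1"
    show "continuous (at z within sphere 0 1) ?G"
    proof (cases "cos \<delta> < Re z")
      case True
      have "open {w. cos \<delta> < Re w}" by (rule open_halfspace_Re_gt)
      then have "\<forall>\<^sub>F w in at z within sphere 0 1. w \<in> {w. cos \<delta> < Re w}"
        using True by (intro topological_tendstoD[OF tendsto_ident_at]) auto
      moreover have "\<forall>\<^sub>F w in at z within sphere 0 1. w \<in> sphere 0 1"
        by (simp add: eventually_at_filter)
      ultimately have "\<forall>\<^sub>F w in at z within sphere 0 1. ?G w = 0"
        by eventually_elim (use near1 in auto)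
      then have "(?G \<longlongrightarrow> 0) (at z within sphere 0 1)"
        by (rule tendsto_eventually)
      then show ?thesis using near1[of z] True zs by (simp add: continuous_within)
    next
      case False
      \<comment> \<open>Outside the arc around 1 on which the function vanishes, the point avoids
        the branch cut of \<open>Arg2pi\<close>.\<close>
      have "z \<notin> \<real>\<^sub>\<ge>\<^sub>0"
      proof
        assume "z \<in> \<real>\<^sub>\<ge>\<^sub>0"
        then have "z = 1" using zs by (auto simp: nonneg_Reals_def)
        with False d have "cos \<delta> \<ge> 1" by auto
        moreover have "cos \<delta> < 1" using cos_monotone_0_pi[of 0 \<delta>] d by auto
        ultimately show False by simp
      qed
      then have "isCont Arg2pi z" by (rule continuous_at_Arg2pi)
      moreover have "isCont u (Arg2pi z)" using u by (simp add: continuous_on_eq_continuous_at)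
      ultimately have "isCont ?G z" using isCont_o2 by blast
      then show ?thesis by (rule continuous_at_imp_continuous_within)
    qed
  qed
  obtain p where p: "real_polynomial_function p" "\<And>z. z \<in> sphere 0 1 \<Longrightarrow> \<bar>?G z - p z\<bar> < e"
    using Stone_Weierstrass_real_polynomial_function[OF compact_sphere cont e] by blast
  have "\<bar>u x - p (cis x)\<bar> < e" if x: "x \<in> {0..2*pi}" for x
  proof (cases "x = 2 * pi")
    case True
    have "?G 1 = 0" by (rule near1) (use d cos_monotone_0_pi[of 0 \<delta>] in auto)
    moreover have "u (2 * pi) = 0" by (rule z) (use d in auto)
    ultimately show ?thesis using p(2)[of 1] True by simp
  next
    case False
    then have "Arg2pi (cis x) = x"
      by (intro Arg2pi_unique[of 1]) (use x in \<open>auto simp: cis_conv_exp mult.commute\<close>)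
    then show ?thesis using p(2)[of "cis x"] by simp
  qed
  then show ?thesis using trigp_polynomial[OF p(1)] by (intro bexI[of _ "\<lambda>x. p (cis x)"]) auto
qed

section \<open>Density of trigonometric polynomials in L2\<close>

lemma sqi_bounded:
  assumes "f \<in> borel_measurable circle" "\<And>x. \<bar>f x\<bar> \<le> B"
  shows "sqi f"
proof -
  interpret finite_measure circle by (rule finite_measure_circle)
  have "integrable circle (\<lambda>x. (f x)\<^sup>2)"
  proof (rule Bochner_Integration.integrable_bound)
    show "integrable circle (\<lambda>x. B\<^sup>2)" by auto
    show "AE x in circle. norm ((f x)\<^sup>2) \<le> norm (B\<^sup>2)"
      using assms(2) by (intro AE_I2) (simp add: abs_le_square_iff[symmetric] order_trans[OF _ abs_ge_self])
  qed (use assms(1) in measurable)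
  with assms(1) show ?thesis unfolding sqi_def by auto
qed

lemma AE_circle_interior:
  assumes "negligible N" "\<And>x. x \<notin> N \<Longrightarrow> 0 < x \<Longrightarrow> x < 2 * pi \<Longrightarrow> P x"
  shows "AE x in circle. P x"
proof -
  have "negligible (N \<union> {0, 2 * pi})" using assms(1) by auto
  then have "AE x in lebesgue. x \<notin> N \<union> {0, 2*pi}"
    by (intro AE_not_in) (simp only: negligible_iff_null_sets)
  then have "AE x in lebesgue. x \<in> {0..2*pi} \<longrightarrow> P x"
    by eventually_elim (use assms(2) in force)
  then show ?thesis by (simp add: AE_restrict_space_iff)
qed

lemma cint_square_tendsto:
  fixes w :: "real \<Rightarrow> real"
  assumes "\<And>n. g n \<in> borel_measurable circle" "f \<in> borel_measurable circle"
    and "integrable circle w" "AE x in circle. (\<lambda>n. g n x) \<longlonglongrightarrow> f x"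
    and "\<And>n. AE x in circle. (f x - g n x)\<^sup>2 \<le> w x"
  shows "(\<lambda>n. cint (\<lambda>x. (f x - g n x)\<^sup>2)) \<longlonglongrightarrow> 0"
proof -
  have "(\<lambda>n. cint (\<lambda>x. (f x - g n x)\<^sup>2)) \<longlonglongrightarrow> cint (\<lambda>x. 0)"
  proof (rule integral_dominated_convergence[where w = w])
    show "AE x in circle. (\<lambda>n. (f x - g n x)\<^sup>2) \<longlonglongrightarrow> 0"
      using assms(4)
    proof eventually_elim
      case (elim x)
      from tendsto_power[OF tendsto_diff[OF tendsto_const elim], of "f x" 2] show ?case by simp
    qed
    show "AE x in circle. norm ((f x - g n x)\<^sup>2) \<le> w x" for n
      using assms(5)[of n] by eventually_elim simp
  qed (use assms in auto)
  then show ?thesis by simp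
qed

definition clamp1 :: "real \<Rightarrow> real \<Rightarrow> real" where "clamp1 M x = max (- M) (min M x)"

lemma clamp1_bound: "0 \<le> M \<Longrightarrow> \<bar>clamp1 M x\<bar> \<le> M" by (auto simp: clamp1_def)
lemma clamp1_id: "\<bar>x\<bar> \<le> M \<Longrightarrow> clamp1 M x = x" by (auto simp: clamp1_def)
lemma clamp1_lipschitz: "\<bar>clamp1 M x - clamp1 M y\<bar> \<le> \<bar>x - y\<bar>" by (auto simp: clamp1_def max_def min_def)
lemma clamp1_continuous: "continuous_on S f \<Longrightarrow> continuous_on S (\<lambda>x. clamp1 M (f x))"
  unfolding clamp1_def by (intro continuous_intros)
lemma clamp1_measurable: "f \<in> borel_measurable A \<Longrightarrow> (\<lambda>x. clamp1 M (f x)) \<in> borel_measurable A"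
  unfolding clamp1_def by (intro borel_measurable_max borel_measurable_min borel_measurable_const)

lemma sqi_approx_bounded:
  assumes f: "sqi f" and e: "0 < e"
  shows "\<exists>M\<ge>0. cint (\<lambda>x. (f x - clamp1 M (f x))\<^sup>2) < e"
proof -
  have le: "(f x - clamp1 (real n) (f x))\<^sup>2 \<le> (f x)\<^sup>2" for n x
  proof -
    have "\<bar>f x - clamp1 (real n) (f x)\<bar> \<le> \<bar>f x\<bar>" by (auto simp: clamp1_def)
    then show ?thesis by (simp add: abs_le_square_iff)
  qed
  have "(\<lambda>n. cint (\<lambda>x. (f x - clamp1 (real n) (f x))\<^sup>2)) \<longlonglongrightarrow> 0"
  proof (rule cint_square_tendsto[where w = "\<lambda>x. (f x)\<^sup>2"])
    show "AE x in circle. (\<lambda>n. clamp1 (real n) (f x)) \<longlonglongrightarrow> f x"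
    proof (intro AE_I2)
      fix x
      obtain N where "\<bar>f x\<bar> \<le> real N" using real_arch_simple by blast
      then have "\<forall>\<^sub>F n in sequentially. clamp1 (real n) (f x) = f x"
        by (intro eventually_sequentiallyI[of N] clamp1_id) auto
      then show "(\<lambda>n. clamp1 (real n) (f x)) \<longlonglongrightarrow> f x" by (rule tendsto_eventually)
    qed
  qed (use f le in \<open>auto simp: sqi_def intro: clamp1_measurable\<close>)
  then obtain n where "cint (\<lambda>x. (f x - clamp1 (real n) (f x))\<^sup>2) < e"
    using e by (metis (no_types, lifting) eventually_sequentially order_tendstoD(2) order_refl)
  then show ?thesis by (intro exI[of _ "real n"]) auto
qed

text \<open>A measurable function is an almost everywhere limit of continuous ones. Clamping them
  supplies a majorant for dominated convergence, and a cut-off produces the vanishing near the ends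
  that \<open>trigp_uniform_approx\<close> requires.\<close>

lemma bounded_approx_continuous:
  fixes f :: "real \<Rightarrow> real"
  assumes f: "f \<in> borel_measurable circle" and M: "0 \<le> M" "\<And>x. \<bar>f x\<bar> \<le> M" and e: "0 < e"
  shows "\<exists>u \<delta>. continuous_on UNIV u \<and> 0 < \<delta> \<and> \<delta> < pi \<and> (\<forall>x. x < \<delta> \<or> 2 * pi - \<delta> < x \<longrightarrow> u x = 0) \<and>
     cint (\<lambda>x. (f x - u x)\<^sup>2) < e"
proof -
  interpret finite_measure circle by (rule finite_measure_circle)
  have "f measurable_on {0..2*pi}" using f by (simp add: measurable_on_iff_borel_measurable)
  then obtain N g where N: "negligible N" and g: "\<And>n. continuous_on UNIV (g n)"
    and lim: "\<And>x. x \<notin> N \<Longrightarrow> (\<lambda>n. g n x) \<longlonglongrightarrow> (if x \<in> {0..2*pi} then f x else 0)"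
    unfolding measurable_on_def by blast
  \<comment> \<open>A trapezoid: 0 within distance 1 / n of the ends of the period, 1 beyond
    distance 2 / n.\<close>
  define cut where "cut n x = min 1 (max 0 (real n * min x (2 * pi - x) - 1))" for n x
  define u where "u n x = cut n x * clamp1 M (g n x)" for n x
  have u: "continuous_on UNIV (u n)" for n
    unfolding u_def cut_def by (intro continuous_intros clamp1_continuous g)
  have cut: "0 \<le> cut n x \<and> cut n x \<le> 1" for n x unfolding cut_def by auto
  have ub: "\<bar>u n x\<bar> \<le> M" for n x
    using mult_mono[of "cut n x" 1 "\<bar>clamp1 M (g n x)\<bar>" M] cut[of n x] clamp1_bound[OF M(1)]
    by (auto simp: u_def abs_mult)
  have "(\<lambda>n. cint (\<lambda>x. (f x - u n x)\<^sup>2)) \<longlonglongrightarrow> 0"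
  proof (rule cint_square_tendsto[where w = "\<lambda>x. (2 * M)\<^sup>2"])
    show "AE x in circle. (\<lambda>n. u n x) \<longlonglongrightarrow> f x"
    proof (rule AE_circle_interior[OF N])
      fix x assume x: "x \<notin> N" "0 < x" "x < 2 * pi"
      have d: "0 < min x (2 * pi - x)" using x by auto
      obtain n0 :: nat where n0: "2 / min x (2 * pi - x) < real n0" using reals_Archimedean2 by blast
      have "cut n x = 1" if "n \<ge> n0" for n
      proof -
        have "2 / min x (2 * pi - x) < real n" using n0 that by linarith
        then have "2 < real n * min x (2 * pi - x)" using d by (simp only: pos_divide_less_eq)
        then show ?thesis unfolding cut_def by auto
      qed
      then have 1: "(\<lambda>n. cut n x) \<longlonglongrightarrow> 1"
        by (intro tendsto_eventually eventually_sequentiallyI[of n0]) auto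
      have 2: "(\<lambda>n. clamp1 M (g n x)) \<longlonglongrightarrow> clamp1 M (f x)"
        unfolding clamp1_def using lim[OF x(1)] x by (intro tendsto_intros) auto
      from tendsto_mult[OF 1 2] show "(\<lambda>n. u n x) \<longlonglongrightarrow> f x"
        unfolding u_def using M(2) by (simp add: clamp1_id)
    qed
    show "AE x in circle. (f x - u n x)\<^sup>2 \<le> (2 * M)\<^sup>2" for n
    proof (intro AE_I2)
      fix x
      have "\<bar>f x - u n x\<bar> \<le> \<bar>2 * M\<bar>" using ub[of n x] M(2)[of x] M(1) by linarith
      then show "(f x - u n x)\<^sup>2 \<le> (2 * M)\<^sup>2" by (simp only: abs_le_square_iff)
    qed
  qed (use f u circle_measurable in auto)
  then have "\<forall>\<^sub>F n in sequentially. cint (\<lambda>x. (f x - u n x)\<^sup>2) < e" using e by (rule order_tendstoD(2))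
  then obtain n0 where n0: "\<And>n. n \<ge> n0 \<Longrightarrow> cint (\<lambda>x. (f x - u n x)\<^sup>2) < e"
    by (auto simp: eventually_sequentially)
  \<comment> \<open>The index is at least 1, so that the width 1 / n is positive and smaller than
    pi.\<close>
  define n where "n = max n0 1"
  have z: "u n x = 0" if "x < 1 / real n \<or> 2 * pi - 1 / real n < x" for x
  proof -
    have "min x (2 * pi - x) \<le> 1 / real n" using that by auto
    then have "real n * min x (2 * pi - x) \<le> 1" using mult_left_mono[of _ _ "real n"] by (fastforce simp: n_def)
    then show ?thesis unfolding u_def cut_def by simp
  qed
  have "0 < 1 / real n" "1 / real n < pi"
    using pi_gt3 by (auto simp: n_def field_simps max_def)
       (smt (verit) One_nat_def mult_less_cancel_left2 nat_le_linear of_nat_1 of_nat_le_iff)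
  then show ?thesis using u[of n] z n0[of n]
    by (intro exI[of _ "u n"] exI[of _ "1 / real n"]) (auto simp: n_def)
qed

text \<open>Clamping, continuous approximation and trigonometric approximation each contribute at
  most e / 9 to the squared error; squaring a sum of three terms costs a factor 3.\<close>

lemma sqi_approx_trig:
  assumes f: "sqi f" and e: "0 < e"
  shows "\<exists>a c m. c 0 = 0 \<and> (\<forall>k>m. c k = 0) \<and> cint (\<lambda>x. (f x - (a + fser c x))\<^sup>2) < e"
proof -
  have e': "0 < e / 9" using e by simp
  obtain M where M: "0 \<le> M" "cint (\<lambda>x. (f x - clamp1 M (f x))\<^sup>2) < e / 9"
    using sqi_approx_bounded[OF f e'] by blast
  let ?f = "\<lambda>x. clamp1 M (f x)"
  have fm: "?f \<in> borel_measurable circle" using f by (auto simp: sqi_def intro: clamp1_measurable)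
  obtain u \<delta> where u: "continuous_on UNIV u" "0 < \<delta>" "\<delta> < pi"
    "\<And>x. x < \<delta> \<or> 2 * pi - \<delta> < x \<Longrightarrow> u x = 0" "cint (\<lambda>x. (?f x - u x)\<^sup>2) < e / 9"
    using bounded_approx_continuous[OF fm M(1) clamp1_bound[OF M(1)] e'] by blast
  \<comment> \<open>A uniform error d has squared L2 norm at most 2 pi d^2 = e / 9.\<close>
  define d where "d = sqrt (e / (18 * pi))"
  have d: "0 < d" "d\<^sup>2 = e / (18 * pi)" using e by (auto simp: d_def)
  obtain p where p: "p \<in> trigp" "\<And>x. x \<in> {0..2*pi} \<Longrightarrow> \<bar>u x - p x\<bar> < d"
    using trigp_uniform_approx[OF u(1-4) d(1)] by blast
  obtain a c m where c: "c 0 = 0" "\<forall>k>m. c k = 0" "\<And>x. p x = a + fser c x"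
    using trigp_fser[OF p(1)] by blast
  have sc: "summable (\<lambda>k. norm (c k))"
    by (rule summable_finite[of "{..m}"]) (use c in \<open>auto simp: not_le\<close>)
  have pc: "continuous_on UNIV p" using c(3) fser_continuous[OF sc]
    by (subst (1) ext[of p "\<lambda>x. a + fser c x"]) (auto intro: continuous_intros)
  have q1: "sqi (\<lambda>x. f x - ?f x)" by (intro sqi_diff f sqi_bounded[OF fm clamp1_bound[OF M(1)]])
  have q2: "sqi (\<lambda>x. ?f x - u x)" by (intro sqi_diff sqi_continuous u sqi_bounded[OF fm clamp1_bound[OF M(1)]])
  have q3: "sqi (\<lambda>x. u x - p x)" by (intro sqi_diff sqi_continuous u pc)
  have q: "sqi (\<lambda>x. f x - p x)" by (intro sqi_diff sqi_continuous f pc)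
  interpret finite_measure circle by (rule finite_measure_circle)
  have "cint (\<lambda>x. (u x - p x)\<^sup>2) \<le> cint (\<lambda>x. d\<^sup>2)"
  proof (rule integral_mono_AE)
    show "AE x in circle. (u x - p x)\<^sup>2 \<le> d\<^sup>2"
    proof (rule AE_I2)
      fix x assume "x \<in> space circle"
      then have "\<bar>u x - p x\<bar> \<le> \<bar>d\<bar>" using p(2)[of x] d by (auto simp: space_restrict_space)
      then show "(u x - p x)\<^sup>2 \<le> d\<^sup>2" by (simp only: abs_le_square_iff)
    qed
  qed (use q3 in \<open>auto simp: sqi_def\<close>)
  also have "\<dots> = e / 9" by (subst cint_const) (simp add: d)
  finally have up: "cint (\<lambda>x. (u x - p x)\<^sup>2) \<le> e / 9" .
  have le: "(f x - p x)\<^sup>2 \<le> 3 * ((f x - ?f x)\<^sup>2 + (?f x - u x)\<^sup>2 + (u x - p x)\<^sup>2)" for x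
  proof -
    have "(r + s + t)\<^sup>2 \<le> 3 * (r\<^sup>2 + s\<^sup>2 + t\<^sup>2)" for r s t :: real
    proof -
      have "0 \<le> (r - s)\<^sup>2 + (s - t)\<^sup>2 + (r - t)\<^sup>2" by simp
      then show ?thesis by (simp add: power2_eq_square algebra_simps)
    qed
    from this[of "f x - ?f x" "?f x - u x" "u x - p x"] show ?thesis by simp
  qed
  have "cint (\<lambda>x. (f x - p x)\<^sup>2) \<le> cint (\<lambda>x. 3 * ((f x - ?f x)\<^sup>2 + (?f x - u x)\<^sup>2 + (u x - p x)\<^sup>2))"
    by (rule integral_mono) (use q q1 q2 q3 le in \<open>auto simp: sqi_def\<close>)
  also have "\<dots> = 3 * (cint (\<lambda>x. (f x - ?f x)\<^sup>2) + cint (\<lambda>x. (?f x - u x)\<^sup>2) + cint (\<lambda>x. (u x - p x)\<^sup>2))"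
    using q1 q2 q3 by (simp add: sqi_def)
  also have "\<dots> < e" using M(2) u(5) up by simp
  finally show ?thesis using c by auto
qed

section \<open>Parseval's identity and Bessel's inequality\<close>

lemma cint_fser_sq:
  assumes "\<And>k. m < k \<Longrightarrow> c k = 0" "c 0 = 0"
  shows "cint (\<lambda>x. (fser c x)\<^sup>2) = pi * (\<Sum>k\<le>m. (cmod (c k))\<^sup>2)"
proof -
  have sc: "summable (\<lambda>k. norm (c k))"
    by (rule summable_finite[of "{..m}"]) (use assms in \<open>auto simp: not_le\<close>)
  have "cint (\<lambda>x. fser c x * fser c x) = pi * (\<Sum>k\<le>m. Re (c k * cnj (fc (fser c) k)))"
    by (rule cint_mult_fser) (auto intro: circle_integrable fser_continuous sc assms)
  also have "\<dots> = pi * (\<Sum>k\<le>m. (cmod (c k))\<^sup>2)"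
    unfolding fc_fser[OF sc assms(2)] by (simp add: complex_mult_cnj cmod_power2)
  finally show ?thesis by (simp add: power2_eq_square)
qed

text \<open>Completing the square in the coefficients: the last two terms vanish exactly for the
  Fourier coefficients of \<open>f\<close>, which are therefore the best choice.\<close>

lemma cint_fser_remainder:
  assumes f: "sqi f" and c: "\<And>k. m < k \<Longrightarrow> c k = 0" "c 0 = 0" and mz: "cint f = 0"
  shows "cint (\<lambda>x. (f x - (a + fser c x))\<^sup>2) =
    cint (\<lambda>x. (f x)\<^sup>2) - pi * (\<Sum>k\<le>m. if k = 0 then 0 else (cmod (fc f k))\<^sup>2)
    + 2 * pi * a\<^sup>2 + pi * (\<Sum>k\<le>m. if k = 0 then 0 else (cmod (c k - fc f k))\<^sup>2)"
proof -
  have sc: "summable (\<lambda>k. norm (c k))"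
    by (rule summable_finite[of "{..m}"]) (use c in \<open>auto simp: not_le\<close>)
  have qs: "sqi (fser c)" by (intro sqi_continuous fser_continuous sc)
  note i = sqi_integrable[OF f] sqi_integrable[OF qs] sqi_mult_integrable[OF f qs]
    f[unfolded sqi_def, THEN conjunct2] qs[unfolded sqi_def, THEN conjunct2]
  interpret finite_measure circle by (rule finite_measure_circle)
  have "(\<lambda>x. (f x - (a + fser c x))\<^sup>2) =
    (\<lambda>x. (f x)\<^sup>2 + a\<^sup>2 + (fser c x)\<^sup>2 - 2 * a * f x - 2 * (f x * fser c x) + 2 * a * fser c x)"
    by (auto simp: power2_eq_square algebra_simps)
  then have "cint (\<lambda>x. (f x - (a + fser c x))\<^sup>2) = cint (\<lambda>x. (f x)\<^sup>2) + 2 * pi * a\<^sup>2 + cint (\<lambda>x. (fser c x)\<^sup>2)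
      - 2 * a * cint f - 2 * cint (\<lambda>x. f x * fser c x) + 2 * a * cint (fser c)"
    using i cint_const[of "a\<^sup>2"] by simp
  also have "\<dots> = cint (\<lambda>x. (f x)\<^sup>2) + 2 * pi * a\<^sup>2 + pi * ((\<Sum>k\<le>m. (cmod (c k))\<^sup>2) - 2 * (\<Sum>k\<le>m. Re (c k * cnj (fc f k))))"
    using cint_fser[OF sc c(2)] cint_mult_fser[where m=m and c=c, OF i(1) c(1)] cint_fser_sq[where m=m and c=c, OF c(1,2)] mz
    by (simp add: algebra_simps)
  also have "(\<Sum>k\<le>m. (cmod (c k))\<^sup>2) - 2 * (\<Sum>k\<le>m. Re (c k * cnj (fc f k))) =
     (\<Sum>k\<le>m. (if k = 0 then 0 else (cmod (c k - fc f k))\<^sup>2) - (if k = 0 then 0 else (cmod (fc f k))\<^sup>2))"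
    unfolding sum_distrib_left sum_subtractf[symmetric]
  proof (rule sum.cong)
    fix k
    have "(cmod z)\<^sup>2 - 2 * Re (z * cnj w) = (cmod (z - w))\<^sup>2 - (cmod w)\<^sup>2" for z w
      unfolding cmod_power2 by (simp add: power2_eq_square algebra_simps)
    then show "(cmod (c k))\<^sup>2 - 2 * Re (c k * cnj (fc f k)) =
      (if k = 0 then 0 else (cmod (c k - fc f k))\<^sup>2) - (if k = 0 then 0 else (cmod (fc f k))\<^sup>2)"
      using c(2) by auto
  qed auto
  finally show ?thesis by (simp add: sum_subtractf algebra_simps)
qed

text \<open>Inserting the true coefficients into the remainder formula bounds the partial sums from
  above. For the lower bound, the error of any approximating trigonometric polynomial dominates the
  part of the norm that the partial sum misses, and by density this error can be made small.\<close>

lemma parseval: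
  assumes f: "sqi f" and mz: "cint f = 0"
  shows "(\<lambda>k. (cmod (fc f k))\<^sup>2) sums (cint (\<lambda>x. (f x)\<^sup>2) / pi)"
proof -
  have f0: "fc f 0 = 0" using mz by (simp add: fc_0)
  let ?s = "\<lambda>m. (\<Sum>k\<le>m. (cmod (fc f k))\<^sup>2)"
  let ?I = "cint (\<lambda>x. (f x)\<^sup>2) / pi"
  have R: "cint (\<lambda>x. (f x - (a + fser c x))\<^sup>2) / pi = ?I - ?s m + 2 * a\<^sup>2 + (\<Sum>k\<le>m. (cmod (c k - fc f k))\<^sup>2)"
    if "\<And>k. m < k \<Longrightarrow> c k = 0" "c 0 = 0" for a c m
  proof -
    have e: "(\<Sum>k\<le>m. if k = 0 then 0 else (cmod (fc f k))\<^sup>2) = ?s m"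
      "(\<Sum>k\<le>m. if k = 0 then 0 else (cmod (c k - fc f k))\<^sup>2) = (\<Sum>k\<le>m. (cmod (c k - fc f k))\<^sup>2)"
      by (rule sum.cong; use f0 that in auto)+
    have "cint (\<lambda>x. (f x - (a + fser c x))\<^sup>2) = pi * (?I - ?s m + 2 * a\<^sup>2 + (\<Sum>k\<le>m. (cmod (c k - fc f k))\<^sup>2))"
      using cint_fser_remainder[where c=c and m=m and a=a, OF f that mz] unfolding e by (simp add: algebra_simps)
    then show ?thesis by simp
  qed
  have up: "?s m \<le> ?I" for m
  proof -
    have "0 \<le> cint (\<lambda>x. (f x - (0 + fser (tr m (fc f)) x))\<^sup>2) / pi"
      by (intro divide_nonneg_pos cint_nonneg) auto
    also have "\<dots> = ?I - ?s m + 2 * 0\<^sup>2 + (\<Sum>k\<le>m. (cmod (tr m (fc f) k - fc f k))\<^sup>2)"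
      by (rule R) auto
    also have "(\<Sum>k\<le>m. (cmod (tr m (fc f) k - fc f k))\<^sup>2) = 0"
      by (rule sum.neutral) (use f0 in \<open>auto simp: tr_def not_le less_Suc_eq_0_disj\<close>)
    finally show ?thesis by simp
  qed
  have lo: "\<exists>m. \<forall>n\<ge>m. ?I - e < ?s n" if e: "0 < e" for e
  proof -
    obtain a c m where c: "c 0 = 0" "\<forall>k>m. c k = 0" "cint (\<lambda>x. (f x - (a + fser c x))\<^sup>2) < pi * e"
      using sqi_approx_trig[OF f, of "pi * e"] e by auto
    have "?I - e < ?s n" if n: "n \<ge> m" for n
    proof -
      have "cint (\<lambda>x. (f x - (a + fser c x))\<^sup>2) / pi = ?I - ?s n + 2 * a\<^sup>2 + (\<Sum>k\<le>n. (cmod (c k - fc f k))\<^sup>2)"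
        by (rule R) (use c n in auto)
      moreover have "0 \<le> (\<Sum>k\<le>n. (cmod (c k - fc f k))\<^sup>2)" by (intro sum_nonneg) auto
      moreover have "cint (\<lambda>x. (f x - (a + fser c x))\<^sup>2) / pi < e" using c(3) by (simp add: field_simps)
      ultimately show ?thesis using zero_le_power2[of a] by linarith
    qed
    then show ?thesis by blast
  qed
  have "?s \<longlonglongrightarrow> ?I"
  proof (rule LIMSEQ_I)
    fix e :: real assume "0 < e"
    then obtain m where m: "\<forall>n\<ge>m. ?I - e < ?s n" using lo by blast
    have "norm (?s n - ?I) < e" if "n \<ge> m" for n
      using m[rule_format, OF that] up[of n] unfolding real_norm_def by linarith
    then show "\<exists>no. \<forall>n\<ge>no. norm (?s n - ?I) < e" by blast
  qed
  then show ?thesis unfolding sums_def_le .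
qed

text \<open>Parseval is applied after subtracting the mean, which leaves the coefficients with k
  \<ge> 1 unchanged and does not increase the L2 norm.\<close>

lemma bessel:
  assumes f: "sqi f"
  shows "(\<Sum>k=1..m. (cmod (fc f k))\<^sup>2) \<le> cint (\<lambda>x. (f x)\<^sup>2) / pi"
proof -
  define a where "a = cint f / (2 * pi)"
  interpret finite_measure circle by (rule finite_measure_circle)
  have i: "integrable circle f" "integrable circle (\<lambda>x. (f x)\<^sup>2)"
    using sqi_integrable[OF f] f by (auto simp: sqi_def)
  have g: "sqi (\<lambda>x. f x - a)" by (intro sqi_diff f sqi_const)
  have "fc (\<lambda>x. a) k = 0" if "k \<ge> 1" for k
  proof -
    have "cint (\<lambda>x. cis (of_int (- int k) * x)) = 0" using that by (intro cint_cis) auto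
    then show ?thesis unfolding fc_def by simp
  qed
  then have e: "fc (\<lambda>x. f x - a) k = fc f k" if "k \<ge> 1" for k
    using that by (subst fc_diff) (auto simp: i)
  have z: "cint (\<lambda>x. f x - a) = 0" using i cint_const[of a] by (simp add: a_def)
  note P = parseval[OF g z]
  have "(\<Sum>k=1..m. (cmod (fc f k))\<^sup>2) = (\<Sum>k=1..m. (cmod (fc (\<lambda>x. f x - a) k))\<^sup>2)"
    by (rule sum.cong) (auto simp: e)
  also have "\<dots> \<le> cint (\<lambda>x. (f x - a)\<^sup>2) / pi"
    using sum_le_suminf[OF sums_summable[OF P], of "{1..m}"] sums_unique[OF P] by simp
  also have "cint (\<lambda>x. (f x - a)\<^sup>2) \<le> cint (\<lambda>x. (f x)\<^sup>2)"
  proof -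
    have "(\<lambda>x. (f x - a)\<^sup>2) = (\<lambda>x. (f x)\<^sup>2 - 2 * a * f x + a\<^sup>2)"
      by (auto simp: power2_eq_square algebra_simps)
    then have "cint (\<lambda>x. (f x - a)\<^sup>2) = cint (\<lambda>x. (f x)\<^sup>2) - 2 * a * cint f + 2 * pi * a\<^sup>2"
      using i cint_const[of "a\<^sup>2"] by simp
    also have "\<dots> = cint (\<lambda>x. (f x)\<^sup>2) - 2 * pi * a\<^sup>2"
      by (simp add: a_def power2_eq_square)
    finally show ?thesis by simp
  qed
  finally show ?thesis by (simp add: divide_right_mono)
qed

lemma fc_zero_imp_AE_zero:
  assumes f: "sqi f" and mz: "cint f = 0" and z: "\<And>k. k \<ge> 1 \<Longrightarrow> fc f k = 0"
  shows "AE x in circle. f x = 0"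
proof -
  have "fc f k = 0" for k using z[of k] mz by (cases k) (auto simp: fc_0)
  then have "(\<lambda>k. 0::real) sums (cint (\<lambda>x. (f x)\<^sup>2) / pi)"
    using parseval[OF f mz] by simp
  then have "cint (\<lambda>x. (f x)\<^sup>2) = 0" by (simp add: sums_iff)
  then have "AE x in circle. (f x)\<^sup>2 = 0"
    using integral_nonneg_eq_0_iff_AE[of circle "\<lambda>x. (f x)\<^sup>2"] f by (simp add: sqi_def)
  then show ?thesis by simp
qed

subsection \<open>Sobolev functions and their Fourier coefficients\<close>

lemma ddc_funpow: "(ddc ^^ j) c k = (\<i> * of_nat k) ^ j * c k"
  by (induction j arbitrary: c) (auto simp: ddc_def)

lemma mode_DERIV:
  "((\<lambda>x. Re (a * cis (real k * x))) has_real_derivative Re (\<i> * of_nat k * a * cis (real k * x))) (at x)"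
proof -
  have "((\<lambda>x. a * cis (real k * x)) has_vector_derivative a * (\<i> * of_real (real k) * cis (real k * x))) (at x)"
    by (rule has_vector_derivative_mult_right[OF cis_vector_derivative])
  then have "((\<lambda>x. Re (a * cis (real k * x))) has_vector_derivative Re (a * (\<i> * of_real (real k) * cis (real k * x)))) (at x)"
    by (rule bounded_linear.has_vector_derivative[OF bounded_linear_Re])
  then show ?thesis by (simp add: has_real_derivative_iff_has_vector_derivative mult_ac)
qed

lemma mode_deriv: "deriv (\<lambda>x. Re (a * cis (real k * x))) = (\<lambda>x. Re (\<i> * of_nat k * a * cis (real k * x)))"
  by (rule ext) (rule DERIV_imp_deriv[OF mode_DERIV])

lemma mode_deriv_n:
  "(deriv ^^ j) (\<lambda>x. Re (a * cis (real k * x))) = (\<lambda>x. Re ((\<i> * of_nat k) ^ j * a * cis (real k * x)))"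
proof (induction j)
  case (Suc j)
  then show ?case
    using mode_deriv[of "(\<i> * of_nat k) ^ j * a" k] by (simp only: funpow.simps comp_apply power_Suc mult.assoc)
qed simp

lemma smooth_fun_mode: "smooth_fun (\<lambda>x. Re (a * cis (real k * x)))"
proof (rule smooth_fun_coinduct[of _ "range (\<lambda>a x. Re (a * cis (real k * x)))"])
  fix g assume "g \<in> range (\<lambda>a x. Re (a * cis (real k * x)))"
  then obtain a where g: "g = (\<lambda>x. Re (a * cis (real k * x)))" by auto
  show "(\<forall>x. g field_differentiable at x) \<and> deriv g \<in> range (\<lambda>a x. Re (a * cis (real k * x)))"
    unfolding g mode_deriv field_differentiable_def using mode_DERIV by blast
qed auto

lemma mode_periodic: "periodic_fun_simple (\<lambda>x. Re (a * cis (real k * x))) (2 * pi)"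
proof
  fix x
  have "cis (real k * (x + 2 * pi)) = cis (real k * x) * cis (2 * pi * of_int (int k))"
    by (simp add: cis_mult algebra_simps)
  also have "\<dots> = cis (real k * x)" by (simp only: cis_2pi_mult) simp
  finally show "Re (a * cis (real k * (x + 2 * pi))) = Re (a * cis (real k * x))" by simp
qed

text \<open>The modes are admissible test functions and determine all coefficients of the weak
  derivative. The amplitudes 1 and -\<i> yield its real and imaginary parts.\<close>

lemma weak_deriv_fc:
  assumes "has_weak_deriv j f g"
  shows "fc g k = (\<i> * of_nat k) ^ j * fc f k"
proof -
  have f: "integrable circle f" and g: "integrable circle g"
    using assms sqi_integrable sqi_L2 unfolding has_weak_deriv_def by blast+
  have *: "Re ((\<i> * of_nat k) ^ j * a * cnj (fc f k)) = (-1) ^ j * Re (a * cnj (fc g k))" for a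
  proof -
    have "cint (\<lambda>x. f x * (deriv ^^ j) (\<lambda>x. Re (a * cis (real k * x))) x) =
        (-1)^j * cint (\<lambda>x. g x * Re (a * cis (real k * x)))"
      using assms smooth_fun_mode mode_periodic unfolding has_weak_deriv_def by blast
    then have "pi * Re ((\<i> * of_nat k) ^ j * a * cnj (fc f k)) = (-1)^j * (pi * Re (a * cnj (fc g k)))"
      unfolding mode_deriv_n cint_mult_mode(1)[OF f] cint_mult_mode(1)[OF g] .
    then show ?thesis by simp
  qed
  have "(\<i> * of_nat k) ^ j * cnj (fc f k) = (-1) ^ j * cnj (fc g k)" (is "?l = ?r")
  proof (rule complex_eqI)
    show "Re ?l = Re ?r" using *[of 1] by (cases "even j") auto
    show "Im ?l = Im ?r" using *[of "-\<i>"] by (cases "even j") auto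
  qed
  then have "cnj ?l = cnj ?r" by simp
  then have "(- (\<i> * of_nat k)) ^ j * fc f k = (-1) ^ j * fc g k" by simp
  then show ?thesis by (cases "even j") auto
qed

lemma weak_deriv_cint:
  assumes "has_weak_deriv j f g" "1 \<le> j"
  shows "cint g = 0"
  using weak_deriv_fc[OF assms(1), of 0] assms(2) by (cases j) (auto simp: fc_0)

lemma weak_deriv_spec:
  assumes "f \<in> sobolev s" "j \<le> s"
  shows "has_weak_deriv j f (weak_deriv j f)"
proof -
  have "\<exists>g. has_weak_deriv j f g" using assms unfolding sobolev_def by auto
  then show ?thesis unfolding weak_deriv_def by (rule someI_ex)
qed

lemma sqi_weak_deriv: "has_weak_deriv j f g \<Longrightarrow> sqi f" "has_weak_deriv j f g \<Longrightarrow> sqi g"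
  unfolding has_weak_deriv_def by (auto intro: sqi_L2)

lemma weak_deriv_sums:
  assumes "has_weak_deriv j f g" "cint f = 0"
  shows "(\<lambda>k. (real k ^ j * cmod (fc f k))\<^sup>2) sums (cint (\<lambda>x. (g x)\<^sup>2) / pi)"
proof -
  have "cint g = 0" using weak_deriv_fc[OF assms(1), of 0] assms(2) by (simp add: fc_0)
  from parseval[OF sqi_weak_deriv(2)[OF assms(1)] this] show ?thesis
    unfolding weak_deriv_fc[OF assms(1)] by (simp add: norm_mult norm_power)
qed

text \<open>The square of the homogeneous Sobolev norm of order s on the coefficient side. On
  sequences with \<open>c 0 = 0\<close> all frequencies are at least 1, so it is increasing in s and
  equivalent to the full norm.\<close>

definition nrm2 :: "nat \<Rightarrow> (nat \<Rightarrow> complex) \<Rightarrow> real" where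
  "nrm2 s c = (\<Sum>k. (real k ^ s * cmod (c k))\<^sup>2)"

definition hseq :: "nat \<Rightarrow> (nat \<Rightarrow> complex) \<Rightarrow> bool" where
  "hseq s c \<longleftrightarrow> c 0 = 0 \<and> summable (\<lambda>k. (real k ^ s * cmod (c k))\<^sup>2)"

lemma hseq_term_mono:
  assumes "c 0 = 0" "j \<le> s"
  shows "(real k ^ j * cmod (c k))\<^sup>2 \<le> (real k ^ s * cmod (c k))\<^sup>2"
proof (cases k)
  case 0
  then show ?thesis using assms(1) by simp
next
  case (Suc n)
  then have "real k ^ j \<le> real k ^ s" using assms(2) by (intro power_increasing) auto
  then show ?thesis by (intro power_mono mult_right_mono) auto
qed

lemma hseq_mono:
  assumes "hseq s c" "j \<le> s"
  shows "hseq j c"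
proof -
  have "summable (\<lambda>k. (real k ^ j * cmod (c k))\<^sup>2)"
  proof (rule summable_comparison_test'[of "\<lambda>k. (real k ^ s * cmod (c k))\<^sup>2" 0])
    show "summable (\<lambda>k. (real k ^ s * cmod (c k))\<^sup>2)" using assms by (simp add: hseq_def)
    fix k show "norm ((real k ^ j * cmod (c k))\<^sup>2) \<le> (real k ^ s * cmod (c k))\<^sup>2"
      using hseq_term_mono[of c j s k] assms by (simp add: hseq_def)
  qed
  then show ?thesis using assms by (simp add: hseq_def)
qed

lemma nrm2_mono: "hseq s c \<Longrightarrow> j \<le> s \<Longrightarrow> nrm2 j c \<le> nrm2 s c"
  unfolding nrm2_def using hseq_mono[of s c j] hseq_term_mono[of c j s]
  by (intro suminf_le) (auto simp: hseq_def)

lemma nrm2_nonneg: "hseq s c \<Longrightarrow> 0 \<le> nrm2 s c"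
  unfolding nrm2_def hseq_def by (auto intro: suminf_nonneg)

text \<open>Parseval for each weak derivative gives the factor pi. The factor s + 1 counts the
  summands of the norm, each of which is dominated by the one of highest order.\<close>

lemma sobolev_fc:
  assumes f: "f \<in> sobolev s" and mz: "cint f = 0"
  shows "hseq s (fc f)" "j \<le> s \<Longrightarrow> cint (\<lambda>x. (weak_deriv j f x)\<^sup>2) = pi * nrm2 j (fc f)"
    "pi * nrm2 s (fc f) \<le> (sobolev_norm s f)\<^sup>2"
    "(sobolev_norm s f)\<^sup>2 \<le> (real s + 1) * (pi * nrm2 s (fc f))"
proof -
  have S: "(\<lambda>k. (real k ^ j * cmod (fc f k))\<^sup>2) sums (cint (\<lambda>x. (weak_deriv j f x)\<^sup>2) / pi)" if "j \<le> s" for j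
    by (rule weak_deriv_sums[OF weak_deriv_spec[OF f that] mz])
  show h: "hseq s (fc f)"
    unfolding hseq_def using S[of s] mz by (auto simp: fc_0 sums_iff)
  have C: "cint (\<lambda>x. (weak_deriv j f x)\<^sup>2) = pi * nrm2 j (fc f)" if "j \<le> s" for j
    using S[OF that] by (simp add: nrm2_def sums_iff)
  then show "j \<le> s \<Longrightarrow> cint (\<lambda>x. (weak_deriv j f x)\<^sup>2) = pi * nrm2 j (fc f)" .
  have N: "(sobolev_norm s f)\<^sup>2 = (\<Sum>j\<le>s. pi * nrm2 j (fc f))"
    unfolding sobolev_norm_def
    by (subst real_sqrt_pow2) (auto intro!: sum_nonneg cint_nonneg sum.cong C)
  show "pi * nrm2 s (fc f) \<le> (sobolev_norm s f)\<^sup>2"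
    unfolding N by (rule member_le_sum) (auto intro!: mult_nonneg_nonneg nrm2_nonneg[OF hseq_mono[OF h]])
  have "(\<Sum>j\<le>s. pi * nrm2 j (fc f)) \<le> (\<Sum>j\<le>s. pi * nrm2 s (fc f))"
    by (intro sum_mono mult_left_mono nrm2_mono[OF h]) auto
  then show "(sobolev_norm s f)\<^sup>2 \<le> (real s + 1) * (pi * nrm2 s (fc f))"
    unfolding N by (simp add: algebra_simps)
qed

lemma sobolev_norm_nonneg: "0 \<le> sobolev_norm s f"
  unfolding sobolev_norm_def by (auto intro!: sum_nonneg cint_nonneg)

section \<open>Linearity of weak derivatives and comparison with classical ones\<close>

lemma L2_circle_diff: "f \<in> L2_circle \<Longrightarrow> g \<in> L2_circle \<Longrightarrow> (\<lambda>x. f x - g x) \<in> L2_circle"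
  using sqi_diff[OF sqi_L2 sqi_L2, of f g]
  by (auto simp: L2_circle_def sqi_def periodic_fun_simple_def)

lemma L2_circle_cmult: "f \<in> L2_circle \<Longrightarrow> (\<lambda>x. a * f x) \<in> L2_circle"
  using sqi_cmult[OF sqi_L2, of f a]
  by (auto simp: L2_circle_def sqi_def periodic_fun_simple_def)

lemma weak_deriv_diff:
  assumes "has_weak_deriv j f g" "has_weak_deriv j f' g'"
  shows "has_weak_deriv j (\<lambda>x. f x - f' x) (\<lambda>x. g x - g' x)"
  unfolding has_weak_deriv_def
proof (intro conjI allI impI)
  show "(\<lambda>x. f x - f' x) \<in> L2_circle" "(\<lambda>x. g x - g' x) \<in> L2_circle"
    using assms by (auto simp: has_weak_deriv_def intro: L2_circle_diff)
  fix \<phi> assume \<phi>: "smooth_fun \<phi> \<and> periodic_fun_simple \<phi> (2 * pi)"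
  have q: "sqi ((deriv ^^ j) \<phi>)" "sqi \<phi>"
    using \<phi> by (auto intro!: sqi_continuous smooth_fun_continuous smooth_fun_deriv_n)
  note s = sqi_weak_deriv[OF assms(1)] sqi_weak_deriv[OF assms(2)]
  have 1: "cint (\<lambda>x. (f x - f' x) * (deriv ^^ j) \<phi> x) =
     cint (\<lambda>x. f x * (deriv ^^ j) \<phi> x) - cint (\<lambda>x. f' x * (deriv ^^ j) \<phi> x)"
    unfolding left_diff_distrib by (intro Bochner_Integration.integral_diff sqi_mult_integrable s q)
  have 2: "cint (\<lambda>x. (g x - g' x) * \<phi> x) = cint (\<lambda>x. g x * \<phi> x) - cint (\<lambda>x. g' x * \<phi> x)"
    unfolding left_diff_distrib by (intro Bochner_Integration.integral_diff sqi_mult_integrable s q)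
  show "cint (\<lambda>x. (f x - f' x) * (deriv ^^ j) \<phi> x) = (-1)^j * cint (\<lambda>x. (g x - g' x) * \<phi> x)"
    unfolding 1 2 using assms \<phi> by (simp add: has_weak_deriv_def right_diff_distrib)
qed

lemma weak_deriv_cmult:
  assumes "has_weak_deriv j f g"
  shows "has_weak_deriv j (\<lambda>x. a * f x) (\<lambda>x. a * g x)"
  using assms unfolding has_weak_deriv_def by (auto simp: L2_circle_cmult mult.assoc)

lemma sobolev_diff: "f \<in> sobolev s \<Longrightarrow> g \<in> sobolev s \<Longrightarrow> (\<lambda>x. f x - g x) \<in> sobolev s"
  unfolding sobolev_def using weak_deriv_diff L2_circle_diff by blast

lemma sobolev_cmult: "f \<in> sobolev s \<Longrightarrow> (\<lambda>x. a * f x) \<in> sobolev s"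
  unfolding sobolev_def using weak_deriv_cmult L2_circle_cmult by blast

lemma periodic_deriv:
  assumes "periodic_fun_simple f (2 * pi)"
  shows "periodic_fun_simple (deriv f) (2 * pi)"
proof
  fix x :: real
  have "f (y + 2 * pi) = f y" for y using assms by (simp add: periodic_fun_simple_def)
  then have "(\<lambda>y. f (y + 2 * pi)) = f" by auto
  then have "(f has_field_derivative D) (at (x + 2 * pi)) \<longleftrightarrow> (f has_field_derivative D) (at x)" for D
    using DERIV_shift[of f D x "2 * pi"] by simp
  then show "deriv f (x + 2 * pi) = deriv f x" unfolding deriv_def by simp
qed

lemma periodic_deriv_n:
  "periodic_fun_simple f (2 * pi) \<Longrightarrow> periodic_fun_simple ((deriv ^^ n) f) (2 * pi)"
  by (induction n) (auto intro: periodic_deriv)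

lemma periodic_0_2pi: "periodic_fun_simple f (2 * pi) \<Longrightarrow> f (2 * pi) = f 0"
  by (metis add_0 periodic_fun_simple_def)

lemma cint_by_parts:
  assumes f: "\<And>x. (f has_real_derivative f' x) (at x)" and g: "\<And>x. (g has_real_derivative g' x) (at x)"
    and c: "continuous_on UNIV f'" "continuous_on UNIV g'"
    and p: "f (2 * pi) = f 0" "g (2 * pi) = g 0"
  shows "cint (\<lambda>x. f x * g' x) = - cint (\<lambda>x. f' x * g x)"
proof -
  have cf: "continuous_on UNIV f" "continuous_on UNIV g"
    using f g by (meson DERIV_isCont continuous_at_imp_continuous_on)+
  have "((\<lambda>x. f x * g x) has_real_derivative (f' x * g x + f x * g' x)) (at x)" for x
    using DERIV_mult[OF f g, of x] by (simp add: mult.commute)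
  then have "cint (\<lambda>x. f' x * g x + f x * g' x) = 0"
    by (rule fc_deriv(2)) (auto intro!: continuous_intros c cf simp: p)
  moreover have "cint (\<lambda>x. f' x * g x + f x * g' x) = cint (\<lambda>x. f' x * g x) + cint (\<lambda>x. f x * g' x)"
    by (rule Bochner_Integration.integral_add; rule circle_integrable; intro continuous_intros c cf)
  ultimately show ?thesis by simp
qed

lemma L2_circle_continuous:
  "continuous_on UNIV f \<Longrightarrow> periodic_fun_simple f (2 * pi) \<Longrightarrow> f \<in> L2_circle"
  using sqi_continuous[of f] by (auto simp: L2_circle_def sqi_def)

text \<open>One integration by parts at a time moves a derivative from the test function to the
  chain \<open>F\<close>, each step contributing a sign.\<close>

lemma classical_weak_deriv:
  assumes D: "\<And>i x. i < j \<Longrightarrow> (F i has_real_derivative F (Suc i) x) (at x)"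
    and c: "\<And>i. i \<le> j \<Longrightarrow> continuous_on UNIV (F i)"
    and p: "\<And>i. i \<le> j \<Longrightarrow> periodic_fun_simple (F i) (2 * pi)"
  shows "has_weak_deriv j (F 0) (F j)"
  unfolding has_weak_deriv_def
proof (intro conjI allI impI)
  show "F 0 \<in> L2_circle" "F j \<in> L2_circle" using c p by (auto intro: L2_circle_continuous)
  fix \<phi> assume \<phi>: "smooth_fun \<phi> \<and> periodic_fun_simple \<phi> (2 * pi)"
  have "cint (\<lambda>x. F 0 x * (deriv ^^ j) \<phi> x) = (-1) ^ i * cint (\<lambda>x. F i x * (deriv ^^ (j - i)) \<phi> x)"
    if "i \<le> j" for i
    using that
  proof (induction i)
    case (Suc i)
    have e: "j - i = Suc (j - Suc i)" using Suc.prems by simp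
    have "cint (\<lambda>x. F i x * (deriv ^^ (j - i)) \<phi> x) = - cint (\<lambda>x. F (Suc i) x * (deriv ^^ (j - Suc i)) \<phi> x)"
      unfolding e
    proof (rule cint_by_parts)
      show "((deriv ^^ (j - Suc i)) \<phi> has_real_derivative (deriv ^^ Suc (j - Suc i)) \<phi> x) (at x)" for x
        using \<phi> smooth_fun_DERIV_n by blast
      show "continuous_on UNIV ((deriv ^^ Suc (j - Suc i)) \<phi>)"
        using \<phi> smooth_fun_continuous smooth_fun_deriv_n by blast
      show "(deriv ^^ (j - Suc i)) \<phi> (2 * pi) = (deriv ^^ (j - Suc i)) \<phi> 0"
        using \<phi> periodic_0_2pi periodic_deriv_n by blast
    qed (use Suc.prems D c p[THEN periodic_0_2pi] in auto)
    with Suc show ?case by simp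
  qed simp
  from this[of j] show "cint (\<lambda>x. F 0 x * (deriv ^^ j) \<phi> x) = (-1) ^ j * cint (\<lambda>x. F j x * \<phi> x)" by simp
qed

lemma fser_weak_deriv:
  assumes "\<And>i. i \<le> j \<Longrightarrow> summable (\<lambda>k. real k ^ i * norm (c k))"
  shows "has_weak_deriv j (fser c) (fser ((ddc ^^ j) c))"
proof -
  have s: "summable (\<lambda>k. norm ((ddc ^^ i) c k))" if "i \<le> j" for i
    using assms[OF that] by (simp add: ddc_funpow norm_mult norm_power)
  have "has_weak_deriv j (fser ((ddc ^^ 0) c)) (fser ((ddc ^^ j) c))"
  proof (rule classical_weak_deriv[where F = "\<lambda>i. fser ((ddc ^^ i) c)"])
    show "(fser ((ddc ^^ i) c) has_real_derivative fser ((ddc ^^ Suc i) c) x) (at x)" if "i < j" for i x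
      using fser_DERIV[of "(ddc ^^ i) c" x] s[of i] s[of "Suc i"] that by simp
  qed (auto intro: fser_continuous s simp: periodic_fun_simple_def fser_periodic)
  then show ?thesis by simp
qed

lemma AE_eq_fser:
  assumes g: "sqi g" "cint g = 0" and s: "summable (\<lambda>k. norm (d k))" "d 0 = 0"
    and e: "\<And>k. 1 \<le> k \<Longrightarrow> fc g k = d k"
  shows "AE x in circle. g x = fser d x"
proof -
  have q: "sqi (fser d)" by (intro sqi_continuous fser_continuous s)
  have "AE x in circle. g x - fser d x = 0"
  proof (rule fc_zero_imp_AE_zero)
    show "sqi (\<lambda>x. g x - fser d x)" by (rule sqi_diff[OF g(1) q])
    show "cint (\<lambda>x. g x - fser d x) = 0"
      using sqi_integrable[OF g(1)] sqi_integrable[OF q] g(2) cint_fser[OF s] by simp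
    show "fc (\<lambda>x. g x - fser d x) k = 0" if "1 \<le> k" for k
      using fc_diff[OF sqi_integrable[OF g(1)] sqi_integrable[OF q], of k] e[OF that] fc_fser[OF s, of k] by simp
  qed
  then show ?thesis by simp
qed

text \<open>The representative chosen by \<open>weak_deriv\<close> is arbitrary. Its coefficients
  are not, so it agrees almost everywhere with the series differentiated term by term, which is
  continuous.\<close>

lemma weak_deriv_AE_fser:
  assumes "has_weak_deriv j f g" "1 \<le> j" "summable (\<lambda>k. real k ^ j * norm (fc f k))"
  shows "AE x in circle. g x = fser ((ddc ^^ j) (fc f)) x"
proof (rule AE_eq_fser)
  show "sqi g" "cint g = 0" using assms sqi_weak_deriv weak_deriv_cint by auto
  show "summable (\<lambda>k. norm ((ddc ^^ j) (fc f) k))"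
    using assms(3) by (simp add: ddc_funpow norm_mult norm_power)
  show "(ddc ^^ j) (fc f) 0 = 0" using assms(2) by (simp add: ddc_funpow)
  show "fc g k = (ddc ^^ j) (fc f) k" for k using weak_deriv_fc[OF assms(1)] by (simp add: ddc_funpow)
qed

subsection \<open>Tame product estimates\<close>

definition sper :: "(real \<Rightarrow> real) \<Rightarrow> bool" where
  "sper f \<longleftrightarrow> smooth_fun f \<and> periodic_fun_simple f (2 * pi)"

lemma sper_const: "sper (\<lambda>x. a)"
  and sper_add: "sper f \<Longrightarrow> sper g \<Longrightarrow> sper (\<lambda>x. f x + g x)"
  and sper_mult: "sper f \<Longrightarrow> sper g \<Longrightarrow> sper (\<lambda>x. f x * g x)"
  and sper_comp: "smooth_fun R \<Longrightarrow> sper f \<Longrightarrow> sper (\<lambda>x. R (f x))"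
  unfolding sper_def
  by (auto simp: periodic_fun_simple_def intro: smooth_intros smooth_fun_comp)

lemma sper_deriv_n: "sper f \<Longrightarrow> sper ((deriv ^^ n) f)"
  unfolding sper_def by (auto intro: smooth_fun_deriv_n periodic_deriv_n)

lemma sper_continuous: "sper f \<Longrightarrow> continuous_on S f"
  unfolding sper_def by (auto intro: smooth_fun_continuous)

lemma sper_sqi: "sper f \<Longrightarrow> sqi f"
  by (intro sqi_continuous sper_continuous)

lemma sper_DERIV_n: "sper f \<Longrightarrow> ((deriv ^^ n) f has_real_derivative (deriv ^^ Suc n) f x) (at x)"
  unfolding sper_def using smooth_fun_DERIV_n by blast

lemma sper_cint_deriv: "sper f \<Longrightarrow> cint ((deriv ^^ Suc n) f) = 0"
  using fc_deriv(2)[OF sper_DERIV_n, of f n] sper_continuous[OF sper_deriv_n, of f UNIV "Suc n"]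
    periodic_0_2pi sper_deriv_n[of f n] unfolding sper_def by blast

lemma sper_fc_deriv: "sper f \<Longrightarrow> fc ((deriv ^^ n) f) k = (\<i> * of_nat k) ^ n * fc f k"
proof (induction n)
  case (Suc n)
  have "fc ((deriv ^^ Suc n) f) k = \<i> * of_nat k * fc ((deriv ^^ n) f) k"
    by (rule fc_deriv(1)[OF sper_DERIV_n[OF Suc.prems]])
      (use Suc.prems sper_deriv_n[of f] sper_continuous periodic_0_2pi in \<open>auto simp: sper_def simp del: funpow.simps\<close>)
  with Suc show ?case by simp
qed simp

section \<open>Integral inequalities and the sup bound\<close>

lemma cint_sq_sum_le:
  fixes F :: "'i \<Rightarrow> real \<Rightarrow> real"
  assumes "finite A" "\<And>i. i \<in> A \<Longrightarrow> continuous_on UNIV (F i)"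
  shows "cint (\<lambda>x. (\<Sum>i\<in>A. F i x)\<^sup>2) \<le> real (card A) * (\<Sum>i\<in>A. cint (\<lambda>x. (F i x)\<^sup>2))"
proof -
  have "cint (\<lambda>x. (\<Sum>i\<in>A. F i x)\<^sup>2) \<le> cint (\<lambda>x. real (card A) * (\<Sum>i\<in>A. (F i x)\<^sup>2))"
    by (rule cint_mono) (auto intro!: continuous_intros assms simp: sum_squared_le_sum_of_squares mult.commute[of "real (card A)"])
  also have "\<dots> = real (card A) * (\<Sum>i\<in>A. cint (\<lambda>x. (F i x)\<^sup>2))"
    by (simp, rule disjI2, rule Bochner_Integration.integral_sum) (auto intro!: circle_integrable continuous_intros assms)
  finally show ?thesis .
qed

lemma cint_sq_mult_le:
  fixes f g :: "real \<Rightarrow> real"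
  assumes "continuous_on UNIV f" "continuous_on UNIV g" "\<And>x. (f x)\<^sup>2 \<le> B"
  shows "cint (\<lambda>x. (f x * g x)\<^sup>2) \<le> B * cint (\<lambda>x. (g x)\<^sup>2)"
proof -
  have "cint (\<lambda>x. (f x * g x)\<^sup>2) \<le> cint (\<lambda>x. B * (g x)\<^sup>2)"
    by (rule cint_mono) (auto intro!: continuous_intros assms mult_right_mono simp: power_mult_distrib)
  then show ?thesis by simp
qed

text \<open>Cauchy-Schwarz against the constant 1, obtained from the nonnegative variance of
  |f|.\<close>

lemma cint_sq_abs_le:
  assumes "continuous_on UNIV f"
  shows "(cint (\<lambda>x. \<bar>f x\<bar>))\<^sup>2 \<le> 2 * pi * cint (\<lambda>x. (f x)\<^sup>2)"
proof -
  define a where "a = cint (\<lambda>x. \<bar>f x\<bar>) / (2 * pi)"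
  have i: "integrable circle (\<lambda>x. \<bar>f x\<bar>)" "integrable circle (\<lambda>x. (f x)\<^sup>2)"
    by (auto intro!: circle_integrable continuous_intros assms)
  interpret finite_measure circle by (rule finite_measure_circle)
  have "0 \<le> cint (\<lambda>x. (\<bar>f x\<bar> - a)\<^sup>2)" by (rule cint_nonneg) simp
  also have "(\<lambda>x. (\<bar>f x\<bar> - a)\<^sup>2) = (\<lambda>x. (f x)\<^sup>2 - 2 * a * \<bar>f x\<bar> + a\<^sup>2)"
    by (auto simp: power2_eq_square algebra_simps)
  also have "cint \<dots> = cint (\<lambda>x. (f x)\<^sup>2) - 2 * a * cint (\<lambda>x. \<bar>f x\<bar>) + 2 * pi * a\<^sup>2"
    using i cint_const[of "a\<^sup>2"] by simp
  also have "\<dots> = cint (\<lambda>x. (f x)\<^sup>2) - (cint (\<lambda>x. \<bar>f x\<bar>))\<^sup>2 / (2 * pi)"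
    by (simp add: a_def power2_eq_square)
  finally show ?thesis by (simp add: field_simps)
qed

text \<open>With mean zero, f x is the average over y of f x - f y, and each difference is at most
  the integral of |f'|. Periodicity extends the bound from one period to the whole line.\<close>

lemma mean_zero_sup:
  assumes D: "\<And>x. (f has_real_derivative f' x) (at x)" and c: "continuous_on UNIV f'"
    and p: "periodic_fun_simple f (2 * pi)" and z: "cint f = 0"
  shows "(f x)\<^sup>2 \<le> 2 * pi * cint (\<lambda>x. (f' x)\<^sup>2)"
proof -
  let ?I = "cint (\<lambda>x. \<bar>f' x\<bar>)"
  have cf: "continuous_on UNIV f"
    using D by (meson DERIV_isCont continuous_at_imp_continuous_on)
  have I: "?I = integral {0..2*pi} (\<lambda>x. \<bar>f' x\<bar>)"
    by (rule lebesgue_integral_eq_integral) (auto intro!: circle_integrable continuous_intros c)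
  have io: "(\<lambda>x. \<bar>f' x\<bar>) integrable_on {a..b}" for a b
    by (rule integrable_continuous_real) (auto intro!: continuous_intros continuous_on_subset[OF c])
  have le: "\<bar>f x - f y\<bar> \<le> ?I" if "0 \<le> y" "y \<le> x" "x \<le> 2 * pi" for x y
  proof -
    have "(f' has_integral f x - f y) {y..x}"
      by (rule fundamental_theorem_of_calculus)
        (use D that in \<open>auto simp: has_real_derivative_iff_has_vector_derivative[symmetric] intro: has_field_derivative_at_within\<close>)
    then have "f x - f y = integral {y..x} f'" "f' integrable_on {y..x}" by (auto simp: has_integral_iff)
    then have "\<bar>f x - f y\<bar> \<le> integral {y..x} (\<lambda>x. \<bar>f' x\<bar>)"
      using integral_norm_bound_integral[of f' "{y..x}" "\<lambda>x. \<bar>f' x\<bar>"] io by auto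
    also have "\<dots> \<le> integral {0..2*pi} (\<lambda>x. \<bar>f' x\<bar>)"
      by (rule integral_subset_le) (use that io in auto)
    finally show ?thesis using I by simp
  qed
  have le': "\<bar>f x - f y\<bar> \<le> ?I" if "x \<in> {0..2*pi}" "y \<in> {0..2*pi}" for x y
    using le[of x y] le[of y x] that by (cases "x \<le> y") (auto simp: abs_minus_commute)
  have b: "\<bar>f x\<bar> \<le> ?I" if x: "x \<in> {0..2*pi}" for x
  proof -
    interpret finite_measure circle by (rule finite_measure_circle)
    have "\<bar>cint (\<lambda>y. f x - f y)\<bar> \<le> cint (\<lambda>y. \<bar>f x - f y\<bar>)"
      using integral_norm_bound[of circle "\<lambda>y. f x - f y"] by simp
    also have "\<dots> \<le> cint (\<lambda>y. ?I)"
      by (rule integral_mono) (use le'[OF x] in \<open>auto intro!: circle_integrable continuous_intros cf simp: space_restrict_space\<close>)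
    also have "\<dots> = 2 * pi * ?I" by (subst cint_const) simp
    also have "cint (\<lambda>y. f x - f y) = 2 * pi * f x"
      using z circle_integrable[OF cf] cint_const[of "f x"] by simp
    finally show ?thesis by (simp add: abs_mult)
  qed
  have "\<exists>y\<in>{0..2*pi}. f x = f y"
  proof -
    define n where "n = \<lfloor>x / (2 * pi)\<rfloor>"
    have n: "of_int n \<le> x / (2 * pi)" "x / (2 * pi) < of_int n + 1" unfolding n_def by linarith+
    interpret periodic_fun_simple f "2 * pi" by (rule p)
    have "f (x - of_int n * (2 * pi)) = f x" by (rule minus_of_int)
    moreover have "x - of_int n * (2 * pi) \<in> {0..2*pi}" using n by (auto simp: field_simps)
    ultimately show ?thesis by metis
  qed
  then have "\<bar>f x\<bar> \<le> ?I" using b by auto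
  then have "(f x)\<^sup>2 \<le> ?I\<^sup>2" using abs_le_square_iff[of "f x" ?I] by linarith
  also have "\<dots> \<le> 2 * pi * cint (\<lambda>x. (f' x)\<^sup>2)" by (rule cint_sq_abs_le[OF c])
  finally show ?thesis .
qed

lemma sper_deriv_sup:
  assumes "sper f" "1 \<le> i"
  shows "((deriv ^^ i) f x)\<^sup>2 \<le> 2 * pi * cint (\<lambda>x. ((deriv ^^ Suc i) f x)\<^sup>2)"
proof (rule mean_zero_sup[OF sper_DERIV_n[OF assms(1)]])
  obtain n where "i = Suc n" using assms(2) by (cases i) auto
  then show "cint ((deriv ^^ i) f) = 0" using sper_cint_deriv[OF assms(1)] by simp
qed (use assms sper_deriv_n[of f] sper_continuous in \<open>auto simp: sper_def simp del: funpow.simps\<close>)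

lemma leibniz:
  assumes "smooth_fun f" "smooth_fun g"
  shows "(deriv ^^ n) (\<lambda>x. f x * g x) =
    (\<lambda>x. \<Sum>i\<le>n. of_nat (n choose i) * ((deriv ^^ i) f x * (deriv ^^ (n - i)) g x))"
proof (induction n)
  case (Suc n)
  let ?a = "\<lambda>i x. (deriv ^^ i) f x" and ?b = "\<lambda>i x. (deriv ^^ i) g x"
  have D: "((\<lambda>x. \<Sum>i\<le>n. of_nat (n choose i) * (?a i x * ?b (n - i) x)) has_real_derivative
     (\<Sum>i\<le>n. of_nat (n choose i) * (?a (Suc i) x * ?b (n - i) x + ?b (Suc (n - i)) x * ?a i x))) (at x)" for x
    by (intro DERIV_sum DERIV_cmult DERIV_mult smooth_fun_DERIV_n assms)
  have "(\<Sum>i\<le>n. of_nat (n choose i) * (?a (Suc i) x * ?b (n - i) x + ?b (Suc (n - i)) x * ?a i x)) =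
     (\<Sum>i\<le>Suc n. of_nat (Suc n choose i) * (?a i x * ?b (Suc n - i) x))" for x
  proof -
    have 1: "(\<Sum>i\<le>Suc n. of_nat (Suc n choose i) * (?a i x * ?b (Suc n - i) x)) =
      ?a 0 x * ?b (Suc n) x + (\<Sum>i\<le>n. of_nat (n choose i) * (?a (Suc i) x * ?b (n - i) x))
       + (\<Sum>i\<le>n. of_nat (n choose Suc i) * (?a (Suc i) x * ?b (n - i) x))"
      by (subst sum.atMost_Suc_shift) (simp add: ring_distribs sum.distrib del: funpow.simps sum.atMost_Suc)
    have 2: "(\<Sum>i\<le>n. of_nat (n choose i) * (?b (Suc (n - i)) x * ?a i x)) =
       (\<Sum>i\<le>Suc n. of_nat (n choose i) * (?a i x * ?b (Suc n - i) x))"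
      by (simp add: Suc_diff_le mult.commute del: funpow.simps)
    also have "\<dots> = ?a 0 x * ?b (Suc n) x + (\<Sum>i\<le>n. of_nat (n choose Suc i) * (?a (Suc i) x * ?b (n - i) x))"
      by (subst sum.atMost_Suc_shift) (simp del: funpow.simps sum.atMost_Suc)
    finally show ?thesis unfolding 1 ring_distribs sum.distrib by simp
  qed
  with D have "deriv (\<lambda>x. \<Sum>i\<le>n. of_nat (n choose i) * (?a i x * ?b (n - i) x)) =
      (\<lambda>x. \<Sum>i\<le>Suc n. of_nat (Suc n choose i) * (?a i x * ?b (Suc n - i) x))"
    by (intro ext DERIV_imp_deriv) simp
  with Suc show ?case by simp
qed simp

text \<open>The weights bound the squared \<open>L\<^sup>2\<close> norms of derivatives. The condition on products is what the
  log-convexity of Sobolev norms provides; it makes products and compositions linear in \<open>\<mu>\<close>.\<close>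

definition wt :: "(nat \<Rightarrow> real) \<Rightarrow> bool" where
  "wt \<mu> \<longleftrightarrow> (\<forall>j. 0 \<le> \<mu> j) \<and> (\<forall>i\<ge>1. \<forall>j\<ge>1. \<mu> i * \<mu> j \<le> \<mu> (i + j - 1))"

text \<open>\<open>K 0\<close> bounds the squared sup norm and is not multiplied by a weight. The
  constants are kept apart from \<mu>, so that they can be fixed before the function and the weights
  are known.\<close>

definition tame :: "(nat \<Rightarrow> real) \<Rightarrow> (nat \<Rightarrow> real) \<Rightarrow> (real \<Rightarrow> real) \<Rightarrow> bool" where
  "tame \<mu> K f \<longleftrightarrow> sper f \<and> (\<forall>j. 0 \<le> K j) \<and> (\<forall>x. (f x)\<^sup>2 \<le> K 0) \<and>
     (\<forall>j\<ge>1. cint (\<lambda>x. ((deriv ^^ j) f x)\<^sup>2) \<le> K j * \<mu> j)"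

lemma tame_sup:
  assumes "tame \<mu> K f" "1 \<le> i"
  shows "((deriv ^^ i) f x)\<^sup>2 \<le> 2 * pi * (K (Suc i) * \<mu> (Suc i))"
proof -
  have "((deriv ^^ i) f x)\<^sup>2 \<le> 2 * pi * cint (\<lambda>x. ((deriv ^^ Suc i) f x)\<^sup>2)"
    by (rule sper_deriv_sup) (use assms in \<open>auto simp: tame_def\<close>)
  also have "\<dots> \<le> 2 * pi * (K (Suc i) * \<mu> (Suc i))"
    using assms unfolding tame_def by (intro mult_left_mono) (auto simp del: funpow.simps)
  finally show ?thesis .
qed

text \<open>A factor that carries all derivatives is taken in L2 and the other one in sup norm. In
  the mixed case the sup norm of the derivative of order j - i costs one order, so the weights of
  indices i and j - i + 1 meet; this is the origin of the shift by 1 in \<open>wt\<close>. The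
  hypotheses on \<open>f\<close> stop below order j unless i = j, because the induction for
  compositions knows no more.\<close>

lemma tame_product_term:
  assumes w: "wt \<mu>" and f: "sper f" "\<And>x. (f x)\<^sup>2 \<le> K 0" "\<And>j. 0 \<le> K j"
    and fi: "\<And>i. 1 \<le> i \<Longrightarrow> i < j \<Longrightarrow> cint (\<lambda>x. ((deriv ^^ i) f x)\<^sup>2) \<le> K i * \<mu> i"
    and fj: "i = j \<Longrightarrow> cint (\<lambda>x. ((deriv ^^ j) f x)\<^sup>2) \<le> K j * \<mu> j"
    and g: "tame \<mu> L g" and ij: "i \<le> j" "1 \<le> j"
  shows "cint (\<lambda>x. ((deriv ^^ i) f x * (deriv ^^ (j - i)) g x)\<^sup>2) \<le>
    (if i = 0 then K 0 * L j else if i = j then K j * L 0 else 2 * pi * K i * L (Suc (j - i))) * \<mu> j"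
proof -
  have cf: "continuous_on UNIV ((deriv ^^ n) f)" for n by (intro sper_continuous sper_deriv_n f)
  have cg: "continuous_on UNIV ((deriv ^^ n) g)" for n
    using g by (intro sper_continuous sper_deriv_n) (auto simp: tame_def)
  note gt = g[unfolded tame_def]
  consider "i = 0" | "i \<noteq> 0" "i = j" | "i \<noteq> 0" "i < j" using ij by linarith
  then show ?thesis
  proof cases
    case 1
    have "cint (\<lambda>x. (f x * (deriv ^^ j) g x)\<^sup>2) \<le> K 0 * cint (\<lambda>x. ((deriv ^^ j) g x)\<^sup>2)"
      by (rule cint_sq_mult_le[OF sper_continuous[OF f(1)] cg f(2)])
    also have "\<dots> \<le> K 0 * (L j * \<mu> j)" using gt ij f by (intro mult_left_mono) auto
    finally show ?thesis using 1 by (simp add: mult.assoc)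
  next
    case 2
    have "cint (\<lambda>x. (g x * (deriv ^^ j) f x)\<^sup>2) \<le> L 0 * cint (\<lambda>x. ((deriv ^^ j) f x)\<^sup>2)"
      by (rule cint_sq_mult_le) (use gt cg[of 0] cf in auto)
    also have "\<dots> \<le> L 0 * (K j * \<mu> j)" using gt ij fj 2 by (intro mult_left_mono) auto
    finally show ?thesis using 2 by (simp add: mult_ac)
  next
    case 3
    have s: "((deriv ^^ (j - i)) g x)\<^sup>2 \<le> 2 * pi * (L (Suc (j - i)) * \<mu> (Suc (j - i)))" for x
      by (rule tame_sup[OF g]) (use 3 in auto)
    have "cint (\<lambda>x. ((deriv ^^ (j - i)) g x * (deriv ^^ i) f x)\<^sup>2) \<le>
       2 * pi * (L (Suc (j - i)) * \<mu> (Suc (j - i))) * cint (\<lambda>x. ((deriv ^^ i) f x)\<^sup>2)"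
      by (rule cint_sq_mult_le[OF cg cf s])
    also have "\<dots> \<le> 2 * pi * (L (Suc (j - i)) * \<mu> (Suc (j - i))) * (K i * \<mu> i)"
      using fi[of i] 3 w gt by (intro mult_left_mono) (auto simp: wt_def)
    also have "\<dots> = 2 * pi * K i * L (Suc (j - i)) * (\<mu> i * \<mu> (Suc (j - i)))" by simp
    also have "\<dots> \<le> 2 * pi * K i * L (Suc (j - i)) * \<mu> j"
    proof (rule mult_left_mono)
      have "i + Suc (j - i) - 1 = j" using 3 by simp
      then show "\<mu> i * \<mu> (Suc (j - i)) \<le> \<mu> j"
        using w[unfolded wt_def, THEN conjunct2, rule_format, of i "Suc (j - i)"] 3 by auto
    qed (use f gt in auto)
    finally show ?thesis using 3 by (simp add: mult_ac)
  qed
qed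

lemma cint_deriv_mult_le:
  assumes "sper f" "sper g"
  shows "cint (\<lambda>x. ((deriv ^^ j) (\<lambda>x. f x * g x) x)\<^sup>2) \<le>
    real (Suc j) * (\<Sum>i\<le>j. (real (j choose i))\<^sup>2 * cint (\<lambda>x. ((deriv ^^ i) f x * (deriv ^^ (j - i)) g x)\<^sup>2))"
proof -
  have c: "continuous_on UNIV (\<lambda>x. of_nat (j choose i) * ((deriv ^^ i) f x * (deriv ^^ (j - i)) g x))" for i
    by (intro continuous_intros sper_continuous sper_deriv_n assms)
  have "cint (\<lambda>x. ((deriv ^^ j) (\<lambda>x. f x * g x) x)\<^sup>2) =
    cint (\<lambda>x. (\<Sum>i\<le>j. of_nat (j choose i) * ((deriv ^^ i) f x * (deriv ^^ (j - i)) g x))\<^sup>2)"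
    using leibniz[of f g j] assms by (simp add: sper_def)
  also have "\<dots> \<le> real (card {..j}) * (\<Sum>i\<le>j. cint (\<lambda>x. (of_nat (j choose i) * ((deriv ^^ i) f x * (deriv ^^ (j - i)) g x))\<^sup>2))"
    by (rule cint_sq_sum_le) (use c in auto)
  finally show ?thesis by (simp add: power_mult_distrib)
qed

definition Kmulp :: "(nat \<Rightarrow> real) \<Rightarrow> (nat \<Rightarrow> real) \<Rightarrow> nat \<Rightarrow> real" where
  "Kmulp K L j = (if j = 0 then K 0 * L 0 else real (Suc j) * (\<Sum>i\<le>j. (real (j choose i))\<^sup>2 *
     (if i = 0 then K 0 * L j else if i = j then K j * L 0 else 2 * pi * K i * L (Suc (j - i)))))"

lemma tame_mult:
  assumes w: "wt \<mu>" and f: "tame \<mu> K f" and g: "tame \<mu> L g"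
  shows "tame \<mu> (Kmulp K L) (\<lambda>x. f x * g x)"
  unfolding tame_def
proof (intro conjI allI impI)
  note ft = f[unfolded tame_def] and gt = g[unfolded tame_def]
  show "sper (\<lambda>x. f x * g x)" using ft gt by (auto intro: sper_mult)
  show "0 \<le> Kmulp K L j" for j
    using ft gt unfolding Kmulp_def by (auto intro!: sum_nonneg mult_nonneg_nonneg)
  show "(f x * g x)\<^sup>2 \<le> Kmulp K L 0" for x
    using ft gt by (simp add: Kmulp_def power_mult_distrib mult_mono)
  fix j :: nat assume j: "1 \<le> j"
  have "cint (\<lambda>x. ((deriv ^^ j) (\<lambda>x. f x * g x) x)\<^sup>2) \<le>
    real (Suc j) * (\<Sum>i\<le>j. (real (j choose i))\<^sup>2 * cint (\<lambda>x. ((deriv ^^ i) f x * (deriv ^^ (j - i)) g x)\<^sup>2))"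
    by (rule cint_deriv_mult_le) (use ft gt in auto)
  also have "\<dots> \<le> real (Suc j) * (\<Sum>i\<le>j. (real (j choose i))\<^sup>2 *
     ((if i = 0 then K 0 * L j else if i = j then K j * L 0 else 2 * pi * K i * L (Suc (j - i))) * \<mu> j))"
    by (intro mult_left_mono sum_mono tame_product_term[OF w _ _ _ _ _ g]) (use ft j in auto)
  also have "\<dots> = Kmulp K L j * \<mu> j"
    using j by (simp add: Kmulp_def sum_distrib_right mult.assoc)
  finally show "cint (\<lambda>x. ((deriv ^^ j) (\<lambda>x. f x * g x) x)\<^sup>2) \<le> Kmulp K L j * \<mu> j" .
qed

lemma deriv_n_add:
  assumes "sper f" "sper g"
  shows "(deriv ^^ j) (\<lambda>x. f x + g x) = (\<lambda>x. (deriv ^^ j) f x + (deriv ^^ j) g x)"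
proof (induction j)
  case (Suc j)
  have "((\<lambda>x. (deriv ^^ j) f x + (deriv ^^ j) g x) has_real_derivative
      ((deriv ^^ Suc j) f x + (deriv ^^ Suc j) g x)) (at x)" for x
    by (intro DERIV_add sper_DERIV_n assms)
  then have "deriv (\<lambda>x. (deriv ^^ j) f x + (deriv ^^ j) g x) = (\<lambda>x. (deriv ^^ Suc j) f x + (deriv ^^ Suc j) g x)"
    by (intro ext DERIV_imp_deriv)
  with Suc show ?case by simp
qed simp

lemma tame_add:
  assumes f: "tame \<mu> K f" and g: "tame \<mu> L g"
  shows "tame \<mu> (\<lambda>j. 2 * (K j + L j)) (\<lambda>x. f x + g x)"
  unfolding tame_def
proof (intro conjI allI impI)
  note ft = f[unfolded tame_def] and gt = g[unfolded tame_def]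
  have sq: "(a + b)\<^sup>2 \<le> 2 * (a\<^sup>2 + b\<^sup>2)" for a b :: real
    using sum_squares_bound[of a b] by (simp add: power2_sum)
  show "sper (\<lambda>x. f x + g x)" using ft gt by (auto intro: sper_add)
  show "0 \<le> 2 * (K j + L j)" for j using ft gt by (simp add: add_nonneg_nonneg)
  show "(f x + g x)\<^sup>2 \<le> 2 * (K 0 + L 0)" for x
    by (rule order_trans[OF sq]) (use ft gt in \<open>auto intro!: mult_left_mono add_mono\<close>)
  fix j :: nat assume j: "1 \<le> j"
  let ?a = "(deriv ^^ j) f" and ?b = "(deriv ^^ j) g"
  have ca: "continuous_on UNIV ?a" "continuous_on UNIV ?b"
    using ft gt by (auto intro: sper_continuous sper_deriv_n)
  have "cint (\<lambda>x. ((deriv ^^ j) (\<lambda>x. f x + g x) x)\<^sup>2) = cint (\<lambda>x. (?a x + ?b x)\<^sup>2)"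
    using deriv_n_add[of f g j] ft gt by simp
  also have "\<dots> \<le> cint (\<lambda>x. 2 * ((?a x)\<^sup>2 + (?b x)\<^sup>2))"
    by (rule cint_mono; (rule sq | intro continuous_intros ca))
  also have "\<dots> = 2 * (cint (\<lambda>x. (?a x)\<^sup>2) + cint (\<lambda>x. (?b x)\<^sup>2))"
    using sper_sqi[OF sper_deriv_n, of f j] sper_sqi[OF sper_deriv_n, of g j] ft gt by (simp add: sqi_def)
  also have "\<dots> \<le> 2 * (K j + L j) * \<mu> j"
    using ft gt j by (auto simp: ring_distribs intro!: add_mono)
  finally show "cint (\<lambda>x. ((deriv ^^ j) (\<lambda>x. f x + g x) x)\<^sup>2) \<le> 2 * (K j + L j) * \<mu> j" .
qed

lemma tame_const:
  assumes "wt \<mu>" shows "tame \<mu> (\<lambda>j. if j = 0 then a\<^sup>2 else 0) (\<lambda>x. a)"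
proof -
  have "(deriv ^^ j) (\<lambda>x. a) = (\<lambda>x. 0)" if "1 \<le> j" for j
  proof -
    have "(deriv ^^ Suc n) (\<lambda>x. a) = (\<lambda>x. 0)" for n by (induction n) auto
    then show ?thesis using that by (cases j) auto
  qed
  then show ?thesis unfolding tame_def by (auto simp: sper_const)
qed

text \<open>Induction on the order through (R o f)' = (R' o f) f'. Derivatives of R' o f appear only
  below the current order, so the product estimate yields a bound linear in the weight. The constant
  depends on R and K alone.\<close>

lemma tame_comp:
  assumes R: "smooth_fun R" and K: "\<And>j. 0 \<le> K j"
  shows "\<exists>L. \<forall>\<mu> f. wt \<mu> \<longrightarrow> tame \<mu> K f \<longrightarrow> tame \<mu> L (\<lambda>x. R (f x))"
proof -
  have sup: "\<exists>B\<ge>0. \<forall>\<mu> f x. tame \<mu> K f \<longrightarrow> (R (f x))\<^sup>2 \<le> B" if R: "smooth_fun R" for R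
  proof -
    have "compact (R ` {- sqrt (K 0)..sqrt (K 0)})"
      by (intro compact_continuous_image smooth_fun_continuous R) auto
    then obtain C where "\<forall>z\<in>R ` {- sqrt (K 0)..sqrt (K 0)}. \<bar>z\<bar> \<le> C"
      using compact_imp_bounded bounded_real by blast
    then have C: "\<bar>R y\<bar> \<le> C" if "\<bar>y\<bar> \<le> sqrt (K 0)" for y
      using that by (auto simp: abs_le_iff)
    have "(R (f x))\<^sup>2 \<le> C\<^sup>2" if "tame \<mu> K f" for \<mu> f x
    proof -
      have "\<bar>f x\<bar> \<le> sqrt (K 0)" using that real_le_rsqrt[of "\<bar>f x\<bar>" "K 0"] by (auto simp: tame_def)
      then have "\<bar>R (f x)\<bar> \<le> C" by (rule C)
      then show ?thesis using abs_le_square_iff[of "R (f x)" C] by linarith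
    qed
    then show ?thesis by (intro exI[of _ "C\<^sup>2"]) auto
  qed
  \<comment> \<open>All outer functions are treated in one induction, since each step replaces R by
    its derivative.\<close>
  have step: "\<forall>R. smooth_fun R \<longrightarrow> (\<exists>B\<ge>0. \<forall>\<mu> f. wt \<mu> \<longrightarrow> tame \<mu> K f \<longrightarrow>
      cint (\<lambda>x. ((deriv ^^ j) (\<lambda>x. R (f x)) x)\<^sup>2) \<le> B * \<mu> j)" if "1 \<le> j" for j
    using that
  proof (induction j rule: less_induct)
    case (less j)
    show ?case
    proof (intro allI impI)
      fix R :: "real \<Rightarrow> real" assume R: "smooth_fun R"
      note R' = smooth_fun_deriv[OF R]
      obtain B0 where B0: "0 \<le> B0" "\<And>\<mu> f x. tame \<mu> K f \<Longrightarrow> (deriv R (f x))\<^sup>2 \<le> B0"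
        using sup[OF R'] by blast
      have "\<forall>i. \<exists>B\<ge>0. 1 \<le> i \<and> i < j \<longrightarrow> (\<forall>\<mu> f. wt \<mu> \<longrightarrow> tame \<mu> K f \<longrightarrow>
          cint (\<lambda>x. ((deriv ^^ i) (\<lambda>x. deriv R (f x)) x)\<^sup>2) \<le> B * \<mu> i)"
        using less.IH R' by (metis order_refl)
      then obtain B where B: "\<And>i. 0 \<le> B i" "\<And>i \<mu> f. 1 \<le> i \<Longrightarrow> i < j \<Longrightarrow> wt \<mu> \<Longrightarrow> tame \<mu> K f \<Longrightarrow>
          cint (\<lambda>x. ((deriv ^^ i) (\<lambda>x. deriv R (f x)) x)\<^sup>2) \<le> B i * \<mu> i" by metis
      obtain n where n: "j = Suc n" using less.prems by (cases j) auto
      let ?C = "real (Suc n) * (\<Sum>i\<le>n. (real (n choose i))\<^sup>2 * (if i = 0 then B0 * K j else 2 * pi * B i * K (Suc (j - i))))"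
      have "cint (\<lambda>x. ((deriv ^^ j) (\<lambda>x. R (f x)) x)\<^sup>2) \<le> ?C * \<mu> j" if w: "wt \<mu>" and f: "tame \<mu> K f" for \<mu> f
      proof -
        have sf: "sper f" using f by (simp add: tame_def)
        have sR: "sper (\<lambda>x. deriv R (f x))" by (rule sper_comp[OF R' sf])
        have sf': "sper (deriv f)" using sper_deriv_n[OF sf, of 1] by simp
        have "deriv (\<lambda>x. R (f x)) = (\<lambda>x. deriv R (f x) * deriv f x)"
          by (intro ext DERIV_imp_deriv DERIV_chain2 smooth_fun_DERIV) (use R sf in \<open>auto simp: sper_def\<close>)
        then have "(deriv ^^ j) (\<lambda>x. R (f x)) = (deriv ^^ n) (\<lambda>x. deriv R (f x) * deriv f x)"
          unfolding n deriv_funpow_Suc by simp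
        then have "cint (\<lambda>x. ((deriv ^^ j) (\<lambda>x. R (f x)) x)\<^sup>2) \<le>
          real (Suc n) * (\<Sum>i\<le>n. (real (n choose i))\<^sup>2 * cint (\<lambda>x. ((deriv ^^ i) (\<lambda>x. deriv R (f x)) x * (deriv ^^ (n - i)) (deriv f) x)\<^sup>2))"
          using cint_deriv_mult_le[OF sR sf', of n] by simp
        also have "\<dots> \<le> real (Suc n) * (\<Sum>i\<le>n. (real (n choose i))\<^sup>2 * ((if i = 0 then B0 * K j else 2 * pi * B i * K (Suc (j - i))) * \<mu> j))"
        proof (intro mult_left_mono sum_mono)
          fix i assume i: "i \<in> {..n}"
          then have e: "(deriv ^^ (n - i)) (deriv f) = (deriv ^^ (j - i)) f"
            using n by (simp add: deriv_funpow_Suc[symmetric] Suc_diff_le del: funpow.simps)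
          \<comment> \<open>As i \<le> n < j, the case i = j of the product estimate does not occur,
            and the induction hypothesis covers every derivative that does.\<close>
          let ?K = "\<lambda>i. if i = 0 then B0 else B i"
          have "cint (\<lambda>x. ((deriv ^^ i) (\<lambda>x. deriv R (f x)) x * (deriv ^^ (j - i)) f x)\<^sup>2) \<le>
            (if i = 0 then ?K 0 * K j else if i = j then ?K j * K 0 else 2 * pi * ?K i * K (Suc (j - i))) * \<mu> j"
            by (rule tame_product_term[OF w sR, where K = ?K])
              (use f B0 B w i n in auto)
          then show "cint (\<lambda>x. ((deriv ^^ i) (\<lambda>x. deriv R (f x)) x * (deriv ^^ (n - i)) (deriv f) x)\<^sup>2) \<le>
             (if i = 0 then B0 * K j else 2 * pi * B i * K (Suc (j - i))) * \<mu> j"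
            unfolding e using i n by (auto split: if_splits)
        qed auto
        also have "\<dots> = ?C * \<mu> j" by (simp add: sum_distrib_right mult.assoc)
        finally show ?thesis .
      qed
      moreover have "0 \<le> ?C" using B0 B K by (auto intro!: mult_nonneg_nonneg sum_nonneg)
      ultimately show "\<exists>B\<ge>0. \<forall>\<mu> f. wt \<mu> \<longrightarrow> tame \<mu> K f \<longrightarrow>
        cint (\<lambda>x. ((deriv ^^ j) (\<lambda>x. R (f x)) x)\<^sup>2) \<le> B * \<mu> j" by blast
    qed
  qed
  obtain B0 where B0: "0 \<le> B0" "\<And>\<mu> f x. tame \<mu> K f \<Longrightarrow> (R (f x))\<^sup>2 \<le> B0"
    using sup[OF R] by blast
  have "\<forall>j. \<exists>B\<ge>0. 1 \<le> j \<longrightarrow> (\<forall>\<mu> f. wt \<mu> \<longrightarrow> tame \<mu> K f \<longrightarrow>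
      cint (\<lambda>x. ((deriv ^^ j) (\<lambda>x. R (f x)) x)\<^sup>2) \<le> B * \<mu> j)"
    using step R by (metis order_refl)
  then obtain B where B: "\<And>j. 0 \<le> B j" "\<And>j \<mu> f. 1 \<le> j \<Longrightarrow> wt \<mu> \<Longrightarrow> tame \<mu> K f \<Longrightarrow>
      cint (\<lambda>x. ((deriv ^^ j) (\<lambda>x. R (f x)) x)\<^sup>2) \<le> B j * \<mu> j" by metis
  have "tame \<mu> (\<lambda>j. if j = 0 then B0 else B j) (\<lambda>x. R (f x))" if "wt \<mu>" "tame \<mu> K f" for \<mu> f
    unfolding tame_def using that B0 B sper_comp[OF R] by (auto simp: tame_def)
  then show ?thesis by blast
qed

subsection \<open>The flux near the constant state\<close>

definition fin :: "nat \<Rightarrow> (nat \<Rightarrow> complex) \<Rightarrow> bool" where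
  "fin m c \<longleftrightarrow> c 0 = 0 \<and> (\<forall>k>m. c k = 0)"

text \<open>The coefficients of \<open>v' + v'''\<close>.\<close>

definition Ls :: "(nat \<Rightarrow> complex) \<Rightarrow> nat \<Rightarrow> complex" where
  "Ls c k = (\<i> * of_nat k + (\<i> * of_nat k) ^ 3) * c k"

lemma fin_ddc: "fin m c \<Longrightarrow> fin m ((ddc ^^ j) c)"
  unfolding fin_def by (simp add: ddc_funpow)

lemma fin_Ls: "fin m c \<Longrightarrow> fin m (Ls c)"
  unfolding fin_def Ls_def by simp

lemma fin_tr: "fin m (tr m c)"
  unfolding fin_def by simp

lemma finD: "fin m c \<Longrightarrow> \<not> k \<le> m \<Longrightarrow> c k = 0" and finD0: "fin m c \<Longrightarrow> c 0 = 0"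
  unfolding fin_def by auto

lemma fin_summable: "fin m c \<Longrightarrow> summable (\<lambda>k. norm (c k))"
  by (rule summable_finite[of "{..m}"]) (auto simp: fin_def not_le)

lemma fin_hseq: "fin m c \<Longrightarrow> hseq s c"
  unfolding hseq_def by (intro conjI summable_finite[of "{..m}"]) (simp_all add: finD0 finD)

lemma fin_nrm2: "fin m c \<Longrightarrow> nrm2 s c = (\<Sum>k\<le>m. (real k ^ s * cmod (c k))\<^sup>2)"
  unfolding nrm2_def by (rule suminf_finite) (auto simp: fin_def not_le)

lemma fin_nrm2_atLeast: "fin m c \<Longrightarrow> nrm2 s c = (\<Sum>k=1..m. (real k ^ s * cmod (c k))\<^sup>2)"
proof -
  assume f: "fin m c"
  have "(\<Sum>k\<le>m. (real k ^ s * cmod (c k))\<^sup>2) = (\<Sum>k=1..m. (real k ^ s * cmod (c k))\<^sup>2)"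
    by (rule sum.mono_neutral_right) (use f in \<open>auto simp: fin_def not_le less_Suc_eq_0_disj\<close>)
  then show ?thesis using fin_nrm2[OF f] by simp
qed

text \<open>The symbol of \<partial> + \<partial>^3 is - \<i> (k^3 - k). Its zero at k = 1 is the
  neutral mode.\<close>

lemma cmod_Ls: "cmod (Ls c k) = (real k ^ 3 - real k) * cmod (c k)"
proof -
  have "\<i> * of_nat k + (\<i> * of_nat k) ^ 3 = - \<i> * of_real (real k ^ 3 - real k)"
    by (simp add: power3_eq_cube algebra_simps)
  moreover have "0 \<le> real k ^ 3 - real k"
    using self_le_power[of "real k" 3] by (cases k) auto
  ultimately show ?thesis unfolding Ls_def by (simp only: norm_mult norm_of_real) simp
qed

lemma cmod_Ls_le: "cmod (Ls c k) \<le> real k ^ 3 * cmod (c k)"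
  unfolding cmod_Ls by (intro mult_right_mono) auto

lemma hseq_Ls: "hseq (j + 3) c \<Longrightarrow> hseq j (Ls c)"
  and nrm2_Ls: "hseq (j + 3) c \<Longrightarrow> nrm2 j (Ls c) \<le> nrm2 (j + 3) c"
proof -
  assume c: "hseq (j + 3) c"
  have le: "(real k ^ j * cmod (Ls c k))\<^sup>2 \<le> (real k ^ (j + 3) * cmod (c k))\<^sup>2" for k
    using mult_left_mono[OF cmod_Ls_le[of c k], of "real k ^ j"]
    by (intro power_mono) (auto simp: power_add mult.assoc)
  have "summable (\<lambda>k. (real k ^ j * cmod (Ls c k))\<^sup>2)"
    by (rule summable_comparison_test'[of "\<lambda>k. (real k ^ (j + 3) * cmod (c k))\<^sup>2" 0])
      (use le c in \<open>auto simp: hseq_def\<close>)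
  then show h: "hseq j (Ls c)" using c by (simp add: hseq_def Ls_def)
  show "nrm2 j (Ls c) \<le> nrm2 (j + 3) c"
    unfolding nrm2_def by (rule suminf_le) (use le h c in \<open>auto simp: hseq_def\<close>)
qed

section \<open>Embedding and interpolation for coefficient norms\<close>

lemma sum_inverse_squares: "(\<Sum>k=1..n. 1 / (real k)\<^sup>2) \<le> 2"
proof -
  have "(\<Sum>k=1..Suc n. 1 / (real k)\<^sup>2) \<le> 2 - 1 / real (Suc n)" for n
  proof (induction n)
    case (Suc n)
    have "1 / (real (Suc (Suc n)))\<^sup>2 \<le> 1 / (real (Suc n) * real (Suc (Suc n)))"
      by (intro divide_left_mono) (auto simp: power2_eq_square)
    also have "\<dots> = 1 / real (Suc n) - 1 / real (Suc (Suc n))" by (simp add: field_simps)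
    finally show ?case using Suc by (simp add: sum.cl_ivl_Suc del: of_nat_Suc)
  qed simp
  then have "(\<Sum>k=1..Suc n. 1 / (real k)\<^sup>2) \<le> 2" for n by (rule order_trans) simp
  then show ?thesis by (cases n) (auto simp del: sum.cl_ivl_Suc)
qed

text \<open>Cauchy-Schwarz with weights 1 / k, whose squares sum to at most 2: one extra Sobolev
  order buys absolute convergence.\<close>

lemma hseq_l1:
  assumes "hseq (Suc s) c" "s = 0 \<Longrightarrow> c 0 = 0"
  shows "summable (\<lambda>k. real k ^ s * norm (c k))"
    and "(\<Sum>k. real k ^ s * norm (c k))\<^sup>2 \<le> 2 * nrm2 (Suc s) c"
proof -
  have c0: "c 0 = 0" and sm: "summable (\<lambda>k. (real k ^ Suc s * cmod (c k))\<^sup>2)"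
    using assms(1) by (auto simp: hseq_def)
  have le: "(\<Sum>k<n. real k ^ s * norm (c k)) \<le> sqrt (2 * nrm2 (Suc s) c)" for n
  proof -
    have "(\<Sum>k<n. real k ^ s * norm (c k)) = (\<Sum>k=1..<n. real k ^ s * norm (c k))"
      by (rule sum.mono_neutral_right) (auto simp: c0 not_le less_Suc_eq_0_disj)
    also have "\<dots> = (\<Sum>k=1..<n. (1 / real k) * (real k ^ Suc s * norm (c k)))"
      by (rule sum.cong) auto
    finally have "(\<Sum>k<n. real k ^ s * norm (c k))\<^sup>2 \<le>
        (\<Sum>k=1..<n. (1 / real k)\<^sup>2) * (\<Sum>k=1..<n. (real k ^ Suc s * norm (c k))\<^sup>2)"
      using Cauchy_Schwarz_ineq_sum[of "\<lambda>k. 1 / real k" "\<lambda>k. real k ^ Suc s * norm (c k)" "{1..<n}"] by simp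
    also have "\<dots> \<le> 2 * nrm2 (Suc s) c"
    proof (rule mult_mono)
      have "{1..<n} \<subseteq> {1..n}" by auto
      then have "(\<Sum>k=1..<n. (1 / real k)\<^sup>2) \<le> (\<Sum>k=1..n. (1 / real k)\<^sup>2)" by (intro sum_mono2) auto
      then show "(\<Sum>k=1..<n. (1 / real k)\<^sup>2) \<le> 2" using sum_inverse_squares[of n] by (simp add: power_divide)
      show "(\<Sum>k=1..<n. (real k ^ Suc s * norm (c k))\<^sup>2) \<le> nrm2 (Suc s) c"
        unfolding nrm2_def by (rule sum_le_suminf[OF sm]) auto
    qed (auto intro: sum_nonneg)
    finally show ?thesis by (intro real_le_rsqrt) simp
  qed
  show S: "summable (\<lambda>k. real k ^ s * norm (c k))"
    by (rule summableI_nonneg_bounded[where x = "sqrt (2 * nrm2 (Suc s) c)"]) (auto intro: le)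
  have "(\<Sum>k. real k ^ s * norm (c k)) \<le> sqrt (2 * nrm2 (Suc s) c)"
    by (rule suminf_le_const[OF S le])
  moreover have "0 \<le> (\<Sum>k. real k ^ s * norm (c k))" by (rule suminf_nonneg[OF S]) auto
  ultimately have "(\<Sum>k. real k ^ s * norm (c k))\<^sup>2 \<le> (sqrt (2 * nrm2 (Suc s) c))\<^sup>2" by (rule power_mono)
  then show "(\<Sum>k. real k ^ s * norm (c k))\<^sup>2 \<le> 2 * nrm2 (Suc s) c"
    using nrm2_nonneg[OF assms(1)] by simp
qed

text \<open>Symmetrising the double sum reduces the claim to (x^p - y^p) (y^q - x^q) \<le> 0 for x,
  y \<ge> 0. After division by the norm of order 4 this becomes the product condition in
  \<open>wt\<close>.\<close>

lemma nrm2_log_convex: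
  assumes f: "fin m c" and ab: "4 \<le> a" "4 \<le> b"
  shows "nrm2 a c * nrm2 b c \<le> nrm2 (a + b - 4) c * nrm2 4 c"
proof -
  define t where "t k = (cmod (c k))\<^sup>2" for k
  define q where "q k = (real k)\<^sup>2" for k
  have n: "nrm2 s c = (\<Sum>k\<le>m. q k ^ s * t k)" for s
    unfolding fin_nrm2[OF f] t_def q_def by (simp add: power_mult_distrib power_mult[symmetric] mult.commute)
  have dbl: "2 * (nrm2 r c * nrm2 s c) = (\<Sum>k\<le>m. \<Sum>l\<le>m. (q k ^ r * q l ^ s + q l ^ r * q k ^ s) * (t k * t l))" for r s
  proof -
    have "nrm2 r c * nrm2 s c = (\<Sum>k\<le>m. \<Sum>l\<le>m. q k ^ r * q l ^ s * (t k * t l))"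
      unfolding n sum_product by (intro sum.cong) (auto simp: mult_ac)
    moreover have "(\<Sum>k\<le>m. \<Sum>l\<le>m. q k ^ r * q l ^ s * (t k * t l)) = (\<Sum>k\<le>m. \<Sum>l\<le>m. q l ^ r * q k ^ s * (t k * t l))"
      by (subst sum.swap) (auto simp: mult_ac)
    ultimately show ?thesis by (simp add: sum.distrib ring_distribs)
  qed
  have pt: "x ^ a * y ^ b + y ^ a * x ^ b \<le> x ^ (a + b - 4) * y ^ 4 + y ^ (a + b - 4) * x ^ 4"
    if "0 \<le> x" "0 \<le> y" for x y :: real
  proof -
    obtain a' b' where e: "a = a' + 4" "b = b' + 4" using ab by (metis le_add_diff_inverse2)
    have "0 \<le> (x ^ a' - y ^ a') * (x ^ b' - y ^ b')"
    proof (cases "x \<le> y")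
      case True
      then show ?thesis using that by (intro mult_nonpos_nonpos) (auto intro: power_mono)
    next
      case False
      then have "y ^ n \<le> x ^ n" for n using that by (intro power_mono) auto
      then show ?thesis by simp
    qed
    from mult_nonneg_nonneg[OF _ this, of "x ^ 4 * y ^ 4"]
    have "0 \<le> (x ^ 4 * y ^ 4) * ((x ^ a' - y ^ a') * (x ^ b' - y ^ b'))"
      using that by simp
    then show ?thesis unfolding e by (simp add: power_add algebra_simps)
  qed
  have "2 * (nrm2 a c * nrm2 b c) \<le> 2 * (nrm2 (a + b - 4) c * nrm2 4 c)"
    unfolding dbl by (intro sum_mono mult_right_mono pt) (auto simp: q_def t_def)
  then show ?thesis by simp
qed

lemma fin_fser_DERIV: "fin m c \<Longrightarrow> (fser c has_real_derivative fser (ddc c) x) (at x)"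
  using fin_ddc[of m c 1] by (intro fser_DERIV fin_summable[of m]) auto

lemma fin_fser_deriv_n: "fin m c \<Longrightarrow> (deriv ^^ j) (fser c) = fser ((ddc ^^ j) c)"
proof (induction j)
  case (Suc j)
  have "deriv (fser ((ddc ^^ j) c)) = fser ((ddc ^^ Suc j) c)"
    using fin_fser_DERIV[OF fin_ddc[OF Suc.prems, of j]] by (auto intro!: ext DERIV_imp_deriv)
  with Suc show ?case by simp
qed simp

lemma fin_fser_sper: "fin m c \<Longrightarrow> sper (fser c)"
proof -
  assume f: "fin m c"
  have "smooth_fun (fser c)"
  proof (rule smooth_fun_coinduct[of _ "fser ` {c. fin m c}"])
    fix g assume "g \<in> fser ` {c. fin m c}"
    then obtain d where d: "fin m d" "g = fser d" by auto
    then have "deriv g = fser (ddc d)" using fin_fser_deriv_n[of m d 1] by simp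
    moreover have "fin m (ddc d)" using fin_ddc[OF d(1), of 1] by simp
    ultimately show "(\<forall>x. g field_differentiable at x) \<and> deriv g \<in> fser ` {c. fin m c}"
      using fin_fser_DERIV[OF d(1)] d(2) unfolding field_differentiable_def by blast
  qed (use f in auto)
  then show ?thesis unfolding sper_def by (auto simp: periodic_fun_simple_def fser_periodic)
qed

lemma fin_cint_deriv_sq:
  assumes "fin m c"
  shows "cint (\<lambda>x. ((deriv ^^ j) (fser c) x)\<^sup>2) = pi * nrm2 j c"
  using cint_fser_sq[of m "(ddc ^^ j) c"] fin_ddc[OF assms, of j]
  by (simp add: fin_fser_deriv_n[OF assms] fin_nrm2[OF assms] fin_def ddc_funpow norm_mult norm_power)

text \<open>The entry at 0 is the constant of \<open>mean_zero_sup\<close> with Parseval inserted, 2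
  pi times pi; the other entries are Parseval's factor alone.\<close>

definition K0 :: "nat \<Rightarrow> real" where "K0 j = (if j = 0 then 2 * pi\<^sup>2 else pi)"

lemma tame_fser:
  assumes f: "fin m d" and w: "wt \<mu>" and j: "\<And>j. 1 \<le> j \<Longrightarrow> nrm2 j d \<le> \<mu> j" and 1: "nrm2 1 d \<le> 1"
  shows "tame \<mu> K0 (fser d)"
  unfolding tame_def
proof (intro conjI allI impI)
  show s: "sper (fser d)" by (rule fin_fser_sper[OF f])
  show "0 \<le> K0 j" for j by (simp add: K0_def)
  show "(fser d x)\<^sup>2 \<le> K0 0" for x
  proof -
    have "(fser d x)\<^sup>2 \<le> 2 * pi * cint (\<lambda>x. (fser (ddc d) x)\<^sup>2)"
    proof (rule mean_zero_sup[where f = "fser d" and f' = "fser (ddc d)"])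
      show "(fser d has_real_derivative fser (ddc d) x) (at x)" for x by (rule fin_fser_DERIV[OF f])
      show "continuous_on UNIV (fser (ddc d))"
        using fin_ddc[OF f, of 1] by (intro fser_continuous fin_summable[of m]) simp
      show "periodic_fun_simple (fser d) (2 * pi)" using s by (simp add: sper_def)
      show "cint (fser d) = 0" using f by (intro cint_fser fin_summable[OF f]) (simp add: fin_def)
    qed
    also have "\<dots> = 2 * pi * (pi * nrm2 1 d)"
      using fin_cint_deriv_sq[OF f, of 1] fin_fser_deriv_n[OF f, of 1] by simp
    also have "\<dots> \<le> 2 * pi * (pi * 1)" using 1 by (intro mult_left_mono) auto
    finally show ?thesis by (simp add: K0_def power2_eq_square)
  qed
  fix i :: nat assume "1 \<le> i"
  then show "cint (\<lambda>x. ((deriv ^^ i) (fser d) x)\<^sup>2) \<le> K0 i * \<mu> i"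
    unfolding fin_cint_deriv_sq[OF f] using j[of i] by (simp add: K0_def)
qed

lemma deriv_n_cmult:
  assumes "sper f"
  shows "(deriv ^^ j) (\<lambda>x. a * f x) = (\<lambda>x. a * (deriv ^^ j) f x)"
proof (induction j)
  case (Suc j)
  have "((\<lambda>x. a * (deriv ^^ j) f x) has_real_derivative (a * (deriv ^^ Suc j) f x)) (at x)" for x
    by (intro DERIV_cmult sper_DERIV_n assms)
  then have "deriv (\<lambda>x. a * (deriv ^^ j) f x) = (\<lambda>x. a * (deriv ^^ Suc j) f x)"
    by (intro ext DERIV_imp_deriv)
  with Suc show ?case by simp
qed simp

text \<open>\<Psi> stands for the averaged law y \<mapsto> \<integral> z \<psi>(\<beta> + z y) dz
  over 0 \<le> z \<le> 1, with p0 = \<psi>(\<beta>) and p1 = \<psi>'(\<beta>). The fractions 1/2 and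
  1/3 are the moments of z and z^2, and R is the quotient in the second order Taylor remainder. All
  later estimates use just these properties.\<close>

locale film =
  fixes hbar p0 p1 :: real and \<Psi> R :: "real \<Rightarrow> real"
  assumes hbar: "0 < hbar" and p0: "0 < p0" and p1: "0 < p1"
    and smooth_\<Psi>: "smooth_fun \<Psi>" and smooth_R: "smooth_fun R"
    and \<Psi>_pos: "\<And>y. 0 < deriv \<Psi> y"
    and \<Psi>_expand: "\<And>y. \<Psi> y = p0 / 2 + p1 / 3 * y + y\<^sup>2 * R y"
begin

definition Fl :: "(nat \<Rightarrow> complex) \<Rightarrow> real \<Rightarrow> real" where
  "Fl c x = (hbar + fser c x)\<^sup>2 * \<Psi> ((hbar + fser c x) * fser (Ls c) x)"

text \<open>The part of the flux of order at least two, with the factors \<open>v', w'\<close> separated so that an estimate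
  quadratic in the solution can be obtained from tame estimates after rescaling.\<close>

definition G2 :: "real \<Rightarrow> real \<Rightarrow> real \<Rightarrow> real \<Rightarrow> real" where
  "G2 v w v' w' = p0 / 2 * (v' * v') + p1 / 3 * ((3 * hbar\<^sup>2 + 3 * hbar * v + v * v) * (v' * w'))
     + ((hbar + v) * (hbar + v)) * ((hbar + v) * (hbar + v)) * ((w' * w') * R ((hbar + v) * w))"

definition F2 :: "(nat \<Rightarrow> complex) \<Rightarrow> real \<Rightarrow> real" where
  "F2 c x = G2 (fser c x) (fser (Ls c) x) (fser c x) (fser (Ls c) x)"

text \<open>The linear damping constant: mode k decays at rate D (k^4 - k^2).\<close>

definition D :: real where "D = hbar ^ 3 * p1 / 3"

lemma D_pos: "0 < D" unfolding D_def using hbar p1 by simp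

lemma Fl_expand: "Fl c x = hbar\<^sup>2 * p0 / 2 + hbar * p0 * fser c x + D * fser (Ls c) x + F2 c x"
  unfolding Fl_def F2_def G2_def D_def \<Psi>_expand
  by (simp add: power2_eq_square power3_eq_cube field_simps)

lemma F2_sper: "fin m c \<Longrightarrow> sper (F2 c)"
  unfolding F2_def G2_def
  by (intro sper_add sper_mult sper_const sper_comp[OF smooth_R] fin_fser_sper[of m] fin_Ls) auto

lemma G2_tame:
  "\<exists>K. \<forall>\<mu> v w v' w'. wt \<mu> \<longrightarrow> tame \<mu> K0 v \<longrightarrow> tame \<mu> K0 w \<longrightarrow> tame \<mu> K0 v' \<longrightarrow> tame \<mu> K0 w' \<longrightarrow>
     tame \<mu> K (\<lambda>x. G2 (v x) (w x) (v' x) (w' x))"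
proof -
  note T = tame_add tame_mult tame_const
  define Kc where "Kc a = (\<lambda>j::nat. if j = 0 then a\<^sup>2 else (0::real))" for a :: real
  have c: "wt \<mu> \<Longrightarrow> tame \<mu> (Kc a) (\<lambda>x. a)" for \<mu> a unfolding Kc_def by (rule tame_const)
  define Ky where "Ky = Kmulp (\<lambda>j. 2 * (Kc hbar j + K0 j)) K0"
  have y: "wt \<mu> \<Longrightarrow> tame \<mu> K0 v \<Longrightarrow> tame \<mu> K0 w \<Longrightarrow> tame \<mu> Ky (\<lambda>x. (hbar + v x) * w x)" for \<mu> v w
    unfolding Ky_def by (intro tame_mult tame_add c)
  show ?thesis
  \<comment> \<open>\<open>tame_comp\<close> wants nonnegative constants. They are read off from any
    function that is tame with \<open>Ky\<close>; if there is none, the claim holds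
    vacuously.\<close>
  proof (cases "\<exists>\<mu> f. wt \<mu> \<and> tame \<mu> Ky f")
    case True
    then have "0 \<le> Ky j" for j by (auto simp: tame_def)
    then obtain KR where KR: "\<And>\<mu> f. wt \<mu> \<Longrightarrow> tame \<mu> Ky f \<Longrightarrow> tame \<mu> KR (\<lambda>x. R (f x))"
      using tame_comp[OF smooth_R] by blast
    have KRy: "wt \<mu> \<Longrightarrow> tame \<mu> K0 v \<Longrightarrow> tame \<mu> K0 w \<Longrightarrow> tame \<mu> KR (\<lambda>x. R ((hbar + v x) * w x))" for \<mu> v w
      by (intro KR y)
    show ?thesis
      unfolding G2_def
      \<comment> \<open>The witness stays schematic and is assembled by the sum and product rules
        along the structure of \<open>G2\<close>.\<close>
      by (rule exI, intro allI impI) (assumption | rule c | rule KRy | rule tame_add | rule tame_mult)+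
  next
    case False
    then have "\<not> (wt \<mu> \<and> tame \<mu> K0 v \<and> tame \<mu> K0 w)" for \<mu> v w using y by blast
    then show ?thesis by blast
  qed
qed

text \<open>The bound has to be quadratic in the solution and yet linear in the highest norm. The
  tame estimate alone is only linear; the second small factor is gained by rescaling the two marked
  factors of \<open>G2\<close>.\<close>

lemma F2_bound:
  assumes j: "1 \<le> j"
  shows "\<exists>K\<ge>0. \<forall>m c. fin m c \<longrightarrow> nrm2 4 c \<le> 1 \<longrightarrow>
    cint (\<lambda>x. ((deriv ^^ j) (F2 c) x)\<^sup>2) \<le> K * (nrm2 4 c * nrm2 (j + 3) c)"
proof -
  obtain K where K: "\<And>\<mu> v w v' w'. wt \<mu> \<Longrightarrow> tame \<mu> K0 v \<Longrightarrow> tame \<mu> K0 w \<Longrightarrow> tame \<mu> K0 v' \<Longrightarrow> tame \<mu> K0 w' \<Longrightarrow>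
     tame \<mu> K (\<lambda>x. G2 (v x) (w x) (v' x) (w' x))"
    using G2_tame by blast
  have "cint (\<lambda>x. ((deriv ^^ j) (F2 c) x)\<^sup>2) \<le> \<bar>K j\<bar> * (nrm2 4 c * nrm2 (j + 3) c)"
    if f: "fin m c" and n1: "nrm2 4 c \<le> 1" for m c
  proof (cases "nrm2 4 c = 0")
    case True
    have h: "hseq 4 c" by (rule fin_hseq[OF f])
    have "c k = 0" for k
    proof -
      have "(\<Sum>k\<le>m. (real k ^ 4 * cmod (c k))\<^sup>2) = 0" using True fin_nrm2[OF f] by simp
      then have "\<forall>k\<le>m. (real k ^ 4 * cmod (c k))\<^sup>2 = 0" by (subst (asm) sum_nonneg_eq_0_iff) auto
      then show ?thesis using f by (cases "k \<le> m"; cases "k = 0") (auto simp: fin_def)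
    qed
    then have "fser c x = 0" "fser (Ls c) x = 0" for x by (auto simp: fser_def Ls_def)
    then have "F2 c = (\<lambda>x. 0)" by (simp add: F2_def G2_def fun_eq_iff)
    moreover have "(deriv ^^ Suc n) (\<lambda>x. 0::real) = (\<lambda>x. 0)" for n by (induction n) auto
    ultimately show ?thesis using j True by (cases j) auto
  next
    case False
    define \<nu> where "\<nu> = nrm2 4 c"
    have nn: "0 \<le> nrm2 s c" for s by (rule nrm2_nonneg[OF fin_hseq[OF f]])
    have \<nu>: "0 < \<nu>" "\<nu> \<le> 1" using False n1 nn[of 4] by (auto simp: \<nu>_def)
    \<comment> \<open>The shift by 3 pays for the derivatives in \<open>Ls\<close>. Dividing by
      \<nu> turns log-convexity into the condition on weights and normalises \<mu> 1 = 1, from which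
      the smallness demanded by \<open>tame_fser\<close> follows.\<close>
    define \<mu> where "\<mu> j = nrm2 (j + 3) c / \<nu>" for j
    have w: "wt \<mu>"
      unfolding wt_def
    proof (intro conjI allI impI)
      show "0 \<le> \<mu> j" for j unfolding \<mu>_def using \<nu> nn by (auto intro: divide_nonneg_pos)
      fix i j :: nat assume "1 \<le> i" "1 \<le> j"
      then have "nrm2 (i + 3) c * nrm2 (j + 3) c \<le> nrm2 (i + j - 1 + 3) c * \<nu>"
        using nrm2_log_convex[OF f, of "i + 3" "j + 3"] by (simp add: \<nu>_def)
      then show "\<mu> i * \<mu> j \<le> \<mu> (i + j - 1)" unfolding \<mu>_def using \<nu> by (simp add: field_simps power2_eq_square)
    qed
    have le: "nrm2 j c \<le> \<mu> j * \<nu>" "nrm2 j (Ls c) \<le> \<mu> j * \<nu>" for j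
      using nrm2_mono[OF fin_hseq[OF f], of j "j + 3"] nrm2_Ls[OF fin_hseq[OF f], of j] \<nu> by (auto simp: \<mu>_def)
    have le': "\<mu> j * \<nu> \<le> \<mu> j" for j using w \<nu> by (auto simp: wt_def mult_left_le)
    have \<mu>1: "\<mu> 1 = 1" using \<nu> by (simp add: \<mu>_def \<nu>_def)
    have fL: "fin m (Ls c)" by (rule fin_Ls[OF f])
    define N where "N = sqrt \<nu>"
    have N: "0 < N" "N * N = \<nu>" using \<nu> by (auto simp: N_def)
    let ?s = "\<lambda>d k. of_real (1 / N) * d k :: complex"
    have sf: "fin m (?s d)" if "fin m d" for d using that by (simp add: fin_def)
    have sn: "nrm2 j (?s d) = nrm2 j d / \<nu>" if "fin m d" for j d
    proof -
      have "(real k ^ j * cmod (?s d k))\<^sup>2 = (real k ^ j * cmod (d k))\<^sup>2 / \<nu>" for k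
        using N by (simp add: norm_mult norm_divide power_mult_distrib power_divide power2_eq_square)
      then show ?thesis unfolding fin_nrm2[OF sf[OF that]] fin_nrm2[OF that] by (simp add: sum_divide_distrib)
    qed
    have t1: "tame \<mu> K0 (fser c)" "tame \<mu> K0 (fser (Ls c))"
      using order_trans[OF le(1) le'] order_trans[OF le(2) le'] le[of 1] \<mu>1 \<nu>
      by (auto intro!: tame_fser[OF _ w] f fL)
    have le1: "nrm2 j c / \<nu> \<le> \<mu> j" "nrm2 j (Ls c) / \<nu> \<le> \<mu> j" for j
      using le[of j] \<nu> by (simp_all add: field_simps)
    have t2: "tame \<mu> K0 (fser (?s d))" if "fin m d" "\<And>j. nrm2 j d / \<nu> \<le> \<mu> j" for d
    proof (rule tame_fser[OF sf[OF that(1)] w])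
      show "nrm2 j (?s d) \<le> \<mu> j" for j unfolding sn[OF that(1)] by (rule that(2))
      show "nrm2 1 (?s d) \<le> 1" unfolding sn[OF that(1)] using that(2)[of 1] \<mu>1 by simp
    qed
    \<comment> \<open>Only the primed arguments are divided by sqrt \<nu>; they remain tame because
      the squared norms involved are at most \<nu> \<mu> j. Every term of \<open>G2\<close> has
      exactly two primed factors, so F2 is \<nu> times G.\<close>
    define G where "G x = G2 (fser c x) (fser (Ls c) x) (fser (?s c) x) (fser (?s (Ls c)) x)" for x
    have tG: "tame \<mu> K G" unfolding G_def by (rule K[OF w t1 t2[OF f le1(1)] t2[OF fL le1(2)]])
    have sv: "fser c x = N * fser (?s c) x" "fser (Ls c) x = N * fser (?s (Ls c)) x" for x
      using fser_cmult[OF fin_summable[OF f], of "1 / N" x] fser_cmult[OF fin_summable[OF fL], of "1 / N" x] N by auto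
    have "F2 c x = \<nu> * G x" for x
    proof -
      have "G2 v w (N * v') (N * w') = (N * N) * G2 v w v' w'" for v w v' w'
        unfolding G2_def by (simp add: algebra_simps)
      then show ?thesis unfolding F2_def G_def N(2)[symmetric] using sv[of x] by metis
    qed
    then have "F2 c = (\<lambda>x. \<nu> * G x)" by auto
    then have "cint (\<lambda>x. ((deriv ^^ j) (F2 c) x)\<^sup>2) = \<nu>\<^sup>2 * cint (\<lambda>x. ((deriv ^^ j) G x)\<^sup>2)"
      using tG by (simp add: deriv_n_cmult tame_def power_mult_distrib)
    also have "\<dots> \<le> \<nu>\<^sup>2 * (K j * \<mu> j)" using tG j by (intro mult_left_mono) (auto simp: tame_def)
    also have "\<dots> = \<bar>K j\<bar> * (nrm2 4 c * nrm2 (j + 3) c)"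
      using \<nu> tG by (simp add: \<mu>_def \<nu>_def[symmetric] power2_eq_square tame_def)
    finally show ?thesis .
  qed
  then show ?thesis by (intro exI[of _ "\<bar>K j\<bar>"]) auto
qed

end

subsection \<open>Galerkin approximations\<close>

lemma integral_from_0_DERIV:
  fixes g :: "real \<Rightarrow> 'a::banach"
  assumes g: "continuous_on {0..} g" and t: "0 \<le> t"
  shows "((\<lambda>t. integral {0..t} g) has_vector_derivative g t) (at t within {0..})"
proof -
  have "((\<lambda>t. integral {0..t} g) has_vector_derivative g t) (at t within {0..t+1})"
    by (rule integral_has_vector_derivative) (use t in \<open>auto intro: continuous_on_subset[OF g]\<close>)
  moreover have "at t within {0..t+1} = at t within {0..}"
    by (rule at_within_nhd[of t "{..<t+1}"]) auto
  ultimately show ?thesis by simp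
qed

lemma integral_exp_le:
  fixes K t :: real
  assumes K: "0 < K" and t: "0 \<le> t"
  shows "integral {0..t} (\<lambda>s. exp (K * s)) \<le> exp (K * t) / K"
proof -
  have "((\<lambda>s. exp (K * s)) has_integral exp (K * t) / K - exp (K * 0) / K) {0..t}"
    by (rule fundamental_theorem_of_calculus)
      (use K t in \<open>auto intro!: derivative_eq_intros simp: has_real_derivative_iff_has_vector_derivative[symmetric]\<close>)
  then show "integral {0..t} (\<lambda>s. exp (K * s)) \<le> exp (K * t) / K"
    using K by (simp add: has_integral_iff)
qed

text \<open>Picard iteration converges on all of \<open>[0,\<infinity>)\<close> at once in the norm
  \<open>sup\<^sub>t exp (- 2 L t) |u t|\<close>.\<close>

lemma ode_global_lipschitz:
  fixes f :: "'a::banach \<Rightarrow> 'a"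
  assumes L: "0 < L" and lip: "\<And>x y. norm (f x - f y) \<le> L * norm (x - y)"
  shows "\<exists>u. u 0 = x0 \<and> (\<forall>t\<ge>0. (u has_vector_derivative f (u t)) (at t within {0..}))"
proof -
  \<comment> \<open>The exponential weight makes the contraction factor L / K = 1/2.\<close>
  define K where "K = 2 * L"
  have K: "0 < K" using L by (simp add: K_def)
  have cf: "continuous_on UNIV f"
  proof (rule continuous_onI)
    fix x and e :: real assume "0 < e"
    then show "\<exists>d>0. \<forall>x'\<in>UNIV. dist x' x < d \<longrightarrow> dist (f x') (f x) \<le> e"
      using L order_trans[OF lip] by (intro exI[of _ "e / L"]) (auto simp: dist_norm field_simps)
  qed
  define G where "G g s = f (exp (K * s) *\<^sub>R apply_bcontfun g s)" for g :: "real \<Rightarrow>\<^sub>C 'a" and s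
  have cG: "continuous_on S (G g)" for S g
    unfolding G_def by (intro continuous_on_compose2[OF cf] continuous_intros) auto
  have iG: "G g integrable_on {0..t}" for g t by (intro integrable_continuous_real cG)
  \<comment> \<open>The unknown is exp (- K t) u t, which stays bounded. Freezing it at its initial
    value for t < 0 gives a bounded continuous function on the whole line, the space in which the
    fixed point is sought.\<close>
  define T where "T g t = exp (- K * max 0 t) *\<^sub>R (x0 + integral {0..max 0 t} (G g))" for g t
  have DI: "((\<lambda>t. integral {0..t} (G g)) has_vector_derivative G g t) (at t within {0..})" if "0 \<le> t" for g t
    by (rule integral_from_0_DERIV[OF cG that])
  have cI: "continuous_on {0..} (\<lambda>t. integral {0..t} (G g))" for g
    by (rule continuous_on_vector_derivative) (use DI in auto)
  have cT: "continuous_on UNIV (T g)" for g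
    unfolding T_def by (intro continuous_intros continuous_on_compose2[OF cI]) auto
  have gen: "a * (x + M * (b / K)) = a * x + (a * b) * (M / K)" for a b x M :: real
    by (simp add: algebra_simps)
  have e1: "exp (- K * s) * exp (K * s) = 1" for s by (simp add: exp_minus)
  have bT: "norm (T g t) \<le> norm x0 + norm (f 0) / K + L * norm g / K" for g t
  proof -
    define s where "s = max 0 t"
    have s: "0 \<le> s" by (simp add: s_def)
    have le: "norm (G g r) \<le> (norm (f 0) + L * norm g) * exp (K * r)" if "r \<in> {0..s}" for r
    proof -
      have "norm (G g r) \<le> norm (f 0) + norm (G g r - f 0)" by (rule norm_triangle_sub)
      also have "norm (G g r - f 0) \<le> L * (exp (K * r) * norm (apply_bcontfun g r))"
        using lip[of "exp (K * r) *\<^sub>R apply_bcontfun g r" 0] by (simp add: G_def)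
      also have "\<dots> \<le> L * (exp (K * r) * norm g)"
        using L norm_bounded[of g r] by (intro mult_left_mono) auto
      also have "norm (f 0) \<le> norm (f 0) * exp (K * r)"
        using mult_left_mono[of 1 "exp (K * r)" "norm (f 0)"] that K by auto
      finally show ?thesis by (simp add: algebra_simps)
    qed
    have "norm (integral {0..s} (G g)) \<le> integral {0..s} (\<lambda>r. (norm (f 0) + L * norm g) * exp (K * r))"
      by (rule integral_norm_bound_integral[OF iG]) (use le in \<open>auto intro!: integrable_continuous_real continuous_intros\<close>)
    also have "\<dots> \<le> (norm (f 0) + L * norm g) * (exp (K * s) / K)"
      by (subst integral_mult_right, rule mult_left_mono[OF integral_exp_le[OF K s]]) (use L in auto)
    finally have "norm (x0 + integral {0..s} (G g)) \<le> norm x0 + (norm (f 0) + L * norm g) * (exp (K * s) / K)"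
      by (intro norm_triangle_le) simp
    then have "norm (T g t) \<le> exp (- K * s) * (norm x0 + (norm (f 0) + L * norm g) * (exp (K * s) / K))"
      unfolding T_def s_def[symmetric] by (simp add: mult_left_mono)
    also have "\<dots> = exp (- K * s) * norm x0 + (norm (f 0) + L * norm g) / K"
            using e1[of s] gen[of "exp (- K * s)" "norm x0" "norm (f 0) + L * norm g" "exp (K * s)"] by simp
    also have "exp (- K * s) * norm x0 \<le> norm x0" using K s by (simp add: mult_left_le_one_le)
    finally show ?thesis by (simp add: add_divide_distrib)
  qed
  have Tb: "apply_bcontfun (Bcontfun (T g)) = T g" for g
    by (intro Bcontfun_inverse bcontfun_normI[OF cT bT])
  have con: "dist (Bcontfun (T g)) (Bcontfun (T h)) \<le> 1/2 * dist g h" for g h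
  proof (rule dist_bound)
    fix t :: real
    define s where "s = max 0 t"
    have s: "0 \<le> s" by (simp add: s_def)
    have le: "norm (G g r - G h r) \<le> (L * dist g h) * exp (K * r)" for r
    proof -
      have "norm (G g r - G h r) \<le> L * (exp (K * r) * norm (apply_bcontfun g r - apply_bcontfun h r))"
        using lip[of "exp (K * r) *\<^sub>R apply_bcontfun g r" "exp (K * r) *\<^sub>R apply_bcontfun h r"]
        by (simp add: G_def scaleR_diff_right[symmetric])
      also have "\<dots> \<le> L * (exp (K * r) * dist g h)"
        using L dist_bounded[of g r h] by (intro mult_left_mono) (auto simp: dist_norm)
      finally show ?thesis by (simp add: mult_ac)
    qed
    have "norm (integral {0..s} (G g) - integral {0..s} (G h)) = norm (integral {0..s} (\<lambda>r. G g r - G h r))"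
      by (simp add: Henstock_Kurzweil_Integration.integral_diff iG)
    also have "\<dots> \<le> integral {0..s} (\<lambda>r. (L * dist g h) * exp (K * r))"
      by (rule integral_norm_bound_integral) (use le in \<open>auto intro!: integrable_diff iG cG integrable_continuous_real continuous_intros\<close>)
    also have "\<dots> \<le> (L * dist g h) * (exp (K * s) / K)"
      by (subst integral_mult_right, rule mult_left_mono[OF integral_exp_le[OF K s]]) (use L in auto)
    finally have *: "norm (integral {0..s} (G g) - integral {0..s} (G h)) \<le> (L * dist g h) * (exp (K * s) / K)" .
    have "dist (T g t) (T h t) = exp (- K * s) * norm (integral {0..s} (G g) - integral {0..s} (G h))"
      unfolding T_def s_def[symmetric] dist_norm scaleR_diff_right[symmetric] by simp
    also have "\<dots> \<le> exp (- K * s) * ((L * dist g h) * (exp (K * s) / K))"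
      using * by (intro mult_left_mono) auto
    also have "\<dots> = (exp (- K * s) * exp (K * s)) * (L * dist g h / K)"
      using gen[of "exp (- K * s)" 0 "L * dist g h" "exp (K * s)"] by simp
    also have "\<dots> = 1/2 * dist g h" unfolding e1 using L by (simp add: K_def)
    finally show "dist (apply_bcontfun (Bcontfun (T g)) t) (apply_bcontfun (Bcontfun (T h)) t) \<le> 1/2 * dist g h"
      unfolding Tb .
  qed
  obtain g where g: "Bcontfun (T g) = g"
    using banach_fix_type[of "1/2" "\<lambda>g. Bcontfun (T g)"] con by auto
  define u where "u t = exp (K * t) *\<^sub>R apply_bcontfun g t" for t
  have Gu: "G g = (\<lambda>s. f (u s))" by (rule ext) (simp add: G_def u_def)
  have u: "u t = x0 + integral {0..t} (\<lambda>s. f (u s))" if "0 \<le> t" for t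
  proof -
    have "apply_bcontfun g t = T g t" using Tb[of g] g by simp
    then show ?thesis
      using that unfolding u_def T_def G_def by (simp add: exp_minus max_absorb2 flip: scaleR_left.minus)
  qed
  have "(u has_vector_derivative f (u t)) (at t within {0..})" if t: "0 \<le> t" for t
  proof -
    have "((\<lambda>t. x0 + integral {0..t} (G g)) has_vector_derivative G g t) (at t within {0..})"
      using has_vector_derivative_add[OF has_vector_derivative_const DI[OF t]] by simp
    then have "((\<lambda>t. x0 + integral {0..t} (\<lambda>s. f (u s))) has_vector_derivative f (u t)) (at t within {0..})"
      unfolding Gu .
    then show ?thesis
      by (rule has_vector_derivative_transform[rotated 2]) (use t u in auto)
  qed
  then show ?thesis using u[of 0] by (intro exI[of _ u]) auto
qed

section \<open>Monotonicity and Lipschitz bounds for the flux law\<close>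

context film
begin

definition Phi :: "real \<Rightarrow> real \<Rightarrow> real" where "Phi h w = h\<^sup>2 * \<Psi> (h * w)"

lemma \<Psi>_bounds:
  "\<exists>a B M. 0 < a \<and> 0 < B \<and> 0 < M \<and> (\<forall>y. \<bar>y\<bar> \<le> 2 * hbar \<longrightarrow> a \<le> deriv \<Psi> y \<and> deriv \<Psi> y \<le> M \<and> \<bar>\<Psi> y\<bar> \<le> B)"
proof -
  let ?S = "{- (2 * hbar)..2 * hbar}"
  have c: "continuous_on ?S (deriv \<Psi>)" "continuous_on ?S \<Psi>"
    using smooth_\<Psi> smooth_fun_deriv smooth_fun_continuous by blast+
  have ne: "?S \<noteq> {}" using hbar by auto
  obtain y0 where y0: "\<forall>y\<in>?S. deriv \<Psi> y0 \<le> deriv \<Psi> y"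
    using continuous_attains_inf[OF compact_Icc ne c(1)] by blast
  obtain y1 where y1: "\<forall>y\<in>?S. deriv \<Psi> y \<le> deriv \<Psi> y1"
    using continuous_attains_sup[OF compact_Icc ne c(1)] by blast
  obtain B where B: "\<forall>y\<in>?S. \<bar>\<Psi> y\<bar> \<le> B"
    using compact_imp_bounded[OF compact_continuous_image[OF c(2) compact_Icc]] by (auto simp: bounded_real)
  have "deriv \<Psi> y0 \<le> deriv \<Psi> y \<and> deriv \<Psi> y \<le> deriv \<Psi> y1 \<and> \<bar>\<Psi> y\<bar> \<le> \<bar>B\<bar> + 1" if "\<bar>y\<bar> \<le> 2 * hbar" for y
  proof -
    have y: "y \<in> ?S" using that by auto
    show ?thesis using y0[rule_format, OF y] y1[rule_format, OF y] B[rule_format, OF y] by linarith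
  qed
  moreover have "0 < deriv \<Psi> y0" "0 < \<bar>B\<bar> + 1" "0 < deriv \<Psi> y1" using \<Psi>_pos by auto
  ultimately show ?thesis by blast
qed

text \<open>On this range the height hbar + v lies between hbar / 2 and 3 hbar / 2, and the argument
  of \<Psi> stays within 2 hbar, where \<open>\<Psi>_bounds\<close> applies.\<close>

definition reg :: "real \<Rightarrow> real \<Rightarrow> bool" where
  "reg v w \<longleftrightarrow> \<bar>v\<bar> \<le> hbar / 2 \<and> \<bar>w\<bar> \<le> 1"

text \<open>Since \<Psi>' is bounded below on a compact range, the flux is uniformly monotone in w;
  a change of height only costs a Lipschitz error. As w holds the highest derivatives, this
  monotonicity is the coercivity on which the comparison of two solutions rests.\<close>

lemma Phi_estimates:
  "\<exists>a L. 0 < a \<and> 0 < L \<and> (\<forall>v w v' w'. reg v w \<longrightarrow> reg v' w' \<longrightarrow>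
     \<bar>Phi (hbar + v) w - Phi (hbar + v') w'\<bar> \<le> L * (\<bar>v - v'\<bar> + \<bar>w - w'\<bar>) \<and>
     a * (w - w')\<^sup>2 - L * \<bar>v - v'\<bar> * \<bar>w - w'\<bar> \<le> (Phi (hbar + v) w - Phi (hbar + v') w') * (w - w'))"
proof -
  obtain a B M where aBM: "0 < a" "0 < B" "0 < M"
    and bd: "\<And>y. \<bar>y\<bar> \<le> 2 * hbar \<Longrightarrow> a \<le> deriv \<Psi> y \<and> deriv \<Psi> y \<le> M \<and> \<bar>\<Psi> y\<bar> \<le> B"
    using \<Psi>_bounds by blast
  have mvt: "\<exists>z. \<bar>z\<bar> \<le> 2 * hbar \<and> \<Psi> y - \<Psi> y' = deriv \<Psi> z * (y - y')"
    if yb: "\<bar>y\<bar> \<le> 2 * hbar" "\<bar>y'\<bar> \<le> 2 * hbar" for y y'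
  proof -
    have *: "\<exists>z. \<bar>z\<bar> \<le> 2 * hbar \<and> \<Psi> y - \<Psi> y' = deriv \<Psi> z * (y - y')"
      if yy: "\<bar>y\<bar> \<le> 2 * hbar" "\<bar>y'\<bar> \<le> 2 * hbar" "y' < y" for y y'
    proof -
      obtain z where "y' < z" "z < y" "\<Psi> y - \<Psi> y' = (y - y') * deriv \<Psi> z"
        using MVT2[OF yy(3), of \<Psi> "deriv \<Psi>"] smooth_fun_DERIV[OF smooth_\<Psi>] by blast
      then show ?thesis using yy by (intro exI[of _ z]) auto
    qed
    consider "y' < y" | "y < y'" | "y = y'" by linarith
    then show ?thesis
    proof cases
      case 2
      then obtain z where "\<bar>z\<bar> \<le> 2 * hbar" "\<Psi> y' - \<Psi> y = deriv \<Psi> z * (y' - y)" using *[of y' y] yb by blast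
      then show ?thesis by (intro exI[of _ z]) (auto simp: algebra_simps)
    next
      case 1
      then show ?thesis using * yb by blast
    next
      case 3
      then show ?thesis using hbar by (intro exI[of _ 0]) auto
    qed
  qed
  define k where "k = 2 * hbar"
  have k: "0 < k" using hbar by (simp add: k_def)
  define L where "L = 3 * hbar * B + k\<^sup>2 * M + k ^ 3 * M"
  have L0: "0 \<le> 3 * hbar * B" "0 \<le> k\<^sup>2 * M" "0 \<le> k ^ 3 * M" using aBM hbar k by auto
  have Lpos: "0 < L" unfolding L_def using aBM hbar k by (intro add_pos_pos mult_pos_pos) auto
  have "\<bar>Phi (hbar + v) w - Phi (hbar + v') w'\<bar> \<le> L * (\<bar>v - v'\<bar> + \<bar>w - w'\<bar>) \<and>
     (hbar / 2) ^ 3 * a * (w - w')\<^sup>2 - L * \<bar>v - v'\<bar> * \<bar>w - w'\<bar> \<le> (Phi (hbar + v) w - Phi (hbar + v') w') * (w - w')"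
    if r: "reg v w" "reg v' w'" for v w v' w'
  proof -
    define h h' where "h = hbar + v" and "h' = hbar + v'"
    have h: "hbar / 2 \<le> h" "h \<le> 3 / 2 * hbar" "hbar / 2 \<le> h'" "h' \<le> 3 / 2 * hbar"
      using r unfolding reg_def h_def h'_def abs_le_iff by (auto simp: field_simps)
    have hk: "h \<le> k" "h' \<le> k" "0 \<le> h" "0 \<le> h'" using h hbar by (auto simp: k_def)
    have hw: "\<bar>g * x\<bar> \<le> 2 * hbar" if "hbar / 2 \<le> g" "g \<le> 3 / 2 * hbar" "\<bar>x\<bar> \<le> 1" for g x
    proof -
      have "\<bar>g * x\<bar> \<le> (2 * hbar) * 1" unfolding abs_mult using that hbar by (intro mult_mono) auto
      then show ?thesis by simp
    qed
    have w: "\<bar>w\<bar> \<le> 1" "\<bar>w'\<bar> \<le> 1" using r by (auto simp: reg_def)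
    obtain z where z: "\<bar>z\<bar> \<le> 2 * hbar" "\<Psi> (h * w) - \<Psi> (h * w') = deriv \<Psi> z * (h * w - h * w')"
      using mvt[OF hw[OF h(1,2) w(1)] hw[OF h(1,2) w(2)]] by blast
    obtain z' where z': "\<bar>z'\<bar> \<le> 2 * hbar" "\<Psi> (h * w') - \<Psi> (h' * w') = deriv \<Psi> z' * (h * w' - h' * w')"
      using mvt[OF hw[OF h(1,2) w(2)] hw[OF h(3,4) w(2)]] by blast
    \<comment> \<open>First w is changed with h fixed, which gives the coercive coefficient A; then
      h is changed with w' fixed, which gives the error E.\<close>
    define A where "A = h ^ 3 * deriv \<Psi> z"
    define E where "E = (h\<^sup>2 - h'\<^sup>2) * \<Psi> (h * w') + h'\<^sup>2 * (deriv \<Psi> z' * (h * w' - h' * w'))"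
    have eq: "Phi h w - Phi h' w' = A * (w - w') + E"
    proof -
      have "Phi h w - Phi h' w' = h\<^sup>2 * (\<Psi> (h * w) - \<Psi> (h * w')) + (h\<^sup>2 - h'\<^sup>2) * \<Psi> (h * w') + h'\<^sup>2 * (\<Psi> (h * w') - \<Psi> (h' * w'))"
        unfolding Phi_def by (simp add: algebra_simps)
      also have "\<dots> = A * (w - w') + E"
        unfolding z(2) z'(2) A_def E_def by (simp add: power2_eq_square power3_eq_cube algebra_simps)
      finally show ?thesis .
    qed
    have A: "(hbar / 2) ^ 3 * a \<le> A" "A \<le> k ^ 3 * M"
      unfolding A_def using bd[OF z(1)] h hk hbar aBM by (intro mult_mono power_mono; simp)+
    have "0 \<le> (hbar / 2) ^ 3 * a" using hbar aBM by simp
    then have A0: "0 \<le> A" using A(1) by linarith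
    have E: "\<bar>E\<bar> \<le> (3 * hbar * B + k\<^sup>2 * M) * \<bar>v - v'\<bar>"
    proof -
      have hv: "h - h' = v - v'" by (simp add: h_def h'_def)
      have "\<bar>(h\<^sup>2 - h'\<^sup>2) * \<Psi> (h * w')\<bar> = (\<bar>h + h'\<bar> * \<bar>\<Psi> (h * w')\<bar>) * \<bar>v - v'\<bar>"
        by (simp add: square_diff_square_factored power2_eq_square abs_mult hv[symmetric] mult_ac)
      also have "\<dots> \<le> (3 * hbar * B) * \<bar>v - v'\<bar>"
        using bd[OF hw[OF h(1,2) w(2)]] h hbar aBM by (intro mult_right_mono mult_mono) auto
      finally have 1: "\<bar>(h\<^sup>2 - h'\<^sup>2) * \<Psi> (h * w')\<bar> \<le> (3 * hbar * B) * \<bar>v - v'\<bar>" .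
      have "\<bar>h'\<^sup>2 * (deriv \<Psi> z' * (h * w' - h' * w'))\<bar> = (h'\<^sup>2 * deriv \<Psi> z' * \<bar>w'\<bar>) * \<bar>v - v'\<bar>"
        using bd[OF z'(1)] aBM by (simp add: left_diff_distrib[symmetric] hv abs_mult mult_ac)
      also have "\<dots> \<le> (k\<^sup>2 * M * 1) * \<bar>v - v'\<bar>"
        using bd[OF z'(1)] h hk hbar aBM w by (intro mult_right_mono mult_mono power_mono) auto
      finally have 2: "\<bar>h'\<^sup>2 * (deriv \<Psi> z' * (h * w' - h' * w'))\<bar> \<le> (k\<^sup>2 * M) * \<bar>v - v'\<bar>" by simp
      show ?thesis unfolding E_def distrib_right
        by (rule order_trans[OF abs_triangle_ineq add_mono[OF 1 2]])
    qed
    have "\<bar>Phi h w - Phi h' w'\<bar> \<le> A * \<bar>w - w'\<bar> + \<bar>E\<bar>"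
      unfolding eq using A0 abs_triangle_ineq[of "A * (w - w')" E] by (simp add: abs_mult)
    also have "\<dots> \<le> k ^ 3 * M * \<bar>w - w'\<bar> + (3 * hbar * B + k\<^sup>2 * M) * \<bar>v - v'\<bar>"
      using A E by (intro add_mono mult_right_mono) auto
    also have "\<dots> \<le> L * \<bar>w - w'\<bar> + L * \<bar>v - v'\<bar>"
    proof -
      have "k ^ 3 * M \<le> L" "3 * hbar * B + k\<^sup>2 * M \<le> L" unfolding L_def using L0 by linarith+
      then show ?thesis by (intro add_mono mult_right_mono) auto
    qed
    finally have 1: "\<bar>Phi h w - Phi h' w'\<bar> \<le> L * (\<bar>v - v'\<bar> + \<bar>w - w'\<bar>)" by (simp add: algebra_simps)
    have "\<bar>E * (w - w')\<bar> \<le> L * \<bar>v - v'\<bar> * \<bar>w - w'\<bar>"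
    proof -
      have "\<bar>E\<bar> \<le> L * \<bar>v - v'\<bar>"
        by (rule order_trans[OF E]) (use L0 in \<open>auto simp: L_def intro: mult_right_mono\<close>)
      then show ?thesis unfolding abs_mult by (rule mult_right_mono) auto
    qed
    moreover have "(hbar / 2) ^ 3 * a * (w - w')\<^sup>2 \<le> A * (w - w')\<^sup>2" using A by (intro mult_right_mono) auto
    moreover have "(Phi h w - Phi h' w') * (w - w') = A * (w - w')\<^sup>2 + E * (w - w')"
      unfolding eq by (simp add: power2_eq_square algebra_simps)
    ultimately have 2: "(hbar / 2) ^ 3 * a * (w - w')\<^sup>2 - L * \<bar>v - v'\<bar> * \<bar>w - w'\<bar> \<le> (Phi h w - Phi h' w') * (w - w')"
      by linarith
    show ?thesis using 1 2 unfolding h_def h'_def by simp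
  qed
  moreover have "0 < (hbar / 2) ^ 3 * a" using hbar aBM by simp
  ultimately show ?thesis using Lpos by blast
qed

end

text \<open>The constants grow with m. This suffices for the Lipschitz property of one Galerkin
  system, and for passing to the limit, where it is applied to a fixed number of low modes.\<close>

lemma fser_diff_bound:
  assumes "fin m c" "fin m d" "\<And>k. norm (c k - d k) \<le> B" "0 \<le> B"
  shows "\<bar>fser c x - fser d x\<bar> \<le> real (Suc m) * B"
    and "\<bar>fser (Ls c) x - fser (Ls d) x\<bar> \<le> real (Suc m) * (real m ^ 3 * B)"
proof -
  have *: "\<bar>fser e x\<bar> \<le> real (Suc m) * C" if "fin m e" "\<And>k. k \<le> m \<Longrightarrow> norm (e k) \<le> C" for e C
  proof -
    have "\<bar>fser e x\<bar> \<le> (\<Sum>k. norm (e k))" by (rule fser_bound[OF fin_summable[OF that(1)]])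
    also have "\<dots> = (\<Sum>k\<le>m. norm (e k))" by (rule suminf_finite) (use that(1) in \<open>auto simp: finD\<close>)
    also have "\<dots> \<le> (\<Sum>k\<le>m. C)" by (rule sum_mono) (use that(2) in auto)
    finally show ?thesis by simp
  qed
  have "fser c x - fser d x = fser (\<lambda>k. c k - d k) x"
    by (rule fser_diff[symmetric]) (auto intro: fin_summable assms)
  also have "\<bar>\<dots>\<bar> \<le> real (Suc m) * B" by (rule *) (use assms in \<open>auto simp: fin_def\<close>)
  finally show "\<bar>fser c x - fser d x\<bar> \<le> real (Suc m) * B" .
  have "fser (Ls c) x - fser (Ls d) x = fser (\<lambda>k. Ls c k - Ls d k) x"
    by (rule fser_diff[symmetric]) (auto intro: fin_summable fin_Ls assms)
  also have "(\<lambda>k. Ls c k - Ls d k) = Ls (\<lambda>k. c k - d k)" by (auto simp: Ls_def algebra_simps)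
  also have "\<bar>fser (Ls (\<lambda>k. c k - d k)) x\<bar> \<le> real (Suc m) * (real m ^ 3 * B)"
  proof (rule *)
    show "norm (Ls (\<lambda>k. c k - d k) k) \<le> real m ^ 3 * B" if "k \<le> m" for k
      by (rule order_trans[OF cmod_Ls_le]) (use that assms in \<open>auto intro!: mult_mono power_mono\<close>)
  qed (use assms in \<open>auto simp: fin_def Ls_def\<close>)
  finally show "\<bar>fser (Ls c) x - fser (Ls d) x\<bar> \<le> real (Suc m) * (real m ^ 3 * B)" .
qed

lemma bcontfun_integrable: "integrable circle (apply_bcontfun (y :: real \<Rightarrow>\<^sub>C real))"
  by (rule circle_integrable) simp

text \<open>Being bounded and linear, the extraction of a coefficient commutes with the time
  derivative of a curve of functions.\<close>

lemma bounded_linear_fc: "bounded_linear (\<lambda>y :: real \<Rightarrow>\<^sub>C real. fc (apply_bcontfun y) k)"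
proof (rule bounded_linear_intro[where K = 2])
  fix y z :: "real \<Rightarrow>\<^sub>C real" and r :: real
  show "fc (apply_bcontfun (y + z)) k = fc (apply_bcontfun y) k + fc (apply_bcontfun z) k"
    using fc_add[OF bcontfun_integrable bcontfun_integrable, of y z k] by (simp add: plus_bcontfun.rep_eq)
  show "fc (apply_bcontfun (r *\<^sub>R y)) k = r *\<^sub>R fc (apply_bcontfun y) k"
    using fc_cmult[of r "apply_bcontfun y" k] by (simp add: scaleR_bcontfun.rep_eq scaleR_conv_of_real)
  show "norm (fc (apply_bcontfun y) k) \<le> norm y * 2"
    using fc_bound[OF bcontfun_integrable, of y "norm y" k] norm_bounded[of y] by simp
qed

text \<open>Lets \<open>ode_global_lipschitz\<close> be used with bounded continuous functions as
  the states.\<close>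

instance bcontfun :: (metric_space, banach) banach ..

context film
begin

text \<open>Clamping the arguments makes the vector field globally Lipschitz; as long as the solution is small
  it is the original one.\<close>

definition Fc :: "(nat \<Rightarrow> complex) \<Rightarrow> real \<Rightarrow> real" where
  "Fc c x = Phi (hbar + clamp1 (hbar / 2) (fser c x)) (clamp1 1 (fser (Ls c) x))"

lemma reg_clamp: "reg (clamp1 (hbar / 2) v) (clamp1 1 w)"
  unfolding reg_def using hbar clamp1_bound[of "hbar / 2"] clamp1_bound[of 1] by auto

lemma Fc_eq_Fl: "(\<And>x. reg (fser c x) (fser (Ls c) x)) \<Longrightarrow> Fc c = Fl c"
  unfolding Fc_def Fl_def Phi_def reg_def by (auto simp: clamp1_id)

lemma Phi_continuous:
  "continuous_on S f \<Longrightarrow> continuous_on S g \<Longrightarrow> continuous_on S (\<lambda>x. Phi (f x) (g x))"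
  unfolding Phi_def
  by (intro continuous_intros continuous_on_compose2[OF smooth_fun_continuous[OF smooth_\<Psi>, of UNIV]]) auto

lemma Fc_continuous: "fin m c \<Longrightarrow> continuous_on S (Fc c)"
  unfolding Fc_def
  by (intro Phi_continuous continuous_intros clamp1_continuous fser_continuous fin_summable[of m] fin_Ls)

text \<open>The system is solved as an ODE for bounded continuous functions: the field reads off
  finitely many coefficients with \<open>fc\<close> and returns a trigonometric polynomial. Thus the
  state space is a ready-made Banach space that serves all m.\<close>

lemma galerkin_exists:
  assumes c0: "fin m c0"
  shows "\<exists>c. c 0 = c0 \<and> (\<forall>t\<ge>0. fin m (c t)) \<and> (\<forall>t\<ge>0. \<forall>k. ((\<lambda>t. c t k) has_vector_derivative
      (if 1 \<le> k \<and> k \<le> m then - (\<i> * of_nat k * fc (Fc (c t)) k) else 0)) (at t within {0..}))"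
proof -
  define g where "g c k = (if 1 \<le> k \<and> k \<le> m then - (\<i> * of_nat k * fc (Fc c) k) else 0)" for c k
  define f :: "(real \<Rightarrow>\<^sub>C real) \<Rightarrow> (real \<Rightarrow>\<^sub>C real)"
    where "f y = Bcontfun (fser (g (tr m (fc (apply_bcontfun y)))))" for y
  obtain a L where L: "0 < L" "\<And>v w v' w'. reg v w \<Longrightarrow> reg v' w' \<Longrightarrow>
     \<bar>Phi (hbar + v) w - Phi (hbar + v') w'\<bar> \<le> L * (\<bar>v - v'\<bar> + \<bar>w - w'\<bar>)"
    using Phi_estimates by blast
  have fg: "fin m (g c)" for c by (simp add: fin_def g_def)
  have bc: "fser h \<in> bcontfun" if "fin m h" for h
    by (rule bcontfun_normI[OF fser_continuous fser_bound[folded real_norm_def]]) (use that in \<open>auto intro: fin_summable\<close>)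
  have fa: "apply_bcontfun (f y) = fser (g (tr m (fc (apply_bcontfun y))))" for y
    unfolding f_def by (intro Bcontfun_inverse bc fg)
  \<comment> \<open>A Lipschitz constant that may depend on m; the added 1 keeps it positive for m =
    0.\<close>
  define B where "B = real (Suc m) * (real m * (2 * (L * (real (Suc m) + real (Suc m) * real m ^ 3) * 2))) + 1"
  have B: "0 < B" using L unfolding B_def by (intro add_nonneg_pos) auto
  have lip: "norm (f y - f z) \<le> B * norm (y - z)" for y z
  proof (rule norm_bound)
    fix x
    define N where "N = 2 * norm (y - z)"
    define c d where "c = tr m (fc (apply_bcontfun y))" and "d = tr m (fc (apply_bcontfun z))"
    have fin: "fin m c" "fin m d" by (auto simp: c_def d_def fin_tr)
    have N0: "0 \<le> N" by (simp add: N_def)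
    have cd: "norm (c j - d j) \<le> N" for j
    proof -
      interpret bounded_linear "\<lambda>y :: real \<Rightarrow>\<^sub>C real. fc (apply_bcontfun y) j" by (rule bounded_linear_fc)
      have "norm (fc (apply_bcontfun (y - z)) j) \<le> N"
        unfolding N_def by (rule fc_bound[OF bcontfun_integrable]) (use norm_bounded[of "y - z"] in simp)
      then have "norm (fc (apply_bcontfun y) j - fc (apply_bcontfun z) j) \<le> N" by (simp only: diff)
      then show ?thesis using N0 by (auto simp: c_def d_def tr_def)
    qed
    have "\<bar>Fc c x - Fc d x\<bar> \<le> L * (real (Suc m) + real (Suc m) * real m ^ 3) * N" for x
    proof -
      have "\<bar>Fc c x - Fc d x\<bar> \<le> L * (\<bar>clamp1 (hbar/2) (fser c x) - clamp1 (hbar/2) (fser d x)\<bar> +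
          \<bar>clamp1 1 (fser (Ls c) x) - clamp1 1 (fser (Ls d) x)\<bar>)"
        unfolding Fc_def by (rule L(2)[OF reg_clamp reg_clamp])
      also have "\<dots> \<le> L * (real (Suc m) * N + real (Suc m) * (real m ^ 3 * N))"
        using L(1) by (intro mult_left_mono add_mono order_trans[OF clamp1_lipschitz] fser_diff_bound fin cd N0) auto
      finally show ?thesis by (simp add: algebra_simps)
    qed
    moreover have i: "integrable circle (Fc c)" "integrable circle (Fc d)"
      using fin by (auto intro!: circle_integrable Fc_continuous)
    ultimately have F0: "norm (fc (\<lambda>x. Fc c x - Fc d x) k) \<le> 2 * (L * (real (Suc m) + real (Suc m) * real m ^ 3) * N)" for k
      by (intro fc_bound) auto
    have F: "norm (fc (Fc c) k - fc (Fc d) k) \<le> 2 * (L * (real (Suc m) + real (Suc m) * real m ^ 3) * N)" for k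
      using F0[of k] by (simp add: fc_diff[OF i])
    have gk: "norm (g c k - g d k) \<le> real m * (2 * (L * (real (Suc m) + real (Suc m) * real m ^ 3) * N))" for k
    proof (cases "1 \<le> k \<and> k \<le> m")
      case True
      then have "g c k - g d k = - (\<i> * of_nat k * (fc (Fc c) k - fc (Fc d) k))"
        by (simp add: g_def algebra_simps)
      then have "norm (g c k - g d k) = real k * norm (fc (Fc c) k - fc (Fc d) k)" by (simp add: norm_mult)
      also have "\<dots> \<le> real m * (2 * (L * (real (Suc m) + real (Suc m) * real m ^ 3) * N))"
        using True F by (intro mult_mono) auto
      finally show ?thesis .
    next
      case False
      then have "g c k - g d k = 0" by (auto simp: g_def)
      then show ?thesis using L(1) N0 by simp
    qed
    have "\<bar>fser (g c) x - fser (g d) x\<bar> \<le> real (Suc m) * (real m * (2 * (L * (real (Suc m) + real (Suc m) * real m ^ 3) * N)))"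
      by (rule fser_diff_bound(1)[OF fg fg gk]) (use L(1) N0 in simp)
    also have "\<dots> \<le> B * norm (y - z)" by (simp add: B_def N_def algebra_simps)
    finally show "norm (apply_bcontfun (f y - f z) x) \<le> B * norm (y - z)"
      by (simp add: fa c_def d_def)
  qed
  obtain u where u: "u 0 = Bcontfun (fser c0)" "\<And>t. 0 \<le> t \<Longrightarrow> (u has_vector_derivative f (u t)) (at t within {0..})"
    using ode_global_lipschitz[where f = f and L = B and ?x0.0 = "Bcontfun (fser c0)"] B lip by blast
  define c where "c t k = fc (apply_bcontfun (u t)) k" for t k
  have fcg: "fc (fser h) = h" if "fin m h" for h
    by (rule ext, rule fc_fser) (use that in \<open>auto intro: fin_summable simp: finD0\<close>)
  have D: "((\<lambda>t. c t k) has_vector_derivative g (tr m (c t)) k) (at t within {0..})" if "0 \<le> t" for t k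
    using bounded_linear.has_vector_derivative[OF bounded_linear_fc u(2)[OF that], of k]
    unfolding fa fcg[OF fg] c_def[abs_def] by simp
  have "apply_bcontfun (u 0) = fser c0" unfolding u(1) by (rule Bcontfun_inverse[OF bc[OF c0]])
  then have c00: "c 0 = c0" using fcg[OF c0] by (simp add: c_def[abs_def])
  have fin: "fin m (c t)" if t: "0 \<le> t" for t
  proof -
    \<comment> \<open>Outside 1..m both the vector field and the initial value vanish, so these
      modes are constantly zero.\<close>
    have "c t k = 0" if k: "\<not> (1 \<le> k \<and> k \<le> m)" for k
    proof -
      have "((\<lambda>t. c t k) has_vector_derivative 0) (at s within {0..})" if "s \<in> {0..}" for s
        using D[of s k] that k by (auto simp: g_def)
      then obtain C where "\<And>s. s \<in> {0..} \<Longrightarrow> c s k = C"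
        using has_vector_derivative_zero_constant[of "{0..}" "\<lambda>t. c t k"] by (metis convex_real_interval(1))
      moreover have "c 0 k = 0" using k c0 c00 by (auto simp: fin_def not_le less_Suc_eq_0_disj)
      ultimately show ?thesis using t by (metis atLeast_iff order_refl)
    qed
    then show ?thesis by (auto simp: fin_def)
  qed
  have T: "tr m (c t) = c t" if "0 \<le> t" for t
    using fin[OF that] by (auto simp: tr_def fin_def not_le less_Suc_eq_0_disj)
  have "((\<lambda>t. c t k) has_vector_derivative
      (if 1 \<le> k \<and> k \<le> m then - (\<i> * of_nat k * fc (Fc (c t)) k) else 0)) (at t within {0..})"
    if "0 \<le> t" for t k
    using D[OF that, of k] unfolding T[OF that] g_def .
  then show ?thesis using fin c00 by (intro exI[of _ c]) blast
qed

end

text \<open>Multiplication by a mode of frequency 1 couples neighbouring frequencies. The index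
  \<open>Suc k\<close> avoids a coefficient of index -1.\<close>

lemma fc_mode_mult:
  assumes "integrable circle g"
  shows "fc (\<lambda>x. Re (A * cis x) * g x) (Suc k) = (A * fc g k + cnj A * fc g (k + 2)) / 2"
proof -
  have eq: "complex_of_real (Re (A * cis x) * g x) * cis (- (real (Suc k) * x)) =
    (A / 2) * (complex_of_real (g x) * cis (- (real k * x))) + (cnj A / 2) * (complex_of_real (g x) * cis (- (real (k + 2) * x)))" for x
  proof -
    have "complex_of_real (Re (A * cis x)) = (A * cis x + cnj (A * cis x)) / 2"
      using complex_add_cnj[of "A * cis x"] by (simp only: of_real_mult) simp
    also have "\<dots> = (A * cis x + cnj A * cis (- x)) / 2" by (simp add: cis_cnj)
    finally have X: "complex_of_real (Re (A * cis x)) = (A * cis x + cnj A * cis (- x)) / 2" .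
    have "complex_of_real (Re (A * cis x) * g x) * cis (- (real (Suc k) * x)) =
      (A / 2) * (complex_of_real (g x) * (cis x * cis (- (real (Suc k) * x)))) + (cnj A / 2) * (complex_of_real (g x) * (cis (- x) * cis (- (real (Suc k) * x))))"
      unfolding of_real_mult X by (simp add: algebra_simps add_divide_distrib)
    moreover have "cis x * cis (- (real (Suc k) * x)) = cis (- (real k * x))" "cis (- x) * cis (- (real (Suc k) * x)) = cis (- (real (k + 2) * x))"
      unfolding cis_mult by (auto intro!: arg_cong[where f = cis] simp: algebra_simps)
    ultimately show ?thesis by simp
  qed
  show ?thesis unfolding fc_def eq
    by (subst Bochner_Integration.integral_add[OF integrable_mult_right integrable_mult_right, OF
          integrable_mult_cis'[OF assms] integrable_mult_cis'[OF assms]]) (simp add: field_simps)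
qed

lemma fc_add_cont:
  "continuous_on UNIV f \<Longrightarrow> continuous_on UNIV g \<Longrightarrow> fc (\<lambda>x. f x + g x) k = fc f k + fc g k"
  by (intro fc_add circle_integrable)

lemma fc_bound_cont:
  "continuous_on UNIV f \<Longrightarrow> (\<And>x. \<bar>f x\<bar> \<le> B) \<Longrightarrow> norm (fc f k) \<le> 2 * B"
  by (intro fc_bound circle_integrable)

lemma fc_const_pos: "1 \<le> k \<Longrightarrow> fc (\<lambda>x. a) k = 0"
  using cint_cis[of "- int k"] unfolding fc_def by simp

lemma fc_fser_fin: "fin m c \<Longrightarrow> fc (fser c) k = c k"
  by (rule fc_fser) (auto intro: fin_summable simp: finD0)

text \<open>Removes the neutral mode; what is left is linearly damped.\<close>

definition drop1 :: "(nat \<Rightarrow> complex) \<Rightarrow> nat \<Rightarrow> complex" where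
  "drop1 c k = (if k = 1 then 0 else c k)"

lemma fin_drop1: "fin m c \<Longrightarrow> fin m (drop1 c)"
  unfolding fin_def drop1_def by auto

lemma nrm2_drop1:
  assumes f: "fin m c" and m: "1 \<le> m"
  shows "nrm2 s c = (cmod (c 1))\<^sup>2 + nrm2 s (drop1 c)"
    and "nrm2 s (drop1 c) = (\<Sum>k=2..m. (real k ^ s * cmod (c k))\<^sup>2)"
proof -
  have 1: "{1..m} = insert 1 {2..m}" using m by auto
  have 2: "(\<Sum>k=2..m. (real k ^ s * cmod (drop1 c k))\<^sup>2) = (\<Sum>k=2..m. (real k ^ s * cmod (c k))\<^sup>2)"
    by (rule sum.cong) (auto simp: drop1_def)
  show "nrm2 s (drop1 c) = (\<Sum>k=2..m. (real k ^ s * cmod (c k))\<^sup>2)"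
    unfolding fin_nrm2_atLeast[OF fin_drop1[OF f]] 1 using 2 by (simp add: drop1_def)
  then show "nrm2 s c = (cmod (c 1))\<^sup>2 + nrm2 s (drop1 c)"
    unfolding fin_nrm2_atLeast[OF f] 1 by simp
qed

lemma fin_fser_sup:
  assumes "fin m d"
  shows "\<bar>fser d x\<bar> \<le> sqrt (2 * nrm2 1 d)"
proof -
  have h: "hseq (Suc 0) d" by (rule fin_hseq[OF assms])
  have "\<bar>fser d x\<bar> \<le> (\<Sum>k. real k ^ 0 * norm (d k))"
    using fser_bound[OF fin_summable[OF assms]] by simp
  also have "\<dots> \<le> sqrt (2 * nrm2 1 d)"
    using hseq_l1(2)[OF h] finD0[OF assms] by (intro real_le_rsqrt) simp
  finally show ?thesis .
qed

lemma Ls_drop1: "Ls (drop1 c) = Ls c"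
  by (auto simp: Ls_def drop1_def fun_eq_iff power3_eq_cube)

text \<open>Since \<open>Ls\<close> does not see mode 1, v' + v''' is controlled by the damped modes
  alone. This is where the factor y in all later error terms comes from.\<close>

lemma fin_fser_Ls_sup:
  assumes "fin m d"
  shows "\<bar>fser (Ls d) x\<bar> \<le> sqrt (2 * nrm2 4 (drop1 d))"
proof -
  have f: "fin m (drop1 d)" by (rule fin_drop1[OF assms])
  have "\<bar>fser (Ls (drop1 d)) x\<bar> \<le> sqrt (2 * nrm2 1 (Ls (drop1 d)))"
    by (rule fin_fser_sup[OF fin_Ls[OF f]])
  also have "\<dots> \<le> sqrt (2 * nrm2 4 (drop1 d))"
    using nrm2_Ls[of 1 "drop1 d"] fin_hseq[OF f] by (auto simp: numeral_eq_Suc)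
  finally show ?thesis unfolding Ls_drop1 .
qed

lemma fser_split1:
  assumes "fin m c"
  shows "fser c x = Re (c 1 * cis x) + fser (drop1 c) x"
proof -
  let ?d = "\<lambda>k. if k = 1 then c 1 else 0"
  have d: "fin 1 ?d" by (auto simp: fin_def)
  have "c = (\<lambda>k. ?d k + drop1 c k)" by (auto simp: drop1_def)
  then have "fser c x = fser ?d x + fser (drop1 c) x"
    using fser_add[OF fin_summable[OF d] fin_summable[OF fin_drop1[OF assms]], of x] by simp
  moreover have "fser ?d x = Re (c 1 * cis x)"
    by (subst fser_finite[of 1]) auto
  ultimately show ?thesis by simp
qed

section \<open>Energy estimates and resonances of the lowest modes\<close>

context film
begin

definition vf :: "nat \<Rightarrow> (nat \<Rightarrow> complex) \<Rightarrow> nat \<Rightarrow> complex" where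
  "vf m c k = (if 1 \<le> k \<and> k \<le> m then - (\<i> * of_nat k * fc (Fl c) k) else 0)"

lemma fc_Fl:
  assumes f: "fin m c" and k: "1 \<le> k"
  shows "fc (Fl c) k = of_real (hbar * p0) * c k + of_real D * Ls c k + fc (F2 c) k"
proof -
  note cc = sper_continuous[OF fin_fser_sper[OF f]] sper_continuous[OF fin_fser_sper[OF fin_Ls[OF f]]]
    sper_continuous[OF F2_sper[OF f]]
  have "fc (Fl c) k = fc (\<lambda>x. hbar\<^sup>2 * p0 / 2 + hbar * p0 * fser c x + D * fser (Ls c) x + F2 c x) k"
    using Fl_expand by presburger
  also have "\<dots> = fc (\<lambda>x. hbar\<^sup>2 * p0 / 2) k + fc (\<lambda>x. hbar * p0 * fser c x) k + fc (\<lambda>x. D * fser (Ls c) x) k + fc (F2 c) k"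
    by (subst fc_add_cont, (intro continuous_intros cc)+)+ simp
  finally show ?thesis
    using fc_const_pos[OF k] fc_cmult[of "hbar * p0" "fser c" k] fc_cmult[of D "fser (Ls c)" k]
    by (simp add: fc_fser_fin[OF f] fc_fser_fin[OF fin_Ls[OF f]])
qed

text \<open>The drift term has a purely imaginary symbol and does no work, so only the damping and
  the nonlinear flux contribute.\<close>

lemma inner_vf:
  assumes f: "fin m c" and k: "1 \<le> k" "k \<le> m"
  shows "c k \<bullet> vf m c k \<le> - D * (real k ^ 4 - real k ^ 2) * (cmod (c k))\<^sup>2 + real k * cmod (c k) * cmod (fc (F2 c) k)"
proof -
  have "vf m c k = \<i> * of_real (- real k * hbar * p0) * c k + of_real (- D * (real k ^ 4 - real k ^ 2)) * c k + (- \<i> * of_nat k) * fc (F2 c) k"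
    using k by (simp add: vf_def fc_Fl[OF f] Ls_def algebra_simps power4_eq_xxxx power3_eq_cube power2_eq_square)
  then have "c k \<bullet> vf m c k = c k \<bullet> (\<i> * of_real (- real k * hbar * p0) * c k) + c k \<bullet> (of_real (- D * (real k ^ 4 - real k ^ 2)) * c k)
      + c k \<bullet> ((- \<i> * of_nat k) * fc (F2 c) k)"
    by (simp only: inner_add_right)
  also have "c k \<bullet> (\<i> * of_real (- real k * hbar * p0) * c k) = 0"
    by (simp add: inner_complex_def)
  also have "c k \<bullet> (of_real (- D * (real k ^ 4 - real k ^ 2)) * c k) = - D * (real k ^ 4 - real k ^ 2) * (cmod (c k))\<^sup>2"
    by (simp only: scaleR_conv_of_real[symmetric] inner_scaleR_right dot_square_norm)
  also have "c k \<bullet> ((- \<i> * of_nat k) * fc (F2 c) k) \<le> cmod (c k) * cmod ((- \<i> * of_nat k) * fc (F2 c) k)"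
    by (rule norm_cauchy_schwarz)
  also have "cmod ((- \<i> * of_nat k) * fc (F2 c) k) = real k * cmod (fc (F2 c) k)" by (simp add: norm_mult)
  finally show ?thesis by (simp add: mult_ac)
qed

text \<open>Bessel's inequality for the j-th derivative of the nonlinear flux. The constant is
  independent of the number of modes, which makes all subsequent estimates uniform over the Galerkin
  truncations.\<close>

lemma sum_fc_F2:
  assumes j: "1 \<le> j"
  shows "\<exists>K\<ge>0. \<forall>m c n. fin m c \<longrightarrow> nrm2 4 c \<le> 1 \<longrightarrow>
     (\<Sum>k=1..n. (real k ^ j * cmod (fc (F2 c) k))\<^sup>2) \<le> K * (nrm2 4 c * nrm2 (j + 3) c)"
proof -
  obtain K where K: "0 \<le> K" "\<And>m c. fin m c \<Longrightarrow> nrm2 4 c \<le> 1 \<Longrightarrow>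
    cint (\<lambda>x. ((deriv ^^ j) (F2 c) x)\<^sup>2) \<le> K * (nrm2 4 c * nrm2 (j + 3) c)"
    using F2_bound[OF j] by blast
  have "(\<Sum>k=1..n. (real k ^ j * cmod (fc (F2 c) k))\<^sup>2) \<le> (K / pi) * (nrm2 4 c * nrm2 (j + 3) c)"
    if f: "fin m c" and n: "nrm2 4 c \<le> 1" for m c n
  proof -
    have "(\<Sum>k=1..n. (real k ^ j * cmod (fc (F2 c) k))\<^sup>2) = (\<Sum>k=1..n. (cmod (fc ((deriv ^^ j) (F2 c)) k))\<^sup>2)"
      by (simp add: sper_fc_deriv[OF F2_sper[OF f]] norm_mult norm_power)
    also have "\<dots> \<le> cint (\<lambda>x. ((deriv ^^ j) (F2 c) x)\<^sup>2) / pi"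
      by (rule bessel[OF sper_sqi[OF sper_deriv_n[OF F2_sper[OF f]]]])
    also have "\<dots> \<le> K * (nrm2 4 c * nrm2 (j + 3) c) / pi"
      by (intro divide_right_mono K(2)[OF f n]) auto
    finally show ?thesis by simp
  qed
  then show ?thesis using K(1) by (intro exI[of _ "K / pi"]) auto
qed

text \<open>The nonlinear contribution carries the power 2 s + 1 of the frequency, split as (s + 2)
  + (s - 1). The flux loses three derivatives, so both factors end at order s + 2, which is the
  order the damping controls. The index set is free, in order to include or exclude mode 1.\<close>

lemma energy_sum:
  assumes s: "2 \<le> s"
  shows "\<exists>K\<ge>0. \<forall>m c A. fin m c \<longrightarrow> nrm2 4 c \<le> 1 \<longrightarrow> A \<subseteq> {1..m} \<longrightarrow>
    2 * (\<Sum>k\<in>A. (real k ^ s)\<^sup>2 * (c k \<bullet> vf m c k)) \<le>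
     - 2 * D * (\<Sum>k\<in>A. (real k ^ 4 - real k ^ 2) * (real k ^ s * cmod (c k))\<^sup>2)
     + 2 * sqrt (\<Sum>k\<in>A. (real k ^ (s + 2) * cmod (c k))\<^sup>2) * (K * sqrt (nrm2 4 c * nrm2 (s + 2) c))"
proof -
  have "1 \<le> s - 1" using s by simp
  then obtain K where K: "0 \<le> K" "\<And>m c n. fin m c \<Longrightarrow> nrm2 4 c \<le> 1 \<Longrightarrow>
     (\<Sum>k=1..n. (real k ^ (s - 1) * cmod (fc (F2 c) k))\<^sup>2) \<le> K * (nrm2 4 c * nrm2 (s - 1 + 3) c)"
    using sum_fc_F2 by blast
  have s3: "s - 1 + 3 = s + 2" using s by simp
  have "2 * (\<Sum>k\<in>A. (real k ^ s)\<^sup>2 * (c k \<bullet> vf m c k)) \<le>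
     - 2 * D * (\<Sum>k\<in>A. (real k ^ 4 - real k ^ 2) * (real k ^ s * cmod (c k))\<^sup>2)
     + 2 * sqrt (\<Sum>k\<in>A. (real k ^ (s + 2) * cmod (c k))\<^sup>2) * (sqrt K * sqrt (nrm2 4 c * nrm2 (s + 2) c))"
    if f: "fin m c" and n: "nrm2 4 c \<le> 1" and A: "A \<subseteq> {1..m}" for m c A
  proof -
    have fA: "finite A" using A finite_subset by blast
    have "(\<Sum>k\<in>A. (real k ^ s)\<^sup>2 * (c k \<bullet> vf m c k)) \<le>
       (\<Sum>k\<in>A. - D * ((real k ^ 4 - real k ^ 2) * (real k ^ s * cmod (c k))\<^sup>2)
         + (real k ^ (s + 2) * cmod (c k)) * (real k ^ (s - 1) * cmod (fc (F2 c) k)))"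
    proof (rule sum_mono)
      fix k assume "k \<in> A"
      then have k: "1 \<le> k" "k \<le> m" using A by auto
      have "(real k ^ s)\<^sup>2 * real k = real k ^ (s + 2) * real k ^ (s - 1)"
      proof -
        obtain r where "s = Suc r" using s by (cases s) auto
        then show ?thesis by (simp add: power_add power2_eq_square)
      qed
      note kk = this
      have "(real k ^ s)\<^sup>2 * (- D * (real k ^ 4 - real k ^ 2) * (cmod (c k))\<^sup>2 + real k * cmod (c k) * cmod (fc (F2 c) k)) =
        - D * ((real k ^ 4 - real k ^ 2) * (real k ^ s * cmod (c k))\<^sup>2)
         + (real k ^ (s + 2) * cmod (c k)) * (real k ^ (s - 1) * cmod (fc (F2 c) k))"
      proof -
        have "X * (- D * P * z\<^sup>2 + r * z * z') = - D * (P * (X * z\<^sup>2)) + (U * z) * (W * z')"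
          if "X * r = U * W" for X P r z z' U W :: real
        proof -
          have "(U * z) * (W * z') = (U * W) * (z * z')" by simp
          also have "\<dots> = (X * r) * (z * z')" by (simp only: that)
          finally have e: "(U * z) * (W * z') = (X * r) * (z * z')" .
          show ?thesis unfolding e by (simp add: algebra_simps)
        qed
        from this[OF kk] show ?thesis unfolding power_mult_distrib .
      qed
      then show "(real k ^ s)\<^sup>2 * (c k \<bullet> vf m c k) \<le> - D * ((real k ^ 4 - real k ^ 2) * (real k ^ s * cmod (c k))\<^sup>2)
         + (real k ^ (s + 2) * cmod (c k)) * (real k ^ (s - 1) * cmod (fc (F2 c) k))"
        using mult_left_mono[OF inner_vf[OF f k], of "(real k ^ s)\<^sup>2"] by simp
    qed
    also have "\<dots> = - D * (\<Sum>k\<in>A. (real k ^ 4 - real k ^ 2) * (real k ^ s * cmod (c k))\<^sup>2)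
       + (\<Sum>k\<in>A. (real k ^ (s + 2) * cmod (c k)) * (real k ^ (s - 1) * cmod (fc (F2 c) k)))"
      by (simp only: sum.distrib sum_distrib_left)
    also have "(\<Sum>k\<in>A. (real k ^ (s + 2) * cmod (c k)) * (real k ^ (s - 1) * cmod (fc (F2 c) k))) \<le>
       sqrt (\<Sum>k\<in>A. (real k ^ (s + 2) * cmod (c k))\<^sup>2) * sqrt (\<Sum>k\<in>A. (real k ^ (s - 1) * cmod (fc (F2 c) k))\<^sup>2)"
      unfolding real_sqrt_mult[symmetric] by (rule real_le_rsqrt[OF Cauchy_Schwarz_ineq_sum])
    also have "sqrt (\<Sum>k\<in>A. (real k ^ (s - 1) * cmod (fc (F2 c) k))\<^sup>2) \<le> sqrt K * sqrt (nrm2 4 c * nrm2 (s + 2) c)"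
    proof -
      have "(\<Sum>k\<in>A. (real k ^ (s - 1) * cmod (fc (F2 c) k))\<^sup>2) \<le> (\<Sum>k=1..m. (real k ^ (s - 1) * cmod (fc (F2 c) k))\<^sup>2)"
        by (rule sum_mono2) (use A in auto)
      also have "\<dots> \<le> K * (nrm2 4 c * nrm2 (s + 2) c)" using K(2)[OF f n, of m] unfolding s3 .
      finally show ?thesis unfolding real_sqrt_mult[symmetric] by (rule real_sqrt_le_mono)
    qed
    finally show ?thesis by (simp add: mult_left_mono sum_nonneg)
  qed
  then show ?thesis using K(1) by (intro exI[of _ "sqrt K"]) auto
qed

text \<open>The square of mode 1 has no component at frequency 1 and gives p0 / 4 * (c 1)^2 at
  frequency 2; modes 1 and 2 interact into frequency 1. All other terms contain w or two factors
  from the higher modes at frequency 1, and at least one such factor at frequency 2, hence the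
  powers of y in the errors.\<close>

lemma fc_F2_modes:
  "\<exists>C\<ge>0. \<forall>m c. 2 \<le> m \<longrightarrow> fin m c \<longrightarrow> nrm2 4 c \<le> 1 \<longrightarrow>
    (let a = cmod (c 1); y = sqrt (nrm2 6 (drop1 c)); M = sqrt (nrm2 4 c) in
      cmod (fc (F2 c) 1 - (of_real (p0 / 2) - 3 * \<i> * of_real (p1 * hbar\<^sup>2)) * (cnj (c 1) * c 2)) \<le> C * (a\<^sup>2 * y + y\<^sup>2) \<and>
      cmod (fc (F2 c) 2 - of_real (p0 / 4) * (c 1)\<^sup>2) \<le> C * (M * y))"
proof -
  have "continuous_on {- (4 * (hbar + 2))..4 * (hbar + 2)} R" by (rule smooth_fun_continuous[OF smooth_R])
  then obtain Q0 where Q0: "\<forall>z\<in>R ` {- (4 * (hbar + 2))..4 * (hbar + 2)}. \<bar>z\<bar> \<le> Q0"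
    using compact_imp_bounded[OF compact_continuous_image] bounded_real by (metis compact_Icc)
  define Q where "Q = (hbar + 2) ^ 4 * \<bar>Q0\<bar>"
  have Q: "0 \<le> Q" unfolding Q_def using hbar by simp
  \<comment> \<open>Chosen generously; only nonnegativity and the inequality \<open>SC\<close> below
    are used.\<close>
  define C where "C = 10000 * (p0 + p1 * hbar\<^sup>2 + p1 * hbar + p1 + Q)"
  have C: "0 \<le> C" unfolding C_def using p0 p1 hbar Q by simp
  have "cmod (fc (F2 c) 1 - (of_real (p0 / 2) - 3 * \<i> * of_real (p1 * hbar\<^sup>2)) * (cnj (c 1) * c 2)) \<le> C * (a\<^sup>2 * y + y\<^sup>2) \<and>
      cmod (fc (F2 c) 2 - of_real (p0 / 4) * (c 1)\<^sup>2) \<le> C * (M * y)"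
    if m: "2 \<le> m" and f: "fin m c" and n: "nrm2 4 c \<le> 1"
      and a: "a = cmod (c 1)" and y: "y = sqrt (nrm2 6 (drop1 c))" and M: "M = sqrt (nrm2 4 c)" for m c a y M
  proof -
    define A where "A = c 1"
    define v1 v' w where "v1 x = Re (A * cis x)" and "v' = fser (drop1 c)" and "w = fser (Ls c)" for x
    have fd: "fin m (drop1 c)" by (rule fin_drop1[OF f])
    have hd: "hseq s (drop1 c)" for s by (rule fin_hseq[OF fd])
    have n4: "nrm2 4 c = a\<^sup>2 + nrm2 4 (drop1 c)" using nrm2_drop1(1)[OF f] m a by simp
    have nn: "0 \<le> nrm2 s (drop1 c)" for s by (rule nrm2_nonneg[OF hd])
    have bas: "0 \<le> a" "0 \<le> y" "0 \<le> M" "M \<le> 1" using a y M n nn n4 by auto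
    have aM: "a \<le> M" unfolding M using n4 nn[of 4] bas by (intro real_le_rsqrt) simp
    have sq2: "sqrt 2 \<le> 2" by (rule real_le_lsqrt) auto
    have le2: "sqrt (2 * u) \<le> 2 * z" if "u \<le> z\<^sup>2" "0 \<le> z" for u z :: real
    proof (rule real_le_lsqrt)
      have "2 * u \<le> 4 * z\<^sup>2" using that zero_le_power2[of z] by linarith
      then show "2 * u \<le> (2 * z)\<^sup>2" by (simp only: power_mult_distrib) simp
    qed (use that in auto)
    have y2: "y\<^sup>2 = nrm2 6 (drop1 c)" and M2: "M\<^sup>2 = nrm2 4 c" unfolding y M using nn n4 by auto
    have v'y: "\<bar>v' x\<bar> \<le> 2 * y" and v'M: "\<bar>v' x\<bar> \<le> 2 * M" and wy: "\<bar>w x\<bar> \<le> 2 * y" and wM: "\<bar>w x\<bar> \<le> 2 * M" for x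
    proof -
      have 1: "nrm2 1 (drop1 c) \<le> nrm2 4 (drop1 c)" "nrm2 4 (drop1 c) \<le> nrm2 6 (drop1 c)"
        by (rule nrm2_mono[OF hd]; simp)+
      have 2: "nrm2 4 (drop1 c) \<le> M\<^sup>2" unfolding M2 n4 by simp
      show "\<bar>v' x\<bar> \<le> 2 * y" "\<bar>v' x\<bar> \<le> 2 * M" unfolding v'_def
        by (rule order_trans[OF fin_fser_sup[OF fd]], rule le2; use 1 2 y2 bas in linarith)+
      show "\<bar>w x\<bar> \<le> 2 * y" "\<bar>w x\<bar> \<le> 2 * M" unfolding w_def
        by (rule order_trans[OF fin_fser_Ls_sup[OF f]], rule le2; use 1 2 y2 bas in linarith)+
    qed
    have v1a: "\<bar>v1 x\<bar> \<le> a" for x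
      using abs_Re_le_cmod[of "A * cis x"] by (simp add: v1_def a A_def norm_mult)
    define v where "v x = v1 x + v' x" for x
    have vf: "fser c x = v x" for x
      unfolding v_def v1_def v'_def A_def by (rule fser_split1[OF f])
    have vM: "\<bar>v x\<bar> \<le> 3 * M" for x
      using v1a[of x] v'M[of x] aM unfolding v_def by linarith
    \<comment> \<open>Collects what is at least cubic in v and w, together with the w^2 part. Each
      term has a factor w and is therefore small with y.\<close>
    define Rem where "Rem x = p1 / 3 * ((3 * hbar * (v x * v x) + v x * v x * v x) * w x) + (hbar + v x) ^ 4 * R ((hbar + v x) * w x) * (w x * w x)" for x
    have F2: "F2 c x = p0 / 2 * (v1 x * v1 x) + p0 * (v1 x * v' x) + p0 / 2 * (v' x * v' x) + p1 * hbar\<^sup>2 * (v1 x * w x)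
        + p1 * hbar\<^sup>2 * (v' x * w x) + Rem x" for x
    proof -
      have e: "F2 c x = p0 / 2 * (v x * v x) + p1 * hbar\<^sup>2 * (v x * w x) + Rem x"
        unfolding F2_def G2_def vf Rem_def w_def[symmetric]
        by (simp add: power4_eq_xxxx algebra_simps)
      show ?thesis unfolding e v_def by (simp add: algebra_simps)
    qed
    have cv1: "continuous_on UNIV v1" unfolding v1_def by (intro continuous_intros)
    have cv': "continuous_on UNIV v'" unfolding v'_def by (rule sper_continuous[OF fin_fser_sper[OF fd]])
    have cw: "continuous_on UNIV w" unfolding w_def by (rule sper_continuous[OF fin_fser_sper[OF fin_Ls[OF f]]])
    have cv: "continuous_on UNIV v" unfolding v_def by (intro continuous_intros cv1 cv')
    have cR: "continuous_on UNIV Rem" unfolding Rem_def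
      by (intro continuous_intros cv cw continuous_on_compose2[OF smooth_fun_continuous[OF smooth_R, of UNIV]]) auto
    have fcF2: "fc (F2 c) k = of_real (p0 / 2) * fc (\<lambda>x. v1 x * v1 x) k + of_real p0 * fc (\<lambda>x. v1 x * v' x) k + of_real (p0 / 2) * fc (\<lambda>x. v' x * v' x) k
       + of_real (p1 * hbar\<^sup>2) * fc (\<lambda>x. v1 x * w x) k + of_real (p1 * hbar\<^sup>2) * fc (\<lambda>x. v' x * w x) k + fc Rem k" for k
      unfolding F2 fc_cmult[symmetric]
      by (subst fc_add_cont[symmetric], (intro continuous_intros cv1 cv' cw cR)+)+ (simp add: F2[abs_def])
    have fv1: "fc v1 k = (if k = 1 then A else 0)" for k
      using Re_mult_cis_fourier[of 1 A k] unfolding v1_def by simp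
    have fv': "fc v' k = drop1 c k" and fw: "fc w k = Ls c k" for k
      unfolding v'_def w_def using fc_fser_fin[OF fd] fc_fser_fin[OF fin_Ls[OF f]] by auto
    have mm: "fc (\<lambda>x. v1 x * g x) (Suc k) = (A * fc g k + cnj A * fc g (k + 2)) / 2" if "continuous_on UNIV g" for g k
      unfolding v1_def by (rule fc_mode_mult[OF circle_integrable[OF that]])
    have d0: "drop1 c 0 = 0" by (rule finD0[OF fd])
    have m11: "fc (\<lambda>x. v1 x * v1 x) 1 = 0" and m12: "fc (\<lambda>x. v1 x * v1 x) 2 = A\<^sup>2 / 2"
      using mm[OF cv1, of 0] mm[OF cv1, of 1] by (simp_all add: fv1 numeral_2_eq_2 power2_eq_square)
    have m1v: "fc (\<lambda>x. v1 x * v' x) 1 = cnj A * c 2 / 2"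
      using mm[OF cv', of 0] by (simp add: fv' drop1_def finD0[OF f] numeral_2_eq_2)
    \<comment> \<open>The factor - 6 \<i> is 2 \<i> + (2 \<i>)^3, the symbol of \<partial> +
      \<partial>^3 at frequency 2.\<close>
    have m1w: "fc (\<lambda>x. v1 x * w x) 1 = cnj A * (- 6 * \<i> * c 2) / 2"
      using mm[OF cw, of 0] by (simp add: fw Ls_def power3_eq_cube numeral_2_eq_2[symmetric] algebra_simps)
    have prod: "cmod (fc (\<lambda>x. g x * h x) k) \<le> 2 * (X * Y)" if "continuous_on UNIV g" "continuous_on UNIV h"
      "\<And>x. \<bar>g x\<bar> \<le> X" "\<And>x. \<bar>h x\<bar> \<le> Y" "0 \<le> X" for g h k X Y
      by (rule fc_bound_cont) (use that in \<open>auto intro!: continuous_intros mult_mono simp: abs_mult\<close>)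
    have vsq: "\<bar>v x\<bar> \<le> 3" for x using vM[of x] bas by linarith
    have hwR: "\<bar>(hbar + v x) ^ 4 * R ((hbar + v x) * w x)\<bar> \<le> 5 ^ 4 * Q" for x
    proof -
      have hv: "\<bar>hbar + v x\<bar> \<le> hbar + 3" using vsq[of x] hbar by linarith
      have "\<bar>w x\<bar> \<le> 2" using wM[of x] bas by linarith
      then have "\<bar>(hbar + v x) * w x\<bar> \<le> (hbar + 3) * 2" unfolding abs_mult using hv hbar by (intro mult_mono) auto
      then have "\<bar>R ((hbar + v x) * w x)\<bar> \<le> \<bar>Q0\<bar>" using Q0 hbar by (auto simp: abs_le_iff intro!: order_trans[OF _ abs_ge_self])
      moreover have "\<bar>hbar + v x\<bar> ^ 4 \<le> (5 * (hbar + 2)) ^ 4" using hv hbar by (intro power_mono) auto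
      ultimately have "\<bar>hbar + v x\<bar> ^ 4 * \<bar>R ((hbar + v x) * w x)\<bar> \<le> (5 * (hbar + 2)) ^ 4 * \<bar>Q0\<bar>" by (intro mult_mono) auto
      then show ?thesis unfolding abs_mult power_abs Q_def power_mult_distrib mult.assoc .
    qed
    define S where "S = 2500 * (p1 * hbar + p1 + Q)"
    have Rb: "\<bar>Rem x\<bar> \<le> (p1 * hbar + p1) * (\<bar>v x * v x\<bar> * \<bar>w x\<bar>) + 5 ^ 4 * Q * (\<bar>w x\<bar> * \<bar>w x\<bar>)" for x
    proof -
      have "\<bar>3 * hbar * (v x * v x) + v x * v x * v x\<bar> = \<bar>3 * hbar + v x\<bar> * \<bar>v x * v x\<bar>"
        by (simp only: abs_mult[symmetric]) (simp only: algebra_simps)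
      also have "\<dots> \<le> (3 * hbar + 3) * \<bar>v x * v x\<bar>"
        using vsq[of x] hbar by (intro mult_right_mono) auto
      finally have "p1 / 3 * (\<bar>3 * hbar * (v x * v x) + v x * v x * v x\<bar> * \<bar>w x\<bar>) \<le> p1 / 3 * (((3 * hbar + 3) * \<bar>v x * v x\<bar>) * \<bar>w x\<bar>)"
        using p1 by (intro mult_left_mono mult_right_mono) auto
      also have "\<dots> = (p1 * hbar + p1) * (\<bar>v x * v x\<bar> * \<bar>w x\<bar>)" by (simp add: algebra_simps)
      finally have 1: "\<bar>p1 / 3 * ((3 * hbar * (v x * v x) + v x * v x * v x) * w x)\<bar> \<le> (p1 * hbar + p1) * (\<bar>v x * v x\<bar> * \<bar>w x\<bar>)"
        using p1 by (simp only: abs_mult[of "p1 / 3"] abs_mult[of _ "w x"])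
      have 2: "\<bar>(hbar + v x) ^ 4 * R ((hbar + v x) * w x) * (w x * w x)\<bar> \<le> 5 ^ 4 * Q * (\<bar>w x\<bar> * \<bar>w x\<bar>)"
        unfolding abs_mult[of _ "w x * w x"] abs_mult[of "w x" "w x"] by (rule mult_right_mono[OF hwR]) auto
      show ?thesis unfolding Rem_def by (rule order_trans[OF abs_triangle_ineq add_mono[OF 1 2]])
    qed
    have pq: "0 \<le> p1 * hbar + p1" "0 \<le> 5 ^ 4 * Q" using p1 hbar Q by auto
    have pq': "0 \<le> hbar * p1" "0 \<le> p1" using p1 hbar by auto
    have R1: "\<bar>Rem x\<bar> \<le> S * (a\<^sup>2 * y + y\<^sup>2)" for x
    proof -
      have "\<bar>v x * v x\<bar> \<le> 2 * (\<bar>v1 x\<bar> * \<bar>v1 x\<bar>) + 2 * (\<bar>v' x\<bar> * \<bar>v' x\<bar>)"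
      proof -
        have "\<bar>v x * v x\<bar> = (v1 x + v' x)\<^sup>2" by (simp add: v_def power2_eq_square)
        also have "\<dots> \<le> 2 * (v1 x)\<^sup>2 + 2 * (v' x)\<^sup>2"
          using sum_squares_bound[of "v1 x" "v' x"] by (simp add: power2_sum)
        finally show ?thesis by (simp add: power2_eq_square)
      qed
      also have "\<dots> \<le> 2 * (a * a) + 2 * ((2 * M) * (2 * y))"
        using v1a[of x] v'y[of x] v'M[of x] bas by (intro add_mono mult_left_mono mult_mono) auto
      also have "\<dots> \<le> 2 * (a * a) + 8 * y" using bas by (simp add: mult_left_le_one_le)
      finally have "\<bar>v x * v x\<bar> * \<bar>w x\<bar> \<le> (2 * (a * a) + 8 * y) * (2 * y)"
        using wy[of x] bas by (intro mult_mono) auto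
      also have "\<dots> \<le> 16 * (a\<^sup>2 * y + y\<^sup>2)" using bas by (simp add: power2_eq_square algebra_simps)
      finally have 1: "\<bar>v x * v x\<bar> * \<bar>w x\<bar> \<le> 16 * (a\<^sup>2 * y + y\<^sup>2)" .
      have "\<bar>w x\<bar> * \<bar>w x\<bar> \<le> (2 * y) * (2 * y)" using wy[of x] bas by (intro mult_mono) auto
      also have "\<dots> \<le> 4 * (a\<^sup>2 * y + y\<^sup>2)" using bas by (simp add: power2_eq_square)
      finally have 2: "\<bar>w x\<bar> * \<bar>w x\<bar> \<le> 4 * (a\<^sup>2 * y + y\<^sup>2)" .
      have "\<bar>Rem x\<bar> \<le> (p1 * hbar + p1) * (16 * (a\<^sup>2 * y + y\<^sup>2)) + 5 ^ 4 * Q * (4 * (a\<^sup>2 * y + y\<^sup>2))"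
        by (rule order_trans[OF Rb]) (intro add_mono mult_left_mono 1 2 pq)
      also have "\<dots> = (16 * (p1 * hbar + p1) + 2500 * Q) * (a\<^sup>2 * y + y\<^sup>2)" by (simp add: algebra_simps)
      also have "\<dots> \<le> S * (a\<^sup>2 * y + y\<^sup>2)"
        unfolding S_def using pq pq' Q bas by (intro mult_right_mono) (auto simp: algebra_simps)
      finally show ?thesis .
    qed
    have R2: "\<bar>Rem x\<bar> \<le> S * (M * y)" for x
    proof -
      have "\<bar>v x * v x\<bar> * \<bar>w x\<bar> \<le> ((3 * M) * 3) * (2 * y)"
        unfolding abs_mult using vM[of x] vsq[of x] wy[of x] bas by (intro mult_mono) auto
      then have 1: "\<bar>v x * v x\<bar> * \<bar>w x\<bar> \<le> 18 * (M * y)" by simp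
      have "\<bar>w x\<bar> * \<bar>w x\<bar> \<le> (2 * M) * (2 * y)" using wy[of x] wM[of x] bas by (intro mult_mono) auto
      then have 2: "\<bar>w x\<bar> * \<bar>w x\<bar> \<le> 4 * (M * y)" by simp
      have "\<bar>Rem x\<bar> \<le> (p1 * hbar + p1) * (18 * (M * y)) + 5 ^ 4 * Q * (4 * (M * y))"
        by (rule order_trans[OF Rb]) (intro add_mono mult_left_mono 1 2 pq)
      also have "\<dots> = (18 * (p1 * hbar + p1) + 2500 * Q) * (M * y)" by (simp add: algebra_simps)
      also have "\<dots> \<le> S * (M * y)"
        unfolding S_def using pq pq' Q bas by (intro mult_right_mono) (auto simp: algebra_simps)
      finally show ?thesis .
    qed
    have SC: "8 * p0 + 16 * (p1 * hbar\<^sup>2) + 2 * S \<le> C"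
      unfolding S_def C_def using p0 p1 hbar Q by (simp add: algebra_simps)
    have nm: "cmod (of_real q * z) \<le> q * X" if "cmod z \<le> X" "0 \<le> q" for q X z
      using that by (simp add: norm_mult mult_left_mono)
    have ph: "0 \<le> p1 * hbar\<^sup>2" using p1 by simp
    have S0: "0 \<le> S" unfolding S_def using pq Q by simp
    show ?thesis
    proof
      define T where "T = a\<^sup>2 * y + y\<^sup>2"
      have T: "y * y \<le> T" "0 \<le> T" unfolding T_def using bas by (auto simp: power2_eq_square)
      have 1: "cmod (of_real (p0 / 2) * fc (\<lambda>x. v' x * v' x) 1) \<le> p0 / 2 * (2 * ((2 * y) * (2 * y)))"
        by (intro nm prod cv' v'y) (use bas p0 in auto)
      have 2: "cmod (of_real (p1 * hbar\<^sup>2) * fc (\<lambda>x. v' x * w x) 1) \<le> p1 * hbar\<^sup>2 * (2 * ((2 * y) * (2 * y)))"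
        by (intro nm prod cv' cw v'y wy) (use bas p1 in auto)
      have 3: "cmod (fc Rem 1) \<le> 2 * (S * T)" unfolding T_def by (rule fc_bound_cont[OF cR R1])
      have "fc (F2 c) 1 - (of_real (p0 / 2) - 3 * \<i> * of_real (p1 * hbar\<^sup>2)) * (cnj (c 1) * c 2) =
        of_real (p0 / 2) * fc (\<lambda>x. v' x * v' x) 1 + of_real (p1 * hbar\<^sup>2) * fc (\<lambda>x. v' x * w x) 1 + fc Rem 1"
        unfolding fcF2[of 1] m11 m1v m1w A_def by (simp add: algebra_simps)
      then have "cmod (fc (F2 c) 1 - (of_real (p0 / 2) - 3 * \<i> * of_real (p1 * hbar\<^sup>2)) * (cnj (c 1) * c 2)) \<le>
         p0 / 2 * (2 * ((2 * y) * (2 * y))) + p1 * hbar\<^sup>2 * (2 * ((2 * y) * (2 * y))) + 2 * (S * T)"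
        by (simp only:) (intro norm_triangle_mono 1 2 3)
      also have "\<dots> = (4 * p0 + 8 * (p1 * hbar\<^sup>2)) * (y * y) + 2 * S * T" by (simp add: algebra_simps)
      also have "\<dots> \<le> (8 * p0 + 16 * (p1 * hbar\<^sup>2)) * T + 2 * S * T"
        using T p0 p1 ph bas S0 by (intro add_mono mult_mono) auto
      also have "\<dots> = (8 * p0 + 16 * (p1 * hbar\<^sup>2) + 2 * S) * T" by (simp add: algebra_simps)
      also have "\<dots> \<le> C * T" by (rule mult_right_mono[OF SC T(2)])
      finally show "cmod (fc (F2 c) 1 - (of_real (p0 / 2) - 3 * \<i> * of_real (p1 * hbar\<^sup>2)) * (cnj (c 1) * c 2)) \<le> C * (a\<^sup>2 * y + y\<^sup>2)"
        unfolding T_def .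
    next
      have My: "0 \<le> M * y" using bas by simp
      have v1M: "\<bar>v1 x\<bar> \<le> M" for x using v1a[of x] aM by linarith
      have 1: "cmod (of_real p0 * fc (\<lambda>x. v1 x * v' x) 2) \<le> p0 * (2 * (M * (2 * y)))"
        by (intro nm prod cv' cv1 v'y v1M) (use bas p0 in auto)
      have 2: "cmod (of_real (p0 / 2) * fc (\<lambda>x. v' x * v' x) 2) \<le> p0 / 2 * (2 * ((2 * M) * (2 * y)))"
        by (intro nm prod cv' v'y v'M) (use bas p0 in auto)
      have 3: "cmod (of_real (p1 * hbar\<^sup>2) * fc (\<lambda>x. v1 x * w x) 2) \<le> p1 * hbar\<^sup>2 * (2 * (M * (2 * y)))"
        by (intro nm prod cv1 cw v1M wy) (use bas p1 in auto)
      have 4: "cmod (of_real (p1 * hbar\<^sup>2) * fc (\<lambda>x. v' x * w x) 2) \<le> p1 * hbar\<^sup>2 * (2 * ((2 * M) * (2 * y)))"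
        by (intro nm prod cv' cw v'M wy) (use bas p1 in auto)
      have 5: "cmod (fc Rem 2) \<le> 2 * (S * (M * y))" by (rule fc_bound_cont[OF cR R2])
      have "fc (F2 c) 2 - of_real (p0 / 4) * (c 1)\<^sup>2 = of_real p0 * fc (\<lambda>x. v1 x * v' x) 2 + of_real (p0 / 2) * fc (\<lambda>x. v' x * v' x) 2
        + of_real (p1 * hbar\<^sup>2) * fc (\<lambda>x. v1 x * w x) 2 + of_real (p1 * hbar\<^sup>2) * fc (\<lambda>x. v' x * w x) 2 + fc Rem 2"
        unfolding fcF2[of 2] m12 A_def by (simp add: algebra_simps)
      then have "cmod (fc (F2 c) 2 - of_real (p0 / 4) * (c 1)\<^sup>2) \<le> p0 * (2 * (M * (2 * y))) + p0 / 2 * (2 * ((2 * M) * (2 * y)))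
         + p1 * hbar\<^sup>2 * (2 * (M * (2 * y))) + p1 * hbar\<^sup>2 * (2 * ((2 * M) * (2 * y))) + 2 * (S * (M * y))"
        by (simp only:) (intro norm_triangle_mono 1 2 3 4 5)
      also have "\<dots> = (8 * p0 + 12 * (p1 * hbar\<^sup>2) + 2 * S) * (M * y)" by (simp add: algebra_simps)
      also have "\<dots> \<le> C * (M * y)"
        using SC ph My by (intro mult_right_mono) auto
      finally show "cmod (fc (F2 c) 2 - of_real (p0 / 4) * (c 1)\<^sup>2) \<le> C * (M * y)" .
    qed
  qed
  then show ?thesis using C by (intro exI[of _ C]) (auto simp: Let_def)
qed

end

subsection \<open>The Lyapunov function\<close>

text \<open>At the first time the level \<epsilon> is reached, the bound \<epsilon> holds up to that
  time, so the value is at most \<rho> < \<epsilon>, a contradiction.\<close>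

lemma continuous_bootstrap:
  fixes f :: "real \<Rightarrow> real"
  assumes c: "continuous_on {0..} f" and r: "\<rho> < \<epsilon>" "f 0 \<le> \<epsilon>"
    and imp: "\<And>t. 0 \<le> t \<Longrightarrow> (\<And>s. 0 \<le> s \<Longrightarrow> s \<le> t \<Longrightarrow> f s \<le> \<epsilon>) \<Longrightarrow> f t \<le> \<rho>"
    and t: "0 \<le> t"
  shows "f t \<le> \<rho>"
proof (rule ccontr)
  assume nt: "\<not> f t \<le> \<rho>"
  then obtain s0 where s0: "0 \<le> s0" "\<epsilon> < f s0"
    using imp[OF t] by force
  have f0: "f 0 \<le> \<rho>" by (rule imp) (use r in auto)
  let ?S = "{s \<in> {0..s0}. f s = \<epsilon>}"
  have c0: "continuous_on {0..a} f" for a by (rule continuous_on_subset[OF c]) auto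
  have iv: "\<exists>s\<ge>0. s \<le> a \<and> f s = \<epsilon>" if "0 \<le> a" "\<epsilon> < f a" for a
    using IVT'[of f 0 \<epsilon> a] that f0 r c0[of a] by force
  have "closed ?S"
    by (rule continuous_closed_preimage_constant[OF c0]) simp
  moreover have "?S \<noteq> {}" using iv[OF s0] by auto
  moreover have "bdd_below ?S" by (auto intro!: bdd_belowI[of _ 0])
  ultimately have I: "Inf ?S \<in> ?S" by (intro closed_contains_Inf)
  define s1 where "s1 = Inf ?S"
  have s1: "0 \<le> s1" "s1 \<le> s0" "f s1 = \<epsilon>" using I by (auto simp: s1_def)
  have "f s \<le> \<epsilon>" if s: "0 \<le> s" "s \<le> s1" for s
  proof (rule ccontr)
    assume "\<not> f s \<le> \<epsilon>"
    then obtain s' where s': "0 \<le> s'" "s' \<le> s" "f s' = \<epsilon>" using iv[of s] s by auto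
    then have "s' \<in> ?S" using s s1 by auto
    then have "s1 \<le> s'" unfolding s1_def by (rule cInf_lower) (auto intro!: bdd_belowI[of _ 0])
    then have "s = s1" using s' s by auto
    then show False using \<open>\<not> f s \<le> \<epsilon>\<close> s1 by simp
  qed
  then have "f s1 \<le> \<rho>" using imp s1 by blast
  then show False using s1 r by simp
qed

lemma cmod_sq_DERIV:
  assumes "(z has_vector_derivative z') (at t within S)"
  shows "((\<lambda>t. (cmod (z t))\<^sup>2) has_real_derivative 2 * (z t \<bullet> z')) (at t within S)"
proof -
  have "((\<lambda>t. z t \<bullet> z t) has_vector_derivative (z t \<bullet> z' + z' \<bullet> z t)) (at t within S)"
    by (rule bounded_bilinear.has_vector_derivative[OF bounded_bilinear_inner assms assms])
  then show ?thesis
    by (simp add: has_real_derivative_iff_has_vector_derivative inner_commute dot_square_norm)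
qed

lemma inner_conv_Re: "z \<bullet> w = Re (cnj z * w)"
  by (simp add: inner_complex_def)

context film
begin

text \<open>\<kappa> is - 2 \<i> times the resonant coefficient p0 / 2 - 3 \<i> p1 hbar^2 of
  \<open>fc_F2_modes\<close>, and dd is the damping rate D (2^4 - 2^2) of mode 2.\<close>

definition \<kappa> :: complex where "\<kappa> = - \<i> * of_real p0 - 6 * of_real (p1 * hbar\<^sup>2)"
definition dd :: real where "dd = 12 * D"

text \<open>With \<open>a\<^sub>2' \<approx> - dd * a\<^sub>2 - \<i> p0/2 * a\<^sub>1\<^sup>2\<close> and the coupling \<open>Re (\<kappa> a\<^sub>2 (cnj a\<^sub>1)\<^sup>2)\<close> in \<open>(|a\<^sub>1|\<^sup>2)'\<close>, the correction
  term trades the coupling for \<open>- p0\<^sup>2 / (2 dd) * |a\<^sub>1|\<^sup>4\<close>.\<close>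

definition Gf :: "(nat \<Rightarrow> complex) \<Rightarrow> real" where
  "Gf c = (cmod (c 1))\<^sup>2 + Re (\<kappa> * (c 2 * (cnj (c 1))\<^sup>2)) / dd"

definition Gdot :: "nat \<Rightarrow> (nat \<Rightarrow> complex) \<Rightarrow> real" where
  "Gdot m c = 2 * (c 1 \<bullet> vf m c 1) +
     Re (\<kappa> * (vf m c 2 * (cnj (c 1))\<^sup>2 + 2 * c 2 * cnj (c 1) * cnj (vf m c 1))) / dd"

lemma dd_pos: "0 < dd" unfolding dd_def using D_pos by simp

lemma Gf_DERIV:
  assumes "((\<lambda>t. c t 1) has_vector_derivative vf m (c t) 1) (at t within S)"
    and "((\<lambda>t. c t 2) has_vector_derivative vf m (c t) 2) (at t within S)"
  shows "((\<lambda>t. Gf (c t)) has_real_derivative Gdot m (c t)) (at t within S)"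
proof -
  have 1: "((\<lambda>t. cnj (c t 1)) has_vector_derivative cnj (vf m (c t) 1)) (at t within S)"
    by (rule bounded_linear.has_vector_derivative[OF bounded_linear_cnj assms(1)])
  have "((\<lambda>t. c t 2 * (cnj (c t 1) * cnj (c t 1))) has_vector_derivative
     (c t 2 * (cnj (c t 1) * cnj (vf m (c t) 1) + cnj (vf m (c t) 1) * cnj (c t 1)) + vf m (c t) 2 * (cnj (c t 1) * cnj (c t 1)))) (at t within S)"
    by (intro has_vector_derivative_mult assms 1)
  from bounded_linear.has_vector_derivative[OF bounded_linear_Re has_vector_derivative_mult_right[OF this, of \<kappa>]]
  have "((\<lambda>t. Re (\<kappa> * (c t 2 * (cnj (c t 1))\<^sup>2))) has_real_derivative
     Re (\<kappa> * (vf m (c t) 2 * (cnj (c t 1))\<^sup>2 + 2 * c t 2 * cnj (c t 1) * cnj (vf m (c t) 1)))) (at t within S)"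
    by (simp add: has_real_derivative_iff_has_vector_derivative power2_eq_square algebra_simps)
  from DERIV_add[OF cmod_sq_DERIV[OF assms(1)] DERIV_cdivide[OF this, of dd]]
  show ?thesis unfolding Gf_def Gdot_def .
qed

text \<open>After the exact cancellations only terms with E1, with E2 or with a^2 b^2 remain.
  Because a and b are at most M and a^2 y \<le> a^4 + y^2, each of them is at most a constant times
  M (a^4 + y^2).\<close>

lemma Gdot_bound:
  "\<exists>C\<ge>0. \<forall>m c. 2 \<le> m \<longrightarrow> fin m c \<longrightarrow> nrm2 4 c \<le> 1 \<longrightarrow>
     Gdot m c \<le> - (p0\<^sup>2 / (2 * dd)) * (cmod (c 1)) ^ 4
       + C * sqrt (nrm2 4 c) * ((cmod (c 1)) ^ 4 + nrm2 6 (drop1 c))"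
proof -
  obtain C0 where C0: "0 \<le> C0" and modes: "\<And>m c. 2 \<le> m \<Longrightarrow> fin m c \<Longrightarrow> nrm2 4 c \<le> 1 \<Longrightarrow>
    (let a = cmod (c 1); y = sqrt (nrm2 6 (drop1 c)); M = sqrt (nrm2 4 c) in
      cmod (fc (F2 c) 1 - (of_real (p0 / 2) - 3 * \<i> * of_real (p1 * hbar\<^sup>2)) * (cnj (c 1) * c 2)) \<le> C0 * (a\<^sup>2 * y + y\<^sup>2) \<and>
      cmod (fc (F2 c) 2 - of_real (p0 / 4) * (c 1)\<^sup>2) \<le> C0 * (M * y))"
    using fc_F2_modes by blast
  define C where "C = 4 * C0 + cmod \<kappa> / dd * (2 * C0 + cmod \<kappa> + 4 * C0)"
  have C: "0 \<le> C" unfolding C_def using C0 dd_pos by (intro add_nonneg_nonneg mult_nonneg_nonneg) auto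
  have "Gdot m c \<le> - (p0\<^sup>2 / (2 * dd)) * (cmod (c 1)) ^ 4
       + C * sqrt (nrm2 4 c) * ((cmod (c 1)) ^ 4 + nrm2 6 (drop1 c))"
    if m: "2 \<le> m" and f: "fin m c" and n: "nrm2 4 c \<le> 1" for m c
  proof -
    define A B where "A = c 1" and "B = c 2"
    define a b y M where "a = cmod A" and "b = cmod B" and "y = sqrt (nrm2 6 (drop1 c))" and "M = sqrt (nrm2 4 c)"
    define E1 E2 where "E1 = fc (F2 c) 1 - (of_real (p0 / 2) - 3 * \<i> * of_real (p1 * hbar\<^sup>2)) * (cnj A * B)"
      and "E2 = fc (F2 c) 2 - of_real (p0 / 4) * A\<^sup>2"
    have E: "cmod E1 \<le> C0 * (a\<^sup>2 * y + y\<^sup>2)" "cmod E2 \<le> C0 * (M * y)"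
      using modes[OF m f n] unfolding Let_def E1_def E2_def A_def B_def a_def y_def M_def by auto
    have fd: "fin m (drop1 c)" by (rule fin_drop1[OF f])
    have nn: "0 \<le> nrm2 s (drop1 c)" for s by (rule nrm2_nonneg[OF fin_hseq[OF fd]])
    have n4: "nrm2 4 c = a\<^sup>2 + nrm2 4 (drop1 c)"
      using nrm2_drop1(1)[OF f] m by (simp add: a_def A_def)
    have bas: "0 \<le> a" "0 \<le> b" "0 \<le> y" "0 \<le> M" "M \<le> 1"
      unfolding a_def b_def y_def M_def using nn n n4 by auto
    have aM: "a \<le> M" unfolding M_def using n4 nn[of 4] by (intro real_le_rsqrt) simp
    have bs: "b\<^sup>2 \<le> nrm2 s (drop1 c)" for s
    proof -
      have "1 * b \<le> 2 ^ s * b" using bas by (intro mult_right_mono) auto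
      then have "b\<^sup>2 \<le> (2 ^ s * b)\<^sup>2" using bas by (intro power_mono) auto
      also have "\<dots> \<le> nrm2 s (drop1 c)"
        unfolding nrm2_drop1(2)[OF f, of s, simplified, OF le_trans[OF _ m], simplified]
        using member_le_sum[of 2 "{2..m}" "\<lambda>k. (real k ^ s * cmod (c k))\<^sup>2"] m by (simp add: b_def B_def)
      finally show ?thesis .
    qed
    have bley: "b \<le> y" unfolding y_def by (intro real_le_rsqrt bs)
    have bM: "b \<le> M" unfolding M_def using bs[of 4] n4 by (intro real_le_rsqrt) (smt (verit) zero_le_power2)
    have cA: "c (Suc 0) = A" by (simp add: A_def)
    have v1: "vf m c 1 = - \<i> * of_real (hbar * p0) * A + \<kappa> / 2 * (cnj A * B) - \<i> * E1"
      using m unfolding vf_def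
      by (simp add: fc_Fl[OF f] Ls_def power3_eq_cube E1_def cA B_def[symmetric] \<kappa>_def algebra_simps add_divide_distrib diff_divide_distrib)
    have v2: "vf m c 2 = - 2 * \<i> * of_real (hbar * p0) * B - of_real dd * B - \<i> * of_real (p0 / 2) * A\<^sup>2 - 2 * \<i> * E2"
      using m unfolding vf_def
      by (simp add: fc_Fl[OF f] Ls_def power3_eq_cube E2_def cA B_def[symmetric] dd_def algebra_simps)
    define Z where "Z = - 2 * \<i> * E2 * (cnj A)\<^sup>2 + cnj \<kappa> * of_real (a\<^sup>2 * b\<^sup>2) + 2 * \<i> * B * cnj A * cnj E1"
    have a2: "of_real (a\<^sup>2) = A * cnj A" and b2: "of_real (b\<^sup>2) = B * cnj B"
      unfolding a_def b_def by (rule complex_norm_square)+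
    \<comment> \<open>The drift terms cancel: mode 2 rotates exactly twice as fast as mode 1, so B
      (cnj A)^2 is invariant under the rotation.\<close>
    have X: "vf m c 2 * (cnj A)\<^sup>2 + 2 * B * cnj A * cnj (vf m c 1) =
       - of_real dd * (B * (cnj A)\<^sup>2) - \<i> * of_real (p0 / 2) * of_real (a ^ 4) + Z"
    proof -
      have "of_real (a ^ 4) = (A * cnj A) * (A * cnj A)"
        unfolding a2[symmetric] by (simp add: power4_eq_xxxx power2_eq_square)
      then show ?thesis unfolding v1 v2 Z_def of_real_mult[of "a\<^sup>2"] a2 b2
        by (simp add: power2_eq_square algebra_simps)
    qed
    have R1: "2 * (A \<bullet> vf m c 1) = Re (\<kappa> * (B * (cnj A)\<^sup>2)) + 2 * Re (- \<i> * cnj A * E1)"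
    proof -
      have "cnj A * vf m c 1 = - \<i> * of_real (hbar * p0) * of_real (a\<^sup>2) + (\<kappa> * (B * (cnj A)\<^sup>2)) / 2 + (- \<i> * cnj A * E1)"
        unfolding v1 a2 by (simp add: power2_eq_square algebra_simps)
      then show ?thesis unfolding inner_conv_Re by simp
    qed
    have R2: "Re (\<kappa> * (vf m c 2 * (cnj A)\<^sup>2 + 2 * B * cnj A * cnj (vf m c 1))) =
       - dd * Re (\<kappa> * (B * (cnj A)\<^sup>2)) - p0\<^sup>2 / 2 * a ^ 4 + Re (\<kappa> * Z)"
    proof -
      have "\<kappa> * (- of_real dd * (B * (cnj A)\<^sup>2) - \<i> * of_real (p0 / 2) * of_real (a ^ 4) + Z) =
        of_real (- dd) * (\<kappa> * (B * (cnj A)\<^sup>2)) + of_real (a ^ 4) * (- \<i> * of_real (p0 / 2) * \<kappa>) + \<kappa> * Z"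
        by (simp add: algebra_simps)
      moreover have "Re (- \<i> * of_real (p0 / 2) * \<kappa>) = - p0\<^sup>2 / 2" by (simp add: \<kappa>_def power2_eq_square)
      ultimately show ?thesis unfolding X by simp
    qed
    \<comment> \<open>Division by dd makes the cubic term of the correction cancel the coupling in
      the derivative of |A|^2. What survives is quartic with a definite sign, because Re (- \<i> p0
      / 2 * \<kappa>) = - p0^2 / 2.\<close>
    have G: "Gdot m c = - (p0\<^sup>2 / (2 * dd)) * a ^ 4 + 2 * Re (- \<i> * cnj A * E1) + Re (\<kappa> * Z) / dd"
    proof -
      have gen: "W + e + (- dd * W - p0\<^sup>2 / 2 * t + z) / dd = - (p0\<^sup>2 / (2 * dd)) * t + e + z / dd" for W e t z
        using dd_pos by (simp add: field_simps)
      have "Gdot m c = 2 * (A \<bullet> vf m c 1) + Re (\<kappa> * (vf m c 2 * (cnj A)\<^sup>2 + 2 * B * cnj A * cnj (vf m c 1))) / dd"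
        by (simp only: Gdot_def A_def B_def)
      then show ?thesis unfolding R1 R2 gen .
    qed
    define T where "T = a ^ 4 + y\<^sup>2"
    have T: "0 \<le> T" unfolding T_def using bas by simp
    have a2y: "a\<^sup>2 * y \<le> T"
    proof -
      have "2 * a\<^sup>2 * y \<le> (a\<^sup>2)\<^sup>2 + y\<^sup>2" by (rule sum_squares_bound)
      moreover have "(a\<^sup>2)\<^sup>2 = a ^ 4" by simp
      moreover have "0 \<le> a\<^sup>2 * y" using bas by simp
      ultimately show ?thesis unfolding T_def by linarith
    qed
    have aE1: "a * cmod E1 \<le> 2 * C0 * (M * T)"
    proof -
      have "y\<^sup>2 \<le> T" unfolding T_def by simp
      from add_mono[OF a2y this] have "a\<^sup>2 * y + y\<^sup>2 \<le> 2 * T" by simp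
      then have "C0 * (a\<^sup>2 * y + y\<^sup>2) \<le> C0 * (2 * T)" using C0 by (intro mult_left_mono)
      then have "a * cmod E1 \<le> M * (C0 * (2 * T))" using E(1) aM bas by (intro mult_mono) auto
      then show ?thesis by (simp add: mult_ac)
    qed
    have E2a: "cmod E2 * a\<^sup>2 \<le> C0 * (M * T)"
    proof -
      have "cmod E2 * a\<^sup>2 \<le> (C0 * (M * y)) * a\<^sup>2" using E(2) by (intro mult_right_mono) auto
      also have "\<dots> = C0 * (M * (a\<^sup>2 * y))" by simp
      also have "\<dots> \<le> C0 * (M * T)" using a2y C0 bas by (intro mult_left_mono)
      finally show ?thesis .
    qed
    have ab: "a\<^sup>2 * b\<^sup>2 \<le> M * T"
    proof -
      have "a\<^sup>2 \<le> M * 1" unfolding power2_eq_square using aM bas by (intro mult_mono) auto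
      moreover have "b\<^sup>2 \<le> T" unfolding T_def by (rule order_trans[OF power_mono[OF bley bas(2)]]) simp
      ultimately show ?thesis using bas by (intro mult_mono) auto
    qed
    have "cmod Z \<le> 2 * (cmod E2 * a\<^sup>2) + cmod \<kappa> * (a\<^sup>2 * b\<^sup>2) + 2 * (b * (a * cmod E1))"
      unfolding Z_def
      by (intro norm_triangle_mono) (auto simp: norm_mult norm_power a_def b_def)
    also have "\<dots> \<le> 2 * (C0 * (M * T)) + cmod \<kappa> * (M * T) + 2 * (1 * (2 * C0 * (M * T)))"
    proof -
      have b1E: "b * (a * cmod E1) \<le> 1 * (2 * C0 * (M * T))"
        by (rule mult_mono[OF _ aE1]) (use bM bas in auto)
      show ?thesis by (intro add_mono mult_left_mono E2a ab b1E) auto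
    qed
    finally have Z: "cmod Z \<le> (2 * C0 + cmod \<kappa> + 4 * C0) * (M * T)" by (simp add: algebra_simps)
    have "Re (\<kappa> * Z) \<le> cmod \<kappa> * cmod Z" using complex_Re_le_cmod[of "\<kappa> * Z"] by (simp add: norm_mult)
    also have "\<dots> \<le> cmod \<kappa> * ((2 * C0 + cmod \<kappa> + 4 * C0) * (M * T))" using Z by (intro mult_left_mono) auto
    finally have "Re (\<kappa> * Z) / dd \<le> cmod \<kappa> * ((2 * C0 + cmod \<kappa> + 4 * C0) * (M * T)) / dd"
      using dd_pos by (intro divide_right_mono) auto
    also have "\<dots> = cmod \<kappa> / dd * (2 * C0 + cmod \<kappa> + 4 * C0) * (M * T)" by simp
    finally have "Re (\<kappa> * Z) / dd \<le> cmod \<kappa> / dd * (2 * C0 + cmod \<kappa> + 4 * C0) * (M * T)" .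
    moreover have "2 * Re (- \<i> * cnj A * E1) \<le> 4 * C0 * (M * T)"
    proof -
      have "Re (- \<i> * cnj A * E1) \<le> cmod (- \<i> * cnj A * E1)" by (rule complex_Re_le_cmod)
      also have "\<dots> = a * cmod E1" by (simp add: norm_mult a_def)
      finally show ?thesis using aE1 by linarith
    qed
    ultimately have "Gdot m c \<le> - (p0\<^sup>2 / (2 * dd)) * a ^ 4 + C * (M * T)"
      unfolding G C_def by (simp add: algebra_simps)
    moreover have "T = a ^ 4 + nrm2 6 (drop1 c)" unfolding T_def y_def using nn by simp
    ultimately show ?thesis unfolding a_def A_def M_def by (simp add: mult_ac)
  qed
  then show ?thesis using C by blast
qed

text \<open>The derivative of \<open>nrm2 4 (drop1 c)\<close> along the Galerkin vector
  field.\<close>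

definition Ydot :: "nat \<Rightarrow> (nat \<Rightarrow> complex) \<Rightarrow> real" where
  "Ydot m c = 2 * (\<Sum>k=2..m. (real k ^ 4)\<^sup>2 * (c k \<bullet> vf m c k))"

text \<open>Equality holds at k = 2. This is the spectral gap available once mode 1 is
  removed.\<close>

lemma power4_minus_power2: "2 \<le> k \<Longrightarrow> 3 / 4 * real k ^ 4 \<le> real k ^ 4 - real k ^ 2"
proof -
  assume "2 \<le> k"
  then have "4 * (real k)\<^sup>2 \<le> (real k)\<^sup>2 * (real k)\<^sup>2"
    using power_mono[of 2 "real k" 2] by (intro mult_right_mono) auto
  then show ?thesis by (simp add: power4_eq_xxxx power2_eq_square)
qed

text \<open>Mode 1 must force the damped modes only through a^2: Young's inequality turns a^2 y into
  a multiple of a^4, which the quartic decay of mode 1 can absorb, whereas a forcing linear in a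
  could not be absorbed.\<close>

lemma Ydot_bound:
  "\<exists>K\<ge>0. \<forall>m c. 2 \<le> m \<longrightarrow> fin m c \<longrightarrow> nrm2 4 c \<le> 1 \<longrightarrow>
     (let a = cmod (c 1); y = sqrt (nrm2 6 (drop1 c)); M = sqrt (nrm2 4 c) in
     Ydot m c \<le> - (3 / 2) * D * y\<^sup>2 + 2 * K * y * (a\<^sup>2 + 2 * M * y))"
proof -
  obtain K where K: "0 \<le> K" "\<And>m c A. fin m c \<Longrightarrow> nrm2 4 c \<le> 1 \<Longrightarrow> A \<subseteq> {1..m} \<Longrightarrow>
    2 * (\<Sum>k\<in>A. (real k ^ 4)\<^sup>2 * (c k \<bullet> vf m c k)) \<le>
     - 2 * D * (\<Sum>k\<in>A. (real k ^ 4 - real k ^ 2) * (real k ^ 4 * cmod (c k))\<^sup>2)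
     + 2 * sqrt (\<Sum>k\<in>A. (real k ^ (4 + 2) * cmod (c k))\<^sup>2) * (K * sqrt (nrm2 4 c * nrm2 (4 + 2) c))"
    using energy_sum[of 4] by auto
  have "Ydot m c \<le> - (3 / 2) * D * y\<^sup>2 + 2 * K * y * (a\<^sup>2 + 2 * M * y)"
    if m: "2 \<le> m" and f: "fin m c" and n: "nrm2 4 c \<le> 1"
      and a: "a = cmod (c 1)" and y: "y = sqrt (nrm2 6 (drop1 c))" and M: "M = sqrt (nrm2 4 c)" for m c a y M
  proof -
    have fd: "fin m (drop1 c)" by (rule fin_drop1[OF f])
    have nn: "0 \<le> nrm2 s (drop1 c)" for s by (rule nrm2_nonneg[OF fin_hseq[OF fd]])
    have m1: "1 \<le> m" using m by simp
    have sp: "nrm2 s c = a\<^sup>2 + nrm2 s (drop1 c)" for s using nrm2_drop1(1)[OF f m1] by (simp add: a)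
    have y2: "y\<^sup>2 = nrm2 6 (drop1 c)" unfolding y using nn by simp
    have bas: "0 \<le> a" "0 \<le> y" "0 \<le> M" unfolding a y M using nn sp by auto
    have aM: "a \<le> M" unfolding M sp using nn[of 4] by (intro real_le_rsqrt) simp
    define r where "r = sqrt (nrm2 4 (drop1 c))"
    have r: "0 \<le> r" "r \<le> y" unfolding r_def y using nn nrm2_mono[OF fin_hseq[OF fd], of 4 6] by auto
    have Mr: "M \<le> a + r"
      unfolding M sp using sqrt_add_le_add_sqrt[of "a\<^sup>2" "nrm2 4 (drop1 c)"] nn bas by (simp add: r_def)
    have y6: "(\<Sum>k=2..m. (real k ^ (4 + 2) * cmod (c k))\<^sup>2) = y\<^sup>2"
      unfolding y2 nrm2_drop1(2)[OF f m1] by simp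
    have "Ydot m c \<le> - 2 * D * (\<Sum>k=2..m. (real k ^ 4 - real k ^ 2) * (real k ^ 4 * cmod (c k))\<^sup>2)
      + 2 * y * (K * sqrt (nrm2 4 c * nrm2 (4 + 2) c))"
      using K(2)[OF f n, of "{2..m}"] bas unfolding Ydot_def y6 by simp
    also have "\<dots> \<le> - 2 * D * (3 / 4 * y\<^sup>2) + 2 * y * (K * (a\<^sup>2 + 2 * M * y))"
    proof (rule add_mono)
      have "3 / 4 * y\<^sup>2 = (\<Sum>k=2..m. (3 / 4 * real k ^ 4) * (real k ^ 4 * cmod (c k))\<^sup>2)"
        unfolding y2 nrm2_drop1(2)[OF f m1] sum_distrib_left
        by (intro sum.cong) (simp_all add: power_mult_distrib flip: power_mult power_add)
      also have "\<dots> \<le> (\<Sum>k=2..m. (real k ^ 4 - real k ^ 2) * (real k ^ 4 * cmod (c k))\<^sup>2)"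
        by (intro sum_mono mult_right_mono power4_minus_power2) auto
      finally show "- 2 * D * (\<Sum>k=2..m. (real k ^ 4 - real k ^ 2) * (real k ^ 4 * cmod (c k))\<^sup>2) \<le> - 2 * D * (3 / 4 * y\<^sup>2)"
        using D_pos by (simp add: mult_left_mono)
      have "sqrt (nrm2 (4 + 2) c) \<le> a + y"
        unfolding sp using sqrt_add_le_add_sqrt[of "a\<^sup>2" "nrm2 6 (drop1 c)"] nn bas by (simp add: y)
      then have "sqrt (nrm2 4 c * nrm2 (4 + 2) c) \<le> M * (a + y)"
        unfolding real_sqrt_mult M using nn sp by (intro mult_left_mono) auto
      also have "\<dots> = M * a + M * y" by (simp add: algebra_simps)
      also have "\<dots> \<le> a\<^sup>2 + 2 * M * y"
      \<comment> \<open>With M \<le> a + r, where r is the H^4 norm of the damped modes and r \<le>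
        y, the product M a becomes a^2 plus a term small with M y.\<close>
      proof -
        have "M * a \<le> (a + r) * a" using Mr bas by (intro mult_right_mono)
        moreover have "(a + r) * a = a\<^sup>2 + r * a" by (simp add: power2_eq_square algebra_simps)
        moreover have "r * a \<le> y * M" using r aM bas by (intro mult_mono)
        ultimately show ?thesis by (simp add: mult.commute)
      qed
      finally show "2 * y * (K * sqrt (nrm2 4 c * nrm2 (4 + 2) c)) \<le> 2 * y * (K * (a\<^sup>2 + 2 * M * y))"
        using bas K(1) by (intro mult_left_mono) auto
    qed
    finally show ?thesis by (simp add: mult_ac)
  qed
  then show ?thesis using K(1) by (intro exI[of _ K]) (auto simp: Let_def)
qed

lemma lyapunov_dissipation:
  "\<exists>\<epsilon>>0. \<exists>\<rho>>0. \<forall>m c. 2 \<le> m \<longrightarrow> fin m c \<longrightarrow> nrm2 4 c \<le> \<rho> \<longrightarrow> Gdot m c + \<epsilon> * Ydot m c \<le> 0"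
proof -
  obtain C where C: "0 \<le> C" "\<And>m c. 2 \<le> m \<Longrightarrow> fin m c \<Longrightarrow> nrm2 4 c \<le> 1 \<Longrightarrow>
     Gdot m c \<le> - (p0\<^sup>2 / (2 * dd)) * (cmod (c 1)) ^ 4
       + C * sqrt (nrm2 4 c) * ((cmod (c 1)) ^ 4 + nrm2 6 (drop1 c))"
    using Gdot_bound by blast
  obtain K where K: "0 \<le> K" "\<And>m c. 2 \<le> m \<Longrightarrow> fin m c \<Longrightarrow> nrm2 4 c \<le> 1 \<Longrightarrow>
     (let a = cmod (c 1); y = sqrt (nrm2 6 (drop1 c)); M = sqrt (nrm2 4 c) in
     Ydot m c \<le> - (3 / 2) * D * y\<^sup>2 + 2 * K * y * (a\<^sup>2 + 2 * M * y))"
    using Ydot_bound by blast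
  \<comment> \<open>Half of the quartic decay coefficient. One half pays for the forcing of the
    damped modes, the other for the error terms.\<close>
  define \<eta> where "\<eta> = p0\<^sup>2 / (4 * dd)"
  have \<eta>: "0 < \<eta>" unfolding \<eta>_def using p0 dd_pos by simp
  \<comment> \<open>Young's inequality produces 2 K^2 / D * a^4 in \<open>Ydot\<close>; this weight
    keeps its share below \<eta>.\<close>
  define \<epsilon> where "\<epsilon> = \<eta> * D / (2 * K\<^sup>2 + 1)"
  have K1: "0 < 2 * K\<^sup>2 + 1" by (simp add: add_nonneg_pos)
  have \<epsilon>: "0 < \<epsilon>" unfolding \<epsilon>_def using \<eta> D_pos K1 by simp
  have \<epsilon>K: "\<epsilon> * (2 * K\<^sup>2 / D) \<le> \<eta>"
  proof -
    have "\<epsilon> * (2 * K\<^sup>2 / D) = \<eta> * (2 * K\<^sup>2 / (2 * K\<^sup>2 + 1))" unfolding \<epsilon>_def using D_pos by simp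
    also have "\<dots> \<le> \<eta> * 1" using \<eta> K1 by (intro mult_left_mono) (auto simp: field_simps)
    finally show ?thesis by simp
  qed
  define S where "S = C + 4 * \<epsilon> * K + 1"
  have S: "0 < S" unfolding S_def using C K \<epsilon> by (simp add: add_nonneg_pos)
  \<comment> \<open>At radius r the errors, at most S M, stay below both the remaining \<eta> and
    the damping \<epsilon> D.\<close>
  define r where "r = min 1 (min (\<eta> / S) (\<epsilon> * D / S))"
  have r: "0 < r" unfolding r_def using \<eta> \<epsilon> D_pos S by simp
  have "Gdot m c + \<epsilon> * Ydot m c \<le> 0" if m: "2 \<le> m" and f: "fin m c" and n: "nrm2 4 c \<le> r\<^sup>2" for m c
  proof -
    have "r\<^sup>2 \<le> 1" using r by (intro power_le_one) (auto simp: r_def)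
    then have n1: "nrm2 4 c \<le> 1" using n by simp
    define a y M where "a = cmod (c 1)" and "y = sqrt (nrm2 6 (drop1 c))" and "M = sqrt (nrm2 4 c)"
    have nn: "0 \<le> nrm2 6 (drop1 c)" "0 \<le> nrm2 4 c"
      by (rule nrm2_nonneg[OF fin_hseq[OF fin_drop1[OF f]]], rule nrm2_nonneg[OF fin_hseq[OF f]])
    have y2: "y\<^sup>2 = nrm2 6 (drop1 c)" unfolding y_def using nn by simp
    have M: "0 \<le> M" "M \<le> r" unfolding M_def using nn n r by (auto intro!: real_le_lsqrt)
    have SM: "S * M \<le> \<eta>" "S * M \<le> \<epsilon> * D"
    proof -
      have "S * M \<le> S * (\<eta> / S)" using M S by (intro mult_left_mono) (auto simp: r_def)
      then show "S * M \<le> \<eta>" using S by simp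
      have "S * M \<le> S * (\<epsilon> * D / S)" using M S by (intro mult_left_mono) (auto simp: r_def)
      then show "S * M \<le> \<epsilon> * D" using S by simp
    qed
    have CS: "C * M \<le> S * M" "(C + 4 * \<epsilon> * K) * M \<le> S * M"
      unfolding S_def using M C K \<epsilon> by (intro mult_right_mono; simp)+
    have G: "Gdot m c \<le> - (2 * \<eta>) * a ^ 4 + C * M * (a ^ 4 + y\<^sup>2)"
      using C(2)[OF m f n1] unfolding y2 a_def M_def \<eta>_def by simp
    have Y: "Ydot m c \<le> - D * y\<^sup>2 + 2 * K\<^sup>2 / D * a ^ 4 + 4 * K * M * y\<^sup>2"
    proof -
      have "Ydot m c \<le> - (3 / 2) * D * y\<^sup>2 + 2 * K * y * (a\<^sup>2 + 2 * M * y)"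
        using K(2)[OF m f n1] unfolding Let_def a_def y_def M_def .
      moreover have "2 * K * y * a\<^sup>2 \<le> D / 2 * y\<^sup>2 + 2 * K\<^sup>2 / D * a ^ 4"
      proof -
        have "0 \<le> D / 2 * (y - 2 * K / D * a\<^sup>2)\<^sup>2" using D_pos by simp
        also have "\<dots> = D / 2 * y\<^sup>2 + 2 * K\<^sup>2 / D * a ^ 4 - 2 * K * y * a\<^sup>2"
          using D_pos by (simp add: power2_eq_square power4_eq_xxxx field_simps)
        finally show ?thesis by simp
      qed
      ultimately show ?thesis by (simp add: power2_eq_square algebra_simps)
    qed
    have "Gdot m c + \<epsilon> * Ydot m c \<le> (- (2 * \<eta>) * a ^ 4 + C * M * (a ^ 4 + y\<^sup>2)) + \<epsilon> * (- D * y\<^sup>2 + 2 * K\<^sup>2 / D * a ^ 4 + 4 * K * M * y\<^sup>2)"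
      using G Y \<epsilon> by (intro add_mono mult_left_mono) auto
    also have "\<dots> = (- (2 * \<eta>) + C * M + \<epsilon> * (2 * K\<^sup>2 / D)) * a ^ 4 + ((C + 4 * \<epsilon> * K) * M - \<epsilon> * D) * y\<^sup>2"
      by (simp add: algebra_simps)
    also have "\<dots> \<le> 0"
    proof -
      have "- (2 * \<eta>) + C * M + \<epsilon> * (2 * K\<^sup>2 / D) \<le> 0" "(C + 4 * \<epsilon> * K) * M - \<epsilon> * D \<le> 0"
        using CS SM \<epsilon>K by linarith+
      from mult_nonpos_nonneg[OF this(1), of "a ^ 4"] mult_nonpos_nonneg[OF this(2), of "y\<^sup>2"]
      show ?thesis unfolding a_def by simp
    qed
    finally show ?thesis .
  qed
  then show ?thesis using \<epsilon> r by (intro exI[of _ \<epsilon>] conjI exI[of _ "r\<^sup>2"]) auto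
qed

end

section \<open>Global Galerkin solutions\<close>

lemma nonincreasing_within:
  fixes f f' :: "real \<Rightarrow> real"
  assumes D: "\<And>s. 0 \<le> s \<Longrightarrow> s \<le> t \<Longrightarrow> (f has_real_derivative f' s) (at s within {0..})"
    and n: "\<And>s. 0 < s \<Longrightarrow> s < t \<Longrightarrow> f' s \<le> 0" and t: "0 \<le> t"
  shows "f t \<le> f 0"
proof (cases "t = 0")
  case False
  then have t0: "0 < t" using t by simp
  have "continuous_on {0..t} f"
    unfolding continuous_on_eq_continuous_within
    by (intro ballI continuous_within_subset[OF DERIV_continuous[OF D]]) auto
  moreover have "\<exists>y. (f has_real_derivative y) (at s) \<and> y \<le> 0" if "0 < s" "s < t" for s
  proof -
    have "at s within {0..} = at s" using that by (intro at_within_interior) auto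
    then show ?thesis using D[of s] n[of s] that by auto
  qed
  ultimately show ?thesis using DERIV_nonpos_imp_decreasing_open[OF t, of f] by blast
qed auto

lemma cmod_sum_DERIV:
  assumes "\<And>k. k \<in> A \<Longrightarrow> ((\<lambda>t. c t k) has_vector_derivative c' k) (at t within S)" "finite A"
  shows "((\<lambda>t. \<Sum>k\<in>A. (real k ^ s * cmod (c t k))\<^sup>2) has_real_derivative
     2 * (\<Sum>k\<in>A. (real k ^ s)\<^sup>2 * (c t k \<bullet> c' k))) (at t within S)"
proof -
  have "((\<lambda>t. \<Sum>k\<in>A. (real k ^ s)\<^sup>2 * (cmod (c t k))\<^sup>2) has_real_derivative
     (\<Sum>k\<in>A. (real k ^ s)\<^sup>2 * (2 * (c t k \<bullet> c' k)))) (at t within S)"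
    by (intro DERIV_sum DERIV_cmult cmod_sq_DERIV assms)
  then show ?thesis by (simp add: power_mult_distrib sum_distrib_left mult_ac)
qed

context film
begin

definition gal :: "nat \<Rightarrow> (real \<Rightarrow> nat \<Rightarrow> complex) \<Rightarrow> bool" where
  "gal m c \<longleftrightarrow> (\<forall>t\<ge>0. fin m (c t)) \<and>
     (\<forall>t\<ge>0. \<forall>k. ((\<lambda>t. c t k) has_vector_derivative vf m (c t) k) (at t within {0..}))"

text \<open>From the bound |fser d|^2 \<le> 2 nrm2 1 d: the value hbar^2 / 8 ensures |v| \<le> hbar
  / 2, and 1/2 ensures |w| \<le> 1. These are the conditions in \<open>reg\<close>.\<close>

definition \<rho>0 :: real where "\<rho>0 = min (1 / 2) (hbar\<^sup>2 / 8)"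

lemma \<rho>0_pos: "0 < \<rho>0" unfolding \<rho>0_def using hbar by simp

lemma reg_small:
  assumes h: "hseq 4 c" and n: "nrm2 4 c \<le> \<rho>0"
  shows "reg (fser c x) (fser (Ls c) x)"
proof -
  have h1: "hseq (Suc 0) c" by (rule hseq_mono[OF h]) simp
  have h4: "hseq (1 + 3) c" using h by simp
  have hL: "hseq (Suc 0) (Ls c)" using hseq_Ls[OF h4] by simp
  have "nrm2 1 c \<le> nrm2 4 c" by (rule nrm2_mono[OF h]) simp
  then have n1: "2 * nrm2 1 c \<le> (hbar / 2)\<^sup>2" using n by (auto simp: \<rho>0_def power_divide)
  have "nrm2 1 (Ls c) \<le> nrm2 4 c" using nrm2_Ls[OF h4] by simp
  then have n2: "2 * nrm2 1 (Ls c) \<le> 1\<^sup>2" using n by (auto simp: \<rho>0_def)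
  have *: "\<bar>fser d x\<bar> \<le> B" if "hseq (Suc 0) d" "2 * nrm2 1 d \<le> B\<^sup>2" "0 \<le> B" for d B
  proof -
    have d0: "d 0 = 0" using that(1) by (simp add: hseq_def)
    have s: "summable (\<lambda>k. norm (d k))" using hseq_l1(1)[OF that(1)] d0 by simp
    have "\<bar>fser d x\<bar> \<le> (\<Sum>k. norm (d k))" by (rule fser_bound[OF s])
    moreover have "0 \<le> (\<Sum>k. norm (d k))" by (rule suminf_nonneg[OF s]) simp
    moreover have "(\<Sum>k. norm (d k))\<^sup>2 \<le> B\<^sup>2" using hseq_l1(2)[OF that(1)] d0 that(2) by simp
    ultimately show ?thesis using power2_le_imp_le[OF _ that(3)] by (meson order_trans)
  qed
  show ?thesis unfolding reg_def using *[OF h1 n1] *[OF hL n2] hbar by auto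
qed

text \<open>While the H^4 norm is small the clamping is inactive and the Lyapunov function
  decreases. As it is equivalent to the squared H^4 norm, this gives a better bound than the one
  assumed, and continuity closes the argument for all times. C and \<delta> do not depend on
  m.\<close>

lemma galerkin_global:
  "\<exists>C\<ge>1. \<exists>\<delta>>0. \<forall>m c0. 2 \<le> m \<longrightarrow> fin m c0 \<longrightarrow> nrm2 4 c0 \<le> \<delta> \<longrightarrow>
     (\<exists>c. c 0 = c0 \<and> gal m c \<and> (\<forall>t\<ge>0. nrm2 4 (c t) \<le> C * nrm2 4 c0 \<and> nrm2 4 (c t) \<le> \<rho>0))"
proof -
  obtain \<epsilon> \<rho> where \<epsilon>: "0 < \<epsilon>" and \<rho>: "0 < \<rho>"
    and L: "\<And>m c. 2 \<le> m \<Longrightarrow> fin m c \<Longrightarrow> nrm2 4 c \<le> \<rho> \<Longrightarrow> Gdot m c + \<epsilon> * Ydot m c \<le> 0"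
    using lyapunov_dissipation by blast
  \<comment> \<open>If |c 2| \<le> 1 / q, the cubic correction in \<open>Gf\<close> is at most half
    of |c 1|^2.\<close>
  define q where "q = 2 * (cmod \<kappa> / dd) + 1"
  have q: "0 < q" "2 * (cmod \<kappa> / dd) \<le> q" unfolding q_def using dd_pos by (auto simp: add_nonneg_pos)
  define r where "r = min (min \<rho> \<rho>0) ((1 / q)\<^sup>2)"
  have r: "0 < r" "r \<le> \<rho>" "r \<le> \<rho>0" "r \<le> (1 / q)\<^sup>2" unfolding r_def using \<rho> \<rho>0_pos q by auto
  define V where "V c = Gf c + \<epsilon> * nrm2 4 (drop1 c)" for c
  have V: "(1 / 2) * (cmod (c 1))\<^sup>2 + \<epsilon> * nrm2 4 (drop1 c) \<le> V c"
    "V c \<le> (3 / 2) * (cmod (c 1))\<^sup>2 + \<epsilon> * nrm2 4 (drop1 c)"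
    if m: "2 \<le> m" and f: "fin m c" and n: "nrm2 4 c \<le> r" for m c
  proof -
    have "(2 ^ 4 * cmod (c 2))\<^sup>2 \<le> nrm2 4 c"
      unfolding fin_nrm2[OF f] using member_le_sum[of 2 "{..m}" "\<lambda>k. (real k ^ 4 * cmod (c k))\<^sup>2"] m by simp
    moreover have "(cmod (c 2))\<^sup>2 \<le> (2 ^ 4 * cmod (c 2))\<^sup>2" by (intro power_mono) auto
    ultimately have "(cmod (c 2))\<^sup>2 \<le> (1 / q)\<^sup>2" using n r by linarith
    then have b: "cmod (c 2) \<le> 1 / q" by (rule power2_le_imp_le) (use q in simp)
    have "\<bar>Re (\<kappa> * (c 2 * (cnj (c 1))\<^sup>2))\<bar> \<le> cmod \<kappa> * (cmod (c 2) * (cmod (c 1))\<^sup>2)"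
      using abs_Re_le_cmod[of "\<kappa> * (c 2 * (cnj (c 1))\<^sup>2)"] by (simp add: norm_mult norm_power)
    also have "\<dots> \<le> cmod \<kappa> * (1 / q * (cmod (c 1))\<^sup>2)" using b by (intro mult_left_mono mult_right_mono) auto
    finally have "\<bar>Re (\<kappa> * (c 2 * (cnj (c 1))\<^sup>2))\<bar> / dd \<le> cmod \<kappa> * (1 / q * (cmod (c 1))\<^sup>2) / dd"
      using dd_pos by (intro divide_right_mono) auto
    then have "\<bar>Re (\<kappa> * (c 2 * (cnj (c 1))\<^sup>2)) / dd\<bar> \<le> (cmod \<kappa> / dd) * (1 / q) * (cmod (c 1))\<^sup>2"
      unfolding abs_divide abs_of_pos[OF dd_pos] by (simp only: times_divide_eq_left times_divide_eq_right mult_1 mult_1_right divide_divide_eq_left mult.commute[of q dd])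
    also have "\<dots> \<le> (1 / 2) * (cmod (c 1))\<^sup>2"
    proof (rule mult_right_mono)
      have "cmod \<kappa> / dd * (1 / q) \<le> (q / 2) * (1 / q)" using q by (intro mult_right_mono) (linarith, simp)
      then show "cmod \<kappa> / dd * (1 / q) \<le> 1 / 2" using q by simp
    qed simp
    finally show "(1 / 2) * (cmod (c 1))\<^sup>2 + \<epsilon> * nrm2 4 (drop1 c) \<le> V c"
      "V c \<le> (3 / 2) * (cmod (c 1))\<^sup>2 + \<epsilon> * nrm2 4 (drop1 c)"
      unfolding V_def Gf_def abs_le_iff by linarith+
  qed
  define p where "p = min (1 / 2) \<epsilon>"
  have p: "0 < p" "p \<le> 1 / 2" "p \<le> \<epsilon>" unfolding p_def using \<epsilon> by auto
  \<comment> \<open>The quotient of the upper and lower constants in the equivalence of V with the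
    squared H^4 norm.\<close>
  define C where "C = (3 / 2 + \<epsilon>) / p"
  have C: "1 \<le> C" unfolding C_def using p \<epsilon> by (simp add: field_simps)
  \<comment> \<open>Makes C times the initial size at most r / 2, so that the strict gap required by
    \<open>continuous_bootstrap\<close> is there.\<close>
  define \<delta> where "\<delta> = r / (2 * C)"
  have \<delta>: "0 < \<delta>" unfolding \<delta>_def using r C by simp
  have "\<exists>c. c 0 = c0 \<and> gal m c \<and> (\<forall>t\<ge>0. nrm2 4 (c t) \<le> C * nrm2 4 c0 \<and> nrm2 4 (c t) \<le> \<rho>0)"
    if m: "2 \<le> m" and f0: "fin m c0" and n0: "nrm2 4 c0 \<le> \<delta>" for m c0
  proof -
    obtain c where c0: "c 0 = c0" and f: "\<And>t. 0 \<le> t \<Longrightarrow> fin m (c t)"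
      and D: "\<And>t k. 0 \<le> t \<Longrightarrow> ((\<lambda>t. c t k) has_vector_derivative
        (if 1 \<le> k \<and> k \<le> m then - (\<i> * of_nat k * fc (Fc (c t)) k) else 0)) (at t within {0..})"
      using galerkin_exists[OF f0] by blast
    have Dv: "((\<lambda>t. c t k) has_vector_derivative vf m (c t) k) (at t within {0..})"
      if "0 \<le> t" "nrm2 4 (c t) \<le> r" for t k
    proof -
      have "Fc (c t) = Fl (c t)"
        by (rule Fc_eq_Fl, rule reg_small) (use fin_hseq[OF f[OF that(1)]] that r in auto)
      from D[OF that(1), of k, unfolded this] show ?thesis unfolding vf_def .
    qed
    have n4: "nrm2 4 (c t) = (\<Sum>k\<le>m. (real k ^ 4 * cmod (c t k))\<^sup>2)" if "0 \<le> t" for t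
      by (rule fin_nrm2[OF f[OF that]])
    have cont: "continuous_on {0..} (\<lambda>t. nrm2 4 (c t))"
    proof -
      have "continuous_on {0..} (\<lambda>t. c t k)" for k
        by (rule continuous_on_vector_derivative) (use D in auto)
      then have "continuous_on {0..} (\<lambda>t. \<Sum>k\<le>m. (real k ^ 4 * cmod (c t k))\<^sup>2)"
        by (intro continuous_intros)
      then show ?thesis by (rule continuous_on_eq) (simp add: n4)
    qed
    have rho: "C * nrm2 4 c0 < r"
    proof -
      have "C * nrm2 4 c0 \<le> C * \<delta>" using n0 C by (intro mult_left_mono) auto
      also have "\<dots> < r" unfolding \<delta>_def using C r by simp
      finally show ?thesis .
    qed
    have n4n: "0 \<le> nrm2 4 c0" by (rule nrm2_nonneg[OF fin_hseq[OF f0]])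
    have "nrm2 4 c0 \<le> C * nrm2 4 c0" using C n4n mult_right_mono[of 1 C "nrm2 4 c0"] by simp
    then have n0r: "nrm2 4 (c 0) \<le> r" using rho c0 by simp
    have bd: "nrm2 4 (c t) \<le> C * nrm2 4 c0" if t: "0 \<le> t" for t
    proof (rule continuous_bootstrap[OF cont rho n0r _ t])
      fix t :: real assume t: "0 \<le> t" and le: "\<And>s. 0 \<le> s \<Longrightarrow> s \<le> t \<Longrightarrow> nrm2 4 (c s) \<le> r"
      have Y: "nrm2 4 (drop1 (c s)) = (\<Sum>k=2..m. (real k ^ 4 * cmod (c s k))\<^sup>2)" if "0 \<le> s" for s
        using nrm2_drop1(2)[OF f[OF that]] m by simp
      have DV: "((\<lambda>s. V (c s)) has_real_derivative (Gdot m (c s) + \<epsilon> * Ydot m (c s))) (at s within {0..})"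
        if s: "0 \<le> s" "s \<le> t" for s
      proof -
        have "((\<lambda>s. Gf (c s) + \<epsilon> * (\<Sum>k=2..m. (real k ^ 4 * cmod (c s k))\<^sup>2)) has_real_derivative
          (Gdot m (c s) + \<epsilon> * Ydot m (c s))) (at s within {0..})"
          unfolding Ydot_def
          by (intro DERIV_add Gf_DERIV DERIV_cmult cmod_sum_DERIV Dv s le) auto
        then show ?thesis
          by (rule has_field_derivative_transform_within[of _ _ _ _ 1]) (use s Y in \<open>auto simp: V_def\<close>)
      qed
      have "V (c t) \<le> V (c 0)"
        by (rule nonincreasing_within[OF DV]) (use t in \<open>auto intro!: L[OF m f] intro: order_trans[OF le r(2)]\<close>)
      moreover have "p * nrm2 4 (c t) \<le> V (c t)"
      proof -
        have "0 \<le> nrm2 4 (drop1 (c t))" by (rule nrm2_nonneg[OF fin_hseq[OF fin_drop1[OF f[OF t]]]])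
        then have "p * nrm2 4 (c t) \<le> (1 / 2) * (cmod (c t 1))\<^sup>2 + \<epsilon> * nrm2 4 (drop1 (c t))"
          using nrm2_drop1(1)[OF f[OF t], of 4] m p by (simp only: distrib_left) (intro add_mono mult_right_mono, auto)
        then show ?thesis using V(1)[OF m f[OF t]] le[of t] t by force
      qed
      moreover have "V (c 0) \<le> (3 / 2 + \<epsilon>) * nrm2 4 c0"
      proof -
        have "0 \<le> nrm2 4 (drop1 c0)" by (rule nrm2_nonneg[OF fin_hseq[OF fin_drop1[OF f0]]])
        then have "(3 / 2) * (cmod (c0 1))\<^sup>2 + \<epsilon> * nrm2 4 (drop1 c0) \<le> (3 / 2 + \<epsilon>) * nrm2 4 c0"
          using nrm2_drop1(1)[OF f0, of 4] m \<epsilon> by (simp only: distrib_left) (intro add_mono mult_right_mono, auto)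
        then show ?thesis using V(2)[OF m f0] n0r c0 by force
      qed
      ultimately have "p * nrm2 4 (c t) \<le> (3 / 2 + \<epsilon>) * nrm2 4 c0" by linarith
      then show "nrm2 4 (c t) \<le> C * nrm2 4 c0" unfolding C_def using p by (simp add: field_simps)
    qed
    have "gal m c" unfolding gal_def using f Dv bd rho by (meson less_imp_le order_trans)
    moreover have "nrm2 4 (c t) \<le> \<rho>0" if "0 \<le> t" for t using bd[OF that] rho r(3) by linarith
    ultimately show ?thesis using c0 bd by (intro exI[of _ c]) auto
  qed
  then show ?thesis using C \<delta> by blast
qed


section \<open>Higher norms and parabolic smoothing\<close>

lemma energy_level:
  assumes s: "2 \<le> s"
  shows "\<exists>r>0. \<forall>m c. 2 \<le> m \<longrightarrow> fin m c \<longrightarrow> nrm2 4 c \<le> r \<longrightarrow>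
     2 * (\<Sum>k=1..m. (real k ^ s)\<^sup>2 * (c k \<bullet> vf m c k)) \<le> - D * nrm2 (s + 2) c + 2 * D * nrm2 4 c"
proof -
  obtain K where K: "0 \<le> K" "\<And>m c A. fin m c \<Longrightarrow> nrm2 4 c \<le> 1 \<Longrightarrow> A \<subseteq> {1..m} \<Longrightarrow>
    2 * (\<Sum>k\<in>A. (real k ^ s)\<^sup>2 * (c k \<bullet> vf m c k)) \<le>
     - 2 * D * (\<Sum>k\<in>A. (real k ^ 4 - real k ^ 2) * (real k ^ s * cmod (c k))\<^sup>2)
     + 2 * sqrt (\<Sum>k\<in>A. (real k ^ (s + 2) * cmod (c k))\<^sup>2) * (K * sqrt (nrm2 4 c * nrm2 (s + 2) c))"
    using energy_sum[OF s] by auto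
  \<comment> \<open>If the H^4 norm is at most q, the nonlinear term is at most D / 2 times the
    squared top norm, which leaves - D out of - 3/2 D.\<close>
  define q where "q = min 1 (D / (4 * (K + 1)))"
  have q: "0 < q" "q \<le> 1" "4 * K * q \<le> D"
  proof -
    show "0 < q" "q \<le> 1" unfolding q_def using D_pos K by auto
    have "4 * K * q \<le> 4 * K * (D / (4 * (K + 1)))" using K by (intro mult_left_mono) (auto simp: q_def)
    also have "\<dots> = D * (K / (K + 1))"
    proof -
      have "K + 1 \<noteq> 0" "4 * K + 4 \<noteq> 0" using K by auto
      then show ?thesis by (simp add: field_simps)
    qed
    also have "\<dots> \<le> D * 1" using D_pos K by (intro mult_left_mono) auto
    finally show "4 * K * q \<le> D" by simp
  qed
  have "2 * (\<Sum>k=1..m. (real k ^ s)\<^sup>2 * (c k \<bullet> vf m c k)) \<le> - D * nrm2 (s + 2) c + 2 * D * nrm2 4 c"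
    if m: "2 \<le> m" and f: "fin m c" and n: "nrm2 4 c \<le> q\<^sup>2" for m c
  proof -
    have nn: "0 \<le> nrm2 j c" for j by (rule nrm2_nonneg[OF fin_hseq[OF f]])
    have "q\<^sup>2 \<le> 1" using q by (simp add: power_le_one)
    then have n1: "nrm2 4 c \<le> 1" using n by simp
    have m1: "1 \<le> m" using m by simp
    have sp: "nrm2 (s + 2) c = (cmod (c 1))\<^sup>2 + nrm2 (s + 2) (drop1 c)"
      by (rule nrm2_drop1(1)[OF f m1])
    have a4: "(cmod (c 1))\<^sup>2 \<le> nrm2 4 c"
      using nrm2_drop1(1)[OF f m1, of 4] nrm2_nonneg[OF fin_hseq[OF fin_drop1[OF f]], of 4] by simp
    have sM: "sqrt (nrm2 4 c) \<le> q" using n q by (intro real_le_lsqrt) auto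
    have "2 * (\<Sum>k=1..m. (real k ^ s)\<^sup>2 * (c k \<bullet> vf m c k)) \<le>
      - 2 * D * (\<Sum>k=1..m. (real k ^ 4 - real k ^ 2) * (real k ^ s * cmod (c k))\<^sup>2)
      + 2 * sqrt (nrm2 (s + 2) c) * (K * sqrt (nrm2 4 c * nrm2 (s + 2) c))"
      using K(2)[OF f n1, of "{1..m}"] unfolding fin_nrm2_atLeast[OF f, of "s + 2", symmetric] by simp
    also have "\<dots> \<le> - 2 * D * (3 / 4 * nrm2 (s + 2) (drop1 c)) + D / 2 * nrm2 (s + 2) c"
    proof (rule add_mono)
      have "3 / 4 * nrm2 (s + 2) (drop1 c) = (\<Sum>k=2..m. (3 / 4 * real k ^ 4) * (real k ^ s * cmod (c k))\<^sup>2)"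
        unfolding nrm2_drop1(2)[OF f m1] sum_distrib_left
        by (intro sum.cong) (simp_all add: power_mult_distrib power2_eq_square power_add power4_eq_xxxx)
      also have "\<dots> \<le> (\<Sum>k=2..m. (real k ^ 4 - real k ^ 2) * (real k ^ s * cmod (c k))\<^sup>2)"
        by (intro sum_mono mult_right_mono power4_minus_power2) auto
      also have "\<dots> = (\<Sum>k=1..m. (real k ^ 4 - real k ^ 2) * (real k ^ s * cmod (c k))\<^sup>2)"
      proof -
        have "{1..m} = insert 1 {2..m}" using m by auto
        then show ?thesis by simp
      qed
      finally show "- 2 * D * (\<Sum>k=1..m. (real k ^ 4 - real k ^ 2) * (real k ^ s * cmod (c k))\<^sup>2) \<le> - 2 * D * (3 / 4 * nrm2 (s + 2) (drop1 c))"
        using D_pos by (simp add: mult_left_mono)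
      have "2 * sqrt (nrm2 (s + 2) c) * (K * sqrt (nrm2 4 c * nrm2 (s + 2) c)) = 2 * K * sqrt (nrm2 4 c) * nrm2 (s + 2) c"
        using nn[of "s + 2"] by (simp add: real_sqrt_mult)
      also have "\<dots> \<le> 2 * K * q * nrm2 (s + 2) c" using sM K nn by (intro mult_right_mono mult_left_mono) auto
      also have "\<dots> \<le> D / 2 * nrm2 (s + 2) c" using q(3) nn by (intro mult_right_mono) auto
      finally show "2 * sqrt (nrm2 (s + 2) c) * (K * sqrt (nrm2 4 c * nrm2 (s + 2) c)) \<le> D / 2 * nrm2 (s + 2) c" .
    qed
    \<comment> \<open>Mode 1 is not damped. Putting it back into the full norm leaves a positive
      term in |c 1|^2, which the H^4 norm bounds.\<close>
    also have "\<dots> = - D * nrm2 (s + 2) c + (3 / 2) * D * (cmod (c 1))\<^sup>2" unfolding sp by (simp add: algebra_simps)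
    also have "\<dots> \<le> - D * nrm2 (s + 2) c + (3 / 2) * D * nrm2 4 c" using a4 D_pos by simp
    also have "\<dots> \<le> - D * nrm2 (s + 2) c + 2 * D * nrm2 4 c" using nn D_pos by (intro add_left_mono mult_right_mono) auto
    finally show ?thesis .
  qed
  then show ?thesis using q by (intro exI[of _ "q\<^sup>2"]) auto
qed

lemma gal_nrm2_DERIV:
  assumes g: "gal m c" and t: "0 \<le> t"
  shows "((\<lambda>t. nrm2 s (c t)) has_real_derivative 2 * (\<Sum>k=1..m. (real k ^ s)\<^sup>2 * (c t k \<bullet> vf m (c t) k))) (at t within {0..})"
proof -
  have "((\<lambda>t. \<Sum>k=1..m. (real k ^ s * cmod (c t k))\<^sup>2) has_real_derivative
     2 * (\<Sum>k=1..m. (real k ^ s)\<^sup>2 * (c t k \<bullet> vf m (c t) k))) (at t within {0..})"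
    by (rule cmod_sum_DERIV) (use g t in \<open>auto simp: gal_def\<close>)
  then show ?thesis
    by (rule has_field_derivative_transform_within[of _ _ _ _ 1])
      (use t g in \<open>auto simp: gal_def fin_nrm2_atLeast\<close>)
qed

text \<open>Obtained from the sum over \<open>i \<le> 3\<close> of \<open>(D t / 3)\<^sup>i\<close> times the squared norm of order \<open>4 + 2i\<close>, where the
  dissipation of each term absorbs the time derivative of the next weight.\<close>

lemma smoothing:
  "\<exists>r>0. \<forall>m c. 2 \<le> m \<longrightarrow> gal m c \<longrightarrow> (\<forall>t\<ge>0. nrm2 4 (c t) \<le> r) \<longrightarrow> (\<forall>t\<ge>0.
     nrm2 4 (c t) \<le> nrm2 4 (c 0) + 2 * D * r * t \<and>
     (D / 3 * t) ^ 3 * nrm2 10 (c t) \<le> r + 2 * D * r * (1 + D / 3 * t + (D / 3 * t)\<^sup>2 + (D / 3 * t) ^ 3) * t)"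
proof -
  obtain r4 where r4: "0 < r4" "\<And>m c. 2 \<le> m \<Longrightarrow> fin m c \<Longrightarrow> nrm2 4 c \<le> r4 \<Longrightarrow>
     2 * (\<Sum>k=1..m. (real k ^ 4)\<^sup>2 * (c k \<bullet> vf m c k)) \<le> - D * nrm2 6 c + 2 * D * nrm2 4 c"
    using energy_level[of 4] by auto
  obtain r6 where r6: "0 < r6" "\<And>m c. 2 \<le> m \<Longrightarrow> fin m c \<Longrightarrow> nrm2 4 c \<le> r6 \<Longrightarrow>
     2 * (\<Sum>k=1..m. (real k ^ 6)\<^sup>2 * (c k \<bullet> vf m c k)) \<le> - D * nrm2 8 c + 2 * D * nrm2 4 c"
    using energy_level[of 6] by auto
  obtain r8 where r8: "0 < r8" "\<And>m c. 2 \<le> m \<Longrightarrow> fin m c \<Longrightarrow> nrm2 4 c \<le> r8 \<Longrightarrow>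
     2 * (\<Sum>k=1..m. (real k ^ 8)\<^sup>2 * (c k \<bullet> vf m c k)) \<le> - D * nrm2 10 c + 2 * D * nrm2 4 c"
    using energy_level[of 8] by auto
  obtain r10 where r10: "0 < r10" "\<And>m c. 2 \<le> m \<Longrightarrow> fin m c \<Longrightarrow> nrm2 4 c \<le> r10 \<Longrightarrow>
     2 * (\<Sum>k=1..m. (real k ^ 10)\<^sup>2 * (c k \<bullet> vf m c k)) \<le> - D * nrm2 12 c + 2 * D * nrm2 4 c"
    using energy_level[of 10] by auto
  define r where "r = min (min r4 r6) (min r8 r10)"
  have r: "0 < r" "r \<le> r4" "r \<le> r6" "r \<le> r8" "r \<le> r10"
    unfolding r_def using r4 r6 r8 r10 by auto
  \<comment> \<open>Differentiating the highest weight (g s)^3 gives 3 g (g s)^2 = D (g s)^2,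
    exactly what the damping one level below provides; the lower weights leave a surplus.\<close>
  define g where "g = D / 3"
  have g: "0 < g" "D = 3 * g" unfolding g_def using D_pos by auto
  have "nrm2 4 (c t) \<le> nrm2 4 (c 0) + 2 * D * r * t \<and>
     (g * t) ^ 3 * nrm2 10 (c t) \<le> r + 2 * D * r * (1 + g * t + (g * t)\<^sup>2 + (g * t) ^ 3) * t"
    if m: "2 \<le> m" and G: "gal m c" and le: "\<And>t. 0 \<le> t \<Longrightarrow> nrm2 4 (c t) \<le> r" and t: "0 \<le> t" for m c t
  proof -
    have f: "fin m (c s)" if "0 \<le> s" for s using G that by (simp add: gal_def)
    have nn: "0 \<le> nrm2 j (c s)" if "0 \<le> s" for j s by (rule nrm2_nonneg[OF fin_hseq[OF f[OF that]]])
    define e where "e j s = 2 * (\<Sum>k=1..m. (real k ^ j)\<^sup>2 * (c s k \<bullet> vf m (c s) k))" for j s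
    have D: "((\<lambda>s. nrm2 j (c s)) has_real_derivative e j s) (at s within {0..})" if "0 \<le> s" for s j
      unfolding e_def by (rule gal_nrm2_DERIV[OF G that])
    have e: "e 4 s \<le> - D * nrm2 6 (c s) + 2 * D * r" "e 6 s \<le> - D * nrm2 8 (c s) + 2 * D * r"
      "e 8 s \<le> - D * nrm2 10 (c s) + 2 * D * r" "e 10 s \<le> 2 * D * r" if s: "0 \<le> s" for s
    proof -
      have b: "2 * D * nrm2 4 (c s) \<le> 2 * D * r" using le[OF s] D_pos by simp
      have ls: "nrm2 4 (c s) \<le> r4" "nrm2 4 (c s) \<le> r6" "nrm2 4 (c s) \<le> r8" "nrm2 4 (c s) \<le> r10"
        using le[OF s] r by linarith+
      show "e 4 s \<le> - D * nrm2 6 (c s) + 2 * D * r" "e 6 s \<le> - D * nrm2 8 (c s) + 2 * D * r"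
        "e 8 s \<le> - D * nrm2 10 (c s) + 2 * D * r"
        using r4(2)[OF m f[OF s] ls(1)] r6(2)[OF m f[OF s] ls(2)] r8(2)[OF m f[OF s] ls(3)] b
        unfolding e_def by linarith+
      have "0 \<le> D * nrm2 12 (c s)" using D_pos nn[OF s] by simp
      then show "e 10 s \<le> 2 * D * r"
        using r10(2)[OF m f[OF s] ls(4)] b unfolding e_def by linarith
    qed
    define P where "P = 1 + g * t + (g * t)\<^sup>2 + (g * t) ^ 3"
    define E where "E s = nrm2 4 (c s) + (g * s) * nrm2 6 (c s) + (g * s)\<^sup>2 * nrm2 8 (c s) + (g * s) ^ 3 * nrm2 10 (c s) - 2 * D * r * P * s" for s
    define E' where "E' s = e 4 s + (g * nrm2 6 (c s) + e 6 s * (g * s)) + (2 * (g * s) * g * nrm2 8 (c s) + e 8 s * (g * s)\<^sup>2)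
       + (3 * (g * s)\<^sup>2 * g * nrm2 10 (c s) + e 10 s * (g * s) ^ 3) - 2 * D * r * P" for s
    have DE: "(E has_real_derivative E' s) (at s within {0..})" if "0 \<le> s" for s
      unfolding E_def E'_def
      by (rule derivative_eq_intros D[OF that] refl | simp add: power2_eq_square)+
    have E'n: "E' s \<le> 0" if s: "0 < s" "s < t" for s
    proof -
      have s0: "0 \<le> s" using s by simp
      have gs: "0 \<le> g * s" "0 \<le> (g * s)\<^sup>2" "0 \<le> (g * s) ^ 3" using g s by auto
      have 1: "e 6 s * (g * s) \<le> (- D * nrm2 8 (c s) + 2 * D * r) * (g * s)"
        by (rule mult_right_mono[OF e(2)[OF s0] gs(1)])
      have 2: "e 8 s * (g * s)\<^sup>2 \<le> (- D * nrm2 10 (c s) + 2 * D * r) * (g * s)\<^sup>2"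
        by (rule mult_right_mono[OF e(3)[OF s0] gs(2)])
      have 3: "e 10 s * (g * s) ^ 3 \<le> (2 * D * r) * (g * s) ^ 3"
        by (rule mult_right_mono[OF e(4)[OF s0] gs(3)])
      have P: "2 * D * r * (1 + g * s + (g * s)\<^sup>2 + (g * s) ^ 3) \<le> 2 * D * r * P"
      proof -
        have "g * s \<le> g * t" using s g by simp
        then have "(g * s)\<^sup>2 \<le> (g * t)\<^sup>2" "(g * s) ^ 3 \<le> (g * t) ^ 3" using gs by (intro power_mono; simp)+
        then show ?thesis unfolding P_def using \<open>g * s \<le> g * t\<close> D_pos r by (intro mult_left_mono) auto
      qed
      have "E' s \<le> (- D * nrm2 6 (c s) + 2 * D * r) + (g * nrm2 6 (c s) + (- D * nrm2 8 (c s) + 2 * D * r) * (g * s))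
        + (2 * (g * s) * g * nrm2 8 (c s) + (- D * nrm2 10 (c s) + 2 * D * r) * (g * s)\<^sup>2)
        + (3 * (g * s)\<^sup>2 * g * nrm2 10 (c s) + (2 * D * r) * (g * s) ^ 3) - 2 * D * r * P"
        unfolding E'_def using e(1)[OF s0] 1 2 3 by linarith
      also have "\<dots> = 2 * D * r * (1 + g * s + (g * s)\<^sup>2 + (g * s) ^ 3) - 2 * D * r * P
         - 2 * g * nrm2 6 (c s) - (g * s) * g * nrm2 8 (c s)"
        unfolding g(2) by (simp add: algebra_simps)
      also have "\<dots> \<le> 0"
      proof -
        have "0 \<le> 2 * g * nrm2 6 (c s)" "0 \<le> (g * s) * g * nrm2 8 (c s)"
          using nn[OF s0] g(1) gs(1) by auto
        then show ?thesis using P by linarith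
      qed
      finally show ?thesis .
    qed
    have "E t \<le> E 0" by (rule nonincreasing_within[OF DE E'n t]) 
    moreover have "E 0 \<le> r" unfolding E_def using le[of 0] by simp
    moreover have "(g * t) ^ 3 * nrm2 10 (c t) - 2 * D * r * P * t \<le> E t"
      unfolding E_def using nn[OF t] g t by (simp add: add_nonneg_nonneg)
    ultimately have 1: "(g * t) ^ 3 * nrm2 10 (c t) \<le> r + 2 * D * r * P * t" by linarith
    have "nrm2 4 (c t) - 2 * D * r * t \<le> nrm2 4 (c 0) - 2 * D * r * 0"
    proof (rule nonincreasing_within[where f = "\<lambda>s. nrm2 4 (c s) - 2 * D * r * s"])
      show "((\<lambda>s. nrm2 4 (c s) - 2 * D * r * s) has_real_derivative (e 4 s - 2 * D * r)) (at s within {0..})" if "0 \<le> s" for s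
        by (rule derivative_eq_intros D[OF that] refl | simp)+
      show "e 4 s - 2 * D * r \<le> 0" if "0 < s" for s
      proof -
        have "0 \<le> D * nrm2 6 (c s)" using that nn[of s 6] D_pos by simp
        then show ?thesis using e(1)[of s] that by linarith
      qed
    qed (use t in auto)
    then show ?thesis using 1 unfolding P_def by simp
  qed
  then show ?thesis using r unfolding g_def by (intro exI[of _ r]) auto
qed

text \<open>The vector field costs four derivatives, so order 10 more than suffices for order 5.
  Order 5 is wanted because a bound one order above 4 upgrades coefficientwise convergence to
  convergence in H^4.\<close>

lemma vf_bound:
  "\<exists>K\<ge>0. \<forall>m c. fin m c \<longrightarrow> nrm2 4 c \<le> 1 \<longrightarrow> (\<Sum>k=1..m. (real k ^ 5 * cmod (vf m c k))\<^sup>2) \<le> K * nrm2 10 c"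
proof -
  obtain K where K: "0 \<le> K" "\<And>m c n. fin m c \<Longrightarrow> nrm2 4 c \<le> 1 \<Longrightarrow>
     (\<Sum>k=1..n. (real k ^ 6 * cmod (fc (F2 c) k))\<^sup>2) \<le> K * (nrm2 4 c * nrm2 9 c)"
    using sum_fc_F2[of 6] by auto
  define K' where "K' = 3 * ((hbar * p0)\<^sup>2 + D\<^sup>2 + K)"
  have "(\<Sum>k=1..m. (real k ^ 5 * cmod (vf m c k))\<^sup>2) \<le> K' * nrm2 10 c"
    if f: "fin m c" and n: "nrm2 4 c \<le> 1" for m c
  proof -
    have nn: "0 \<le> nrm2 j c" for j by (rule nrm2_nonneg[OF fin_hseq[OF f]])
    have mono: "nrm2 6 c \<le> nrm2 10 c" "nrm2 9 c \<le> nrm2 10 c" by (rule nrm2_mono[OF fin_hseq[OF f]]; simp)+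
    have sq3: "(x + y + z)\<^sup>2 \<le> 3 * (x\<^sup>2 + y\<^sup>2 + z\<^sup>2)" for x y z :: real
    proof -
      have "0 \<le> (x - y)\<^sup>2 + (y - z)\<^sup>2 + (x - z)\<^sup>2" by simp
      then show ?thesis by (simp add: power2_eq_square algebra_simps)
    qed
    have "(real k ^ 5 * cmod (vf m c k))\<^sup>2 \<le> 3 * ((hbar * p0)\<^sup>2 * (real k ^ 6 * cmod (c k))\<^sup>2 + D\<^sup>2 * (real k ^ 9 * cmod (c k))\<^sup>2 + (real k ^ 6 * cmod (fc (F2 c) k))\<^sup>2)"
      if k: "k \<in> {1..m}" for k
    proof -
      have "cmod (vf m c k) = real k * cmod (of_real (hbar * p0) * c k + of_real D * Ls c k + fc (F2 c) k)"
        using k by (simp add: vf_def fc_Fl[OF f] norm_mult)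
      also have "\<dots> \<le> real k * (hbar * p0 * cmod (c k) + D * (real k ^ 3 * cmod (c k)) + cmod (fc (F2 c) k))"
      proof (intro mult_left_mono norm_triangle_mono)
        show "cmod (of_real (hbar * p0) * c k) \<le> hbar * p0 * cmod (c k)" using hbar p0 by (simp add: norm_mult)
        show "cmod (of_real D * Ls c k) \<le> D * (real k ^ 3 * cmod (c k))"
          using D_pos mult_left_mono[OF cmod_Ls_le[of c k], of D] by (simp add: norm_mult)
      qed auto
      finally have "real k ^ 5 * cmod (vf m c k) \<le> real k ^ 5 * (real k * (hbar * p0 * cmod (c k) + D * (real k ^ 3 * cmod (c k)) + cmod (fc (F2 c) k)))"
        by (intro mult_left_mono) auto
      also have "\<dots> = hbar * p0 * (real k ^ 6 * cmod (c k)) + D * (real k ^ 9 * cmod (c k)) + real k ^ 6 * cmod (fc (F2 c) k)"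
        by (simp add: algebra_simps power_numeral_reduce)
      finally have "(real k ^ 5 * cmod (vf m c k))\<^sup>2 \<le> (hbar * p0 * (real k ^ 6 * cmod (c k)) + D * (real k ^ 9 * cmod (c k)) + real k ^ 6 * cmod (fc (F2 c) k))\<^sup>2"
        by (intro power_mono) auto
      also have "\<dots> \<le> 3 * ((hbar * p0 * (real k ^ 6 * cmod (c k)))\<^sup>2 + (D * (real k ^ 9 * cmod (c k)))\<^sup>2 + (real k ^ 6 * cmod (fc (F2 c) k))\<^sup>2)"
        by (rule sq3)
      finally show ?thesis by (simp only: power_mult_distrib)
    qed
    then have "(\<Sum>k=1..m. (real k ^ 5 * cmod (vf m c k))\<^sup>2) \<le> (\<Sum>k=1..m. 3 * ((hbar * p0)\<^sup>2 * (real k ^ 6 * cmod (c k))\<^sup>2 + D\<^sup>2 * (real k ^ 9 * cmod (c k))\<^sup>2 + (real k ^ 6 * cmod (fc (F2 c) k))\<^sup>2))"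
      by (rule sum_mono)
    also have "\<dots> = 3 * ((hbar * p0)\<^sup>2 * nrm2 6 c + D\<^sup>2 * nrm2 9 c + (\<Sum>k=1..m. (real k ^ 6 * cmod (fc (F2 c) k))\<^sup>2))"
      unfolding fin_nrm2_atLeast[OF f] sum_distrib_left sum.distrib[symmetric] by (rule refl)
    also have "\<dots> \<le> 3 * ((hbar * p0)\<^sup>2 * nrm2 10 c + D\<^sup>2 * nrm2 10 c + K * (1 * nrm2 10 c))"
      using mono n nn K(1) by (intro mult_left_mono add_mono order_trans[OF K(2)[OF f n]] mult_mono) auto
    also have "\<dots> = K' * nrm2 10 c" by (simp add: K'_def algebra_simps)
    finally show ?thesis .
  qed
  moreover have "0 \<le> K'" unfolding K'_def using K(1) by simp
  ultimately show ?thesis by blast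
qed

end

subsection \<open>Comparison with a Galerkin approximation and passage to the limit\<close>

lemma sum_inverse_squares_tail:
  assumes "1 \<le> m"
  shows "(\<Sum>k=Suc m..n. 1 / (real k)\<^sup>2) \<le> 1 / real m"
proof -
  have "(\<Sum>k=Suc m..n. 1 / (real k)\<^sup>2) \<le> 1 / real m - 1 / real n" if "m \<le> n" for n
    using that
  proof (induction n rule: dec_induct)
    case (step n)
    have "1 / (real (Suc n))\<^sup>2 \<le> 1 / (real n * real (Suc n))"
      using step assms by (intro divide_left_mono) (auto simp: power2_eq_square)
    also have "\<dots> = 1 / real n - 1 / real (Suc n)" using step assms by (simp add: field_simps)
    finally show ?case using step by (simp add: sum.cl_ivl_Suc del: of_nat_Suc)
  qed simp
  then have "m \<le> n \<Longrightarrow> ?thesis" by (rule order_trans) auto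
  then show ?thesis using assms by (cases "m \<le> n") auto
qed

text \<open>Cauchy-Schwarz against 1 / k as in \<open>hseq_l1\<close>, where the sum of 1 / k^2
  beyond m is at most 1 / m.\<close>

lemma l1_tail:
  assumes h: "hseq 1 d" and z: "\<And>k. k \<le> m \<Longrightarrow> d k = 0" and m: "1 \<le> m"
  shows "summable (\<lambda>k. norm (d k))" "(\<Sum>k. norm (d k)) \<le> sqrt (nrm2 1 d / real m)"
proof -
  have d0: "d 0 = 0" using h by (simp add: hseq_def)
  have sm: "summable (\<lambda>k. (real k ^ 1 * cmod (d k))\<^sup>2)" using h by (simp add: hseq_def)
  show S: "summable (\<lambda>k. norm (d k))" using hseq_l1(1)[of 0 d] h d0 by simp
  have "(\<Sum>k<n. norm (d k)) \<le> sqrt (nrm2 1 d / real m)" for n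
  proof -
    have "(\<Sum>k<n. norm (d k)) = (\<Sum>k=Suc m..<n. norm (d k))"
      by (rule sum.mono_neutral_right) (auto simp: z)
    also have "\<dots> = (\<Sum>k=Suc m..<n. (1 / real k) * (real k ^ 1 * norm (d k)))"
      by (rule sum.cong) auto
    finally have "(\<Sum>k<n. norm (d k))\<^sup>2 \<le> (\<Sum>k=Suc m..<n. (1 / real k)\<^sup>2) * (\<Sum>k=Suc m..<n. (real k ^ 1 * norm (d k))\<^sup>2)"
      using Cauchy_Schwarz_ineq_sum[of "\<lambda>k. 1 / real k" "\<lambda>k. real k ^ 1 * norm (d k)" "{Suc m..<n}"] by simp
    also have "\<dots> \<le> (1 / real m) * nrm2 1 d"
    proof (rule mult_mono)
      have "(\<Sum>k=Suc m..<n. (1 / real k)\<^sup>2) \<le> (\<Sum>k=Suc m..n. (1 / real k)\<^sup>2)" by (intro sum_mono2) auto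
      then show "(\<Sum>k=Suc m..<n. (1 / real k)\<^sup>2) \<le> 1 / real m"
        using sum_inverse_squares_tail[OF m, of n] by (simp add: power_divide)
      show "(\<Sum>k=Suc m..<n. (real k ^ 1 * norm (d k))\<^sup>2) \<le> nrm2 1 d"
        unfolding nrm2_def by (rule sum_le_suminf[OF sm]) auto
    qed (auto intro: sum_nonneg)
    finally show ?thesis by (intro real_le_rsqrt) simp
  qed
  then show "(\<Sum>k. norm (d k)) \<le> sqrt (nrm2 1 d / real m)" by (intro suminf_le_const[OF S])
qed

lemma hseq_summable_norm: "hseq 1 d \<Longrightarrow> summable (\<lambda>k. norm (d k))"
  using hseq_l1(1)[of 0 d] by (simp add: hseq_def)

lemma hseq_tr:
  assumes "hseq s d"
  shows "nrm2 s (tr m d) \<le> nrm2 s d" "hseq s (\<lambda>k. d k - tr m d k)" "nrm2 s (\<lambda>k. d k - tr m d k) \<le> nrm2 s d"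
proof -
  have d0: "d 0 = 0" using assms by (simp add: hseq_def)
  have S: "summable (\<lambda>k. (real k ^ s * cmod (d k))\<^sup>2)" using assms by (simp add: hseq_def)
  show "nrm2 s (tr m d) \<le> nrm2 s d"
    unfolding nrm2_def
    by (rule suminf_le) (use S fin_hseq[OF fin_tr, of s m d] in \<open>auto simp: tr_def hseq_def\<close>)
  have le: "(real k ^ s * cmod (d k - tr m d k))\<^sup>2 \<le> (real k ^ s * cmod (d k))\<^sup>2" for k
    by (auto simp: tr_def)
  have S': "summable (\<lambda>k. (real k ^ s * cmod (d k - tr m d k))\<^sup>2)"
    by (rule summable_comparison_test'[OF S, of 0]) (use le in auto)
  then show "hseq s (\<lambda>k. d k - tr m d k)" using d0 by (simp add: hseq_def)
  show "nrm2 s (\<lambda>k. d k - tr m d k) \<le> nrm2 s d"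
    unfolding nrm2_def by (rule suminf_le[OF le S' S])
qed

text \<open>Both arguments of the flux are uniformly approximated at rate 1 / sqrt m from an H^4
  bound alone. Thus the comparison below demands no more regularity of a solution than its
  definition provides.\<close>

lemma fser_tail_small:
  assumes h: "hseq 4 d" and m: "1 \<le> m"
  shows "\<bar>fser d x - fser (tr m d) x\<bar> \<le> sqrt (nrm2 4 d / real m)"
    "\<bar>fser (Ls d) x - fser (Ls (tr m d)) x\<bar> \<le> sqrt (nrm2 4 d / real m)"
proof -
  define e where "e = (\<lambda>k. d k - tr m d k)"
  have e: "hseq 4 e" "nrm2 4 e \<le> nrm2 4 d" "hseq (1 + 3) e" "hseq (1 + 3) d" unfolding e_def using hseq_tr[OF h, of m] h by auto
  have d0: "d 0 = 0" using h by (simp add: hseq_def)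
  have z: "e k = 0" if "k \<le> m" for k using that d0 by (cases k) (auto simp: e_def tr_def)
  have zL: "Ls e k = 0" if "k \<le> m" for k using z[OF that] by (simp add: Ls_def)
  have h1: "hseq 1 e" "hseq 1 d" by (rule hseq_mono[OF e(1)] hseq_mono[OF h]; simp)+
  have hL: "hseq 1 (Ls e)" "hseq 1 (Ls d)" by (rule hseq_Ls[OF e(3)], rule hseq_Ls[OF e(4)])
  have n1: "nrm2 1 e \<le> nrm2 4 d" using nrm2_mono[OF e(1), of 1] e(2) by simp
  have nL: "nrm2 1 (Ls e) \<le> nrm2 4 d" using nrm2_Ls[OF e(3)] e(2) by simp
  have *: "\<bar>fser b x\<bar> \<le> sqrt (nrm2 4 d / real m)"
    if "hseq 1 b" "\<And>k. k \<le> m \<Longrightarrow> b k = 0" "nrm2 1 b \<le> nrm2 4 d" for b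
  proof -
    have "\<bar>fser b x\<bar> \<le> sqrt (nrm2 1 b / real m)"
      using fser_bound[OF l1_tail(1)[OF that(1,2) m]] l1_tail(2)[OF that(1,2) m] by (rule order_trans)
    also have "\<dots> \<le> sqrt (nrm2 4 d / real m)" using that(3) by (simp add: divide_right_mono)
    finally show ?thesis .
  qed
  have "fser d x - fser (tr m d) x = fser e x"
    unfolding e_def by (rule fser_diff[symmetric, OF hseq_summable_norm[OF h1(2)] summable_tr])
  then show "\<bar>fser d x - fser (tr m d) x\<bar> \<le> sqrt (nrm2 4 d / real m)"
    using *[OF h1(1) z n1] by simp
  have "Ls e = (\<lambda>k. Ls d k - Ls (tr m d) k)" by (auto simp: e_def Ls_def algebra_simps)
  then have "fser (Ls d) x - fser (Ls (tr m d)) x = fser (Ls e) x"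
    using fser_diff[OF hseq_summable_norm[OF hL(2)] fin_summable[OF fin_Ls[OF fin_tr]], of m d x] by simp
  then show "\<bar>fser (Ls d) x - fser (Ls (tr m d)) x\<bar> \<le> sqrt (nrm2 4 d / real m)"
    using *[OF hL(1) zL nL] by simp
qed

context film
begin

lemma Fl_Phi: "Fl c x = Phi (hbar + fser c x) (fser (Ls c) x)"
  unfolding Fl_def Phi_def ..

lemma Fl_continuous:
  assumes "hseq 4 d"
  shows "continuous_on S (Fl d)"
proof -
  have "hseq (1 + 3) d" using assms by simp
  then have "hseq 1 (Ls d)" by (rule hseq_Ls)
  moreover have "hseq 1 d" by (rule hseq_mono[OF assms]) simp
  ultimately show ?thesis unfolding Fl_Phi[abs_def]
    by (intro Phi_continuous continuous_intros fser_continuous hseq_summable_norm)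
qed

text \<open>Here e = u' and w = u' + u''', so the test function is u' - u''', the one that belongs
  to the H^1 energy. Testing with - w alone would use the monotonicity but lose mode 1, and the
  summand 2 e restores it. Young's inequality is used three times with a / 4 each, within the
  available - a w^2.\<close>

lemma comparison_pointwise:
  fixes a L :: real
  assumes a: "0 < a" and L: "0 < L"
    and f1: "\<bar>f1\<bar> \<le> L * (\<bar>u\<bar> + \<bar>w\<bar>)" "a * w\<^sup>2 - L * \<bar>u\<bar> * \<bar>w\<bar> \<le> f1 * w" and f2: "\<bar>f2\<bar> \<le> 2 * L * r" and r: "0 \<le> r"
  shows "(f1 + f2) * (2 * e - w) \<le> (4 * L\<^sup>2 / a + 3 * L) * (u\<^sup>2 + e\<^sup>2 + r\<^sup>2)"
proof -
  have young: "x * y \<le> a / 4 * x\<^sup>2 + y\<^sup>2 / a" for x y :: real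
  proof -
    have "0 \<le> a * (x / 2 - y / a)\<^sup>2" using a by simp
    also have "\<dots> = a / 4 * x\<^sup>2 + y\<^sup>2 / a - x * y" using a by (simp add: power2_eq_square field_simps)
    finally show ?thesis by simp
  qed
  have "f1 * e \<le> \<bar>f1\<bar> * \<bar>e\<bar>" by (metis abs_ge_self abs_mult)
  also have "\<dots> \<le> L * (\<bar>u\<bar> + \<bar>w\<bar>) * \<bar>e\<bar>" using f1(1) by (intro mult_right_mono) auto
  finally have 1: "2 * (f1 * e) \<le> \<bar>w\<bar> * (2 * L * \<bar>e\<bar>) + 2 * L * (\<bar>u\<bar> * \<bar>e\<bar>)" by (simp add: algebra_simps)
  have 2: "- (f1 * w) \<le> - a * w\<^sup>2 + \<bar>w\<bar> * (L * \<bar>u\<bar>)" using f1(2) by (simp add: mult_ac)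
  have "f2 * (2 * e - w) \<le> \<bar>f2\<bar> * \<bar>2 * e - w\<bar>" by (metis abs_ge_self abs_mult)
  also have "\<dots> \<le> 2 * L * r * (2 * \<bar>e\<bar> + \<bar>w\<bar>)"
    using f2 L r by (intro mult_mono) (auto simp: abs_if)
  finally have 3: "f2 * (2 * e - w) \<le> 4 * L * (r * \<bar>e\<bar>) + \<bar>w\<bar> * (2 * L * r)" by (simp add: algebra_simps)
  have y1: "\<bar>w\<bar> * (2 * L * \<bar>e\<bar>) \<le> a / 4 * w\<^sup>2 + 4 * L\<^sup>2 / a * e\<^sup>2"
    using young[of "\<bar>w\<bar>" "2 * L * \<bar>e\<bar>"] by (simp add: power_mult_distrib)
  have y2: "\<bar>w\<bar> * (L * \<bar>u\<bar>) \<le> a / 4 * w\<^sup>2 + L\<^sup>2 / a * u\<^sup>2"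
    using young[of "\<bar>w\<bar>" "L * \<bar>u\<bar>"] by (simp add: power_mult_distrib)
  have y3: "\<bar>w\<bar> * (2 * L * r) \<le> a / 4 * w\<^sup>2 + 4 * L\<^sup>2 / a * r\<^sup>2"
    using young[of "\<bar>w\<bar>" "2 * L * r"] by (simp add: power_mult_distrib)
  have s1: "2 * L * (\<bar>u\<bar> * \<bar>e\<bar>) \<le> L * u\<^sup>2 + L * e\<^sup>2"
    using mult_left_mono[OF sum_squares_bound[of "\<bar>u\<bar>" "\<bar>e\<bar>"], of L] L by (simp add: algebra_simps)
  have s2: "4 * L * (r * \<bar>e\<bar>) \<le> 2 * L * r\<^sup>2 + 2 * L * e\<^sup>2"
    using mult_left_mono[OF sum_squares_bound[of r "\<bar>e\<bar>"], of "2 * L"] L by (simp add: algebra_simps)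
  have aw: "0 \<le> a * w\<^sup>2" using a by simp
  have p: "0 \<le> L\<^sup>2 / a * u\<^sup>2" "0 \<le> L * u\<^sup>2" "0 \<le> L * r\<^sup>2" using a L by auto
  have "(f1 + f2) * (2 * e - w) = 2 * (f1 * e) + - (f1 * w) + f2 * (2 * e - w)" by (simp add: algebra_simps)
  also have "\<dots> \<le> (a / 4 * w\<^sup>2 + 4 * L\<^sup>2 / a * e\<^sup>2) + (L * u\<^sup>2 + L * e\<^sup>2) + (- a * w\<^sup>2 + (a / 4 * w\<^sup>2 + L\<^sup>2 / a * u\<^sup>2))
     + ((2 * L * r\<^sup>2 + 2 * L * e\<^sup>2) + (a / 4 * w\<^sup>2 + 4 * L\<^sup>2 / a * r\<^sup>2))"
    using 1 2 3 y1 y2 y3 s1 s2 by linarith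
  also have "\<dots> = (4 * L\<^sup>2 / a + 3 * L) * (u\<^sup>2 + e\<^sup>2 + r\<^sup>2) - a * w\<^sup>2 / 4 - 3 * (L\<^sup>2 / a * u\<^sup>2) - 2 * (L * u\<^sup>2) - L * r\<^sup>2"
    by (simp add: algebra_simps add_divide_distrib)
  also have "\<dots> \<le> (4 * L\<^sup>2 / a + 3 * L) * (u\<^sup>2 + e\<^sup>2 + r\<^sup>2)" using aw p by linarith
  finally show ?thesis .
qed

text \<open>The curve \<open>g\<close> is any small solution of the mode equations, be it a finer
  Galerkin approximation or a genuine solution; only its modes up to m have to satisfy them.
  Gronwall is applied to the H^1 energy of the difference in these modes. The truncation of
  \<open>g\<close> is the only source term and is of order 1 / m.\<close>

lemma comparison:
  "\<exists>K>0. \<forall>m c g T t. 1 \<le> m \<longrightarrow> gal m c \<longrightarrow> (\<forall>t\<ge>0. nrm2 4 (c t) \<le> \<rho>0) \<longrightarrow> c 0 = tr m (g 0) \<longrightarrow>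
     (\<forall>t\<in>{0..T}. hseq 4 (g t) \<and> nrm2 4 (g t) \<le> \<rho>0) \<longrightarrow> (\<forall>k. continuous_on {0..T} (\<lambda>t. g t k)) \<longrightarrow>
     (\<forall>t\<in>{0<..<T}. \<forall>k\<in>{1..m}. ((\<lambda>t. g t k) has_vector_derivative - (\<i> * of_nat k * fc (Fl (g t)) k)) (at t)) \<longrightarrow>
     t \<in> {0..T} \<longrightarrow> (\<Sum>k=1..m. (cmod (c t k - g t k))\<^sup>2) \<le> exp (K * t) / real m"
proof -
  obtain a L where aL: "0 < a" "0 < L" and
    P1: "\<And>v w v' w'. reg v w \<Longrightarrow> reg v' w' \<Longrightarrow> \<bar>Phi (hbar + v) w - Phi (hbar + v') w'\<bar> \<le> L * (\<bar>v - v'\<bar> + \<bar>w - w'\<bar>)" and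
    P2: "\<And>v w v' w'. reg v w \<Longrightarrow> reg v' w' \<Longrightarrow>
      a * (w - w')\<^sup>2 - L * \<bar>v - v'\<bar> * \<bar>w - w'\<bar> \<le> (Phi (hbar + v) w - Phi (hbar + v') w') * (w - w')"
    using Phi_estimates by blast
  define K1 where "K1 = 4 * L\<^sup>2 / a + 3 * L"
  have K1: "0 < K1" unfolding K1_def using aL by (intro add_nonneg_pos) auto
  define K where "K = 2 * K1 + 4 * K1 * \<rho>0"
  have K: "0 < K" unfolding K_def using K1 \<rho>0_pos by (intro add_pos_pos mult_pos_pos) auto
  have "(\<Sum>k=1..m. (cmod (c t k - g t k))\<^sup>2) \<le> exp (K * t) / real m"
    if m: "1 \<le> m" and G: "gal m c" and cr: "\<And>t. 0 \<le> t \<Longrightarrow> nrm2 4 (c t) \<le> \<rho>0" and c0: "c 0 = tr m (g 0)"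
      and gh: "\<And>t. t \<in> {0..T} \<Longrightarrow> hseq 4 (g t)" "\<And>t. t \<in> {0..T} \<Longrightarrow> nrm2 4 (g t) \<le> \<rho>0"
      and gc: "\<And>k. continuous_on {0..T} (\<lambda>t. g t k)"
      and gD: "\<And>t k. t \<in> {0<..<T} \<Longrightarrow> k \<in> {1..m} \<Longrightarrow> ((\<lambda>t. g t k) has_vector_derivative - (\<i> * of_nat k * fc (Fl (g t)) k)) (at t)"
      and t: "t \<in> {0..T}" for m c g T t
  proof -
    define e where "e t k = c t k - g t k" for t k
    define E where "E t = (\<Sum>k=1..m. (1 + (real k)\<^sup>2) * (cmod (e t k))\<^sup>2)" for t
    define E' where "E' t = (\<Sum>k=1..m. (1 + (real k)\<^sup>2) * (2 * (e t k \<bullet> (vf m (c t) k - - (\<i> * of_nat k * fc (Fl (g t)) k)))))" for t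
    have f: "fin m (c s)" if "0 \<le> s" for s using G that by (simp add: gal_def)
    have cD: "((\<lambda>t. c t k) has_vector_derivative vf m (c s) k) (at s within {0..})" if "0 \<le> s" for s k
      using G that by (simp add: gal_def)
    have cc: "continuous_on {0..T} (\<lambda>t. c t k)" for k
    proof -
      have "continuous_on {0..} (\<lambda>t. c t k)" by (rule continuous_on_vector_derivative) (use cD in auto)
      then show ?thesis by (rule continuous_on_subset) auto
    qed
    have DE: "(E has_real_derivative E' s) (at s)" if s: "s \<in> {0<..<T}" for s
    proof -
      have "at s within {0..} = at s" using s by (intro at_within_interior) auto
      then have cDs: "((\<lambda>t. c t k) has_vector_derivative vf m (c s) k) (at s)" for k using cD[of s k] s by simp
      show ?thesis unfolding E_def E'_def e_def
        by (intro DERIV_sum DERIV_cmult cmod_sq_DERIV has_vector_derivative_diff cDs gD[OF s]) auto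
    qed
    have cE: "continuous_on {0..T} E" unfolding E_def e_def by (intro continuous_intros cc gc)
    have E0: "0 \<le> E s" for s unfolding E_def by (intro sum_nonneg) auto
    have E'le: "E' s \<le> K * (E s + 1 / real m)" if s: "s \<in> {0<..<T}" for s
    proof -
      have sT: "s \<in> {0..T}" "0 \<le> s" using s by auto
      \<comment> \<open>The flux difference is split at the truncation of \<open>g\<close>: c and d
        have modes up to m only, so monotonicity can be tested there, while d and g differ uniformly
        by at most r.\<close>
      define d where "d = tr m (g s)"
      define b where "b k = c s k - d k" for k
      have fd: "fin m d" unfolding d_def by (rule fin_tr)
      have fb: "fin m b" using f[OF sT(2)] fd unfolding b_def fin_def by simp
      have be: "b k = e s k" if "k \<in> {1..m}" for k using that by (simp add: b_def e_def d_def tr_def)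
      define r where "r = sqrt (\<rho>0 / real m)"
      have r: "0 \<le> r" "r\<^sup>2 = \<rho>0 / real m" unfolding r_def using \<rho>0_pos by auto
      define u w ex where "u = fser b" and "w = fser (Ls b)" and "ex = fser (ddc b)"
      define f1 f2 where "f1 x = Fl (c s) x - Fl d x" and "f2 x = Fl d x - Fl (g s) x" for x
      have hg: "hseq 4 (g s)" by (rule gh(1)[OF sT(1)])
      have n4d: "nrm2 4 d \<le> \<rho>0" unfolding d_def using hseq_tr(1)[OF hg, of m] gh(2)[OF sT(1)] by simp
      have r1: "reg (fser (c s) x) (fser (Ls (c s)) x)" for x by (rule reg_small[OF fin_hseq[OF f[OF sT(2)]] cr[OF sT(2)]])
      have r2: "reg (fser d x) (fser (Ls d) x)" for x by (rule reg_small[OF fin_hseq[OF fd] n4d])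
      have r3: "reg (fser (g s) x) (fser (Ls (g s)) x)" for x by (rule reg_small[OF hg gh(2)[OF sT(1)]])
      have uu: "fser (c s) x - fser d x = u x" for x
        unfolding u_def b_def by (rule fser_diff[symmetric, OF fin_summable[OF f[OF sT(2)]] fin_summable[OF fd]])
      have ww: "fser (Ls (c s)) x - fser (Ls d) x = w x" for x
      proof -
        have "Ls b = (\<lambda>k. Ls (c s) k - Ls d k)" by (auto simp: b_def Ls_def algebra_simps)
        then show ?thesis unfolding w_def
          using fser_diff[OF fin_summable[OF fin_Ls[OF f[OF sT(2)]]] fin_summable[OF fin_Ls[OF fd]], of x] by simp
      qed
      have tail: "\<bar>fser d x - fser (g s) x\<bar> \<le> r" "\<bar>fser (Ls d) x - fser (Ls (g s)) x\<bar> \<le> r" for x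
      proof -
        have "sqrt (nrm2 4 (g s) / real m) \<le> r" unfolding r_def using gh(2)[OF sT(1)] by (simp add: divide_right_mono)
        then show "\<bar>fser d x - fser (g s) x\<bar> \<le> r" "\<bar>fser (Ls d) x - fser (Ls (g s)) x\<bar> \<le> r"
          unfolding d_def using fser_tail_small[OF hg m, of x] by (simp_all add: abs_minus_commute)
      qed
      have pw: "(f1 x + f2 x) * (2 * ex x - w x) \<le> K1 * ((u x)\<^sup>2 + (ex x)\<^sup>2 + r\<^sup>2)" for x
        unfolding K1_def
      proof (rule comparison_pointwise[OF aL])
        show "\<bar>f1 x\<bar> \<le> L * (\<bar>u x\<bar> + \<bar>w x\<bar>)" using P1[OF r1[of x] r2[of x]] unfolding f1_def Fl_Phi uu ww .
        show "a * (w x)\<^sup>2 - L * \<bar>u x\<bar> * \<bar>w x\<bar> \<le> f1 x * w x" using P2[OF r1[of x] r2[of x]] unfolding f1_def Fl_Phi uu ww .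
        have "\<bar>f2 x\<bar> \<le> L * (\<bar>fser d x - fser (g s) x\<bar> + \<bar>fser (Ls d) x - fser (Ls (g s)) x\<bar>)"
          using P1[OF r2[of x] r3[of x]] unfolding f2_def Fl_Phi .
        also have "\<dots> \<le> L * (r + r)" using tail[of x] aL by (intro mult_left_mono add_mono) auto
        finally show "\<bar>f2 x\<bar> \<le> 2 * L * r" by simp
      qed (rule r)
      have cF: "continuous_on UNIV (Fl (c s))" "continuous_on UNIV (Fl d)" "continuous_on UNIV (Fl (g s))"
        by (rule Fl_continuous[OF fin_hseq[OF f[OF sT(2)]]], rule Fl_continuous[OF fin_hseq[OF fd]], rule Fl_continuous[OF hg])
      have fdd: "fin m (ddc b)" using fin_ddc[OF fb, of 1] by simp
      have cb: "continuous_on UNIV u" "continuous_on UNIV w" "continuous_on UNIV ex"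
        unfolding u_def w_def ex_def by (rule sper_continuous[OF fin_fser_sper[OF fb]] sper_continuous[OF fin_fser_sper[OF fin_Ls[OF fb]]] sper_continuous[OF fin_fser_sper[OF fdd]])+
      define F where "F x = Fl (c s) x - Fl (g s) x" for x
      have Fi: "integrable circle F" unfolding F_def by (intro circle_integrable continuous_intros cF)
      \<comment> \<open>The coefficients of u' - u''', that is \<i> k (1 + k^2) times those of u;
        this reproduces the weights in E.\<close>
      define q where "q k = 2 * ddc b k - Ls b k" for k
      have fq: "fser q x = 2 * ex x - w x" for x
      proof -
        have "fser q x = fser (\<lambda>k. of_real 2 * ddc b k) x - fser (Ls b) x"
          unfolding q_def using fser_diff[of "\<lambda>k. of_real 2 * ddc b k" "Ls b" x] fin_summable[OF fdd] fin_summable[OF fin_Ls[OF fb]]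
          by (simp add: norm_mult)
        then show ?thesis unfolding ex_def w_def using fser_cmult[OF fin_summable[OF fdd], of 2 x] by simp
      qed
      have "E' s = 2 * (\<Sum>k=1..m. Re (q k * cnj (fc F k)))"
        unfolding E'_def sum_distrib_left
      proof (rule sum.cong[OF refl])
        fix k assume k: "k \<in> {1..m}"
        have "vf m (c s) k - - (\<i> * of_nat k * fc (Fl (g s)) k) = - (\<i> * of_nat k * fc F k)"
        proof -
          have "F = (\<lambda>x. Fl (c s) x - Fl (g s) x)" by (rule ext) (simp add: F_def)
          then have "fc F k = fc (Fl (c s)) k - fc (Fl (g s)) k"
            using fc_diff[OF circle_integrable[OF cF(1)] circle_integrable[OF cF(3)], of k] by simp
          then show ?thesis using k by (simp add: vf_def right_diff_distrib)
        qed
        moreover have "q k = \<i> * of_real (real k * (1 + (real k)\<^sup>2)) * b k"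
          by (simp add: q_def ddc_def Ls_def power2_eq_square power3_eq_cube algebra_simps)
        ultimately show "(1 + (real k)\<^sup>2) * (2 * (e s k \<bullet> (vf m (c s) k - - (\<i> * of_nat k * fc (Fl (g s)) k)))) = 2 * Re (q k * cnj (fc F k))"
          using be[OF k] by (simp add: inner_complex_def algebra_simps)
      qed
      also have "(\<Sum>k=1..m. Re (q k * cnj (fc F k))) = (\<Sum>k\<le>m. Re (q k * cnj (fc F k)))"
        by (rule sum.mono_neutral_left) (auto simp: q_def ddc_def Ls_def not_le less_Suc_eq_0_disj)
      also have "\<dots> = cint (\<lambda>x. F x * fser q x) / pi"
        using cint_mult_fser[OF Fi, of m q] fb by (simp add: q_def ddc_def Ls_def fin_def)
      also have "cint (\<lambda>x. F x * fser q x) \<le> cint (\<lambda>x. K1 * ((u x)\<^sup>2 + (ex x)\<^sup>2 + r\<^sup>2))"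
      proof (rule cint_mono)
        show "continuous_on UNIV (\<lambda>x. F x * fser q x)" unfolding fq F_def by (intro continuous_intros cF cb)
        show "continuous_on UNIV (\<lambda>x. K1 * ((u x)\<^sup>2 + (ex x)\<^sup>2 + r\<^sup>2))" by (intro continuous_intros cb)
        show "F x * fser q x \<le> K1 * ((u x)\<^sup>2 + (ex x)\<^sup>2 + r\<^sup>2)" for x
          using pw[of x] unfolding fq F_def f1_def f2_def by simp
      qed
      also have "\<dots> = K1 * (cint (\<lambda>x. (u x)\<^sup>2) + cint (\<lambda>x. (ex x)\<^sup>2) + 2 * pi * r\<^sup>2)"
      proof -
        have i: "integrable circle (\<lambda>x. (u x)\<^sup>2)" "integrable circle (\<lambda>x. (ex x)\<^sup>2)"
          by (intro circle_integrable continuous_intros cb)+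
        interpret finite_measure circle by (rule finite_measure_circle)
        show ?thesis using i cint_const[of "r\<^sup>2"] by simp
      qed
      also have "\<dots> = K1 * pi * (E s + 2 * r\<^sup>2)"
      proof -
        have "cint (\<lambda>x. (u x)\<^sup>2) = pi * nrm2 0 b" "cint (\<lambda>x. (ex x)\<^sup>2) = pi * nrm2 1 b"
          using fin_cint_deriv_sq[OF fb, of 0] fin_cint_deriv_sq[OF fb, of 1] fin_fser_deriv_n[OF fb, of 1]
          by (simp_all add: u_def ex_def)
        moreover have "nrm2 0 b + nrm2 1 b = E s"
          unfolding fin_nrm2_atLeast[OF fb] E_def sum.distrib[symmetric]
          by (rule sum.cong) (auto simp: be power_mult_distrib algebra_simps)
        ultimately have su: "cint (\<lambda>x. (u x)\<^sup>2) + cint (\<lambda>x. (ex x)\<^sup>2) = pi * E s"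
          by (simp only: distrib_left[symmetric])
        show ?thesis unfolding su by (simp add: algebra_simps)
      qed
      finally have "E' s \<le> 2 * (K1 * pi * (E s + 2 * r\<^sup>2) / pi)" by (simp add: divide_right_mono)
      also have "\<dots> = 2 * (K1 * (E s + 2 * r\<^sup>2))" by simp
      also have "\<dots> = 2 * K1 * E s + 4 * K1 * \<rho>0 * (1 / real m)" unfolding r(2) by (simp add: algebra_simps)
      also have "\<dots> \<le> K * E s + K * (1 / real m)"
        unfolding K_def using E0[of s] K1 \<rho>0_pos by (intro add_mono mult_right_mono) auto
      finally show ?thesis by (simp add: distrib_left)
    qed
    \<comment> \<open>Gronwall with the source 1 / m absorbed into the unknown; initially E
      vanishes.\<close>
    define H where "H s = exp (- K * s) * (E s + 1 / real m)" for s
    have "H t \<le> H 0"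
    proof (rule DERIV_nonpos_imp_decreasing_open[where f = H and a = 0 and b = t])
      show "0 \<le> t" using t by simp
      fix s assume s: "0 < s" "s < t"
      then have sT: "s \<in> {0<..<T}" using t by auto
      have "(H has_real_derivative (- K * exp (- K * s) * (E s + 1 / real m) + E' s * exp (- K * s))) (at s)"
        unfolding H_def by (rule derivative_eq_intros DE[OF sT] refl | simp)+
      moreover have "- K * exp (- K * s) * (E s + 1 / real m) + E' s * exp (- K * s) = exp (- K * s) * (E' s - K * (E s + 1 / real m))"
        by (simp add: algebra_simps)
      moreover have "\<dots> \<le> 0" using E'le[OF sT] by (simp add: mult_nonneg_nonpos)
      ultimately show "\<exists>y. (H has_real_derivative y) (at s) \<and> y \<le> 0" by metis
    next
      show "continuous_on {0..t} H" unfolding H_def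
        by (intro continuous_intros continuous_on_subset[OF cE]) (use t in auto)
    qed
    moreover have "E 0 = 0" unfolding E_def e_def c0 by (rule sum.neutral) (auto simp: tr_def)
    ultimately have "exp (- K * t) * (E t + 1 / real m) \<le> 1 / real m" unfolding H_def by simp
    then have "exp (K * t) * (exp (- K * t) * (E t + 1 / real m)) \<le> exp (K * t) * (1 / real m)" by (intro mult_left_mono) auto
    then have "E t + 1 / real m \<le> exp (K * t) / real m" by (simp add: mult.assoc[symmetric] flip: exp_add)
    moreover have "(\<Sum>k=1..m. (cmod (c t k - g t k))\<^sup>2) \<le> E t"
      unfolding E_def e_def by (intro sum_mono) (auto simp: algebra_simps)
    ultimately show ?thesis using m by (smt (verit) divide_nonneg_nonneg of_nat_0_le_iff)
  qed
  note main = this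
  show ?thesis
  proof (intro exI[of _ K] conjI allI impI K)
    fix m :: nat and c g :: "real \<Rightarrow> nat \<Rightarrow> complex" and T t :: real
    assume a: "1 \<le> m" "gal m c" "\<forall>t\<ge>0. nrm2 4 (c t) \<le> \<rho>0" "c 0 = tr m (g 0)"
      "\<forall>t\<in>{0..T}. hseq 4 (g t) \<and> nrm2 4 (g t) \<le> \<rho>0" "\<forall>k. continuous_on {0..T} (\<lambda>t. g t k)"
      "\<forall>t\<in>{0<..<T}. \<forall>k\<in>{1..m}. ((\<lambda>t. g t k) has_vector_derivative - (\<i> * of_nat k * fc (Fl (g t)) k)) (at t)"
      "t \<in> {0..T}"
    show "(\<Sum>k=1..m. (cmod (c t k - g t k))\<^sup>2) \<le> exp (K * t) / real m"
      by (rule main[of m c g T t]) (use a in blast)+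
  qed
qed

end

section \<open>Passage to the limit\<close>

lemma limit_hseq:
  assumes f: "\<And>m. fin (N m) (c m)" and b: "\<And>m. nrm2 s (c m) \<le> B"
    and l: "\<And>k. (\<lambda>m. c m k) \<longlonglongrightarrow> g k"
  shows "hseq s g" "nrm2 s g \<le> B"
proof -
  have "(\<lambda>m. c m 0) \<longlonglongrightarrow> 0" using finD0[OF f] by simp
  then have g0: "g 0 = 0" using l[of 0] LIMSEQ_unique by blast
  \<comment> \<open>As in Fatou's lemma, finite partial sums pass to the limit and keep the uniform
    bound.\<close>
  have le: "(\<Sum>k<n. (real k ^ s * cmod (g k))\<^sup>2) \<le> B" for n
  proof (rule LIMSEQ_le_const2)
    show "(\<lambda>m. \<Sum>k<n. (real k ^ s * cmod (c m k))\<^sup>2) \<longlonglongrightarrow> (\<Sum>k<n. (real k ^ s * cmod (g k))\<^sup>2)"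
      by (intro tendsto_intros l)
    have "(\<Sum>k<n. (real k ^ s * cmod (c m k))\<^sup>2) \<le> B" for m
    proof -
      have "(\<Sum>k<n. (real k ^ s * cmod (c m k))\<^sup>2) \<le> nrm2 s (c m)"
        unfolding nrm2_def by (rule sum_le_suminf) (use fin_hseq[OF f[of m]] in \<open>auto simp: hseq_def\<close>)
      then show ?thesis using b[of m] by simp
    qed
    then show "\<exists>M. \<forall>m\<ge>M. (\<Sum>k<n. (real k ^ s * cmod (c m k))\<^sup>2) \<le> B" by blast
  qed
  then have S: "summable (\<lambda>k. (real k ^ s * cmod (g k))\<^sup>2)" by (intro summableI_nonneg_bounded) auto
  then show "hseq s g" using g0 by (simp add: hseq_def)
  show "nrm2 s g \<le> B" unfolding nrm2_def by (rule suminf_le_const[OF S le])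
qed

lemma exp_div_tendsto: "(\<lambda>m. a / real (m + 2)) \<longlonglongrightarrow> 0" for a :: real
proof -
  have "filterlim (\<lambda>m. real (m + 2)) at_top sequentially"
    by (rule filterlim_compose[OF filterlim_real_sequentially]) (rule filterlim_add_const_nat_at_top)
  then show ?thesis by (rule real_tendsto_divide_at_top[OF tendsto_const])
qed

context film
begin

text \<open>Closeness of finitely many coefficients handles the low modes, the H^4 bound handles the
  tail. Choosing N first and then B makes the flux difference uniformly small.\<close>

lemma Fl_diff_bound:
  "\<exists>L>0. \<forall>c g N B x. hseq 4 c \<longrightarrow> hseq 4 g \<longrightarrow> nrm2 4 c \<le> \<rho>0 \<longrightarrow> nrm2 4 g \<le> \<rho>0 \<longrightarrow> 1 \<le> N \<longrightarrow> 0 \<le> B \<longrightarrow>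
    (\<forall>k\<in>{1..N}. cmod (c k - g k) \<le> B) \<longrightarrow>
    \<bar>Fl c x - Fl g x\<bar> \<le> L * (real (Suc N) * (1 + real N ^ 3) * B + 4 * sqrt (\<rho>0 / real N))"
proof -
  obtain a L where aL: "0 < L" and
    P1: "\<And>v w v' w'. reg v w \<Longrightarrow> reg v' w' \<Longrightarrow> \<bar>Phi (hbar + v) w - Phi (hbar + v') w'\<bar> \<le> L * (\<bar>v - v'\<bar> + \<bar>w - w'\<bar>)"
    using Phi_estimates by blast
  have "\<bar>Fl c x - Fl g x\<bar> \<le> L * (real (Suc N) * (1 + real N ^ 3) * B + 4 * sqrt (\<rho>0 / real N))"
    if h: "hseq 4 c" "hseq 4 g" and n: "nrm2 4 c \<le> \<rho>0" "nrm2 4 g \<le> \<rho>0" and N: "1 \<le> N" and B: "0 \<le> B"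
      and cg: "\<forall>k\<in>{1..N}. cmod (c k - g k) \<le> B" for c g N B x
  proof -
    define q where "q = sqrt (\<rho>0 / real N)"
    have t: "\<bar>fser d x - fser (tr N d) x\<bar> \<le> q" "\<bar>fser (Ls d) x - fser (Ls (tr N d)) x\<bar> \<le> q"
      if "hseq 4 d" "nrm2 4 d \<le> \<rho>0" for d
    proof -
      have "sqrt (nrm2 4 d / real N) \<le> q" unfolding q_def using that(2) by (simp add: divide_right_mono)
      then show "\<bar>fser d x - fser (tr N d) x\<bar> \<le> q" "\<bar>fser (Ls d) x - fser (Ls (tr N d)) x\<bar> \<le> q"
        using fser_tail_small[OF that(1) N, of x] by simp_all
    qed
    have b: "norm (tr N c k - tr N g k) \<le> B" for k using cg B by (auto simp: tr_def)
    note d = fser_diff_bound[OF fin_tr fin_tr b B, of x]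
    have 1: "\<bar>fser c x - fser g x\<bar> \<le> real (Suc N) * B + 2 * q"
      using t(1)[OF h(1) n(1)] t(1)[OF h(2) n(2)] d(1) by linarith
    have 2: "\<bar>fser (Ls c) x - fser (Ls g) x\<bar> \<le> real (Suc N) * (real N ^ 3 * B) + 2 * q"
      using t(2)[OF h(1) n(1)] t(2)[OF h(2) n(2)] d(2) by linarith
    have "\<bar>Fl c x - Fl g x\<bar> \<le> L * (\<bar>fser c x - fser g x\<bar> + \<bar>fser (Ls c) x - fser (Ls g) x\<bar>)"
      unfolding Fl_Phi by (rule P1[OF reg_small[OF h(1) n(1)] reg_small[OF h(2) n(2)]])
    also have "\<dots> \<le> L * ((real (Suc N) * B + 2 * q) + (real (Suc N) * (real N ^ 3 * B) + 2 * q))"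
      using 1 2 aL by (intro mult_left_mono add_mono) auto
    also have "\<dots> = L * (real (Suc N) * (1 + real N ^ 3) * B + 4 * q)" by (simp add: algebra_simps)
    finally show ?thesis unfolding q_def .
  qed
  then show ?thesis using aL by blast
qed

text \<open>The linear growth bound on the H^4 norm is recorded for continuity at time 0, where
  smoothing gives nothing. The bounds of orders 10 and 5 on compact intervals of positive times give
  continuity and differentiability in H^4 there.\<close>

lemma limit_exists:
  "\<exists>C\<ge>1. \<exists>\<delta>>0. \<forall>a0. hseq 4 a0 \<longrightarrow> nrm2 4 a0 \<le> \<delta> \<longrightarrow> (\<exists>g. g 0 = a0 \<and>
     (\<forall>t\<ge>0. hseq 4 (g t) \<and> nrm2 4 (g t) \<le> C * nrm2 4 a0 \<and> nrm2 4 (g t) \<le> \<rho>0) \<and>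
     (\<forall>t\<ge>0. \<forall>k. ((\<lambda>t. g t k) has_vector_derivative - (\<i> * of_nat k * fc (Fl (g t)) k)) (at t within {0..})) \<and>
     (\<exists>K. \<forall>t\<ge>0. nrm2 4 (g t) \<le> nrm2 4 a0 + K * t) \<and>
     (\<forall>a b. 0 < a \<longrightarrow> (\<exists>B. \<forall>t\<in>{a..b}. hseq 10 (g t) \<and> nrm2 10 (g t) \<le> B \<and>
        hseq 5 (\<lambda>k. - (\<i> * of_nat k * fc (Fl (g t)) k)) \<and> nrm2 5 (\<lambda>k. - (\<i> * of_nat k * fc (Fl (g t)) k)) \<le> B)))"
proof -
  obtain C \<delta>1 where C: "1 \<le> C" and \<delta>1: "0 < \<delta>1" and gl: "\<And>m c0. 2 \<le> m \<Longrightarrow> fin m c0 \<Longrightarrow> nrm2 4 c0 \<le> \<delta>1 \<Longrightarrow>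
     \<exists>c. c 0 = c0 \<and> gal m c \<and> (\<forall>t\<ge>0. nrm2 4 (c t) \<le> C * nrm2 4 c0 \<and> nrm2 4 (c t) \<le> \<rho>0)"
    using galerkin_global by blast
  obtain r where r: "0 < r" and sm: "\<And>m c t. 2 \<le> m \<Longrightarrow> gal m c \<Longrightarrow> (\<forall>t\<ge>0. nrm2 4 (c t) \<le> r) \<Longrightarrow> 0 \<le> t \<Longrightarrow>
     nrm2 4 (c t) \<le> nrm2 4 (c 0) + 2 * D * r * t \<and>
     (D / 3 * t) ^ 3 * nrm2 10 (c t) \<le> r + 2 * D * r * (1 + D / 3 * t + (D / 3 * t)\<^sup>2 + (D / 3 * t) ^ 3) * t"
    using smoothing by blast
  obtain Kv where Kv: "0 \<le> Kv" "\<And>m c. fin m c \<Longrightarrow> nrm2 4 c \<le> 1 \<Longrightarrow> (\<Sum>k=1..m. (real k ^ 5 * cmod (vf m c k))\<^sup>2) \<le> Kv * nrm2 10 c"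
    using vf_bound by blast
  obtain K where K: "0 < K" and cmp: "\<And>m c g T t. 1 \<le> m \<Longrightarrow> gal m c \<Longrightarrow> (\<forall>t\<ge>0. nrm2 4 (c t) \<le> \<rho>0) \<Longrightarrow> c 0 = tr m (g 0) \<Longrightarrow>
     (\<forall>t\<in>{0..T}. hseq 4 (g t) \<and> nrm2 4 (g t) \<le> \<rho>0) \<Longrightarrow> (\<forall>k. continuous_on {0..T} (\<lambda>t. g t k)) \<Longrightarrow>
     (\<forall>t\<in>{0<..<T}. \<forall>k\<in>{1..m}. ((\<lambda>t. g t k) has_vector_derivative - (\<i> * of_nat k * fc (Fl (g t)) k)) (at t)) \<Longrightarrow>
     t \<in> {0..T} \<Longrightarrow> (\<Sum>k=1..m. (cmod (c t k - g t k))\<^sup>2) \<le> exp (K * t) / real m"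
    using comparison by blast
  obtain L where L: "0 < L" and FL: "\<And>c g N B x. hseq 4 c \<Longrightarrow> hseq 4 g \<Longrightarrow> nrm2 4 c \<le> \<rho>0 \<Longrightarrow> nrm2 4 g \<le> \<rho>0 \<Longrightarrow> 1 \<le> N \<Longrightarrow> 0 \<le> B \<Longrightarrow>
    (\<forall>k\<in>{1..N}. cmod (c k - g k) \<le> B) \<Longrightarrow>
    \<bar>Fl c x - Fl g x\<bar> \<le> L * (real (Suc N) * (1 + real N ^ 3) * B + 4 * sqrt (\<rho>0 / real N))"
    using Fl_diff_bound by blast
  define \<delta> where "\<delta> = min \<delta>1 (r / C)"
  have \<delta>: "0 < \<delta>" "\<delta> \<le> \<delta>1" "C * \<delta> \<le> r"
  proof -
    show "0 < \<delta>" "\<delta> \<le> \<delta>1" unfolding \<delta>_def using \<delta>1 r C by auto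
    have "C * \<delta> \<le> C * (r / C)" unfolding \<delta>_def using C by (intro mult_left_mono) auto
    then show "C * \<delta> \<le> r" using C by simp
  qed
  have "\<exists>g. g 0 = a0 \<and>
     (\<forall>t\<ge>0. hseq 4 (g t) \<and> nrm2 4 (g t) \<le> C * nrm2 4 a0 \<and> nrm2 4 (g t) \<le> \<rho>0) \<and>
     (\<forall>t\<ge>0. \<forall>k. ((\<lambda>t. g t k) has_vector_derivative - (\<i> * of_nat k * fc (Fl (g t)) k)) (at t within {0..})) \<and>
     (\<exists>K. \<forall>t\<ge>0. nrm2 4 (g t) \<le> nrm2 4 a0 + K * t) \<and>
     (\<forall>a b. 0 < a \<longrightarrow> (\<exists>B. \<forall>t\<in>{a..b}. hseq 10 (g t) \<and> nrm2 10 (g t) \<le> B \<and>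
        hseq 5 (\<lambda>k. - (\<i> * of_nat k * fc (Fl (g t)) k)) \<and> nrm2 5 (\<lambda>k. - (\<i> * of_nat k * fc (Fl (g t)) k)) \<le> B))"
    if h0: "hseq 4 a0" and n0: "nrm2 4 a0 \<le> \<delta>" for a0
  proof -
    have ntr: "nrm2 4 (tr m a0) \<le> nrm2 4 a0" for m by (rule hseq_tr(1)[OF h0])
    have "\<forall>m. \<exists>c. c 0 = tr (m + 2) a0 \<and> gal (m + 2) c \<and> (\<forall>t\<ge>0. nrm2 4 (c t) \<le> C * nrm2 4 (tr (m + 2) a0) \<and> nrm2 4 (c t) \<le> \<rho>0)"
    proof
      fix m show "\<exists>c. c 0 = tr (m + 2) a0 \<and> gal (m + 2) c \<and> (\<forall>t\<ge>0. nrm2 4 (c t) \<le> C * nrm2 4 (tr (m + 2) a0) \<and> nrm2 4 (c t) \<le> \<rho>0)"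
        by (rule gl) (use ntr[of "m + 2"] n0 \<delta> in \<open>auto intro: fin_tr\<close>)
    qed
    then obtain c where c0: "\<And>m. c m 0 = tr (m + 2) a0" and G: "\<And>m. gal (m + 2) (c m)"
      and nc: "\<And>m t. 0 \<le> t \<Longrightarrow> nrm2 4 (c m t) \<le> C * nrm2 4 (tr (m + 2) a0)" "\<And>m t. 0 \<le> t \<Longrightarrow> nrm2 4 (c m t) \<le> \<rho>0"
      by metis
    have f: "fin (m + 2) (c m t)" if "0 \<le> t" for m t using G[of m] that by (simp add: gal_def)
    have h: "hseq s (c m t)" if "0 \<le> t" for s m t by (rule fin_hseq[OF f[OF that]])
    have nC: "nrm2 4 (c m t) \<le> C * nrm2 4 a0" if "0 \<le> t" for m t
      by (rule order_trans[OF nc(1)[OF that] mult_left_mono[OF ntr]]) (use C in simp)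
    have nr: "nrm2 4 (c m t) \<le> r" if "0 \<le> t" for m t
      by (rule order_trans[OF nC[OF that] order_trans[OF mult_left_mono[OF n0] \<delta>(3)]]) (use C in simp)
    have cD: "((\<lambda>t. c m t k) has_vector_derivative vf (m + 2) (c m t) k) (at t within {0..})" if "0 \<le> t" for m t k
      using G[of m] that by (simp add: gal_def)
    have cc: "continuous_on {0..T} (\<lambda>t. c m t k)" for m k T
    proof -
      have "continuous_on {0..} (\<lambda>t. c m t k)" by (rule continuous_on_vector_derivative) (use cD in auto)
      then show ?thesis by (rule continuous_on_subset) auto
    qed
    \<comment> \<open>A finer Galerkin approximation solves the untruncated equations in its first m
      + 2 modes, so it is admissible as the second curve of \<open>comparison\<close>.\<close>
    have cmp1: "(\<Sum>k=1..m+2. (cmod (c m t k - c n t k))\<^sup>2) \<le> exp (K * t) / real (m + 2)"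
      if mn: "m \<le> n" and t: "0 \<le> t" for m n t
    proof (rule cmp[where T = t])
      show "c m 0 = tr (m + 2) (c n 0)" unfolding c0 using mn by (auto simp: tr_def)
      show "\<forall>s\<in>{0<..<t}. \<forall>k\<in>{1..m+2}. ((\<lambda>t. c n t k) has_vector_derivative - (\<i> * of_nat k * fc (Fl (c n s)) k)) (at s)"
      proof (intro ballI)
        fix s k assume s: "s \<in> {0<..<t}" and k: "k \<in> {1..m+2}"
        have "at s within {0..} = at s" using s by (intro at_within_interior) auto
        moreover have "vf (n + 2) (c n s) k = - (\<i> * of_nat k * fc (Fl (c n s)) k)" using k mn by (simp add: vf_def)
        ultimately show "((\<lambda>t. c n t k) has_vector_derivative - (\<i> * of_nat k * fc (Fl (c n s)) k)) (at s)"
          using cD[of s n k] s by simp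
      qed
    qed (use G nc(2) h cc t in auto)
    have cmpk: "cmod (c m t k - c n t k) \<le> sqrt (exp (K * t) / real (m + 2))"
      if "m \<le> n" "0 \<le> t" "k \<in> {1..m+2}" for m n t k
    proof (rule real_le_rsqrt)
      show "(cmod (c m t k - c n t k))\<^sup>2 \<le> exp (K * t) / real (m + 2)"
        using member_le_sum[of k "{1..m+2}" "\<lambda>k. (cmod (c m t k - c n t k))\<^sup>2"] cmp1[OF that(1,2)] that(3) by simp
    qed
    have sq0: "(\<lambda>m. sqrt (a / real (m + 2))) \<longlonglongrightarrow> 0" for a
      using tendsto_real_sqrt[OF exp_div_tendsto[of a]] by simp
    have conv: "convergent (\<lambda>m. c m t k)" if t: "0 \<le> t" for t k
    proof (cases "k = 0")
      case True
      then have "(\<lambda>m. c m t k) = (\<lambda>m. 0)" using finD0[OF f[OF t]] by auto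
      then show ?thesis by (simp add: convergent_const)
    next
      case False
      have "Cauchy (\<lambda>m. c m t k)"
      proof (rule metric_CauchyI)
        fix e :: real assume e: "0 < e"
        have "\<forall>\<^sub>F m in sequentially. sqrt (exp (K * t) / real (m + 2)) < e"
          using sq0 e by (rule order_tendstoD(2))
        then obtain M where M: "\<And>m. m \<ge> M \<Longrightarrow> sqrt (exp (K * t) / real (m + 2)) < e"
          by (auto simp: eventually_sequentially)
        have *: "dist (c m t k) (c n t k) < e" if "max M k \<le> m" "m \<le> n" for m n
          using cmpk[OF that(2) t, of k] M[of m] that False by (simp add: dist_norm)
        show "\<exists>M. \<forall>m\<ge>M. \<forall>n\<ge>M. dist (c m t k) (c n t k) < e"
        proof (intro exI[of _ "max M k"] allI impI)
          fix m n assume mn: "max M k \<le> m" "max M k \<le> n"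
          show "dist (c m t k) (c n t k) < e"
            using *[of m n] *[of n m] mn by (cases "m \<le> n") (auto simp: dist_commute)
        qed
      qed
      then show ?thesis by (rule Cauchy_convergent)
    qed
    define g where "g t k = (if t \<le> 0 then a0 k else lim (\<lambda>m. c m t k))" for t k
    have lim: "(\<lambda>m. c m t k) \<longlonglongrightarrow> g t k" if t: "0 \<le> t" for t k
    proof (cases "t = 0")
      case True
      have "c m t k = g t k" if "m \<ge> k" for m
        using that h0 True by (cases "k = 0") (auto simp: c0 g_def tr_def hseq_def)
      then show ?thesis by (intro tendsto_eventually eventually_sequentiallyI[of k])
    next
      case False
      then show ?thesis using convergent_LIMSEQ_iff[THEN iffD1, OF conv[OF t, of k]] t by (simp add: g_def)
    qed
    have g0: "g 0 = a0" by (auto simp: g_def)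
    have close: "cmod (c m t k - g t k) \<le> sqrt (exp (K * t) / real (m + 2))" if t: "0 \<le> t" and k: "k \<in> {1..m+2}" for m t k
    proof (rule LIMSEQ_le_const2)
      show "(\<lambda>n. cmod (c m t k - c n t k)) \<longlonglongrightarrow> cmod (c m t k - g t k)" by (intro tendsto_intros lim t)
      show "\<exists>N. \<forall>n\<ge>N. cmod (c m t k - c n t k) \<le> sqrt (exp (K * t) / real (m + 2))"
        using cmpk[OF _ t k] by blast
    qed
    have hg: "hseq 4 (g t)" "nrm2 4 (g t) \<le> C * nrm2 4 a0" "nrm2 4 (g t) \<le> \<rho>0" "nrm2 4 (g t) \<le> nrm2 4 a0 + 2 * D * r * t"
      if t: "0 \<le> t" for t
    proof -
      show "hseq 4 (g t)" "nrm2 4 (g t) \<le> C * nrm2 4 a0"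
        by (rule limit_hseq[OF f[OF t] nC[OF t] lim[OF t]])+
      show "nrm2 4 (g t) \<le> \<rho>0" by (rule limit_hseq(2)[OF f[OF t] nc(2)[OF t] lim[OF t]])
      have "nrm2 4 (c m t) \<le> nrm2 4 a0 + 2 * D * r * t" for m
      proof -
        have "nrm2 4 (c m t) \<le> nrm2 4 (c m 0) + 2 * D * r * t" using sm[OF _ G _ t, of m] nr by auto
        then show ?thesis using ntr[of "m + 2"] unfolding c0 by simp
      qed
      then show "nrm2 4 (g t) \<le> nrm2 4 a0 + 2 * D * r * t" by (rule limit_hseq(2)[OF f[OF t] _ lim[OF t]])
    qed
    \<comment> \<open>First N is fixed to make the tails small, then m is taken large enough for the
      N low modes; the rate is uniform on {0..T}.\<close>
    have Fconv: "\<exists>M. \<forall>m\<ge>M. \<forall>t\<in>{0..T}. norm (fc (Fl (c m t)) k - fc (Fl (g t)) k) \<le> e" if e: "0 < e" for e T k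
    proof -
      have "(\<lambda>N. 8 * L * sqrt (\<rho>0 / real (N + 2))) \<longlonglongrightarrow> 8 * L * 0" by (intro tendsto_intros sq0)
      then have "\<forall>\<^sub>F N in sequentially. 8 * L * sqrt (\<rho>0 / real (N + 2)) < e / 2" using e by (intro order_tendstoD(2)) auto
      then obtain N' where N': "8 * L * sqrt (\<rho>0 / real (N' + 2)) < e / 2" by (auto simp: eventually_sequentially)
      define N where "N = N' + 2"
      define Q where "Q = 2 * L * (real (Suc N) * (1 + real N ^ 3))"
      have "(\<lambda>m. Q * sqrt (exp (K * T) / real (m + 2))) \<longlonglongrightarrow> Q * 0" by (intro tendsto_intros sq0)
      then have "\<forall>\<^sub>F m in sequentially. Q * sqrt (exp (K * T) / real (m + 2)) < e / 2" using e by (intro order_tendstoD(2)) auto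
      then obtain M where M: "\<And>m. m \<ge> M \<Longrightarrow> Q * sqrt (exp (K * T) / real (m + 2)) < e / 2" by (auto simp: eventually_sequentially)
      have "norm (fc (Fl (c m t)) k - fc (Fl (g t)) k) \<le> e" if m: "m \<ge> max M N" and t: "t \<in> {0..T}" for m t
      proof -
        have t0: "0 \<le> t" using t by simp
        define B where "B = sqrt (exp (K * T) / real (m + 2))"
        have cB: "\<forall>k\<in>{1..N}. cmod (c m t k - g t k) \<le> B"
        proof
          fix k assume "k \<in> {1..N}"
          then have "cmod (c m t k - g t k) \<le> sqrt (exp (K * t) / real (m + 2))" using m by (intro close t0) auto
          also have "\<dots> \<le> B" unfolding B_def using t K by (intro real_sqrt_le_mono divide_right_mono) auto
          finally show "cmod (c m t k - g t k) \<le> B" .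
        qed
        have N1: "1 \<le> N" and B0: "0 \<le> B" by (auto simp: N_def B_def)
        have "\<bar>Fl (c m t) x - Fl (g t) x\<bar> \<le> L * (real (Suc N) * (1 + real N ^ 3) * B + 4 * sqrt (\<rho>0 / real N))" for x
          by (rule FL[OF h[OF t0] hg(1)[OF t0] nc(2)[OF t0] hg(3)[OF t0] N1 B0 cB])
        moreover have i: "integrable circle (Fl (c m t))" "integrable circle (Fl (g t))"
          by (rule circle_integrable[OF Fl_continuous[OF h[OF t0]]], rule circle_integrable[OF Fl_continuous[OF hg(1)[OF t0]]])
        ultimately have "norm (fc (\<lambda>x. Fl (c m t) x - Fl (g t) x) k) \<le> 2 * (L * (real (Suc N) * (1 + real N ^ 3) * B + 4 * sqrt (\<rho>0 / real N)))"
          by (intro fc_bound) auto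
        also have "\<dots> = Q * B + 8 * L * sqrt (\<rho>0 / real (N' + 2))" unfolding Q_def by (simp add: N_def algebra_simps)
        also have "\<dots> \<le> e" using M[of m] m N' unfolding B_def by simp
        finally show ?thesis unfolding fc_diff[OF i] .
      qed
      then show ?thesis by blast
    qed
    have gD: "((\<lambda>t. g t k) has_vector_derivative - (\<i> * of_nat k * fc (Fl (g t)) k)) (at t within {0..})" if t: "0 \<le> t" for t k
    proof -
      define T where "T = t + 1"
      \<comment> \<open>The index is shifted by k so that mode k is never truncated. Uniform
        convergence of the derivatives then allows differentiating the limit.\<close>
      have "\<exists>u. \<forall>s\<in>{0..T}. (\<lambda>m. c (m + k) s k) \<longlonglongrightarrow> u s \<and> (u has_derivative (\<lambda>h. h *\<^sub>R - (\<i> * of_nat k * fc (Fl (g s)) k))) (at s within {0..T})"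
      proof (rule has_derivative_sequence[where f' = "\<lambda>m s h. h *\<^sub>R - (\<i> * of_nat k * fc (Fl (c (m + k) s)) k)" and ?x0.0 = 0])
        show "((\<lambda>s. c (m + k) s k) has_derivative (\<lambda>h. h *\<^sub>R - (\<i> * of_nat k * fc (Fl (c (m + k) s)) k))) (at s within {0..T})"
          if "s \<in> {0..T}" for m s
        proof -
          have "vf (m + k + 2) (c (m + k) s) k = - (\<i> * of_nat k * fc (Fl (c (m + k) s)) k)" by (auto simp: vf_def)
          then have "((\<lambda>s. c (m + k) s k) has_vector_derivative - (\<i> * of_nat k * fc (Fl (c (m + k) s)) k)) (at s within {0..})"
            using cD[of s "m + k" k] that by simp
          then have "((\<lambda>s. c (m + k) s k) has_vector_derivative - (\<i> * of_nat k * fc (Fl (c (m + k) s)) k)) (at s within {0..T})"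
            by (rule has_vector_derivative_within_subset) auto
          then show ?thesis by (simp add: has_vector_derivative_def)
        qed
        show "\<forall>\<^sub>F m in sequentially. \<forall>s\<in>{0..T}. \<forall>h. norm (h *\<^sub>R - (\<i> * of_nat k * fc (Fl (c (m + k) s)) k) - h *\<^sub>R - (\<i> * of_nat k * fc (Fl (g s)) k)) \<le> e * norm h"
          if e: "0 < e" for e
        proof -
          have "0 < e / (real k + 1)" using e by simp
          then obtain M where M: "\<And>m s. m \<ge> M \<Longrightarrow> s \<in> {0..T} \<Longrightarrow> norm (fc (Fl (c m s)) k - fc (Fl (g s)) k) \<le> e / (real k + 1)"
            using Fconv by blast
          have "norm (h *\<^sub>R - (\<i> * of_nat k * fc (Fl (c (m + k) s)) k) - h *\<^sub>R - (\<i> * of_nat k * fc (Fl (g s)) k)) \<le> e * norm h"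
            if "m \<ge> M" "s \<in> {0..T}" for m s h
          proof -
            have "h *\<^sub>R - (\<i> * of_nat k * fc (Fl (c (m + k) s)) k) - h *\<^sub>R - (\<i> * of_nat k * fc (Fl (g s)) k) =
              h *\<^sub>R (- (\<i> * of_nat k) * (fc (Fl (c (m + k) s)) k - fc (Fl (g s)) k))" by (simp add: algebra_simps)
            then have "norm (h *\<^sub>R - (\<i> * of_nat k * fc (Fl (c (m + k) s)) k) - h *\<^sub>R - (\<i> * of_nat k * fc (Fl (g s)) k)) =
              \<bar>h\<bar> * (real k * norm (fc (Fl (c (m + k) s)) k - fc (Fl (g s)) k))" by (simp add: norm_mult)
            also have "\<dots> \<le> \<bar>h\<bar> * ((real k + 1) * (e / (real k + 1)))"
              using M[of "m + k" s] that by (intro mult_left_mono mult_mono) auto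
            also have "\<dots> = e * norm h" by simp
            finally show ?thesis .
          qed
          then show ?thesis unfolding eventually_sequentially by blast
        qed
        show "(\<lambda>m. c (m + k) 0 k) \<longlonglongrightarrow> g 0 k" using LIMSEQ_ignore_initial_segment[OF lim[of 0 k], of k] by simp
      qed (use t in \<open>auto simp: T_def\<close>)
      then obtain u where u: "\<And>s. s \<in> {0..T} \<Longrightarrow> (\<lambda>m. c (m + k) s k) \<longlonglongrightarrow> u s"
        "\<And>s. s \<in> {0..T} \<Longrightarrow> (u has_vector_derivative - (\<i> * of_nat k * fc (Fl (g s)) k)) (at s within {0..T})"
        unfolding has_vector_derivative_def by blast
      have us: "u s = g s k" if "s \<in> {0..T}" for s
        using LIMSEQ_unique[OF u(1)[OF that] LIMSEQ_ignore_initial_segment[OF lim[of s k], of k]] that by simp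
      have "((\<lambda>t. g t k) has_vector_derivative - (\<i> * of_nat k * fc (Fl (g t)) k)) (at t within {0..T})"
        by (rule has_vector_derivative_transform[OF _ _ u(2)]) (use us t in \<open>auto simp: T_def\<close>)
      moreover have "at t within {0..T} = at t within {0..}"
        by (rule at_within_nhd[of t "{..<t+1}"]) (auto simp: T_def)
      ultimately show ?thesis by simp
    qed
    have reg: "\<exists>B. \<forall>t\<in>{a..b}. hseq 10 (g t) \<and> nrm2 10 (g t) \<le> B \<and>
        hseq 5 (\<lambda>k. - (\<i> * of_nat k * fc (Fl (g t)) k)) \<and> nrm2 5 (\<lambda>k. - (\<i> * of_nat k * fc (Fl (g t)) k)) \<le> B" if a: "0 < a" for a b
    proof -
      \<comment> \<open>The smoothing bound, divided by its weight at the left end a of the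
        interval; it blows up as a tends to 0.\<close>
      define B1 where "B1 = (r + 2 * D * r * (1 + D / 3 * b + (D / 3 * b)\<^sup>2 + (D / 3 * b) ^ 3) * b) / (D / 3 * a) ^ 3"
      define B where "B = max B1 (Kv * B1)"
      have "hseq 10 (g t) \<and> nrm2 10 (g t) \<le> B \<and>
        hseq 5 (\<lambda>k. - (\<i> * of_nat k * fc (Fl (g t)) k)) \<and> nrm2 5 (\<lambda>k. - (\<i> * of_nat k * fc (Fl (g t)) k)) \<le> B"
        if t: "t \<in> {a..b}" for t
      proof -
        have t0: "0 \<le> t" using t a by simp
        have n10: "nrm2 10 (c m t) \<le> B1" for m
        proof -
          have Da: "0 < D / 3 * a" "D / 3 * a \<le> D / 3 * t" "D / 3 * t \<le> D / 3 * b" using D_pos a t by auto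
          have "(D / 3 * a) ^ 3 * nrm2 10 (c m t) \<le> (D / 3 * t) ^ 3 * nrm2 10 (c m t)"
            using Da nrm2_nonneg[OF h[OF t0]] by (intro mult_right_mono power_mono) auto
          also have "\<dots> \<le> r + 2 * D * r * (1 + D / 3 * t + (D / 3 * t)\<^sup>2 + (D / 3 * t) ^ 3) * t"
            using sm[OF _ G _ t0, of m] nr by auto
          also have "\<dots> \<le> r + 2 * D * r * (1 + D / 3 * b + (D / 3 * b)\<^sup>2 + (D / 3 * b) ^ 3) * b"
            using Da r D_pos t t0 by (intro add_mono mult_mono mult_nonneg_nonneg add_nonneg_nonneg power_mono) auto
          finally show ?thesis
            unfolding B1_def pos_le_divide_eq[OF zero_less_power[OF Da(1)]] by (simp only: mult.commute[of "nrm2 10 (c m t)"])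
        qed
        have n1: "nrm2 4 (c m t) \<le> 1" for m using nc(2)[OF t0, of m] by (simp add: \<rho>0_def)
        have fv: "fin (m + 2) (vf (m + 2) (c m t))" for m by (simp add: fin_def vf_def)
        have n5: "nrm2 5 (vf (m + 2) (c m t)) \<le> Kv * B1" for m
        proof -
          have "nrm2 5 (vf (m + 2) (c m t)) \<le> Kv * nrm2 10 (c m t)"
            unfolding fin_nrm2_atLeast[OF fv] by (rule Kv(2)[OF f[OF t0] n1])
          also have "\<dots> \<le> Kv * B1" by (rule mult_left_mono[OF n10 Kv(1)])
          finally show ?thesis .
        qed
        have lv: "(\<lambda>m. vf (m + 2) (c m t) k) \<longlonglongrightarrow> - (\<i> * of_nat k * fc (Fl (g t)) k)" for k
        proof -
          have "(\<lambda>m. fc (Fl (c m t)) k) \<longlonglongrightarrow> fc (Fl (g t)) k"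
          proof (rule metric_LIMSEQ_I)
            fix e :: real assume "0 < e"
            then obtain M where "\<forall>m\<ge>M. \<forall>s\<in>{0..t}. norm (fc (Fl (c m s)) k - fc (Fl (g s)) k) \<le> e / 2"
              using Fconv[of "e / 2" t k] by auto
            then show "\<exists>M. \<forall>m\<ge>M. dist (fc (Fl (c m t)) k) (fc (Fl (g t)) k) < e"
              using \<open>0 < e\<close> t0 by (intro exI[of _ M]) (force simp: dist_norm)
          qed
          then have "(\<lambda>m. - (\<i> * of_nat k * fc (Fl (c m t)) k)) \<longlonglongrightarrow> - (\<i> * of_nat k * fc (Fl (g t)) k)"
            by (intro tendsto_intros)
          then show ?thesis
            by (rule Lim_transform_eventually) (auto simp: vf_def intro!: eventually_sequentiallyI[of k])
        qed
        have "nrm2 10 (c m t) \<le> B" "nrm2 5 (vf (m + 2) (c m t)) \<le> B" for m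
          using n10[of m] n5[of m] by (auto simp: B_def)
        then show ?thesis
          using limit_hseq[OF f[OF t0] _ lim[OF t0], of 10 B] limit_hseq[OF fv _ lv, of 5 B] by blast
      qed
      then show ?thesis by blast
    qed
    show ?thesis
      by (intro exI[of _ g] conjI allI impI g0 hg gD reg exI[of _ "2 * D * r"])
  qed
  then show ?thesis using C \<delta>(1) by blast
qed

end

section \<open>Norm convergence from convergence of coefficients\<close>

definition hsum :: "nat \<Rightarrow> nat \<Rightarrow> (nat \<Rightarrow> complex) \<Rightarrow> real" where
  "hsum s N d = (\<Sum>k<N. (real k ^ s * cmod (d k))\<^sup>2)"

lemma hsum_le: "hseq s d \<Longrightarrow> hsum s N d \<le> nrm2 s d"
  unfolding hsum_def nrm2_def hseq_def by (rule sum_le_suminf) auto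

lemma hseq_summable: "hseq s d \<Longrightarrow> summable (\<lambda>k. (real k ^ s * cmod (d k))\<^sup>2)"
  by (simp add: hseq_def)

lemma nrm2_split:
  assumes "hseq s d"
  shows "nrm2 s d = hsum s N d + (\<Sum>k. (real (k + N) ^ s * cmod (d (k + N)))\<^sup>2)"
  unfolding nrm2_def hsum_def
  using suminf_split_initial_segment[OF hseq_summable[OF assms], of N] by simp

lemma hsum_tendsto:
  assumes "\<And>k. ((\<lambda>s. d s k) \<longlongrightarrow> 0) F"
  shows "((\<lambda>s. hsum j N (d s)) \<longlongrightarrow> 0) F"
proof -
  have "((\<lambda>s. \<Sum>k<N. (real k ^ j * cmod (d s k))\<^sup>2) \<longlongrightarrow> (\<Sum>k<N. (real k ^ j * cmod 0)\<^sup>2)) F"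
    by (intro tendsto_intros assms)
  then show ?thesis unfolding hsum_def by simp
qed

lemma nrm2_tail_le:
  assumes h: "hseq (Suc j) d" and N: "1 \<le> N"
  shows "nrm2 j d \<le> hsum j N d + nrm2 (Suc j) d / (real N)\<^sup>2"
proof -
  have hj: "hseq j d" by (rule hseq_mono[OF h]) simp
  have S: "summable (\<lambda>k. (real (k + N) ^ j * cmod (d (k + N)))\<^sup>2)" "summable (\<lambda>k. (real (k + N) ^ Suc j * cmod (d (k + N)))\<^sup>2)"
    using summable_iff_shift[of "\<lambda>k. (real k ^ j * cmod (d k))\<^sup>2" N] summable_iff_shift[of "\<lambda>k. (real k ^ Suc j * cmod (d k))\<^sup>2" N]
      hseq_summable[OF hj] hseq_summable[OF h] by simp_all
  have "(real (k + N) ^ j * cmod (d (k + N)))\<^sup>2 \<le> (real (k + N) ^ Suc j * cmod (d (k + N)))\<^sup>2 / (real N)\<^sup>2" for k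
  proof -
    have "real N * (real (k + N) ^ j * cmod (d (k + N))) \<le> real (k + N) * (real (k + N) ^ j * cmod (d (k + N)))"
      by (intro mult_right_mono) auto
    then have "(real N * (real (k + N) ^ j * cmod (d (k + N))))\<^sup>2 \<le> (real (k + N) ^ Suc j * cmod (d (k + N)))\<^sup>2"
      by (intro power_mono) (auto simp: mult.assoc)
    then show ?thesis using N by (simp add: power_mult_distrib field_simps)
  qed
  then have "(\<Sum>k. (real (k + N) ^ j * cmod (d (k + N)))\<^sup>2) \<le> (\<Sum>k. (real (k + N) ^ Suc j * cmod (d (k + N)))\<^sup>2 / (real N)\<^sup>2)"
    by (intro suminf_le S summable_divide)
  also have "\<dots> = (\<Sum>k. (real (k + N) ^ Suc j * cmod (d (k + N)))\<^sup>2) / (real N)\<^sup>2"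
    by (rule suminf_divide[OF S(2)])
  also have "\<dots> \<le> nrm2 (Suc j) d / (real N)\<^sup>2"
    unfolding nrm2_split[OF h, of N] by (intro divide_right_mono) (auto simp: hsum_def intro: sum_nonneg)
  finally show ?thesis unfolding nrm2_split[OF hj, of N] by simp
qed

text \<open>A compactness argument made explicit: a bound one order higher makes the tails beyond N
  uniformly of size 1 / N^2, and finitely many coefficients converge.\<close>

lemma nrm2_tendsto_0:
  assumes ev: "\<forall>\<^sub>F s in F. hseq (Suc j) (d s) \<and> nrm2 (Suc j) (d s) \<le> B"
    and l: "\<And>k. ((\<lambda>s. d s k) \<longlongrightarrow> 0) F"
  shows "((\<lambda>s. nrm2 j (d s)) \<longlongrightarrow> 0) F"
proof (rule tendstoI)
  fix e :: real assume e: "0 < e"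
  have "filterlim (\<lambda>N. (real N)\<^sup>2) at_top sequentially"
    by (intro filterlim_pow_at_top filterlim_real_sequentially) auto
  then have "(\<lambda>N. \<bar>B\<bar> / (real N)\<^sup>2) \<longlonglongrightarrow> 0" by (rule real_tendsto_divide_at_top[OF tendsto_const])
  then have "\<forall>\<^sub>F N in sequentially. \<bar>B\<bar> / (real N)\<^sup>2 < e / 2 \<and> 1 \<le> N"
    using e by (intro eventually_conj order_tendstoD(2) eventually_ge_at_top) auto
  then obtain N where N: "\<bar>B\<bar> / (real N)\<^sup>2 < e / 2" "1 \<le> N" by (auto simp: eventually_sequentially)
  have "\<forall>\<^sub>F s in F. hsum j N (d s) < e / 2"
    using hsum_tendsto[where d = d, OF l, of j N] e by (intro order_tendstoD(2)) auto
  then show "\<forall>\<^sub>F s in F. dist (nrm2 j (d s)) 0 < e"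
    using ev
  proof eventually_elim
    case (elim s)
    have "nrm2 (Suc j) (d s) / (real N)\<^sup>2 \<le> \<bar>B\<bar> / (real N)\<^sup>2" using elim by (intro divide_right_mono) auto
    then have "nrm2 j (d s) < e" using nrm2_tail_le[of j "d s" N] elim N by linarith
    moreover have "0 \<le> nrm2 j (d s)" using elim hseq_mono[of "Suc j" "d s" j] by (intro nrm2_nonneg) auto
    ultimately show ?case by (simp add: dist_real_def)
  qed
qed

lemma hseq_diff:
  assumes "hseq s c" "hseq s d"
  shows "hseq s (\<lambda>k. c k - d k)" "nrm2 s (\<lambda>k. c k - d k) \<le> 2 * nrm2 s c + 2 * nrm2 s d"
proof -
  have le: "(real k ^ s * cmod (c k - d k))\<^sup>2 \<le> 2 * (real k ^ s * cmod (c k))\<^sup>2 + 2 * (real k ^ s * cmod (d k))\<^sup>2" for k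
  proof -
    have "real k ^ s * cmod (c k - d k) \<le> real k ^ s * cmod (c k) + real k ^ s * cmod (d k)"
      using mult_left_mono[OF norm_triangle_ineq4[of "c k" "d k"], of "real k ^ s"] by (simp add: distrib_left)
    then have "(real k ^ s * cmod (c k - d k))\<^sup>2 \<le> (real k ^ s * cmod (c k) + real k ^ s * cmod (d k))\<^sup>2"
      by (intro power_mono) auto
    then show ?thesis using sum_squares_bound[of "real k ^ s * cmod (c k)" "real k ^ s * cmod (d k)"] by (simp add: power2_sum)
  qed
  have S: "summable (\<lambda>k. 2 * (real k ^ s * cmod (c k))\<^sup>2 + 2 * (real k ^ s * cmod (d k))\<^sup>2)"
    using assms by (intro summable_add summable_mult) (auto simp: hseq_def)
  then have S': "summable (\<lambda>k. (real k ^ s * cmod (c k - d k))\<^sup>2)"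
    by (rule summable_comparison_test'[of _ 0]) (use le in auto)
  then show "hseq s (\<lambda>k. c k - d k)" using assms by (simp add: hseq_def)
  have "nrm2 s (\<lambda>k. c k - d k) \<le> (\<Sum>k. 2 * (real k ^ s * cmod (c k))\<^sup>2 + 2 * (real k ^ s * cmod (d k))\<^sup>2)"
    unfolding nrm2_def by (rule suminf_le[OF le S' S])
  also have "\<dots> = 2 * nrm2 s c + 2 * nrm2 s d"
    unfolding nrm2_def using assms
    by (subst suminf_add[symmetric]) (auto simp: hseq_def suminf_mult intro: summable_mult)
  finally show "nrm2 s (\<lambda>k. c k - d k) \<le> 2 * nrm2 s c + 2 * nrm2 s d" .
qed

text \<open>Weak convergence together with convergence of the norms from above gives strong
  convergence.\<close>

lemma nrm2_tendsto_weak: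
  assumes ha: "hseq j a" and ev: "\<forall>\<^sub>F s in F. hseq j (g s) \<and> nrm2 j (g s) \<le> nrm2 j a + r s"
    and r: "(r \<longlongrightarrow> 0) F" and l: "\<And>k. ((\<lambda>s. g s k) \<longlongrightarrow> a k) F"
  shows "((\<lambda>s. nrm2 j (\<lambda>k. g s k - a k)) \<longlongrightarrow> 0) F"
proof (rule tendstoI)
  fix e :: real assume e: "0 < e"
  have "(\<lambda>N. hsum j N a) \<longlonglongrightarrow> nrm2 j a"
    unfolding hsum_def nrm2_def by (rule summable_LIMSEQ[OF hseq_summable[OF ha]])
  then have "\<forall>\<^sub>F N in sequentially. nrm2 j a - e / 16 < hsum j N a" using e by (intro order_tendstoD(1)) auto
  then obtain N where N: "nrm2 j a - e / 16 < hsum j N a" by (auto simp: eventually_sequentially)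
  have "((\<lambda>s. hsum j N (g s)) \<longlongrightarrow> hsum j N a) F" unfolding hsum_def by (intro tendsto_intros l)
  then have 1: "\<forall>\<^sub>F s in F. hsum j N a - e / 16 < hsum j N (g s)" using e by (intro order_tendstoD(1)) auto
  have "((\<lambda>s. hsum j N (\<lambda>k. g s k - a k)) \<longlongrightarrow> 0) F"
    by (rule hsum_tendsto) (use l LIM_zero in blast)
  then have 2: "\<forall>\<^sub>F s in F. hsum j N (\<lambda>k. g s k - a k) < e / 4" using e by (intro order_tendstoD(2)) auto
  have 3: "\<forall>\<^sub>F s in F. r s < e / 16" using r e by (intro order_tendstoD(2)) auto
  show "\<forall>\<^sub>F s in F. dist (nrm2 j (\<lambda>k. g s k - a k)) 0 < e"
    using ev 1 2 3
  proof eventually_elim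
    case (elim s)
    \<comment> \<open>The tail of the limit is small by the choice of N. The tail of g s is small
      because its full norm hardly exceeds that of the limit while the low modes already account for
      almost all of it.\<close>
    define t where "t k = (if k < N then 0 else g s k)" for k
    define b where "b k = (if k < N then 0 else a k)" for k
    have tl: "hseq j (\<lambda>k. if k < N then 0 else d k)" "nrm2 j (\<lambda>k. if k < N then 0 else d k) = nrm2 j d - hsum j N d"
      if "hseq j d" for d
    proof -
      have S: "summable (\<lambda>k. (real k ^ j * cmod (if k < N then 0 else d k))\<^sup>2)"
        by (rule summable_comparison_test'[OF hseq_summable[OF that], of 0]) auto
      then show h: "hseq j (\<lambda>k. if k < N then 0 else d k)" using that by (simp add: hseq_def)
      have "hsum j N (\<lambda>k. if k < N then 0 else d k) = 0" unfolding hsum_def by (rule sum.neutral) auto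
      then show "nrm2 j (\<lambda>k. if k < N then 0 else d k) = nrm2 j d - hsum j N d"
        unfolding nrm2_split[OF h, of N] nrm2_split[OF that, of N] by simp
    qed
    have ht: "hseq j t" "nrm2 j t = nrm2 j (g s) - hsum j N (g s)" and hb: "hseq j b" "nrm2 j b = nrm2 j a - hsum j N a"
      using tl[of "g s"] tl[OF ha] elim unfolding t_def b_def by auto
    have hd: "hseq j (\<lambda>k. g s k - a k)" using hseq_diff(1) elim ha by blast
    have "nrm2 j (\<lambda>k. g s k - a k) = hsum j N (\<lambda>k. g s k - a k) + nrm2 j (\<lambda>k. if k < N then 0 else g s k - a k)"
      using tl(2)[OF hd] by simp
    also have "(\<lambda>k. if k < N then 0 else g s k - a k) = (\<lambda>k. t k - b k)" by (auto simp: t_def b_def)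
    also have "nrm2 j (\<lambda>k. t k - b k) \<le> 2 * nrm2 j t + 2 * nrm2 j b" by (rule hseq_diff(2)[OF ht(1) hb(1)])
    finally have "nrm2 j (\<lambda>k. g s k - a k) < e" using ht(2) hb(2) elim N e by linarith
    then show ?case using nrm2_nonneg[OF hd] by (simp add: dist_real_def)
  qed
qed

text \<open>The mean value theorem is scalar, so it is applied to the weighted pairing of g with the
  quotient q itself. This gives <q, q> = <q, g' \<xi>> on finitely many modes, and Cauchy-Schwarz in
  the form of Young's inequality bounds q by g' \<xi>.\<close>

lemma derivative_quotient_bound:
  fixes g g' :: "real \<Rightarrow> nat \<Rightarrow> complex"
  assumes D: "\<And>\<tau> k. \<tau> \<in> {a..b} \<Longrightarrow> ((\<lambda>t. g t k) has_vector_derivative g' \<tau> k) (at \<tau> within {a..b})"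
    and B: "\<And>\<tau>. \<tau> \<in> {a..b} \<Longrightarrow> hseq j (g' \<tau>) \<and> nrm2 j (g' \<tau>) \<le> B"
    and s: "s \<in> {a..b}" and t: "t \<in> {a..b}" and st: "s < t" and z: "g s 0 = g t 0"
  shows "hseq j (\<lambda>k. (g t k - g s k) / of_real (t - s))" "nrm2 j (\<lambda>k. (g t k - g s k) / of_real (t - s)) \<le> B"
proof -
  define q where "q k = (g t k - g s k) / of_real (t - s)" for k
  have le: "hsum j n q \<le> B" for n
  proof -
    define w where "w k = (real k ^ j)\<^sup>2" for k
    define \<phi> where "\<phi> \<tau> = (\<Sum>k<n. w k * (q k \<bullet> g \<tau> k))" for \<tau>
    have w0: "0 \<le> w k" for k by (simp add: w_def)
    have "\<exists>\<xi>. s < \<xi> \<and> \<xi> < t \<and> \<phi> t - \<phi> s = (t - s) * (\<Sum>k<n. w k * (q k \<bullet> g' \<xi> k))"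
    proof -
      have d: "(\<phi> has_vector_derivative (\<Sum>k<n. w k * (q k \<bullet> g' \<tau> k))) (at \<tau> within {a..b})" if "\<tau> \<in> {a..b}" for \<tau>
        unfolding \<phi>_def
        by (intro has_vector_derivative_sum has_vector_derivative_mult_right
            bounded_linear.has_vector_derivative[OF bounded_linear_inner_right] D that)
      have "continuous_on {a..b} \<phi>"
        by (rule continuous_on_vector_derivative) (rule d)
      then have c: "continuous_on {s..t} \<phi>" by (rule continuous_on_subset) (use s t in auto)
      have "(\<phi> has_derivative (\<lambda>y. y *\<^sub>R (\<Sum>k<n. w k * (q k \<bullet> g' \<tau> k)))) (at \<tau>)" if "s < \<tau>" "\<tau> < t" for \<tau>
        using d[of \<tau>] that s t at_within_interior[of \<tau> "{a..b}"] by (auto simp: has_vector_derivative_def)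
      from mvt[OF st c this] show ?thesis by (auto simp: mult.commute)
    qed
    then obtain \<xi> where \<xi>: "s < \<xi>" "\<xi> < t" "\<phi> t - \<phi> s = (t - s) * (\<Sum>k<n. w k * (q k \<bullet> g' \<xi> k))" by blast
    have "\<phi> t - \<phi> s = (t - s) * (\<Sum>k<n. w k * (q k \<bullet> q k))"
    proof -
      have "g t k - g s k = (t - s) *\<^sub>R q k" for k using st by (simp add: q_def scaleR_conv_of_real)
      then show ?thesis unfolding \<phi>_def sum_subtractf[symmetric] right_diff_distrib[symmetric] inner_diff_right[symmetric]
        by (simp add: sum_distrib_left mult_ac)
    qed
    then have "(\<Sum>k<n. w k * (q k \<bullet> q k)) = (\<Sum>k<n. w k * (q k \<bullet> g' \<xi> k))" using \<xi>(3) st by simp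
    moreover have "w k * (q k \<bullet> g' \<xi> k) \<le> w k * (q k \<bullet> q k) / 2 + w k * (g' \<xi> k \<bullet> g' \<xi> k) / 2" for k
    proof -
      have "0 \<le> (q k - g' \<xi> k) \<bullet> (q k - g' \<xi> k)" by simp
      then have "q k \<bullet> g' \<xi> k \<le> (q k \<bullet> q k + g' \<xi> k \<bullet> g' \<xi> k) / 2" by (simp add: inner_diff inner_commute)
      from mult_left_mono[OF this w0[of k]] show ?thesis by (simp add: algebra_simps add_divide_distrib)
    qed
    then have "(\<Sum>k<n. w k * (q k \<bullet> g' \<xi> k)) \<le> (\<Sum>k<n. w k * (q k \<bullet> q k) / 2 + w k * (g' \<xi> k \<bullet> g' \<xi> k) / 2)" by (intro sum_mono)
    ultimately have "(\<Sum>k<n. w k * (q k \<bullet> q k)) \<le> (\<Sum>k<n. w k * (g' \<xi> k \<bullet> g' \<xi> k))"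
      by (simp add: sum.distrib sum_divide_distrib[symmetric])
    moreover have e: "w k * (z \<bullet> z) = (real k ^ j * cmod z)\<^sup>2" for k z
      by (simp add: w_def power_mult_distrib dot_square_norm)
    ultimately have "hsum j n q \<le> hsum j n (g' \<xi>)" unfolding hsum_def e by simp
    also have "\<dots> \<le> nrm2 j (g' \<xi>)" using B[of \<xi>] \<xi> s t by (intro hsum_le) auto
    also have "\<dots> \<le> B" using B[of \<xi>] \<xi> s t by auto
    finally show ?thesis .
  qed
  have S: "summable (\<lambda>k. (real k ^ j * cmod (q k))\<^sup>2)"
    by (rule summableI_nonneg_bounded) (use le in \<open>auto simp: hsum_def\<close>)
  then show "hseq j (\<lambda>k. (g t k - g s k) / of_real (t - s))" using z unfolding q_def hseq_def by simp
  have "nrm2 j q \<le> B" unfolding nrm2_def by (rule suminf_le_const[OF S]) (use le in \<open>simp add: hsum_def\<close>)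
  then show "nrm2 j (\<lambda>k. (g t k - g s k) / of_real (t - s)) \<le> B" unfolding q_def .
qed

section \<open>Continuity of flux coefficients and uniqueness\<close>

context film
begin

lemma fc_Fl_tendsto:
  assumes h: "\<forall>\<^sub>F s in F. hseq 4 (g s) \<and> nrm2 4 (g s) \<le> \<rho>0" and a: "hseq 4 a" "nrm2 4 a \<le> \<rho>0"
    and l: "\<And>k. ((\<lambda>s. g s k) \<longlongrightarrow> a k) F"
  shows "((\<lambda>s. fc (Fl (g s)) k) \<longlongrightarrow> fc (Fl a) k) F"
proof (rule tendstoI)
  fix e :: real assume e: "0 < e"
  obtain L where L: "0 < L" and FL: "\<And>c g N B x. hseq 4 c \<Longrightarrow> hseq 4 g \<Longrightarrow> nrm2 4 c \<le> \<rho>0 \<Longrightarrow> nrm2 4 g \<le> \<rho>0 \<Longrightarrow> 1 \<le> N \<Longrightarrow> 0 \<le> B \<Longrightarrow>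
    (\<forall>k\<in>{1..N}. cmod (c k - g k) \<le> B) \<Longrightarrow>
    \<bar>Fl c x - Fl g x\<bar> \<le> L * (real (Suc N) * (1 + real N ^ 3) * B + 4 * sqrt (\<rho>0 / real N))"
    using Fl_diff_bound by blast
  have "(\<lambda>N. 8 * L * sqrt (\<rho>0 / real (N + 2))) \<longlonglongrightarrow> 8 * L * sqrt 0"
    by (intro tendsto_intros exp_div_tendsto)
  then have "\<forall>\<^sub>F N in sequentially. 8 * L * sqrt (\<rho>0 / real (N + 2)) < e / 2" using e by (intro order_tendstoD(2)) auto
  then obtain N' where N': "8 * L * sqrt (\<rho>0 / real (N' + 2)) < e / 2" by (auto simp: eventually_sequentially)
  define N where "N = N' + 2"
  define Q where "Q = 2 * L * (real (Suc N) * (1 + real N ^ 3))"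
  have Q: "0 < Q" unfolding Q_def using L by (intro mult_pos_pos add_pos_nonneg) auto
  define B where "B = e / (4 * Q)"
  have B: "0 < B" "Q * B = e / 4" unfolding B_def using e Q by auto
  have "\<forall>\<^sub>F s in F. \<forall>k\<in>{1..N}. cmod (g s k - a k) < B"
  proof (intro eventually_ball_finite ballI)
    fix k show "\<forall>\<^sub>F s in F. cmod (g s k - a k) < B"
      using tendstoD[OF l[of k] B(1)] by (simp add: dist_norm)
  qed simp
  with h show "\<forall>\<^sub>F s in F. dist (fc (Fl (g s)) k) (fc (Fl a) k) < e"
  proof eventually_elim
    case (elim s)
    have "\<bar>Fl (g s) x - Fl a x\<bar> \<le> L * (real (Suc N) * (1 + real N ^ 3) * B + 4 * sqrt (\<rho>0 / real N))" for x
      by (rule FL) (use elim a B in \<open>auto simp: N_def less_imp_le\<close>)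
    moreover have i: "integrable circle (Fl (g s))" "integrable circle (Fl a)"
      using elim a by (auto intro!: circle_integrable Fl_continuous)
    ultimately have "norm (fc (\<lambda>x. Fl (g s) x - Fl a x) k) \<le> 2 * (L * (real (Suc N) * (1 + real N ^ 3) * B + 4 * sqrt (\<rho>0 / real N)))"
      by (intro fc_bound) auto
    also have "\<dots> = Q * B + 8 * L * sqrt (\<rho>0 / real (N' + 2))" unfolding Q_def by (simp add: N_def algebra_simps)
    also have "\<dots> < e" using B N' e by simp
    finally show ?case unfolding fc_diff[OF i] by (simp add: dist_norm)
  qed
qed

text \<open>Both curves are compared with the same Galerkin approximation, started from the
  truncation of their common initial value. Each is within exp (K t) / (m + 2) of it in the squared
  low-mode distance, so letting m grow identifies them.\<close>

lemma coefficient_uniqueness: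
  "\<exists>\<delta>>0. \<forall>g1 g2 T. g1 0 = g2 0 \<longrightarrow> nrm2 4 (g1 0) \<le> \<delta> \<longrightarrow> hseq 4 (g1 0) \<longrightarrow> (\<forall>g\<in>{g1, g2}.
     (\<forall>t\<in>{0..T}. hseq 4 (g t) \<and> nrm2 4 (g t) \<le> \<rho>0) \<and> (\<forall>k. continuous_on {0..T} (\<lambda>t. g t k)) \<and>
     (\<forall>t\<in>{0<..<T}. \<forall>k. ((\<lambda>t. g t k) has_vector_derivative - (\<i> * of_nat k * fc (Fl (g t)) k)) (at t))) \<longrightarrow>
     (\<forall>t\<in>{0..T}. g1 t = g2 t)"
proof -
  obtain C \<delta> where C: "1 \<le> C" and \<delta>: "0 < \<delta>" and gl: "\<And>m c0. 2 \<le> m \<Longrightarrow> fin m c0 \<Longrightarrow> nrm2 4 c0 \<le> \<delta> \<Longrightarrow>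
     \<exists>c. c 0 = c0 \<and> gal m c \<and> (\<forall>t\<ge>0. nrm2 4 (c t) \<le> C * nrm2 4 c0 \<and> nrm2 4 (c t) \<le> \<rho>0)"
    using galerkin_global by blast
  obtain K where K: "0 < K" and cmp: "\<And>m c g T t. 1 \<le> m \<Longrightarrow> gal m c \<Longrightarrow> (\<forall>t\<ge>0. nrm2 4 (c t) \<le> \<rho>0) \<Longrightarrow> c 0 = tr m (g 0) \<Longrightarrow>
     (\<forall>t\<in>{0..T}. hseq 4 (g t) \<and> nrm2 4 (g t) \<le> \<rho>0) \<Longrightarrow> (\<forall>k. continuous_on {0..T} (\<lambda>t. g t k)) \<Longrightarrow>
     (\<forall>t\<in>{0<..<T}. \<forall>k\<in>{1..m}. ((\<lambda>t. g t k) has_vector_derivative - (\<i> * of_nat k * fc (Fl (g t)) k)) (at t)) \<Longrightarrow>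
     t \<in> {0..T} \<Longrightarrow> (\<Sum>k=1..m. (cmod (c t k - g t k))\<^sup>2) \<le> exp (K * t) / real m"
    using comparison by blast
  have "g1 t k = g2 t k"
    if g0: "g1 0 = g2 0" "nrm2 4 (g1 0) \<le> \<delta>" "hseq 4 (g1 0)" and t: "t \<in> {0..T}"
      and H: "\<And>g. g \<in> {g1, g2} \<Longrightarrow> (\<forall>t\<in>{0..T}. hseq 4 (g t) \<and> nrm2 4 (g t) \<le> \<rho>0)"
        "\<And>g. g \<in> {g1, g2} \<Longrightarrow> (\<forall>k. continuous_on {0..T} (\<lambda>t. g t k))"
        "\<And>g. g \<in> {g1, g2} \<Longrightarrow> (\<forall>t\<in>{0<..<T}. \<forall>k. ((\<lambda>t. g t k) has_vector_derivative - (\<i> * of_nat k * fc (Fl (g t)) k)) (at t))"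
    for g1 g2 :: "real \<Rightarrow> nat \<Rightarrow> complex" and T t k
  proof (cases "k = 0")
    case True
    have "hseq 4 (g1 t)" "hseq 4 (g2 t)" using H(1)[of g1] H(1)[of g2] t by auto
    then show ?thesis using True by (simp add: hseq_def)
  next
    case False
    have "(cmod (g1 t k - g2 t k))\<^sup>2 \<le> 4 * exp (K * t) / real (m + 2)" if m: "m \<ge> k" for m
    proof -
      have "nrm2 4 (tr (m + 2) (g1 0)) \<le> \<delta>" using hseq_tr(1)[OF g0(3), of "m + 2"] g0(2) by simp
      then obtain c where c: "c 0 = tr (m + 2) (g1 0)" "gal (m + 2) c" "\<forall>t\<ge>0. nrm2 4 (c t) \<le> \<rho>0"
        using gl[of "m + 2" "tr (m + 2) (g1 0)"] fin_tr by auto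
      have *: "(cmod (c t k - g t k))\<^sup>2 \<le> exp (K * t) / real (m + 2)" if g: "g \<in> {g1, g2}" for g
      proof -
        have "(\<Sum>k=1..m+2. (cmod (c t k - g t k))\<^sup>2) \<le> exp (K * t) / real (m + 2)"
          by (rule cmp[OF _ c(2,3) _ H(1)[OF g] H(2)[OF g] _ t]) (use c(1) g g0 H(3)[OF g] in auto)
        then show ?thesis using member_le_sum[of k "{1..m+2}" "\<lambda>k. (cmod (c t k - g t k))\<^sup>2"] m False by simp
      qed
      have "(cmod (g1 t k - g2 t k))\<^sup>2 \<le> (cmod (c t k - g1 t k) + cmod (c t k - g2 t k))\<^sup>2"
        using norm_triangle_ineq4[of "c t k - g2 t k" "c t k - g1 t k"] by (intro power_mono) (auto simp: add.commute)
      also have "\<dots> \<le> 2 * (cmod (c t k - g1 t k))\<^sup>2 + 2 * (cmod (c t k - g2 t k))\<^sup>2"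
        using sum_squares_bound[of "cmod (c t k - g1 t k)" "cmod (c t k - g2 t k)"] by (simp add: power2_sum)
      also have "\<dots> \<le> 2 * (exp (K * t) / real (m + 2)) + 2 * (exp (K * t) / real (m + 2))"
        using *[of g1] *[of g2] by (intro add_mono mult_left_mono) auto
      finally show ?thesis by simp
    qed
    then have "(cmod (g1 t k - g2 t k))\<^sup>2 \<le> 0"
      by (intro LIMSEQ_le_const[OF exp_div_tendsto[of "4 * exp (K * t)"]]) blast
    then show ?thesis by simp
  qed
  note main = this
  show ?thesis
  proof (rule exI[of _ \<delta>], intro conjI allI impI ballI ext)
    show "0 < \<delta>" by (rule \<delta>)
    fix g1 g2 :: "real \<Rightarrow> nat \<Rightarrow> complex" and T t k
    assume a: "g1 0 = g2 0" "nrm2 4 (g1 0) \<le> \<delta>" "hseq 4 (g1 0)" and t: "t \<in> {0..T}"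
      and H: "\<forall>g\<in>{g1, g2}.
     (\<forall>t\<in>{0..T}. hseq 4 (g t) \<and> nrm2 4 (g t) \<le> \<rho>0) \<and> (\<forall>k. continuous_on {0..T} (\<lambda>t. g t k)) \<and>
     (\<forall>t\<in>{0<..<T}. \<forall>k. ((\<lambda>t. g t k) has_vector_derivative - (\<i> * of_nat k * fc (Fl (g t)) k)) (at t))"
    show "g1 t k = g2 t k"
    proof (rule main[where ?g1.0 = g1 and ?g2.0 = g2 and T = T, OF a t])
      fix g assume "g \<in> {g1, g2}"
      note H' = bspec[OF H this]
      show "\<forall>t\<in>{0..T}. hseq 4 (g t) \<and> nrm2 4 (g t) \<le> \<rho>0" by (rule conjunct1[OF H'])
      show "\<forall>k. continuous_on {0..T} (\<lambda>t. g t k)" by (rule conjunct1[OF conjunct2[OF H']])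
      show "\<forall>t\<in>{0<..<T}. \<forall>k. ((\<lambda>t. g t k) has_vector_derivative - (\<i> * of_nat k * fc (Fl (g t)) k)) (at t)"
        by (rule conjunct2[OF conjunct2[OF H']])
    qed
  qed
qed

end

subsection \<open>From coefficients to solutions\<close>

lemma smooth_fun_deriv_n_continuous: "smooth_fun \<phi> \<Longrightarrow> continuous_on S ((deriv ^^ j) \<phi>)"
  unfolding smooth_fun_def
  by (meson continuous_at_imp_continuous_on field_differentiable_imp_continuous_at)

lemma has_weak_deriv_cong_AE:
  assumes w: "has_weak_deriv j f g" and f': "f' \<in> L2_circle" and e: "AE x in circle. f' x = f x"
  shows "has_weak_deriv j f' g"
proof -
  have "cint (\<lambda>x. f' x * (deriv ^^ j) \<phi> x) = cint (\<lambda>x. f x * (deriv ^^ j) \<phi> x)" if "smooth_fun \<phi>" for \<phi>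
  proof (rule integral_cong_AE)
    have "(deriv ^^ j) \<phi> \<in> borel_measurable circle"
      by (intro circle_measurable smooth_fun_deriv_n_continuous that)
    then show "(\<lambda>x. f' x * (deriv ^^ j) \<phi> x) \<in> borel_measurable circle" "(\<lambda>x. f x * (deriv ^^ j) \<phi> x) \<in> borel_measurable circle"
      using f' w by (auto simp: L2_circle_def has_weak_deriv_def)
    show "AE x in circle. f' x * (deriv ^^ j) \<phi> x = f x * (deriv ^^ j) \<phi> x" using e by eventually_elim simp
  qed
  then show ?thesis using w f' unfolding has_weak_deriv_def by auto
qed

lemma fc_cong_AE:
  assumes "AE x in circle. f x = g x" "f \<in> borel_measurable circle" "g \<in> borel_measurable circle"
  shows "fc f k = fc g k"
proof -
  have c: "(\<lambda>x. cis (- (real k * x))) \<in> borel_measurable circle"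
    using continuous_on_cis_mult[of UNIV "- real k"] by (intro circle_measurable) simp
  have "cint (\<lambda>x. complex_of_real (f x) * cis (- (real k * x))) = cint (\<lambda>x. complex_of_real (g x) * cis (- (real k * x)))"
  proof (rule integral_cong_AE)
    show "AE x in circle. complex_of_real (f x) * cis (- (real k * x)) = complex_of_real (g x) * cis (- (real k * x))"
      using assms(1) by eventually_elim simp
  qed (use assms c in \<open>auto intro!: borel_measurable_times borel_measurable_of_real\<close>)
  then show ?thesis unfolding fc_def by simp
qed

lemma weak_deriv_const: "has_weak_deriv 1 (\<lambda>_. a) (\<lambda>_. 0)"
  using classical_weak_deriv[of 1 "\<lambda>i _. if i = 0 then a else 0"]
  by (simp add: periodic_fun_simple_def)

lemma sobolev_const: "(\<lambda>_. a) \<in> sobolev s"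
proof -
  have "has_weak_deriv j (\<lambda>_. a) (\<lambda>_. if j = 0 then a else 0)" for j
    using classical_weak_deriv[of j "\<lambda>i _. if i = 0 then a else 0"]
    by (simp add: periodic_fun_simple_def)
  moreover have "(\<lambda>_. a) \<in> L2_circle" by (rule L2_circle_continuous) (auto simp: periodic_fun_simple_def)
  ultimately show ?thesis unfolding sobolev_def by blast
qed

lemma sobolev_L2: "f \<in> sobolev s \<Longrightarrow> f \<in> L2_circle"
  by (simp add: sobolev_def)

lemma sobolev_integrable: "f \<in> sobolev s \<Longrightarrow> integrable circle f"
  by (intro sqi_integrable sqi_L2 sobolev_L2)

lemma fc_const: "fc (\<lambda>_. a) k = (if k = 0 then of_real (2 * a) else 0)"
  by (simp add: fc_const_pos fc_0 cint_const)

text \<open>Turns convergence in the Sobolev norm into convergence of coefficients. The mean may be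
  nonzero here, so index 0 is treated separately, through the nonnegative variance. The order zero
  term of the norm is formed with \<open>weak_deriv 0 f\<close>, which has the same coefficients as
  \<open>f\<close>.\<close>

lemma fc_le_sobolev_norm:
  assumes f: "f \<in> sobolev s"
  shows "cmod (fc f k) \<le> sobolev_norm s f"
proof -
  define w where "w = weak_deriv 0 f"
  have wd: "has_weak_deriv 0 f w" unfolding w_def using f by (rule weak_deriv_spec) simp
  have w: "sqi w" by (rule sqi_weak_deriv(2)[OF wd])
  have i: "integrable circle w" "integrable circle (\<lambda>x. (w x)\<^sup>2)" using w sqi_integrable[OF w] by (auto simp: sqi_def)
  have n0: "0 \<le> cint (\<lambda>x. (w x)\<^sup>2)" by (rule cint_nonneg) simp
  have "(cmod (fc w k))\<^sup>2 \<le> cint (\<lambda>x. (w x)\<^sup>2)"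
  proof (cases "k = 0")
    case True
    define m where "m = cint w / (2 * pi)"
    have "0 \<le> cint (\<lambda>x. (w x)\<^sup>2 - 2 * m * w x + m\<^sup>2)"
    proof (rule cint_nonneg)
        fix x have "0 \<le> (w x - m)\<^sup>2" by simp
        then show "0 \<le> (w x)\<^sup>2 - 2 * m * w x + m\<^sup>2" by (simp add: power2_diff mult_ac)
      qed
    also have "\<dots> = cint (\<lambda>x. (w x)\<^sup>2) - 2 * m * cint w + 2 * pi * m\<^sup>2"
      using i circle_integrable[of "\<lambda>_. m\<^sup>2"] cint_const[of "m\<^sup>2"] by simp
    also have "\<dots> = cint (\<lambda>x. (w x)\<^sup>2) - (cint w)\<^sup>2 / (2 * pi)" by (simp add: m_def power2_eq_square field_simps)
    finally have "(cint w)\<^sup>2 / (2 * pi) \<le> cint (\<lambda>x. (w x)\<^sup>2)" by simp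
    moreover have "(cint w)\<^sup>2 / pi\<^sup>2 \<le> (cint w)\<^sup>2 / (2 * pi)"
      using pi_ge_two by (intro divide_left_mono) (auto simp: power2_eq_square)
    ultimately show ?thesis using True by (simp add: fc_0 norm_divide power_divide)
  next
    case False
    have "(cmod (fc w k))\<^sup>2 \<le> (\<Sum>k=1..k. (cmod (fc w k))\<^sup>2)"
      using member_le_sum[of k "{1..k}" "\<lambda>k. (cmod (fc w k))\<^sup>2"] False by simp
    also have "\<dots> \<le> cint (\<lambda>x. (w x)\<^sup>2) / pi" by (rule bessel[OF w])
    also have "\<dots> \<le> cint (\<lambda>x. (w x)\<^sup>2) / 1" using pi_ge_two n0 by (intro divide_left_mono) auto
    finally show ?thesis by simp
  qed
  also have "\<dots> \<le> (\<Sum>j\<le>s. cint (\<lambda>x. (weak_deriv j f x)\<^sup>2))"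
    unfolding w_def by (rule member_le_sum) (auto intro: cint_nonneg)
  finally have "sqrt ((cmod (fc w k))\<^sup>2) \<le> sobolev_norm s f" unfolding sobolev_norm_def by (rule real_sqrt_le_mono)
  then show ?thesis using weak_deriv_fc[OF wd, of k] by simp
qed

text \<open>Matches the derivative with the form in which \<open>sobolev_C1_on\<close> states
  it.\<close>

lemma has_vector_derivative_quotient:
  fixes f :: "real \<Rightarrow> complex"
  shows "(f has_vector_derivative f') (at t within S) \<longleftrightarrow> ((\<lambda>s. (f s - f t) / of_real (s - t) - f') \<longlongrightarrow> 0) (at t within S)"
proof -
  have "norm ((f s - f t) - (s - t) *\<^sub>R f') / norm (s - t) = norm ((f s - f t) / of_real (s - t) - f')" if "s \<noteq> t" for s
  proof -
    have "(f s - f t) / of_real (s - t) - f' = ((f s - f t) - (s - t) *\<^sub>R f') / of_real (s - t)"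
      using that by (simp add: diff_divide_distrib scaleR_conv_of_real del: of_real_diff)
    then show ?thesis by (simp add: norm_divide del: of_real_diff)
  qed
  then have "((\<lambda>s. norm ((f s - f t) - (s - t) *\<^sub>R f') / norm (s - t)) \<longlongrightarrow> 0) (at t within S)
      \<longleftrightarrow> ((\<lambda>s. norm ((f s - f t) / of_real (s - t) - f')) \<longlongrightarrow> 0) (at t within S)"
    by (intro tendsto_cong) (auto simp: eventually_at_filter)
  then show ?thesis
    unfolding has_vector_derivative_def has_derivative_iff_norm tendsto_norm_zero_iff
    by (simp add: bounded_linear_scaleR_left)
qed

lemma sqrt_nrm2_triangle:
  assumes c: "hseq j c" and d: "hseq j d"
  shows "sqrt (nrm2 j c) \<le> sqrt (nrm2 j d) + sqrt (nrm2 j (\<lambda>k. c k - d k))"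
proof -
  let ?r = "sqrt (nrm2 j d) + sqrt (nrm2 j (\<lambda>k. c k - d k))"
  have cd: "hseq j (\<lambda>k. c k - d k)" by (rule hseq_diff(1)[OF c d])
  have e: "sqrt (hsum j n a) = L2_set (\<lambda>k. real k ^ j * cmod (a k)) {..<n}" for n a
    by (simp add: hsum_def L2_set_def)
  have r0: "0 \<le> ?r" using nrm2_nonneg[OF d] nrm2_nonneg[OF cd] by simp
  have "hsum j n c \<le> ?r\<^sup>2" for n
  proof -
    have "sqrt (hsum j n c) \<le> L2_set (\<lambda>k. real k ^ j * cmod (d k) + real k ^ j * cmod (c k - d k)) {..<n}"
      unfolding e
    proof (rule L2_set_mono)
      fix k
      have "cmod (c k) \<le> cmod (d k) + cmod (c k - d k)" using norm_triangle_sub[of "c k" "d k"] by (simp add: add.commute)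
      from mult_left_mono[OF this, of "real k ^ j"]
      show "real k ^ j * cmod (c k) \<le> real k ^ j * cmod (d k) + real k ^ j * cmod (c k - d k)" by (simp add: distrib_left)
    qed auto
    also have "\<dots> \<le> sqrt (hsum j n d) + sqrt (hsum j n (\<lambda>k. c k - d k))" unfolding e by (rule L2_set_triangle_ineq)
    also have "\<dots> \<le> ?r" by (intro add_mono real_sqrt_le_mono hsum_le d cd)
    finally have "(sqrt (hsum j n c))\<^sup>2 \<le> ?r\<^sup>2" by (intro power_mono) (auto simp: hsum_def intro: sum_nonneg)
    then show ?thesis by (simp add: hsum_def sum_nonneg)
  qed
  then have "nrm2 j c \<le> ?r\<^sup>2" unfolding nrm2_def hsum_def by (intro suminf_le_const hseq_summable[OF c])
  then show ?thesis using r0 real_le_lsqrt by blast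
qed

lemma nrm2_tendsto:
  assumes h: "\<forall>\<^sub>F s in F. hseq j (g s)" and a: "hseq j a" and l: "((\<lambda>s. nrm2 j (\<lambda>k. g s k - a k)) \<longlongrightarrow> 0) F"
  shows "((\<lambda>s. nrm2 j (g s)) \<longlongrightarrow> nrm2 j a) F"
proof -
  have "((\<lambda>s. sqrt (nrm2 j (g s)) - sqrt (nrm2 j a)) \<longlongrightarrow> 0) F"
  proof (rule Lim_null_comparison)
    show "((\<lambda>s. sqrt (nrm2 j (\<lambda>k. g s k - a k))) \<longlongrightarrow> 0) F" using tendsto_real_sqrt[OF l] by simp
    show "\<forall>\<^sub>F s in F. norm (sqrt (nrm2 j (g s)) - sqrt (nrm2 j a)) \<le> sqrt (nrm2 j (\<lambda>k. g s k - a k))"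
      using h
    proof eventually_elim
      case (elim s)
      have "nrm2 j (\<lambda>k. a k - g s k) = nrm2 j (\<lambda>k. g s k - a k)" by (simp add: nrm2_def norm_minus_commute)
      then show ?case using sqrt_nrm2_triangle[OF elim a] sqrt_nrm2_triangle[OF a elim] by (simp add: abs_le_iff)
    qed
  qed
  then have "((\<lambda>s. sqrt (nrm2 j (g s))) \<longlongrightarrow> sqrt (nrm2 j a)) F" by (rule LIM_zero_cancel)
  then have "((\<lambda>s. (sqrt (nrm2 j (g s)))\<^sup>2) \<longlongrightarrow> (sqrt (nrm2 j a))\<^sup>2) F" by (rule tendsto_power)
  moreover have "\<forall>\<^sub>F s in F. (sqrt (nrm2 j (g s)))\<^sup>2 = nrm2 j (g s)"
    using h by eventually_elim (simp add: nrm2_nonneg)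
  ultimately show ?thesis using nrm2_nonneg[OF a] by (auto intro: Lim_transform_eventually)
qed

lemma sobolev_norm_le_nrm2:
  assumes "f \<in> sobolev s" "cint f = 0"
  shows "sobolev_norm s f \<le> sqrt ((real s + 1) * (pi * nrm2 s (fc f)))"
  using sobolev_fc(4)[OF assms] by (rule real_le_rsqrt)

lemma sobolev_norm_tendsto_0:
  assumes ev: "\<forall>\<^sub>F r in F. f r \<in> sobolev s \<and> cint (f r) = 0" and l: "((\<lambda>r. nrm2 s (fc (f r))) \<longlongrightarrow> 0) F"
  shows "((\<lambda>r. sobolev_norm s (f r)) \<longlongrightarrow> 0) F"
proof (rule Lim_null_comparison)
  have "((\<lambda>r. sqrt ((real s + 1) * (pi * nrm2 s (fc (f r))))) \<longlongrightarrow> sqrt ((real s + 1) * (pi * 0))) F"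
    by (intro tendsto_intros l)
  then show "((\<lambda>r. sqrt ((real s + 1) * (pi * nrm2 s (fc (f r))))) \<longlongrightarrow> 0) F" by simp
  show "\<forall>\<^sub>F r in F. norm (sobolev_norm s (f r)) \<le> sqrt ((real s + 1) * (pi * nrm2 s (fc (f r))))"
    using ev by eventually_elim (simp add: sobolev_norm_le_nrm2 sobolev_norm_nonneg)
qed

text \<open>The extra order makes all differentiated series up to order s absolutely convergent, so
  the weak derivatives are classical ones.\<close>

lemma fser_sobolev:
  assumes "hseq (Suc s) c"
  shows "fser c \<in> sobolev s" "cint (fser c) = 0" "fc (fser c) = c"
proof -
  have c0: "c 0 = 0" using assms by (simp add: hseq_def)
  have S: "summable (\<lambda>k. real k ^ i * norm (c k))" if "i \<le> s" for i
    using hseq_l1(1)[of i c] hseq_mono[OF assms, of "Suc i"] that c0 by simp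
  have "has_weak_deriv j (fser c) (fser ((ddc ^^ j) c))" if "j \<le> s" for j
    using that by (intro fser_weak_deriv S) auto
  moreover from this[of 0] have "fser c \<in> L2_circle" by (simp add: has_weak_deriv_def)
  ultimately show "fser c \<in> sobolev s" unfolding sobolev_def by blast
  have "summable (\<lambda>k. norm (c k))" using S[of 0] by simp
  then show "cint (fser c) = 0" "fc (fser c) = c" using c0 by (auto intro: cint_fser fc_fser)
qed

section \<open>Profiles near the constant state and construction of the solution\<close>

context film
begin

definition nflux :: "(real \<Rightarrow> real) \<Rightarrow> real \<Rightarrow> real" where
  "nflux u x = (u x)\<^sup>2 * \<Psi> (u x * (weak_deriv 1 u x + weak_deriv 3 u x))"

text \<open>For integrable \<open>u\<close> the coefficient of index 0 vanishes exactly when the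
  mean of \<open>u\<close> is hbar.\<close>

definition cf :: "(real \<Rightarrow> real) \<Rightarrow> nat \<Rightarrow> complex" where
  "cf u = fc (\<lambda>x. u x - hbar)"

lemma cf_eq: "integrable circle u \<Longrightarrow> cf u k = fc u k - fc (\<lambda>_. hbar) k"
  unfolding cf_def by (rule fc_diff) (auto intro: circle_integrable)

lemma cf_diff: "integrable circle u \<Longrightarrow> integrable circle v \<Longrightarrow> fc (\<lambda>x. u x - v x) k = cf u k - cf v k"
  by (simp add: cf_eq fc_diff)

text \<open>For an H^4 profile the series for derivatives up to order 3 converge absolutely, so the
  weak derivatives in the flux agree almost everywhere with continuous functions. The square
  integrability of the flux is inherited from the continuous \<open>Fl\<close>.\<close>

lemma cf_profile:
  assumes u: "u \<in> sobolev 4" and m: "cint u = 2 * pi * hbar"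
  shows "hseq 4 (cf u)" "pi * nrm2 4 (cf u) \<le> (sobolev_norm 4 (\<lambda>x. u x - hbar))\<^sup>2"
    "(sobolev_norm 4 (\<lambda>x. u x - hbar))\<^sup>2 \<le> 5 * (pi * nrm2 4 (cf u))"
    "AE x in circle. nflux u x = Fl (cf u) x" "nflux u \<in> L2_circle"
proof -
  have ui: "integrable circle u" by (rule sobolev_integrable[OF u])
  have v: "(\<lambda>x. u x - hbar) \<in> sobolev 4" by (rule sobolev_diff[OF u sobolev_const])
  have v0: "cint (\<lambda>x. u x - hbar) = 0"
    using ui m circle_integrable[of "\<lambda>_. hbar"] cint_const[of hbar] by simp
  note vf = sobolev_fc[OF v v0, folded cf_def]
  show h4: "hseq 4 (cf u)" and "pi * nrm2 4 (cf u) \<le> (sobolev_norm 4 (\<lambda>x. u x - hbar))\<^sup>2"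
    "(sobolev_norm 4 (\<lambda>x. u x - hbar))\<^sup>2 \<le> 5 * (pi * nrm2 4 (cf u))" using vf by auto
  have S: "summable (\<lambda>k. real k ^ i * norm (cf u k))" if "i \<le> 3" for i
    using hseq_l1(1)[of i "cf u"] hseq_mono[OF h4, of "Suc i"] h4 that by (simp add: hseq_def)
  have e: "fc u k = cf u k" if "k \<noteq> 0" for k using that by (simp add: cf_eq[OF ui] fc_const)
  have S': "summable (\<lambda>k. real k ^ i * norm (fc u k))" if "i \<le> 3" "1 \<le> i" for i
  proof -
    have "(\<lambda>k. real k ^ i * norm (fc u k)) = (\<lambda>k. real k ^ i * norm (cf u k))"
      using e that by (intro ext) (case_tac "k = 0", auto)
    then show ?thesis using S[OF that(1)] by simp
  qed
  have A0: "AE x in circle. u x - hbar = fser (cf u) x"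
    by (rule AE_eq_fser) (use sqi_L2[OF sobolev_L2[OF v]] v0 S[of 0] h4 in \<open>auto simp: hseq_def cf_def\<close>)
  have d: "has_weak_deriv 1 u (weak_deriv 1 u)" "has_weak_deriv 3 u (weak_deriv 3 u)"
    using weak_deriv_spec[OF u, of 1] weak_deriv_spec[OF u, of 3] by auto
  have sj: "summable (\<lambda>k. norm ((ddc ^^ j) (fc u) k))" if "j \<le> 3" "1 \<le> j" for j
    using S'[of j] that by (simp add: ddc_funpow norm_mult norm_power)
  have "fser (Ls (cf u)) x = fser ((ddc ^^ 1) (fc u)) x + fser ((ddc ^^ 3) (fc u)) x" for x
  proof -
    have "Ls (cf u) = (\<lambda>k. (ddc ^^ 1) (fc u) k + (ddc ^^ 3) (fc u) k)"
      unfolding ddc_funpow Ls_def using e by (intro ext) (case_tac "k = 0", auto simp: algebra_simps)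
    then show ?thesis by (simp only:) (rule fser_add; rule sj; simp)
  qed
  with A0 weak_deriv_AE_fser[OF d(1) _ S'] weak_deriv_AE_fser[OF d(2) _ S']
  have A: "AE x in circle. u x = hbar + fser (cf u) x \<and> weak_deriv 1 u x + weak_deriv 3 u x = fser (Ls (cf u)) x"
    by (auto elim!: eventually_elim2)
  then show AE: "AE x in circle. nflux u x = Fl (cf u) x"
    by eventually_elim (simp add: nflux_def Fl_def)
  have mu: "u \<in> borel_measurable circle" "weak_deriv 1 u \<in> borel_measurable circle" "weak_deriv 3 u \<in> borel_measurable circle"
    using d by (auto simp: has_weak_deriv_def L2_circle_def)
  have "continuous_on UNIV \<Psi>" by (rule smooth_fun_continuous[OF smooth_\<Psi>])
  then have "\<Psi> \<in> borel_measurable borel" by (rule borel_measurable_continuous_onI)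
  then have mn: "nflux u \<in> borel_measurable circle"
    unfolding nflux_def[abs_def] using mu by (intro borel_measurable_times borel_measurable_power) (auto intro: measurable_compose)
  have cF: "continuous_on UNIV (Fl (cf u))" by (rule Fl_continuous[OF h4])
  have "integrable circle (\<lambda>x. (nflux u x)\<^sup>2)"
  proof (subst integrable_cong_AE)
    show "integrable circle (\<lambda>x. (Fl (cf u) x)\<^sup>2)" by (intro circle_integrable continuous_intros cF)
    show "AE x in circle. (nflux u x)\<^sup>2 = (Fl (cf u) x)\<^sup>2" using AE by eventually_elim simp
  qed (use mn circle_measurable[OF cF] in auto)
  moreover have "periodic_fun_simple (nflux u) (2 * pi)"
    using d unfolding has_weak_deriv_def L2_circle_def periodic_fun_simple_def nflux_def by auto
  ultimately show "nflux u \<in> L2_circle" using mn by (simp add: L2_circle_def)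
qed

text \<open>The assumption makes the coefficients of the differentiated flux absolutely summable.
  Hence the flux is almost everywhere its mean plus a series that can be differentiated term by
  term; the mean is split off because the series carries none.\<close>

lemma Fl_weak_deriv:
  assumes c: "hseq 4 c" and d: "hseq 1 (\<lambda>k. - (\<i> * of_nat k * fc (Fl c) k))"
  shows "has_weak_deriv 1 (Fl c) (\<lambda>x. - fser (\<lambda>k. - (\<i> * of_nat k * fc (Fl c) k)) x)"
proof -
  define d' where "d' k = - (\<i> * of_nat k * fc (Fl c) k)" for k
  define e where "e k = (if k = 0 then 0 else fc (Fl c) k)" for k
  define m where "m = cint (Fl c) / (2 * pi)"
  have cF: "continuous_on UNIV (Fl c)" by (rule Fl_continuous[OF c])
  have Fi: "integrable circle (Fl c)" by (rule circle_integrable[OF cF])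
  have sd: "summable (\<lambda>k. norm (d' k))" using hseq_summable_norm[OF d] by (simp add: d'_def)
  have le: "norm (e k) \<le> norm (d' k)" for k
    by (cases "k = 0") (auto simp: e_def d'_def norm_mult mult_left_le_one_le mult_le_cancel_right1)
  have se: "summable (\<lambda>k. norm (e k))" by (rule summable_comparison_test'[OF sd, of 0]) (use le in auto)
  have de: "ddc e = (\<lambda>k. - d' k)" by (auto simp: ddc_def e_def d'_def)
  have "AE x in circle. Fl c x - m = fser e x"
  proof (rule AE_eq_fser[OF _ _ se])
    show "sqi (\<lambda>x. Fl c x - m)" by (intro sqi_continuous continuous_intros cF)
    show "cint (\<lambda>x. Fl c x - m) = 0" using Fi circle_integrable[of "\<lambda>_. m"] cint_const[of m] by (simp add: m_def)
    show "fc (\<lambda>x. Fl c x - m) k = e k" if "1 \<le> k" for k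
      using fc_diff[OF Fi circle_integrable[of "\<lambda>_. m"], of k] that by (simp add: e_def fc_const)
  qed (simp add: e_def)
  then have AE: "AE x in circle. Fl c x = fser e x - (- m)" by eventually_elim simp
  have "has_weak_deriv 1 (fser e) (fser ((ddc ^^ 1) e))"
  proof (rule fser_weak_deriv)
    fix i :: nat assume "i \<le> 1"
    then have "i = 0 \<or> i = 1" by auto
    then show "summable (\<lambda>k. real k ^ i * norm (e k))"
    proof
      assume "i = 1"
      moreover have "real k * norm (e k) = norm (d' k)" for k by (auto simp: e_def d'_def norm_mult)
      ultimately show ?thesis using sd by simp
    qed (use se in simp)
  qed
  then have "has_weak_deriv 1 (fser e) (fser (\<lambda>k. - d' k))" by (simp add: de)
  then have w: "has_weak_deriv 1 (\<lambda>x. fser e x - (- m)) (\<lambda>x. fser (\<lambda>k. - d' k) x - 0)"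
    by (rule weak_deriv_diff) (rule weak_deriv_const)
  have "fser (\<lambda>k. - d' k) x = - fser d' x" for x using fser_cmult[OF sd, of "-1" x] by simp
  then have w': "has_weak_deriv 1 (\<lambda>x. fser e x - (- m)) (\<lambda>x. - fser d' x)" using w by simp
  have "periodic_fun_simple (Fl c) (2 * pi)" by (auto simp: periodic_fun_simple_def Fl_def fser_periodic)
  then have "Fl c \<in> L2_circle" by (rule L2_circle_continuous[OF cF])
  from has_weak_deriv_cong_AE[OF w' this AE]
  show ?thesis unfolding d'_def .
qed


text \<open>At positive times every limit in H^4 is reduced to limits of single coefficients plus a
  local bound in H^5. This applies to the solution, to its time derivative and to the difference
  quotients alike.\<close>

lemma modes_film_solution:
  assumes fl: "\<And>u. flux \<beta> \<psi> u = nflux u"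
    and h0: "h0 \<in> sobolev 4" "cint h0 = 2 * pi * hbar" and g0: "g 0 = cf h0"
    and g4: "\<And>t. 0 \<le> t \<Longrightarrow> hseq 4 (g t) \<and> nrm2 4 (g t) \<le> \<rho>0"
    and gD: "\<And>t k. 0 \<le> t \<Longrightarrow> ((\<lambda>t. g t k) has_vector_derivative - (\<i> * of_nat k * fc (Fl (g t)) k)) (at t within {0..})"
    and gK: "\<And>t. 0 \<le> t \<Longrightarrow> nrm2 4 (g t) \<le> nrm2 4 (g 0) + K * t"
    and gB: "\<And>a b. 0 < a \<Longrightarrow> \<exists>B. \<forall>t\<in>{a..b}. hseq 10 (g t) \<and> nrm2 10 (g t) \<le> B \<and>
        hseq 5 (\<lambda>k. - (\<i> * of_nat k * fc (Fl (g t)) k)) \<and> nrm2 5 (\<lambda>k. - (\<i> * of_nat k * fc (Fl (g t)) k)) \<le> B"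
  shows "\<exists>h. film_solution \<beta> \<psi> h0 h \<and> (\<forall>t\<ge>0. h t \<in> sobolev 4 \<and> cint (h t) = 2 * pi * hbar \<and> cf (h t) = g t)"
proof -
  define d where "d t k = - (\<i> * of_nat k * fc (Fl (g t)) k)" for t k
  \<comment> \<open>At t = 0 the coefficients are known to be in H^4 only, one order short of
    \<open>fser_sobolev\<close>, so the given initial function is used itself.\<close>
  define h where "h t = (if t = 0 then h0 else (\<lambda>x. hbar + fser (g t) x))" for t
  define h' where "h' t = fser (d t)" for t
  have loc: "\<exists>B. \<forall>s\<in>{a..b}. hseq 10 (g s) \<and> nrm2 10 (g s) \<le> B \<and> hseq 5 (d s) \<and> nrm2 5 (d s) \<le> B" if "0 < a" for a b
    using gB[OF that, of b] unfolding d_def .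
  have hp: "hseq 10 (g t)" "hseq 5 (d t)" if "0 < t" for t using loc[OF that, of t] by auto
  have h: "h t \<in> sobolev 4 \<and> cint (h t) = 2 * pi * hbar \<and> cf (h t) = g t" if "0 \<le> t" for t
  proof (cases "t = 0")
    case True
    then show ?thesis using h0 g0 by (simp add: h_def)
  next
    case False
    then have "hseq (Suc 4) (g t)" using that hseq_mono[OF hp(1), of t "Suc 4"] by simp
    note f = fser_sobolev[OF this]
    have "(\<lambda>x. hbar + fser (g t) x) = (\<lambda>x. fser (g t) x - (- hbar))" by auto
    then have "(\<lambda>x. hbar + fser (g t) x) \<in> sobolev 4" using sobolev_diff[OF f(1) sobolev_const[of "- hbar"]] by simp
    moreover have "cint (\<lambda>x. hbar + fser (g t) x) = 2 * pi * hbar"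
      using sobolev_integrable[OF f(1)] circle_integrable[of "\<lambda>_. hbar"] cint_const[of hbar] f(2) by simp
    ultimately show ?thesis using False f(3) by (simp add: h_def cf_def)
  qed
  have hi: "integrable circle (h t)" if "0 \<le> t" for t using h[OF that] sobolev_integrable by blast
  have h's: "h' t \<in> sobolev 4" "cint (h' t) = 0" "fc (h' t) = d t" if "0 < t" for t
    unfolding h'_def using fser_sobolev[of 4 "d t"] hp(2)[OF that] by simp_all
  have hd: "(\<lambda>x. h s x - h t x) \<in> sobolev 4 \<and> cint (\<lambda>x. h s x - h t x) = 0" "fc (\<lambda>x. h s x - h t x) = (\<lambda>k. g s k - g t k)"
    if "0 \<le> s" "0 \<le> t" for s t
  proof -
    show "(\<lambda>x. h s x - h t x) \<in> sobolev 4 \<and> cint (\<lambda>x. h s x - h t x) = 0"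
      using h[OF that(1)] h[OF that(2)] hi[OF that(1)] hi[OF that(2)] sobolev_diff by auto
    show "fc (\<lambda>x. h s x - h t x) = (\<lambda>k. g s k - g t k)"
      using cf_diff[OF hi[OF that(1)] hi[OF that(2)]] h[OF that(1)] h[OF that(2)] by auto
  qed
  have gc: "((\<lambda>s. g s k) \<longlongrightarrow> g t k) (at t within {0..})" if "0 \<le> t" for t k
    using has_vector_derivative_continuous[OF gD[OF that]] by (simp add: continuous_within)
  have gc': "((\<lambda>s. g s k) \<longlongrightarrow> g t k) (at t)" if "0 < t" for t k
    using gc[of t k] that at_within_interior[of t "{0..}"] by simp
  have near: "\<forall>\<^sub>F s in at t. s \<in> {t/2..t+1}" if "0 < t" for t :: real
  proof -
    have "\<forall>\<^sub>F s in at t. s \<in> {t/2<..<t+1}" using that by (intro eventually_at_in_open') auto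
    then show ?thesis by eventually_elim auto
  qed
  \<comment> \<open>At t = 0 no higher norm is available; weak convergence together with the linear
    growth bound on the norm replaces it. For t > 0 the local bound of order 10 suffices.\<close>
  have gdiff: "((\<lambda>s. nrm2 4 (\<lambda>k. g s k - g t k)) \<longlongrightarrow> 0) (at t within {0..})" if t: "0 \<le> t" for t
  proof (cases "t = 0")
    case True
    show ?thesis unfolding True
    proof (rule nrm2_tendsto_weak)
      show "hseq 4 (g 0)" using g4 by simp
      show "\<forall>\<^sub>F s in at 0 within {0..}. hseq 4 (g s) \<and> nrm2 4 (g s) \<le> nrm2 4 (g 0) + K * s"
        using g4 gK by (auto simp: eventually_at_filter)
      have "((\<lambda>s. K * s) \<longlongrightarrow> K * 0) (at 0 within {0..})" by (intro tendsto_intros)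
      then show "((\<lambda>s. K * s) \<longlongrightarrow> 0) (at 0 within {0..})" by simp
      show "((\<lambda>s. g s k) \<longlongrightarrow> g 0 k) (at 0 within {0..})" for k using gc by simp
    qed
  next
    case False
    then have t0: "0 < t" using t by simp
    obtain B where B: "\<And>s. s \<in> {t/2..t+1} \<Longrightarrow> hseq 10 (g s) \<and> nrm2 10 (g s) \<le> B" using loc[OF half_gt_zero[OF t0], of "t+1"] by blast
    have B5: "hseq 5 (g s) \<and> nrm2 5 (g s) \<le> B" if "s \<in> {t/2..t+1}" for s
      using B[OF that] hseq_mono[of 10 "g s" 5] nrm2_mono[of 10 "g s" 5] by auto
    have "((\<lambda>s. nrm2 4 (\<lambda>k. g s k - g t k)) \<longlongrightarrow> 0) (at t)"
    proof (rule nrm2_tendsto_0)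
      show "\<forall>\<^sub>F s in at t. hseq (Suc 4) (\<lambda>k. g s k - g t k) \<and> nrm2 (Suc 4) (\<lambda>k. g s k - g t k) \<le> 4 * B"
        using near[OF t0]
      proof eventually_elim
        case (elim s)
        show ?case using hseq_diff[of 5 "g s" "g t"] B5[OF elim] B5[of t] t0 by auto
      qed
      show "((\<lambda>s. g s k - g t k) \<longlongrightarrow> 0) (at t)" for k using gc'[OF t0] LIM_zero by blast
    qed
    then show ?thesis by (rule tendsto_within_subset) simp
  qed
  have C: "sobolev_continuous_on 4 {0..} h"
    unfolding sobolev_continuous_on_def
  proof (intro conjI ballI)
    fix t :: real assume t: "t \<in> {0..}"
    show "h t \<in> sobolev 4" using h t by simp
    show "((\<lambda>s. sobolev_norm 4 (\<lambda>x. h s x - h t x)) \<longlongrightarrow> 0) (at t within {0..})"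
    proof (rule sobolev_norm_tendsto_0)
      show "\<forall>\<^sub>F s in at t within {0..}. (\<lambda>x. h s x - h t x) \<in> sobolev 4 \<and> cint (\<lambda>x. h s x - h t x) = 0"
        using hd(1) t by (auto simp: eventually_at_filter)
      show "((\<lambda>s. nrm2 4 (fc (\<lambda>x. h s x - h t x))) \<longlongrightarrow> 0) (at t within {0..})"
        by (rule Lim_transform_eventually[OF gdiff]) (use hd(2) t in \<open>auto simp: eventually_at_filter\<close>)
    qed
  qed
  have C0: "sobolev_continuous_on 4 {0<..} h"
    using C unfolding sobolev_continuous_on_def
    by (auto intro: tendsto_within_subset[where S = "{0..}"])
  have dc: "((\<lambda>s. d s k) \<longlongrightarrow> d t k) (at t)" if t: "0 < t" for t k
  proof -
    have "((\<lambda>s. fc (Fl (g s)) k) \<longlongrightarrow> fc (Fl (g t)) k) (at t)"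
    proof (rule fc_Fl_tendsto)
      show "\<forall>\<^sub>F s in at t. hseq 4 (g s) \<and> nrm2 4 (g s) \<le> \<rho>0"
        using near[OF t] by eventually_elim (use t g4 in auto)
    qed (use g4[of t] gc'[OF t] t in auto)
    then show ?thesis unfolding d_def by (intro tendsto_intros)
  qed
  have C': "sobolev_continuous_on 4 {0<..} h'"
    unfolding sobolev_continuous_on_def
  proof (intro conjI ballI)
    fix t :: real assume "t \<in> {0<..}"
    then have t: "0 < t" by simp
    show "h' t \<in> sobolev 4" using h's t by simp
    have near0: "\<forall>\<^sub>F s in at t. 0 < s" using near[OF t] by eventually_elim (use t in auto)
    obtain B where B: "\<And>s. s \<in> {t/2..t+1} \<Longrightarrow> hseq 5 (d s) \<and> nrm2 5 (d s) \<le> B" using loc[OF half_gt_zero[OF t], of "t+1"] by blast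
    have fd: "fc (\<lambda>x. h' s x - h' t x) = (\<lambda>k. d s k - d t k)" if "0 < s" for s
      using fc_diff[of "h' s" "h' t"] h's[OF that] h's[OF t] sobolev_integrable by auto
    have "((\<lambda>s. nrm2 4 (\<lambda>k. d s k - d t k)) \<longlongrightarrow> 0) (at t)"
    proof (rule nrm2_tendsto_0)
      show "\<forall>\<^sub>F s in at t. hseq (Suc 4) (\<lambda>k. d s k - d t k) \<and> nrm2 (Suc 4) (\<lambda>k. d s k - d t k) \<le> 4 * B"
        using near[OF t]
      proof eventually_elim
        case (elim s)
        show ?case using hseq_diff[of 5 "d s" "d t"] B[OF elim] B[of t] t by auto
      qed
      show "((\<lambda>s. d s k - d t k) \<longlongrightarrow> 0) (at t)" for k using dc[OF t] LIM_zero by blast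
    qed
    moreover have "\<forall>\<^sub>F s in at t. nrm2 4 (\<lambda>k. d s k - d t k) = nrm2 4 (fc (\<lambda>x. h' s x - h' t x))"
      using near0 by eventually_elim (simp add: fd)
    ultimately have n: "((\<lambda>s. nrm2 4 (fc (\<lambda>x. h' s x - h' t x))) \<longlongrightarrow> 0) (at t)" by (rule Lim_transform_eventually)
    have "((\<lambda>s. sobolev_norm 4 (\<lambda>x. h' s x - h' t x)) \<longlongrightarrow> 0) (at t)"
    proof (rule sobolev_norm_tendsto_0[OF _ n])
      show "\<forall>\<^sub>F s in at t. (\<lambda>x. h' s x - h' t x) \<in> sobolev 4 \<and> cint (\<lambda>x. h' s x - h' t x) = 0"
        using near0
      proof eventually_elim
        case (elim s)
        show ?case using sobolev_diff[OF h's(1)[OF elim] h's(1)[OF t]] h's(2)[OF elim] h's(2)[OF t]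
            sobolev_integrable[OF h's(1)[OF elim]] sobolev_integrable[OF h's(1)[OF t]] by simp
      qed
    qed
    then show "((\<lambda>s. sobolev_norm 4 (\<lambda>x. h' s x - h' t x)) \<longlongrightarrow> 0) (at t within {0<..})"
      by (rule tendsto_within_subset) simp
  qed
  have Q: "((\<lambda>s. sobolev_norm 4 (\<lambda>x. (h s x - h t x) / (s - t) - h' t x)) \<longlongrightarrow> 0) (at t within {0<..})" if t: "0 < t" for t
  proof -
    define q where "q s k = (g s k - g t k) / of_real (s - t) - d t k" for s k
    have ev: "\<forall>\<^sub>F s in at t. s \<in> {t/2..t+1} \<and> s \<noteq> t"
      using near[OF t] by (auto simp: eventually_at_filter elim: eventually_mono)
    obtain B where B: "\<And>s. s \<in> {t/2..t+1} \<Longrightarrow> hseq 5 (d s) \<and> nrm2 5 (d s) \<le> B" using loc[OF half_gt_zero[OF t], of "t+1"] by blast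
    have f: "(\<lambda>x. (h s x - h t x) / (s - t) - h' t x) \<in> sobolev 4 \<and> cint (\<lambda>x. (h s x - h t x) / (s - t) - h' t x) = 0 \<and>
        fc (\<lambda>x. (h s x - h t x) / (s - t) - h' t x) = q s" if s: "0 < s" "s \<noteq> t" for s
    proof -
      have e: "(\<lambda>x. (h s x - h t x) / (s - t) - h' t x) = (\<lambda>x. (1 / (s - t)) * (h s x - h t x) - h' t x)" by (simp add: divide_inverse mult.commute)
      have 1: "(\<lambda>x. (1 / (s - t)) * (h s x - h t x)) \<in> sobolev 4"
        using hd(1)[of s t] s t by (intro sobolev_cmult) auto
      have 2: "(\<lambda>x. (1 / (s - t)) * (h s x - h t x) - h' t x) \<in> sobolev 4"
        by (rule sobolev_diff[OF 1 h's(1)[OF t]])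
      have 3: "cint (\<lambda>x. (1 / (s - t)) * (h s x - h t x)) = 0"
        using hd(1)[of s t] s t by (subst integral_mult_right_zero) auto
      have 4: "cint (\<lambda>x. (1 / (s - t)) * (h s x - h t x) - h' t x) = 0"
        using Bochner_Integration.integral_diff[OF sobolev_integrable[OF 1] sobolev_integrable[OF h's(1)[OF t]]] 3 h's(2)[OF t] by simp
      have 5: "fc (\<lambda>x. (1 / (s - t)) * (h s x - h t x) - h' t x) k = q s k" for k
      proof -
        have "fc (\<lambda>x. (1 / (s - t)) * (h s x - h t x) - h' t x) k = fc (\<lambda>x. (1 / (s - t)) * (h s x - h t x)) k - fc (h' t) k"
          by (rule fc_diff[OF sobolev_integrable[OF 1] sobolev_integrable[OF h's(1)[OF t]]])
        also have "fc (\<lambda>x. (1 / (s - t)) * (h s x - h t x)) k = of_real (1 / (s - t)) * fc (\<lambda>x. h s x - h t x) k"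
          by (rule fc_cmult)
        also have "fc (\<lambda>x. h s x - h t x) k = g s k - g t k" using hd(2)[of s t] s t by simp
        finally show ?thesis unfolding q_def h's(3)[OF t] by simp
      qed
      show ?thesis unfolding e using 2 4 5 by auto
    qed
    have D: "((\<lambda>t. g t k) has_vector_derivative d \<tau> k) (at \<tau> within {t/2..t+1})" if "\<tau> \<in> {t/2..t+1}" for \<tau> k
      unfolding d_def by (rule has_vector_derivative_within_subset[OF gD]) (use that t in auto)
    \<comment> \<open>The quotient inherits the H^5 bound of the time derivative, on whichever side
      of t the point s lies.\<close>
    have qB: "hseq 5 (\<lambda>k. (g s k - g t k) / of_real (s - t)) \<and> nrm2 5 (\<lambda>k. (g s k - g t k) / of_real (s - t)) \<le> B"
      if s: "s \<in> {t/2..t+1}" "s \<noteq> t" for s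
    proof -
      have z: "g s 0 = g t 0" using g4[of s] g4[of t] s t by (auto simp: hseq_def)
      have tt: "t \<in> {t/2..t+1}" using t by auto
      show ?thesis
      proof (cases "s < t")
        case True
        have "(\<lambda>k. (g s k - g t k) / of_real (s - t)) = (\<lambda>k. (g t k - g s k) / of_real (t - s))"
          using True by (intro ext) (simp add: field_simps)
        then show ?thesis
          using derivative_quotient_bound[of "t/2" "t+1" g d 5 B s t, OF D B s(1) tt True z] by simp
      next
        case False
        then have "t < s" using s by simp
        then show ?thesis
          using derivative_quotient_bound[of "t/2" "t+1" g d 5 B t s, OF D B tt s(1) _ z[symmetric]] by simp
      qed
    qed
    have "((\<lambda>s. nrm2 4 (q s)) \<longlongrightarrow> 0) (at t)"
    proof (rule nrm2_tendsto_0)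
      show "\<forall>\<^sub>F s in at t. hseq (Suc 4) (q s) \<and> nrm2 (Suc 4) (q s) \<le> 4 * B"
        using ev
      proof eventually_elim
        case (elim s)
        have "hseq 5 (q s)" "nrm2 5 (q s) \<le> 2 * nrm2 5 (\<lambda>k. (g s k - g t k) / of_real (s - t)) + 2 * nrm2 5 (d t)"
          unfolding q_def using hseq_diff[of 5 "\<lambda>k. (g s k - g t k) / of_real (s - t)" "d t"] qB[of s] elim hp(2)[OF t] by auto
        moreover have "nrm2 5 (d t) \<le> B" using B[of t] t by auto
        ultimately show ?case using qB[of s] elim by simp
      qed
      fix k
      have "((\<lambda>t. g t k) has_vector_derivative d t k) (at t)"
        using gD[of t k] t at_within_interior[of t "{0..}"] by (simp add: d_def)
      then show "((\<lambda>s. q s k) \<longlongrightarrow> 0) (at t)" unfolding q_def has_vector_derivative_quotient .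
    qed
    moreover have ev': "\<forall>\<^sub>F s in at t. 0 < s \<and> s \<noteq> t" using ev by eventually_elim (use t in auto)
    then have "\<forall>\<^sub>F s in at t. nrm2 4 (q s) = nrm2 4 (fc (\<lambda>x. (h s x - h t x) / (s - t) - h' t x))"
      by eventually_elim (simp add: f)
    ultimately have n: "((\<lambda>s. nrm2 4 (fc (\<lambda>x. (h s x - h t x) / (s - t) - h' t x))) \<longlongrightarrow> 0) (at t)"
      by (rule Lim_transform_eventually)
    have "((\<lambda>s. sobolev_norm 4 (\<lambda>x. (h s x - h t x) / (s - t) - h' t x)) \<longlongrightarrow> 0) (at t)"
    proof (rule sobolev_norm_tendsto_0[OF _ n])
      show "\<forall>\<^sub>F s in at t. (\<lambda>x. (h s x - h t x) / (s - t) - h' t x) \<in> sobolev 4 \<and> cint (\<lambda>x. (h s x - h t x) / (s - t) - h' t x) = 0"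
        using ev' by eventually_elim (use f in blast)
    qed
    then show ?thesis by (rule tendsto_within_subset) simp
  qed
  have W: "has_weak_deriv 1 (nflux (h t)) (\<lambda>x. - h' t x)" if t: "0 < t" for t
  proof -
    note ht = h[OF less_imp_le[OF t]]
    have h1: "hseq 1 (\<lambda>k. - (\<i> * of_nat k * fc (Fl (g t)) k))" using hseq_mono[OF hp(2)[OF t], of 1] by (simp add: d_def[abs_def])
    have "has_weak_deriv 1 (Fl (g t)) (\<lambda>x. - h' t x)"
      unfolding h'_def d_def[abs_def] by (rule Fl_weak_deriv[OF _ h1]) (use g4[of t] t in simp)
    then show ?thesis
      by (rule has_weak_deriv_cong_AE) (use cf_profile(4,5)[of "h t"] ht in auto)
  qed
  have "film_solution \<beta> \<psi> h0 h"
    unfolding film_solution_def fl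
  proof (intro conjI exI[of _ h'])
    show "sobolev_C1_on 4 {0<..} h h'" unfolding sobolev_C1_on_def using C0 C' Q by simp
    show "\<forall>t>0. has_weak_deriv 1 (nflux (h t)) (\<lambda>x. - h' t x)" using W by blast
    show "AE x in circle. h 0 x = h0 x" by (simp add: h_def)
  qed (rule C)
  then show ?thesis using h by blast
qed

end

section \<open>Coefficients of an arbitrary solution\<close>

lemma sobolev_continuous_fc:
  assumes c: "sobolev_continuous_on s I h" and t: "t \<in> I"
  shows "((\<lambda>r. fc (h r) k) \<longlongrightarrow> fc (h t) k) (at t within I)"
proof -
  have h: "h r \<in> sobolev s" if "r \<in> I" for r using c that by (simp add: sobolev_continuous_on_def)
  have "((\<lambda>r. fc (h r) k - fc (h t) k) \<longlongrightarrow> 0) (at t within I)"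
  proof (rule Lim_null_comparison)
    show "((\<lambda>r. sobolev_norm s (\<lambda>x. h r x - h t x)) \<longlongrightarrow> 0) (at t within I)"
      using c t by (simp add: sobolev_continuous_on_def)
    have "cmod (fc (h r) k - fc (h t) k) \<le> sobolev_norm s (\<lambda>x. h r x - h t x)" if "r \<in> I" for r
      using fc_le_sobolev_norm[OF sobolev_diff[OF h[OF that] h[OF t]], of k]
        fc_diff[OF sobolev_integrable[OF h[OF that]] sobolev_integrable[OF h[OF t]], of k] by simp
    then show "\<forall>\<^sub>F r in at t within I. norm (fc (h r) k - fc (h t) k) \<le> sobolev_norm s (\<lambda>x. h r x - h t x)"
      by (auto simp: eventually_at_filter)
  qed
  then show ?thesis by (rule LIM_zero_cancel)
qed

lemma sobolev_C1_fc:
  assumes c: "sobolev_C1_on s I h h'" and t: "t \<in> I"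
  shows "((\<lambda>r. fc (h r) k) has_vector_derivative fc (h' t) k) (at t within I)"
  unfolding has_vector_derivative_quotient
proof (rule Lim_null_comparison)
  have h: "h r \<in> sobolev s" "h' r \<in> sobolev s" if "r \<in> I" for r
    using c that by (auto simp: sobolev_C1_on_def sobolev_continuous_on_def)
  show "((\<lambda>r. sobolev_norm s (\<lambda>x. (h r x - h t x) / (r - t) - h' t x)) \<longlongrightarrow> 0) (at t within I)"
    using c t by (simp add: sobolev_C1_on_def)
  have "cmod ((fc (h r) k - fc (h t) k) / of_real (r - t) - fc (h' t) k) \<le> sobolev_norm s (\<lambda>x. (h r x - h t x) / (r - t) - h' t x)"
    if "r \<in> I" for r
  proof -
    have e: "(\<lambda>x. (h r x - h t x) / (r - t) - h' t x) = (\<lambda>x. (1 / (r - t)) * (h r x - h t x) - h' t x)" by (simp add: divide_inverse mult.commute)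
    have 1: "(\<lambda>x. (1 / (r - t)) * (h r x - h t x)) \<in> sobolev s"
      by (intro sobolev_cmult sobolev_diff h that t)
    have 2: "(\<lambda>x. (1 / (r - t)) * (h r x - h t x) - h' t x) \<in> sobolev s"
      by (rule sobolev_diff[OF 1 h(2)[OF t]])
    have "fc (\<lambda>x. (1 / (r - t)) * (h r x - h t x) - h' t x) k = fc (\<lambda>x. (1 / (r - t)) * (h r x - h t x)) k - fc (h' t) k"
      by (rule fc_diff[OF sobolev_integrable[OF 1] sobolev_integrable[OF h(2)[OF t]]])
    also have "fc (\<lambda>x. (1 / (r - t)) * (h r x - h t x)) k = of_real (1 / (r - t)) * fc (\<lambda>x. h r x - h t x) k"
      by (rule fc_cmult)
    also have "fc (\<lambda>x. h r x - h t x) k = fc (h r) k - fc (h t) k"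
      by (rule fc_diff[OF sobolev_integrable[OF h(1)[OF that]] sobolev_integrable[OF h(1)[OF t]]])
    finally show ?thesis unfolding e using fc_le_sobolev_norm[OF 2, of k] by simp
  qed
  then show "\<forall>\<^sub>F r in at t within I. norm ((fc (h r) k - fc (h t) k) / of_real (r - t) - fc (h' t) k) \<le> sobolev_norm s (\<lambda>x. (h r x - h t x) / (r - t) - h' t x)"
    by (auto simp: eventually_at_filter)
qed

context film
begin

text \<open>Whatever its size, a solution satisfies the mode equations, since coefficients are
  bounded by the Sobolev norm and so inherit limits and time derivatives. This yields what
  \<open>coefficient_uniqueness\<close> requires apart from smallness.\<close>

lemma film_solution_modes:
  assumes fl: "\<And>u. flux \<beta> \<psi> u = nflux u"
    and h0: "h0 \<in> sobolev 4" "cint h0 = 2 * pi * hbar" and sol: "film_solution \<beta> \<psi> h0 h"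
  shows "0 \<le> t \<Longrightarrow> h t \<in> sobolev 4 \<and> cint (h t) = 2 * pi * hbar" "cf (h 0) = cf h0"
    "continuous_on {0..} (\<lambda>t. cf (h t) k)"
    "0 < t \<Longrightarrow> ((\<lambda>t. cf (h t) k) has_vector_derivative - (\<i> * of_nat k * fc (Fl (cf (h t))) k)) (at t)"
    "continuous_on {0..} (\<lambda>t. nrm2 4 (cf (h t)))"
proof -
  from sol obtain h' where c: "sobolev_continuous_on 4 {0..} h" and c1: "sobolev_C1_on 4 {0<..} h h'"
    and w: "\<And>t. 0 < t \<Longrightarrow> has_weak_deriv 1 (nflux (h t)) (\<lambda>x. - h' t x)" and e0: "AE x in circle. h 0 x = h0 x"
    unfolding film_solution_def fl by blast
  have hs: "h t \<in> sobolev 4" if "0 \<le> t" for t using c that by (simp add: sobolev_continuous_on_def)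
  have hm: "f \<in> borel_measurable circle" if "f \<in> sobolev 4" for f
    using sobolev_L2[OF that] by (simp add: L2_circle_def)
  have e: "fc (h 0) k = fc h0 k" for k by (rule fc_cong_AE[OF e0]) (use hs hm h0 in auto)
  show "cf (h 0) = cf h0"
    using e cf_eq[OF sobolev_integrable] hs[of 0] h0 by auto
  have fD: "((\<lambda>r. fc (h r) k) has_vector_derivative fc (h' t) k) (at t)" if "0 < t" for t k
    using sobolev_C1_fc[OF c1, of t k] that at_within_open[of t "{0<..}"] by simp
  have fcont: "continuous_on {0..} (\<lambda>t. fc (h t) k)" for k
    unfolding continuous_on_def using sobolev_continuous_fc[OF c] by blast
  have h'w: "fc (h' t) k = - (\<i> * of_nat k * fc (nflux (h t)) k)" if "0 < t" for t k
    using weak_deriv_fc[OF w[OF that], of k] fc_cmult[of "-1" "h' t" k] by (simp add: minus_equation_iff)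
  \<comment> \<open>Conservation of mass: the equation for index 0 has the factor k = 0.\<close>
  have m: "cint (h t) = 2 * pi * hbar" if "0 \<le> t" for t
  proof -
    have "fc (h t) 0 = fc h0 0"
    proof (rule has_derivative_zero_unique_strong_convex[of "{0..}" "{0}" "\<lambda>t. fc (h t) 0" 0 "fc h0 0" t])
      show "continuous_on {0..} (\<lambda>t. fc (h t) 0)" by (rule fcont)
      show "((\<lambda>t. fc (h t) 0) has_derivative (\<lambda>h. 0)) (at x within {0..})" if "x \<in> {0..} - {0}" for x
        using fD[of x 0] h'w[of x 0] that by (auto simp: has_vector_derivative_def intro: has_derivative_at_withinI)
    qed (use that e in auto)
    then have "cint (h t) / pi = cint h0 / pi" by (simp only: fc_0 of_real_eq_iff)
    then show ?thesis using h0 by (simp add: field_simps)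
  qed
  show "h t \<in> sobolev 4 \<and> cint (h t) = 2 * pi * hbar" if "0 \<le> t" for t using hs m that by blast
  have ce: "cf (h t) k = fc (h t) k - fc (\<lambda>_. hbar) k" if "0 \<le> t" for t k
    by (rule cf_eq[OF sobolev_integrable[OF hs[OF that]]])
  have "continuous_on {0..} (\<lambda>t. fc (h t) k - fc (\<lambda>_. hbar) k)" by (intro continuous_intros fcont)
  then show "continuous_on {0..} (\<lambda>t. cf (h t) k)" by (rule continuous_on_eq) (simp add: ce)
  show "((\<lambda>t. cf (h t) k) has_vector_derivative - (\<i> * of_nat k * fc (Fl (cf (h t))) k)) (at t)" if t: "0 < t" for t
  proof -
    have p: "h t \<in> sobolev 4" "cint (h t) = 2 * pi * hbar" using hs m t by auto
    have "fc (nflux (h t)) k = fc (Fl (cf (h t))) k"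
      by (rule fc_cong_AE[OF cf_profile(4)[OF p]])
        (use cf_profile(5)[OF p] circle_measurable[OF Fl_continuous[OF cf_profile(1)[OF p]]] in \<open>auto simp: L2_circle_def\<close>)
    then have "((\<lambda>r. fc (h r) k - fc (\<lambda>_. hbar) k) has_vector_derivative - (\<i> * of_nat k * fc (Fl (cf (h t))) k) - 0) (at t)"
      using fD[OF t, of k] h'w[OF t, of k] by (intro has_vector_derivative_diff has_vector_derivative_const) simp
    then have "((\<lambda>r. fc (h r) k - fc (\<lambda>_. hbar) k) has_vector_derivative - (\<i> * of_nat k * fc (Fl (cf (h t))) k)) (at t)" by simp
    then show ?thesis
      by (rule has_vector_derivative_transform_within_open[where S = "{0<..}"]) (use t ce in auto)
  qed
  show "continuous_on {0..} (\<lambda>t. nrm2 4 (cf (h t)))"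
    unfolding continuous_on_def
  proof
    fix t :: real assume t: "t \<in> {0..}"
    have d: "(\<lambda>x. h r x - h t x) \<in> sobolev 4" "cint (\<lambda>x. h r x - h t x) = 0" "fc (\<lambda>x. h r x - h t x) = (\<lambda>k. cf (h r) k - cf (h t) k)"
      if "0 \<le> r" for r
      using sobolev_diff[OF hs hs, of r t] m[of r] m[of t] sobolev_integrable[OF hs, of r] sobolev_integrable[OF hs, of t]
        cf_diff[OF sobolev_integrable[OF hs] sobolev_integrable[OF hs], of r t] that t by auto
    show "((\<lambda>t. nrm2 4 (cf (h t))) \<longlongrightarrow> nrm2 4 (cf (h t))) (at t within {0..})"
    proof (rule nrm2_tendsto)
      show "\<forall>\<^sub>F r in at t within {0..}. hseq 4 (cf (h r))"
        using cf_profile(1)[OF hs m] by (auto simp: eventually_at_filter)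
      show "hseq 4 (cf (h t))" using cf_profile(1)[OF hs m] t by auto
      show "((\<lambda>r. nrm2 4 (\<lambda>k. cf (h r) k - cf (h t) k)) \<longlongrightarrow> 0) (at t within {0..})"
      proof (rule Lim_null_comparison)
        have "((\<lambda>r. (sobolev_norm 4 (\<lambda>x. h r x - h t x))\<^sup>2) \<longlongrightarrow> 0\<^sup>2) (at t within {0..})"
          by (intro tendsto_power) (use c t in \<open>simp add: sobolev_continuous_on_def\<close>)
        then show "((\<lambda>r. (sobolev_norm 4 (\<lambda>x. h r x - h t x))\<^sup>2) \<longlongrightarrow> 0) (at t within {0..})" by simp
        have "norm (nrm2 4 (\<lambda>k. cf (h r) k - cf (h t) k)) \<le> (sobolev_norm 4 (\<lambda>x. h r x - h t x))\<^sup>2" if "0 \<le> r" for r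
        proof -
          have "0 \<le> nrm2 4 (fc (\<lambda>x. h r x - h t x))" by (rule nrm2_nonneg[OF sobolev_fc(1)[OF d(1,2)[OF that]]])
          moreover from this have "1 * nrm2 4 (fc (\<lambda>x. h r x - h t x)) \<le> pi * nrm2 4 (fc (\<lambda>x. h r x - h t x))"
            using pi_ge_two by (intro mult_right_mono) auto
          ultimately show ?thesis using sobolev_fc(3)[OF d(1,2)[OF that]] unfolding d(3)[OF that] by simp
        qed
        then show "\<forall>\<^sub>F r in at t within {0..}. norm (nrm2 4 (\<lambda>k. cf (h r) k - cf (h t) k)) \<le> (sobolev_norm 4 (\<lambda>x. h r x - h t x))\<^sup>2"
          by (auto simp: eventually_at_filter)
      qed
    qed
  qed
qed

text \<open>A competing solution is small initially and continuous in H^4. As long as it is small it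
  equals the constructed one, whose bound is strictly better, so it never leaves the region in which
  uniqueness is known.\<close>

lemma film_wellposed:
  assumes fl: "\<And>u. flux \<beta> \<psi> u = nflux u"
  shows "\<exists>C>0. \<exists>\<delta>\<^sub>0>0. \<forall>\<delta>. 0 < \<delta> \<and> \<delta> \<le> \<delta>\<^sub>0 \<longrightarrow>
    (\<forall>h0 \<in> sobolev 4.
       sobolev_norm 4 (\<lambda>x. h0 x - hbar) < \<delta> \<and> cint h0 = 2 * pi * hbar \<longrightarrow>
       (\<exists>h. film_solution \<beta> \<psi> h0 h \<and>
            (\<forall>g. film_solution \<beta> \<psi> h0 g \<longrightarrow> (\<forall>t\<ge>0. AE x in circle. g t x = h t x)) \<and>
            (\<forall>t\<ge>0. sobolev_norm 4 (\<lambda>x. h t x - hbar) \<le> C * \<delta>)))"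
proof -
  obtain C \<delta>1 where C: "1 \<le> C" and \<delta>1: "0 < \<delta>1" and ex: "\<forall>a0. hseq 4 a0 \<longrightarrow> nrm2 4 a0 \<le> \<delta>1 \<longrightarrow> (\<exists>g. g 0 = a0 \<and>
     (\<forall>t\<ge>0. hseq 4 (g t) \<and> nrm2 4 (g t) \<le> C * nrm2 4 a0 \<and> nrm2 4 (g t) \<le> \<rho>0) \<and>
     (\<forall>t\<ge>0. \<forall>k. ((\<lambda>t. g t k) has_vector_derivative - (\<i> * of_nat k * fc (Fl (g t)) k)) (at t within {0..})) \<and>
     (\<exists>K. \<forall>t\<ge>0. nrm2 4 (g t) \<le> nrm2 4 a0 + K * t) \<and>
     (\<forall>a b. 0 < a \<longrightarrow> (\<exists>B. \<forall>t\<in>{a..b}. hseq 10 (g t) \<and> nrm2 10 (g t) \<le> B \<and>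
        hseq 5 (\<lambda>k. - (\<i> * of_nat k * fc (Fl (g t)) k)) \<and> nrm2 5 (\<lambda>k. - (\<i> * of_nat k * fc (Fl (g t)) k)) \<le> B)))"
    using limit_exists by (elim exE conjE) (rule that; assumption)
  obtain \<delta>2 where \<delta>2: "0 < \<delta>2" and un: "\<forall>g1 g2 T. g1 0 = g2 0 \<longrightarrow> nrm2 4 (g1 0) \<le> \<delta>2 \<longrightarrow> hseq 4 (g1 0) \<longrightarrow> (\<forall>g\<in>{g1, g2}.
     (\<forall>t\<in>{0..T}. hseq 4 (g t) \<and> nrm2 4 (g t) \<le> \<rho>0) \<and> (\<forall>k. continuous_on {0..T} (\<lambda>t. g t k)) \<and>
     (\<forall>t\<in>{0<..<T}. \<forall>k. ((\<lambda>t. g t k) has_vector_derivative - (\<i> * of_nat k * fc (Fl (g t)) k)) (at t))) \<longrightarrow>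
     (\<forall>t\<in>{0..T}. g1 t = g2 t)"
    using coefficient_uniqueness by (elim exE conjE) (rule that; assumption)
  \<comment> \<open>Meets both smallness thresholds and leaves C r \<le> \<rho>0 / 2, the strict gap
    used for competing solutions.\<close>
  define r where "r = min (min \<delta>1 \<delta>2) (\<rho>0 / (2 * C))"
  have r: "0 < r" "r \<le> \<delta>1" "r \<le> \<delta>2" "C * r < \<rho>0"
  proof -
    show "0 < r" "r \<le> \<delta>1" "r \<le> \<delta>2" unfolding r_def using \<delta>1 \<delta>2 C \<rho>0_pos by auto
    have "C * r \<le> C * (\<rho>0 / (2 * C))" unfolding r_def using C by (intro mult_left_mono) auto
    then show "C * r < \<rho>0" using C \<rho>0_pos by simp
  qed
  have main: "\<exists>h. film_solution \<beta> \<psi> h0 h \<and>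
            (\<forall>g. film_solution \<beta> \<psi> h0 g \<longrightarrow> (\<forall>t\<ge>0. AE x in circle. g t x = h t x)) \<and>
            (\<forall>t\<ge>0. sobolev_norm 4 (\<lambda>x. h t x - hbar) \<le> sqrt (5 * C) * \<delta>)"
    if \<delta>: "0 < \<delta>" "\<delta> \<le> sqrt (pi * r)" and h0: "h0 \<in> sobolev 4" "cint h0 = 2 * pi * hbar"
      and n0: "sobolev_norm 4 (\<lambda>x. h0 x - hbar) < \<delta>" for \<delta> h0
  proof -
    note p0 = cf_profile[OF h0]
    have "(sobolev_norm 4 (\<lambda>x. h0 x - hbar))\<^sup>2 \<le> \<delta>\<^sup>2"
      using n0 by (intro power_mono) (auto simp: sobolev_norm_nonneg)
    then have a1: "pi * nrm2 4 (cf h0) \<le> \<delta>\<^sup>2" using p0(2) by linarith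
    also have "\<delta>\<^sup>2 \<le> (sqrt (pi * r))\<^sup>2" using \<delta> by (intro power_mono) auto
    also have "\<dots> = pi * r" using r by simp
    finally have a2: "nrm2 4 (cf h0) \<le> r" by simp
    have Ca: "C * nrm2 4 (cf h0) < \<rho>0"
      using mult_left_mono[OF a2, of C] C r(4) by linarith
    obtain g K where g0: "g 0 = cf h0"
      and g4': "\<forall>t\<ge>0. hseq 4 (g t) \<and> nrm2 4 (g t) \<le> C * nrm2 4 (cf h0) \<and> nrm2 4 (g t) \<le> \<rho>0"
      and gD': "\<forall>t\<ge>0. \<forall>k. ((\<lambda>t. g t k) has_vector_derivative - (\<i> * of_nat k * fc (Fl (g t)) k)) (at t within {0..})"
      and gK': "\<forall>t\<ge>0. nrm2 4 (g t) \<le> nrm2 4 (cf h0) + K * t"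
      and gB': "\<forall>a b. 0 < a \<longrightarrow> (\<exists>B. \<forall>t\<in>{a..b}. hseq 10 (g t) \<and> nrm2 10 (g t) \<le> B \<and>
        hseq 5 (\<lambda>k. - (\<i> * of_nat k * fc (Fl (g t)) k)) \<and> nrm2 5 (\<lambda>k. - (\<i> * of_nat k * fc (Fl (g t)) k)) \<le> B)"
      using ex[rule_format, OF p0(1) order_trans[OF a2 r(2)]] by (elim exE conjE) (rule that; assumption)
    note g4 = g4'[rule_format] and gD = gD'[rule_format] and gK = gK'[rule_format]
    obtain h where hsol: "film_solution \<beta> \<psi> h0 h" and h: "\<And>t. 0 \<le> t \<Longrightarrow> h t \<in> sobolev 4 \<and> cint (h t) = 2 * pi * hbar \<and> cf (h t) = g t"
    proof -
      have "\<exists>h. film_solution \<beta> \<psi> h0 h \<and> (\<forall>t\<ge>0. h t \<in> sobolev 4 \<and> cint (h t) = 2 * pi * hbar \<and> cf (h t) = g t)"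
      proof (rule modes_film_solution[where g = g and K = K, OF fl h0 g0])
        show "nrm2 4 (g t) \<le> nrm2 4 (g 0) + K * t" if "0 \<le> t" for t using gK[OF that] g0 by simp
        show "\<exists>B. \<forall>t\<in>{a..b}. hseq 10 (g t) \<and> nrm2 10 (g t) \<le> B \<and>
          hseq 5 (\<lambda>k. - (\<i> * of_nat k * fc (Fl (g t)) k)) \<and> nrm2 5 (\<lambda>k. - (\<i> * of_nat k * fc (Fl (g t)) k)) \<le> B" if "0 < a" for a b
          using gB' that by blast
      qed (use g4 gD in auto)
      then show ?thesis using that by blast
    qed
    have "sobolev_norm 4 (\<lambda>x. h t x - hbar) \<le> sqrt (5 * C) * \<delta>" if t: "0 \<le> t" for t
    proof -
      have "(sobolev_norm 4 (\<lambda>x. h t x - hbar))\<^sup>2 \<le> 5 * (pi * nrm2 4 (g t))"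
        using cf_profile(3)[of "h t"] h[OF t] by simp
      also have "\<dots> \<le> 5 * (pi * (C * nrm2 4 (cf h0)))" using g4[OF t] by simp
      also have "\<dots> = 5 * C * (pi * nrm2 4 (cf h0))" by simp
      also have "\<dots> \<le> 5 * C * \<delta>\<^sup>2" using a1 C by (intro mult_left_mono) auto
      finally have "sobolev_norm 4 (\<lambda>x. h t x - hbar) \<le> sqrt (5 * C * \<delta>\<^sup>2)" by (rule real_le_rsqrt)
      then show ?thesis using \<delta> by (simp add: real_sqrt_mult)
    qed
    moreover have "AE x in circle. f t x = h t x" if f: "film_solution \<beta> \<psi> h0 f" and t: "0 \<le> t" for f t
    proof -
      note fm = film_solution_modes[OF fl h0 f]
      have f4: "hseq 4 (cf (f t))" if "0 \<le> t" for t using fm(1)[OF that] cf_profile(1) by blast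
      have gc: "continuous_on {0..T} (\<lambda>t. g t k)" for T k
        proof (rule continuous_on_vector_derivative)
          fix t assume "t \<in> {0..T}"
          then show "((\<lambda>t. g t k) has_vector_derivative - (\<i> * of_nat k * fc (Fl (g t)) k)) (at t within {0..T})"
            by (intro has_vector_derivative_within_subset[OF gD]) auto
        qed
      have gD': "((\<lambda>t. g t k) has_vector_derivative - (\<i> * of_nat k * fc (Fl (g s)) k)) (at s)" if "0 < s" for s k
        using gD[of s k] that at_within_interior[of s "{0..}"] by simp
      have eq: "\<forall>s\<in>{0..T}. cf (f s) = g s" if T: "0 \<le> T" "\<And>s. 0 \<le> s \<Longrightarrow> s \<le> T \<Longrightarrow> nrm2 4 (cf (f s)) \<le> \<rho>0" for T
      proof (rule un[THEN spec[of _ "\<lambda>s. cf (f s)"], THEN spec[of _ g], THEN spec[of _ T], THEN mp, THEN mp, THEN mp, THEN mp])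
        show "cf (f 0) = g 0" using fm(2) g0 by simp
        show "nrm2 4 (cf (f 0)) \<le> \<delta>2" "hseq 4 (cf (f 0))" using fm(2) a2 r(3) f4[of 0] by auto
        have "continuous_on {0..T} (\<lambda>t. cf (f t) k)" for k by (rule continuous_on_subset[OF fm(3)]) auto
        then show "\<forall>g\<in>{\<lambda>s. cf (f s), g}.
     (\<forall>t\<in>{0..T}. hseq 4 (g t) \<and> nrm2 4 (g t) \<le> \<rho>0) \<and> (\<forall>k. continuous_on {0..T} (\<lambda>t. g t k)) \<and>
     (\<forall>t\<in>{0<..<T}. \<forall>k. ((\<lambda>t. g t k) has_vector_derivative - (\<i> * of_nat k * fc (Fl (g t)) k)) (at t))"
          using T f4 g4 gc gD' fm(4) by simp
      qed
      \<comment> \<open>Under the weaker bound \<rho>0 up to time t, uniqueness transfers the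
        sharper bound from g to the competing solution; continuity removes the assumption.\<close>
      have "nrm2 4 (cf (f s)) \<le> C * nrm2 4 (cf h0)" if "0 \<le> s" for s
      proof (rule continuous_bootstrap[where f = "\<lambda>s. nrm2 4 (cf (f s))" and \<epsilon> = \<rho>0])
        have "1 * nrm2 4 (cf h0) \<le> C * nrm2 4 (cf h0)" using C nrm2_nonneg[OF p0(1)] by (rule mult_right_mono)
        then show "nrm2 4 (cf (f 0)) \<le> \<rho>0" using fm(2) Ca by simp
        fix t assume "0 \<le> t" "\<And>s. 0 \<le> s \<Longrightarrow> s \<le> t \<Longrightarrow> nrm2 4 (cf (f s)) \<le> \<rho>0"
        from eq[OF this] \<open>0 \<le> t\<close> show "nrm2 4 (cf (f t)) \<le> C * nrm2 4 (cf h0)" using g4 by simp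
      qed (use fm(5) Ca that in auto)
      then have "cf (f t) = g t" using eq[OF t] Ca t by force
      then have e: "cf (f t) = cf (h t)" using h[OF t] by simp
      have ft: "f t \<in> sobolev 4" "cint (f t) = 2 * pi * hbar" and ht: "h t \<in> sobolev 4" "cint (h t) = 2 * pi * hbar"
        using fm(1)[OF t] h[OF t] by auto
      have "AE x in circle. f t x - h t x = 0"
      proof (rule fc_zero_imp_AE_zero)
        show "sqi (\<lambda>x. f t x - h t x)" by (intro sqi_diff sqi_L2 sobolev_L2[OF ft(1)] sobolev_L2[OF ht(1)])
        show "cint (\<lambda>x. f t x - h t x) = 0"
          using sobolev_integrable[OF ft(1)] sobolev_integrable[OF ht(1)] ft ht by simp
        show "fc (\<lambda>x. f t x - h t x) k = 0" for k
          using cf_diff[OF sobolev_integrable[OF ft(1)] sobolev_integrable[OF ht(1)], of k] e by simp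
      qed
      then show ?thesis by simp
    qed
    ultimately show ?thesis using hsol by blast
  qed
  show ?thesis
    \<comment> \<open>The 5 is the constant of norm equivalence for order 4, and C that of the
      Lyapunov bound on squared norms. A deviation below sqrt (pi r) has coefficients with squared
      norm at most r.\<close>
    by (rule exI[of _ "sqrt (5 * C)"], rule conjI, use C in simp, rule exI[of _ "sqrt (pi * r)"], rule conjI, use r in simp)
      (use main in blast)
qed

end

section \<open>The averaged constitutive law\<close>

lemma taylor2_remainder:
  assumes f: "smooth_fun f"
  shows "f y = f 0 + deriv f 0 * y + y\<^sup>2 * integral {0..1} (\<lambda>s. (1 - s) * deriv (deriv f) (0 + s * y))"
proof -
  have D: "(f has_real_derivative deriv f x) (at x)" "(deriv f has_real_derivative deriv (deriv f) x) (at x)" for x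
    by (intro smooth_fun_DERIV smooth_fun_deriv f)+
  \<comment> \<open>The antiderivative is (1 - s) y f'(s y) + f(s y). The argument is written 0 + s
    * y to match \<open>smooth_fun_param_integral\<close>.\<close>
  have "((\<lambda>s. y\<^sup>2 * ((1 - s) * deriv (deriv f) (0 + s * y))) has_integral
      (((1 - 1) * (y * deriv f (1 * y)) + f (1 * y)) - ((1 - 0) * (y * deriv f (0 * y)) + f (0 * y)))) {0..1}"
  proof (rule fundamental_theorem_of_calculus)
    fix s :: real
    have "((\<lambda>s. (1 - s) * (y * deriv f (s * y)) + f (s * y)) has_real_derivative y\<^sup>2 * ((1 - s) * deriv (deriv f) (0 + s * y))) (at s)"
      by (auto intro!: derivative_eq_intros DERIV_chain2[OF D(1)] DERIV_chain2[OF D(2)] simp: power2_eq_square algebra_simps)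
    then show "((\<lambda>s. (1 - s) * (y * deriv f (s * y)) + f (s * y)) has_vector_derivative y\<^sup>2 * ((1 - s) * deriv (deriv f) (0 + s * y))) (at s within {0..1})"
      by (simp add: has_real_derivative_iff_has_vector_derivative has_vector_derivative_at_within)
  qed simp
  then have "integral {0..1} (\<lambda>s. y\<^sup>2 * ((1 - s) * deriv (deriv f) (0 + s * y))) = f y - f 0 - deriv f 0 * y"
    by (auto dest!: integral_unique)
  then show ?thesis by simp
qed

theorem theorem4p1:
  fixes \<beta> c :: real and \<mu> \<psi> :: "real \<Rightarrow> real"
  assumes "\<beta> > 0" and "viscosity_inverse \<mu> \<psi>" and "c > 0"
  shows "\<exists>C>0. \<exists>\<delta>\<^sub>0>0. \<forall>\<delta>. 0 < \<delta> \<and> \<delta> \<le> \<delta>\<^sub>0 \<longrightarrow>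
    (\<forall>h0 \<in> sobolev 4.
       sobolev_norm 4 (\<lambda>x. h0 x - c) < \<delta> \<and> 1 / (2 * pi) * (LINT x|circle. h0 x) = c \<longrightarrow>
       (\<exists>h. film_solution \<beta> \<psi> h0 h \<and>
            (\<forall>g. film_solution \<beta> \<psi> h0 g \<longrightarrow> (\<forall>t\<ge>0. AE x in circle. g t x = h t x)) \<and>
            (\<forall>t\<ge>0. sobolev_norm 4 (\<lambda>x. h t x - c) \<le> C * \<delta>)))"
proof -
  define \<phi> where "\<phi> s = \<mu> \<bar>s\<bar> * s" for s
  have mono: "strict_mono \<phi>" and smooth: "smooth_fun \<phi>" "smooth_fun \<psi>" and inv: "\<psi> (\<phi> s) = s" "\<phi> (\<psi> y) = y" for s y
    using assms(2) unfolding viscosity_inverse_def \<phi>_def by auto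
  have \<psi>_mono: "\<psi> x < \<psi> y" if "x < y" for x y
    using strict_mono_less_eq[OF mono, of "\<psi> y" "\<psi> x"] inv(2) that by (auto simp: not_less[symmetric])
  have \<psi>0: "\<psi> 0 = 0" using inv(1)[of 0] by (simp add: \<phi>_def)
  \<comment> \<open>Monotonicity alone gives only \<ge> 0. The chain rule for \<phi> o \<psi> = id
    excludes zero, as \<phi> is differentiable too.\<close>
  have \<psi>'_pos: "0 < deriv \<psi> y" for y
  proof -
    have "((\<lambda>y. \<phi> (\<psi> y)) has_real_derivative deriv \<phi> (\<psi> y) * deriv \<psi> y) (at y)"
      by (intro DERIV_chain2[of \<phi>] smooth_fun_DERIV smooth)
    then have "deriv \<phi> (\<psi> y) * deriv \<psi> y = 1"
      unfolding inv(2) using DERIV_ident DERIV_unique by blast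
    then have "deriv \<psi> y \<noteq> 0" by auto
    moreover have "0 \<le> deriv \<psi> y"
      by (rule mono_on_imp_deriv_nonneg[of UNIV \<psi>])
        (use \<psi>_mono smooth_fun_DERIV[OF smooth(2)] in \<open>auto simp: mono_on_def less_le\<close>)
    ultimately show ?thesis by simp
  qed
  \<comment> \<open>The z-integral in the flux depends on the profile only through the product of h
    and h' + h''', so a function of one variable captures it.\<close>
  define \<Psi> where "\<Psi> y = integral {0..1} (\<lambda>z. z * \<psi> (\<beta> + z * y))" for y
  \<comment> \<open>The remainder in integral form is smooth also at y = 0, where the quotient by
    y^2 would need an argument.\<close>
  define R where "R y = integral {0..1} (\<lambda>s. (1 - s) * deriv (deriv \<Psi>) (0 + s * y))" for y
  have s\<Psi>: "smooth_fun \<Psi>" unfolding \<Psi>_def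
    by (rule smooth_fun_param_integral(1)[OF smooth(2)]) (intro continuous_intros)
  have d\<Psi>: "deriv \<Psi> y = integral {0..1} (\<lambda>z. (z * z) * deriv \<psi> (\<beta> + z * y))" for y
    unfolding \<Psi>_def by (rule DERIV_imp_deriv, rule smooth_fun_param_integral(2)[OF smooth(2)]) (intro continuous_intros)
  have pos: "0 < deriv \<Psi> y" for y
  proof -
    have "continuous_on {0..1} (\<lambda>z. (z * z) * deriv \<psi> (\<beta> + z * y))"
      by (intro continuous_intros continuous_on_compose2[OF smooth_fun_continuous[OF smooth_fun_deriv[OF smooth(2)]]]) auto
    then have "integral {0..1} (\<lambda>z::real. 0) < integral {0..1} (\<lambda>z. (z * z) * deriv \<psi> (\<beta> + z * y))"
      by (intro integral_less_real) (auto simp: \<psi>'_pos)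
    then show ?thesis unfolding d\<Psi> by simp
  qed
  have i1: "integral {0..1} (\<lambda>z::real. z) = 1 / 2"
    using ident_has_integral[of 0 "1::real"] by (auto dest: integral_unique)
  have i2: "integral {0..1} (\<lambda>z::real. z * z) = 1 / 3"
  proof (rule integral_unique)
    have "((\<lambda>z::real. z * z) has_integral (1 ^ 3 / 3 - 0 ^ 3 / 3)) {0..1}"
    proof (rule fundamental_theorem_of_calculus)
      fix x :: real
      have "((\<lambda>z. z ^ 3 / 3) has_real_derivative x * x) (at x)"
        by (auto intro!: derivative_eq_intros simp: power2_eq_square)
      then show "((\<lambda>z. z ^ 3 / 3) has_vector_derivative x * x) (at x within {0..1})"
        by (simp add: has_real_derivative_iff_has_vector_derivative has_vector_derivative_at_within)
    qed simp
    then show "((\<lambda>z::real. z * z) has_integral 1 / 3) {0..1}" by simp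
  qed
  have film: "film c (\<psi> \<beta>) (deriv \<psi> \<beta>) \<Psi> R"
  proof
    \<comment> \<open>This is where the sign of \<beta> enters: it makes the quartic decay of mode 1
      nontrivial.\<close>
    show "0 < \<psi> \<beta>" using \<psi>_mono[OF assms(1)] \<psi>0 by simp
    show "smooth_fun R" unfolding R_def
      by (intro smooth_fun_param_integral(1) smooth_fun_deriv s\<Psi> continuous_intros)
    have 0: "\<Psi> 0 = \<psi> \<beta> / 2" "deriv \<Psi> 0 = deriv \<psi> \<beta> / 3" unfolding d\<Psi> \<Psi>_def using i1 i2 by simp_all
    show "\<Psi> y = \<psi> \<beta> / 2 + deriv \<psi> \<beta> / 3 * y + y\<^sup>2 * R y" for y
      unfolding R_def using taylor2_remainder[OF s\<Psi>, of y] unfolding 0 .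
  qed (use assms s\<Psi> pos \<psi>'_pos in auto)
  have fl: "flux \<beta> \<psi> u = film.nflux \<Psi> u" for u
  proof
    fix x
    define y where "y = u x * (weak_deriv 1 u x + weak_deriv 3 u x)"
    have "continuous_on {0..1} (\<lambda>z. z * \<psi> (\<beta> + z * y))"
      by (intro continuous_intros continuous_on_compose2[OF smooth_fun_continuous[OF smooth(2)]]) auto
    then have "integrable (lebesgue_on {0..1}) (\<lambda>z. z * \<psi> (\<beta> + z * y))" by (rule continuous_imp_integrable_real)
    then have "(LINT z|lebesgue_on {0..1}. z * \<psi> (\<beta> + z * y)) = \<Psi> y"
      unfolding \<Psi>_def by (intro lebesgue_integral_eq_integral) auto
    then show "flux \<beta> \<psi> u x = film.nflux \<Psi> u x"
      unfolding flux_def film.nflux_def[OF film] y_def by (simp add: mult.assoc)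
  qed
  have "1 / (2 * pi) * m = c \<longleftrightarrow> m = 2 * pi * c" for m by (auto simp: field_simps)
  then show ?thesis using film.film_wellposed[OF film fl] by simp
qed

end
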